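(* Let $R$ be a commutative ring with unit, let $\mathcal{A}$ be a homologically connective dg category over $R$, and let $n\geq 0$. There is a homotopy fiber sequence $$P_{n+1}(\mathcal{A})\longrightarrow P_n(\mathcal{A})\stackrel{\gamma_n}{\longrightarrow}\mathbb{P}_n(\mathcal{A})\ltimes\mathsf{H}_{n+1}(\mathcal{A})[n+2]$$ in $\mathsf{Ho}(\mathrm{dgcat}\downarrow\mathbb{P}_n(\mathcal{A}))$; that is, $P_{n+1}(\mathcal{A})$, with its natural dg functors to $P_n(\mathcal{A})$ and $\mathbb{P}_n(\mathcal{A})$, is (up to quasi-equivalence over $\mathbb{P}_n(\mathcal{A})$) the homotopy pullback of the diagram $$P_n(\mathcal{A})\stackrel{\gamma_n}{\longrightarrow}\mathbb{P}_n(\mathcal{A})\ltimes\mathsf{H}_{n+1}(\mathcal{A})[n+2]\longleftarrow\mathbb{P}_n(\mathcal{A}),$$ where the right-hand arrow is the canonical inclusion.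
   Context: Complexes are complexes of $R$-modules with homological grading; $Ch$ is their category. $\mathrm{dgcat}$ is the category of small dg categories over $R$, with the Quillen model structure whose weak equivalences are the quasi-equivalences (dg functors $F$ with all $F(x,y)$ quasi-isomorphisms and $\mathsf{H}_0(F)$ an equivalence of categories) and whose fibrations are the dg functors $F:\mathcal{A}\to\mathcal{B}$ such that (F1) all $F(x,y)$ are degreewise surjective and (F2) for every object $a_1\in\mathcal{A}$ and every morphism $v\in\mathcal{B}(F(a_1),b)$ that becomes invertible in $\mathsf{H}_0(\mathcal{B})$ there is a morphism $u\in\mathcal{A}(a_1,a_2)$ with $F(u)=v$ that becomes invertible in $\mathsf{H}_0(\mathcal{A})$. For $X\in\mathrm{dgcat}$, $\mathrm{dgcat}\downarrow X$ is the category of objects over $X$ with the induced model structure. $\mathcal{A}$ is homologically connective if $\mathsf{H}_i(\mathcal{A}(x,y))=0$ for all $x,y$ and $i<0$, and positively graded if $\mathcal{A}(x,y)_i=0$ for all $x,y$ and $i<0$. All constructions below are defined for positively graded $\mathcal{A}$; for a homologically connective $\mathcal{A}$ they are applied to $\tau_{\geq 0}(\mathcal{A})$, the positively graded dg category obtained by the intelligent truncation (degree $0$ cycles in degree $0$) of each complex of morphisms. So let $\mathcal{A}$ be positively graded. Small Postnikov sections: $\mathbb{P}_n(\mathcal{A})=\tau_{\leq n}(\mathcal{A})$ has the same objects as $\mathcal{A}$ and each complex $M=\mathcal{A}(x,y)$ is replaced by $\tau_{\leq n}(M)$, equal to $M_i$ in degrees $i<n$, $M_n/\mathrm{Im}(M_{n+1})$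 in degree $n$, and $0$ in degrees $>n$. In particular $\mathbb{P}_0(\mathcal{A})=\mathsf{H}_0(\mathcal{A})$. Big Postnikov sections: for $m\in\mathbb{Z}$ let $S_m$ be the complex $R$ concentrated in degree $m$, with $\mathbf{1}_m\in S_m$ the unit of $R$, and $D_{m+1}$ the mapping cone of the identity of $S_m$. $\mathcal{C}(m)$ is the dg category with objects $1,2$, $\mathcal{C}(m)(1,1)=\mathcal{C}(m)(2,2)=R$, $\mathcal{C}(m)(2,1)=0$, $\mathcal{C}(m)(1,2)=S_m$; $\mathcal{D}(m+1)$ is the dg category with objects $3,4$, endomorphisms $R$, $\mathcal{D}(m+1)(4,3)=0$, $\mathcal{D}(m+1)(3,4)=D_{m+1}$. $S(m):\mathcal{C}(m)\to\mathcal{D}(m+1)$ sends $1\mapsto 3$, $2\mapsto 4$ and $S_m\to D_{m+1}$ by the identity of $R$ in degree $m$. Set $P_n(\mathcal{A})^0=\mathcal{A}$, let $P_n(\mathcal{A})^{i+1}$ be the pushout of $P_n(\mathcal{A})^i$ along $\coprod_{m>n}\coprod_{T:\mathcal{C}(m)\to P_n(\mathcal{A})^i}S(m)$ (over all $m>n$ and all dg functors $T$), and $P_n(\mathcal{A})=\mathrm{colim}_i P_n(\mathcal{A})^i$ (the small object argument applied to $\mathcal{A}\to 0$). There are natural dg functors $P_{n+1}(\mathcal{A})\to P_n(\mathcal{A})$. The dg functor $M_n:P_n(\mathcal{A})\to\mathbb{P}_n(\mathcal{A})$ is the identity on objects, is the natural projection on $\mathcal{A}$, and sends every freely adjoined bounding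 chain to $0$; it is a trivial fibration. Square zero extension: for a small dg category $\mathcal{B}$ and a $\mathcal{B}$-$\mathcal{B}$-bimodule $N$ (a dg functor $\mathcal{B}^{op}\otimes\mathcal{B}\to Ch$), $\mathcal{B}\ltimes N$ has the objects of $\mathcal{B}$, $(\mathcal{B}\ltimes N)(x,y)=\mathcal{B}(x,y)\oplus N(x,y)$, and composition given by that of $\mathcal{B}$, the bimodule structure, and zero on pairs of elements of $N$. There are the inclusion $\mathcal{B}\to\mathcal{B}\ltimes N$ and the projection $\mathcal{B}\ltimes N\to\mathcal{B}$. The $\mathbb{P}_n(\mathcal{A})$-bimodule $\mathsf{H}_{n+1}(\mathcal{A})[n+2]$ sends $(x,y)$ to the $R$-module $\mathsf{H}_{n+1}(\mathcal{A}(x,y))$ placed in degree $n+2$, with the natural $\mathsf{H}_0(\mathcal{A})$-bimodule structure restricted along $\mathbb{P}_n(\mathcal{A})\to\mathbb{P}_0(\mathcal{A})=\mathsf{H}_0(\mathcal{A})$. The dg functor $\gamma_n:P_n(\mathcal{A})\to\mathbb{P}_n(\mathcal{A})\ltimes\mathsf{H}_{n+1}(\mathcal{A})[n+2]$ is the colimit of dg functors $\gamma_n^i$ on $P_n(\mathcal{A})^i$, where $\gamma_n^0$ is $\mathcal{A}\to\mathbb{P}_n(\mathcal{A})$ followed by the inclusion, and $\gamma_n^{i+1}$ extends $\gamma_n^i$ as follows: for $T:\mathcal{C}(m)\to P_n(\mathcal{A})^i$, if $m>n+1$ the adjoined bounding chain of $T(\mathbf{1}_m)$ is sent to $0$; if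 $m=n+1$, then since $\mathcal{A}(T(1),T(2))_j\to P_n(\mathcal{A})^i(T(1),T(2))_j$ is an isomorphism for $j\leq n+1$, the cycle $T(\mathbf{1}_{n+1})$ is a cycle of $\mathcal{A}(T(1),T(2))$, and the adjoined bounding chain is sent to its homology class in $\mathsf{H}_{n+1}(\mathcal{A}(T(1),T(2)))$, in degree $n+2$. The composite of $\gamma_n$ with the projection to $\mathbb{P}_n(\mathcal{A})$ is $M_n$. All objects are regarded over $\mathbb{P}_n(\mathcal{A})$: $P_n(\mathcal{A})$ via $M_n$, $P_{n+1}(\mathcal{A})$ via $P_{n+1}(\mathcal{A})\to P_n(\mathcal{A})\to\mathbb{P}_n(\mathcal{A})$, the square zero extension via the projection, and $\mathbb{P}_n(\mathcal{A})$ via the identity. *)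

theory Defs
  imports "HOL-Algebra.AbelCoset" "HOL-Algebra.Module"
begin

section \<open>Modules and complexes\<close>

text \<open>The base ring is any \<open>cring\<close>, including the zero ring. The fields \<open>mult\<close> and \<open>one\<close> of a
  \<open>module\<close> record are never used.\<close>

definition linear_map ::
  "('r, 'x) ring_scheme \<Rightarrow> ('r, 'a) module \<Rightarrow> ('r, 'b) module \<Rightarrow> ('a \<Rightarrow> 'b) \<Rightarrow> bool" where
  "linear_map R M N f \<longleftrightarrow> f \<in> carrier M \<rightarrow> carrier N
     \<and> (\<forall>a\<in>carrier M. \<forall>b\<in>carrier M. f (a \<oplus>\<^bsub>M\<^esub> b) = f a \<oplus>\<^bsub>N\<^esub> f b)
     \<and> (\<forall>r\<in>carrier R. \<forall>a\<in>carrier M. f (r \<odot>\<^bsub>M\<^esub> a) = r \<odot>\<^bsub>N\<^esub> f a)"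

definition quot_module :: "('r, 'a) module \<Rightarrow> 'a set \<Rightarrow> ('r, 'a set) module" where
  "quot_module M K = \<lparr>carrier = a_rcosets\<^bsub>M\<^esub> K, mult = undefined, one = undefined,
     zero = K, add = (\<lambda>X Y. X <+>\<^bsub>M\<^esub> Y), smult = (\<lambda>r X. \<Union>a\<in>X. K +>\<^bsub>M\<^esub> (r \<odot>\<^bsub>M\<^esub> a))\<rparr>"

definition prod_module :: "('r, 'a) module \<Rightarrow> ('r, 'b) module \<Rightarrow> ('r, 'a \<times> 'b) module" where
  "prod_module M N = \<lparr>carrier = carrier M \<times> carrier N, mult = undefined, one = undefined,
     zero = (\<zero>\<^bsub>M\<^esub>, \<zero>\<^bsub>N\<^esub>), add = (\<lambda>(a, b) (a', b'). (a \<oplus>\<^bsub>M\<^esub> a', b \<oplus>\<^bsub>N\<^esub> b')),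
     smult = (\<lambda>r (a, b). (r \<odot>\<^bsub>M\<^esub> a, r \<odot>\<^bsub>N\<^esub> b))\<rparr>"

text \<open>\<open>cdiff M i\<close> is the differential from degree \<open>i\<close> to degree \<open>i - 1\<close>.\<close>

record ('r, 'a) complex =
  cmod :: "int \<Rightarrow> ('r, 'a) module"
  cdiff :: "int \<Rightarrow> 'a \<Rightarrow> 'a"

locale chain_complex = cring R for R (structure) and M :: "('b, 'a) complex" +
  assumes module: "module R (cmod M i)"
    and diff_linear: "linear_map R (cmod M i) (cmod M (i - 1)) (cdiff M i)"
    and diff_diff: "a \<in> carrier (cmod M i) \<Longrightarrow> cdiff M (i - 1) (cdiff M i a) = \<zero>\<^bsub>cmod M (i - 2)\<^esub>"

definition chain_map :: "('r, 'x) ring_scheme \<Rightarrow> ('r, 'a) complex \<Rightarrow> ('r, 'b) complex \<Rightarrow>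
    (int \<Rightarrow> 'a \<Rightarrow> 'b) \<Rightarrow> bool" where
  "chain_map R M N \<phi> \<longleftrightarrow> (\<forall>i. linear_map R (cmod M i) (cmod N i) (\<phi> i)
     \<and> (\<forall>a\<in>carrier (cmod M i). \<phi> (i - 1) (cdiff M i a) = cdiff N i (\<phi> i a)))"

definition cycles :: "('r, 'a) complex \<Rightarrow> int \<Rightarrow> 'a set" where
  "cycles M i = {z \<in> carrier (cmod M i). cdiff M i z = \<zero>\<^bsub>cmod M (i - 1)\<^esub>}"

definition boundaries :: "('r, 'a) complex \<Rightarrow> int \<Rightarrow> 'a set" where
  "boundaries M i = cdiff M (i + 1) ` carrier (cmod M (i + 1))"

definition homology :: "('r, 'a) complex \<Rightarrow> int \<Rightarrow> ('r, 'a set) module" where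
  "homology M i = quot_module (cmod M i\<lparr>carrier := cycles M i\<rparr>) (boundaries M i)"

definition hclass :: "('r, 'a) complex \<Rightarrow> int \<Rightarrow> 'a \<Rightarrow> 'a set" where
  "hclass M i z = boundaries M i +>\<^bsub>cmod M i\<^esub> z"

definition homology_map ::
  "('r, 'b) complex \<Rightarrow> (int \<Rightarrow> 'a \<Rightarrow> 'b) \<Rightarrow> int \<Rightarrow> 'a set \<Rightarrow> 'b set" where
  "homology_map N \<phi> i X = (\<Union>z\<in>X. hclass N i (\<phi> i z))"

definition quasi_isomorphism :: "('r, 'x) ring_scheme \<Rightarrow> ('r, 'a) complex \<Rightarrow> ('r, 'b) complex \<Rightarrow>
    (int \<Rightarrow> 'a \<Rightarrow> 'b) \<Rightarrow> bool" where
  "quasi_isomorphism R M N \<phi> \<longleftrightarrow> chain_map R M N \<phi>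
     \<and> (\<forall>i. bij_betw (homology_map N \<phi> i) (carrier (homology M i)) (carrier (homology N i)))"

definition zero_sub :: "('r, 'a) module \<Rightarrow> ('r, 'a) module" where
  "zero_sub M = M\<lparr>carrier := {\<zero>\<^bsub>M\<^esub>}\<rparr>"

definition quot_complex :: "('r, 'a) complex \<Rightarrow> (int \<Rightarrow> 'a set) \<Rightarrow> ('r, 'a set) complex" where
  "quot_complex M K = \<lparr>cmod = (\<lambda>i. quot_module (cmod M i) (K i)),
     cdiff = (\<lambda>i X. \<Union>a\<in>X. K (i - 1) +>\<^bsub>cmod M (i - 1)\<^esub> cdiff M i a)\<rparr>"

definition prod_complex :: "('r, 'a) complex \<Rightarrow> ('r, 'b) complex \<Rightarrow> ('r, 'a \<times> 'b) complex" where
  "prod_complex M N = \<lparr>cmod = (\<lambda>i. prod_module (cmod M i) (cmod N i)),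
     cdiff = (\<lambda>i (a, b). (cdiff M i a, cdiff N i b))\<rparr>"

definition trunc_ge0 :: "('r, 'a) complex \<Rightarrow> ('r, 'a) complex" where
  "trunc_ge0 M = M\<lparr>cmod := (\<lambda>i. if i > 0 then cmod M i
     else if i = 0 then cmod M 0\<lparr>carrier := cycles M 0\<rparr> else zero_sub (cmod M i))\<rparr>"

text \<open>The truncation \<open>\<tau>\<^sub>\<le>\<^sub>n\<close> is the quotient by the subcomplex \<open>trunc_kernel n M\<close>. In degrees
  below \<open>n\<close> an element \<open>a\<close> is thus represented by the coset \<open>{a}\<close>, and in degrees above \<open>n\<close>
  the quotient is the zero module.\<close>

definition trunc_kernel :: "int \<Rightarrow> ('r, 'a) complex \<Rightarrow> int \<Rightarrow> 'a set" where
  "trunc_kernel n M i = (if i < n then {\<zero>\<^bsub>cmod M i\<^esub>}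
     else if i = n then boundaries M n else carrier (cmod M i))"

definition trunc_le :: "int \<Rightarrow> ('r, 'a) complex \<Rightarrow> ('r, 'a set) complex" where
  "trunc_le n M = quot_complex M (trunc_kernel n M)"


section \<open>dg categories and dg functors\<close>

text \<open>\<open>Cmp A x y z i j g f\<close> is the composite of \<open>g\<close> in \<open>A(y, z)\<close> of degree \<open>i\<close> with \<open>f\<close> in
  \<open>A(x, y)\<close> of degree \<open>j\<close>.\<close>

record ('o, 'r, 'a) dgcat =
  Obj :: "'o set"
  Mor :: "'o \<Rightarrow> 'o \<Rightarrow> ('r, 'a) complex"
  Cmp :: "'o \<Rightarrow> 'o \<Rightarrow> 'o \<Rightarrow> int \<Rightarrow> int \<Rightarrow> 'a \<Rightarrow> 'a \<Rightarrow> 'a"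
  Idt :: "'o \<Rightarrow> 'a"

abbreviation hom_mod :: "('o, 'r, 'a) dgcat \<Rightarrow> 'o \<Rightarrow> 'o \<Rightarrow> int \<Rightarrow> ('r, 'a) module" where
  "hom_mod A x y i \<equiv> cmod (Mor A x y) i"

abbreviation hom_set :: "('o, 'r, 'a) dgcat \<Rightarrow> 'o \<Rightarrow> 'o \<Rightarrow> int \<Rightarrow> 'a set" where
  "hom_set A x y i \<equiv> carrier (hom_mod A x y i)"

abbreviation hom_diff :: "('o, 'r, 'a) dgcat \<Rightarrow> 'o \<Rightarrow> 'o \<Rightarrow> int \<Rightarrow> 'a \<Rightarrow> 'a" where
  "hom_diff A x y i \<equiv> cdiff (Mor A x y) i"

definition signed :: "('r, 'a) module \<Rightarrow> int \<Rightarrow> 'a \<Rightarrow> 'a" where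
  "signed M i a = (if even i then a else \<ominus>\<^bsub>M\<^esub> a)"

locale dg_category = cring R for R (structure) and A :: "('o, 'b, 'a) dgcat" +
  assumes complex: "\<lbrakk>x \<in> Obj A; y \<in> Obj A\<rbrakk> \<Longrightarrow> chain_complex R (Mor A x y)"
    and Idt_closed: "x \<in> Obj A \<Longrightarrow> Idt A x \<in> hom_set A x x 0"
    and Cmp_linear_left: "\<lbrakk>x \<in> Obj A; y \<in> Obj A; z \<in> Obj A; f \<in> hom_set A x y j\<rbrakk> \<Longrightarrow>
      linear_map R (hom_mod A y z i) (hom_mod A x z (i + j)) (\<lambda>g. Cmp A x y z i j g f)"
    and Cmp_linear_right: "\<lbrakk>x \<in> Obj A; y \<in> Obj A; z \<in> Obj A; g \<in> hom_set A y z i\<rbrakk> \<Longrightarrow>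
      linear_map R (hom_mod A x y j) (hom_mod A x z (i + j)) (\<lambda>f. Cmp A x y z i j g f)"
    and Cmp_diff: "\<lbrakk>x \<in> Obj A; y \<in> Obj A; z \<in> Obj A; g \<in> hom_set A y z i; f \<in> hom_set A x y j\<rbrakk> \<Longrightarrow>
      hom_diff A x z (i + j) (Cmp A x y z i j g f) =
        Cmp A x y z (i - 1) j (hom_diff A y z i g) f \<oplus>\<^bsub>hom_mod A x z (i + j - 1)\<^esub>
        signed (hom_mod A x z (i + j - 1)) i (Cmp A x y z i (j - 1) g (hom_diff A x y j f))"
    and Cmp_assoc: "\<lbrakk>w \<in> Obj A; x \<in> Obj A; y \<in> Obj A; z \<in> Obj A;
        h \<in> hom_set A y z i; g \<in> hom_set A x y j; f \<in> hom_set A w x k\<rbrakk> \<Longrightarrow>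
      Cmp A w x z (i + j) k (Cmp A x y z i j h g) f = Cmp A w y z i (j + k) h (Cmp A w x y j k g f)"
    and Cmp_Idt_left: "\<lbrakk>x \<in> Obj A; y \<in> Obj A; f \<in> hom_set A x y i\<rbrakk> \<Longrightarrow>
      Cmp A x y y 0 i (Idt A y) f = f"
    and Cmp_Idt_right: "\<lbrakk>x \<in> Obj A; y \<in> Obj A; f \<in> hom_set A x y i\<rbrakk> \<Longrightarrow>
      Cmp A x x y i 0 f (Idt A x) = f"

record ('o, 'a, 'p, 'b) dgfun =
  fob :: "'o \<Rightarrow> 'p"
  fmor :: "'o \<Rightarrow> 'o \<Rightarrow> int \<Rightarrow> 'a \<Rightarrow> 'b"

definition dg_functor :: "('r, 'x) ring_scheme \<Rightarrow> ('o, 'r, 'a) dgcat \<Rightarrow> ('p, 'r, 'b) dgcat \<Rightarrow>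
    ('o, 'a, 'p, 'b) dgfun \<Rightarrow> bool" where
  "dg_functor R A B F \<longleftrightarrow> dg_category R A \<and> dg_category R B \<and> fob F \<in> Obj A \<rightarrow> Obj B
     \<and> (\<forall>x\<in>Obj A. \<forall>y\<in>Obj A. chain_map R (Mor A x y) (Mor B (fob F x) (fob F y)) (fmor F x y))
     \<and> (\<forall>x\<in>Obj A. fmor F x x 0 (Idt A x) = Idt B (fob F x))
     \<and> (\<forall>x\<in>Obj A. \<forall>y\<in>Obj A. \<forall>z\<in>Obj A. \<forall>i j. \<forall>g\<in>hom_set A y z i. \<forall>f\<in>hom_set A x y j.
          fmor F x z (i + j) (Cmp A x y z i j g f) =
          Cmp B (fob F x) (fob F y) (fob F z) i j (fmor F y z i g) (fmor F x y j f))"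

definition dgfun_eq :: "('o, 'r, 'a) dgcat \<Rightarrow>
    ('o, 'a, 'p, 'b) dgfun \<Rightarrow> ('o, 'a, 'p, 'b) dgfun \<Rightarrow> bool" where
  "dgfun_eq A F G \<longleftrightarrow> (\<forall>x\<in>Obj A. fob F x = fob G x)
     \<and> (\<forall>x\<in>Obj A. \<forall>y\<in>Obj A. \<forall>i. \<forall>a\<in>hom_set A x y i. fmor F x y i a = fmor G x y i a)"

definition dgfun_id :: "('o, 'a, 'o, 'a) dgfun" where
  "dgfun_id = \<lparr>fob = (\<lambda>x. x), fmor = (\<lambda>x y i a. a)\<rparr>"

definition dgfun_comp :: "('p, 'b, 'q, 'c) dgfun \<Rightarrow> ('o, 'a, 'p, 'b) dgfun \<Rightarrow>
    ('o, 'a, 'q, 'c) dgfun" where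
  "dgfun_comp G F = \<lparr>fob = fob G \<circ> fob F,
     fmor = (\<lambda>x y i a. fmor G (fob F x) (fob F y) i (fmor F x y i a))\<rparr>"


section \<open>Quasi-equivalences and fibrations\<close>

record ('o, 'h) cat =
  CObj :: "'o set"
  CHom :: "'o \<Rightarrow> 'o \<Rightarrow> 'h set"
  CCmp :: "'o \<Rightarrow> 'o \<Rightarrow> 'o \<Rightarrow> 'h \<Rightarrow> 'h \<Rightarrow> 'h"
  CIdt :: "'o \<Rightarrow> 'h"

type_synonym ('o, 'h, 'p, 'k) cfun = "('o \<Rightarrow> 'p) \<times> ('o \<Rightarrow> 'o \<Rightarrow> 'h \<Rightarrow> 'k)"

definition cat_functor :: "('o, 'h) cat \<Rightarrow> ('p, 'k) cat \<Rightarrow> ('o, 'h, 'p, 'k) cfun \<Rightarrow> bool" where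
  "cat_functor C D F \<longleftrightarrow> fst F \<in> CObj C \<rightarrow> CObj D
     \<and> (\<forall>x\<in>CObj C. \<forall>y\<in>CObj C. snd F x y \<in> CHom C x y \<rightarrow> CHom D (fst F x) (fst F y))
     \<and> (\<forall>x\<in>CObj C. snd F x x (CIdt C x) = CIdt D (fst F x))
     \<and> (\<forall>x\<in>CObj C. \<forall>y\<in>CObj C. \<forall>z\<in>CObj C. \<forall>g\<in>CHom C y z. \<forall>f\<in>CHom C x y.
          snd F x z (CCmp C x y z g f) =
          CCmp D (fst F x) (fst F y) (fst F z) (snd F y z g) (snd F x y f))"

definition cat_iso :: "('o, 'h) cat \<Rightarrow> 'o \<Rightarrow> 'o \<Rightarrow> 'h \<Rightarrow> bool" where
  "cat_iso C x y f \<longleftrightarrow> f \<in> CHom C x y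
     \<and> (\<exists>g\<in>CHom C y x. CCmp C x y x g f = CIdt C x \<and> CCmp C y x y f g = CIdt C y)"

definition cfun_id :: "('o, 'h, 'o, 'h) cfun" where
  "cfun_id = (\<lambda>x. x, \<lambda>x y f. f)"

definition cfun_comp :: "('p, 'k, 'q, 'l) cfun \<Rightarrow> ('o, 'h, 'p, 'k) cfun \<Rightarrow> ('o, 'h, 'q, 'l) cfun" where
  "cfun_comp G F = (fst G \<circ> fst F, \<lambda>x y f. snd G (fst F x) (fst F y) (snd F x y f))"

definition natural_iso :: "('o, 'h) cat \<Rightarrow> ('p, 'k) cat \<Rightarrow> ('o, 'h, 'p, 'k) cfun \<Rightarrow>
    ('o, 'h, 'p, 'k) cfun \<Rightarrow> ('o \<Rightarrow> 'k) \<Rightarrow> bool" where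
  "natural_iso C D F G \<eta> \<longleftrightarrow> (\<forall>x\<in>CObj C. cat_iso D (fst F x) (fst G x) (\<eta> x))
     \<and> (\<forall>x\<in>CObj C. \<forall>y\<in>CObj C. \<forall>f\<in>CHom C x y.
          CCmp D (fst F x) (fst F y) (fst G y) (\<eta> y) (snd F x y f) =
          CCmp D (fst F x) (fst G x) (fst G y) (snd G x y f) (\<eta> x))"

definition cat_equivalence :: "('o, 'h) cat \<Rightarrow> ('p, 'k) cat \<Rightarrow> ('o, 'h, 'p, 'k) cfun \<Rightarrow> bool" where
  "cat_equivalence C D F \<longleftrightarrow> cat_functor C D F \<and> (\<exists>G \<eta> \<epsilon>. cat_functor D C G
     \<and> natural_iso C C cfun_id (cfun_comp G F) \<eta> \<and> natural_iso D D (cfun_comp F G) cfun_id \<epsilon>)"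

definition H0_cat :: "('o, 'r, 'a) dgcat \<Rightarrow> ('o, 'a set) cat" where
  "H0_cat A = \<lparr>CObj = Obj A, CHom = (\<lambda>x y. carrier (homology (Mor A x y) 0)),
     CCmp = (\<lambda>x y z G F. \<Union>g\<in>G. \<Union>f\<in>F. hclass (Mor A x z) 0 (Cmp A x y z 0 0 g f)),
     CIdt = (\<lambda>x. hclass (Mor A x x) 0 (Idt A x))\<rparr>"

definition H0_functor :: "('p, 'r, 'b) dgcat \<Rightarrow> ('o, 'a, 'p, 'b) dgfun \<Rightarrow>
    ('o, 'a set, 'p, 'b set) cfun" where
  "H0_functor B F =
     (fob F, \<lambda>x y. homology_map (Mor B (fob F x) (fob F y)) (fmor F x y) 0)"

definition quasi_equivalence :: "('r, 'x) ring_scheme \<Rightarrow> ('o, 'r, 'a) dgcat \<Rightarrow>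
    ('p, 'r, 'b) dgcat \<Rightarrow> ('o, 'a, 'p, 'b) dgfun \<Rightarrow> bool" where
  "quasi_equivalence R A B F \<longleftrightarrow> dg_functor R A B F
     \<and> (\<forall>x\<in>Obj A. \<forall>y\<in>Obj A.
          quasi_isomorphism R (Mor A x y) (Mor B (fob F x) (fob F y)) (fmor F x y))
     \<and> cat_equivalence (H0_cat A) (H0_cat B) (H0_functor B F)"

definition H0_invertible :: "('o, 'r, 'a) dgcat \<Rightarrow> 'o \<Rightarrow> 'o \<Rightarrow> 'a \<Rightarrow> bool" where
  "H0_invertible A x y u \<longleftrightarrow>
     u \<in> cycles (Mor A x y) 0 \<and> cat_iso (H0_cat A) x y (hclass (Mor A x y) 0 u)"

definition dg_fibration :: "('r, 'x) ring_scheme \<Rightarrow> ('o, 'r, 'a) dgcat \<Rightarrow>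
    ('p, 'r, 'b) dgcat \<Rightarrow> ('o, 'a, 'p, 'b) dgfun \<Rightarrow> bool" where
  "dg_fibration R A B F \<longleftrightarrow> dg_functor R A B F
     \<and> (\<forall>x\<in>Obj A. \<forall>y\<in>Obj A. \<forall>i. fmor F x y i ` hom_set A x y i = hom_set B (fob F x) (fob F y) i)
     \<and> (\<forall>x\<in>Obj A. \<forall>b\<in>Obj B. \<forall>v. H0_invertible B (fob F x) b v \<longrightarrow>
          (\<exists>y\<in>Obj A. \<exists>u. fob F y = b \<and> H0_invertible A x y u \<and> fmor F x y 0 u = v))"


section \<open>Homotopy pullbacks and homotopy fiber sequences\<close>

definition pullback :: "('o, 'r, 'a) dgcat \<Rightarrow> ('p, 'r, 'b) dgcat \<Rightarrow>
    ('o, 'a, 'q, 'c) dgfun \<Rightarrow> ('p, 'b, 'q, 'c) dgfun \<Rightarrow> ('o \<times> 'p, 'r, 'a \<times> 'b) dgcat" where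
  "pullback A B F G =
     \<lparr>Obj = {(x, y). x \<in> Obj A \<and> y \<in> Obj B \<and> fob F x = fob G y},
      Mor = (\<lambda>(x, y) (x', y').
        \<lparr>cmod = (\<lambda>i. prod_module (hom_mod A x x' i) (hom_mod B y y' i)
            \<lparr>carrier := {(a, b). a \<in> hom_set A x x' i \<and> b \<in> hom_set B y y' i
                \<and> fmor F x x' i a = fmor G y y' i b}\<rparr>),
         cdiff = cdiff (prod_complex (Mor A x x') (Mor B y y'))\<rparr>),
      Cmp = (\<lambda>(x, y) (x', y') (x'', y'') i j (a, b) (a', b').
        (Cmp A x x' x'' i j a a', Cmp B y y' y'' i j b b')),
      Idt = (\<lambda>(x, y). (Idt A x, Idt B y))\<rparr>"

definition dgfun_pair :: "('o, 'a, 'p, 'b) dgfun \<Rightarrow> ('o, 'a, 'q, 'c) dgfun \<Rightarrow>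
    ('o, 'a, 'p \<times> 'q, 'b \<times> 'c) dgfun" where
  "dgfun_pair F G = \<lparr>fob = (\<lambda>x. (fob F x, fob G x)), fmor = (\<lambda>x y i a. (fmor F x y i a, fmor G x y i a))\<rparr>"

text \<open>The strictly commutative square with top \<open>F : W \<rightarrow> B\<close>, left \<open>H : W \<rightarrow> D\<close>, right
  \<open>G : B \<rightarrow> C\<close> and bottom \<open>S : D \<rightarrow> C\<close> is a homotopy pullback square if, for a factorization of
  \<open>S\<close> into a quasi-equivalence \<open>J : D \<rightarrow> E\<close> and a fibration \<open>Q : E \<rightarrow> C\<close>, the induced dg functor
  from \<open>W\<close> to the strict pullback of \<open>G\<close> and \<open>Q\<close> is a quasi-equivalence. Every small dg category
  is fibrant, so the model structure is right proper and the choice of factorization is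
  immaterial. The types of \<open>E\<close> are those of the mapping path object of \<open>S\<close>: an object is a pair
  of objects \<open>d\<close>, \<open>c\<close> with a homotopy equivalence \<open>S d \<rightarrow> c\<close>, and a morphism is a pair of
  morphisms together with a homotopy.\<close>

definition homotopy_pullback :: "('r, 'x) ring_scheme \<Rightarrow>
    ('w, 'r, 'v) dgcat \<Rightarrow> ('o, 'r, 'b) dgcat \<Rightarrow> ('q, 'r, 'c) dgcat \<Rightarrow> ('p, 'r, 'd) dgcat \<Rightarrow>
    ('w, 'v, 'o, 'b) dgfun \<Rightarrow> ('w, 'v, 'p, 'd) dgfun \<Rightarrow>
    ('o, 'b, 'q, 'c) dgfun \<Rightarrow> ('p, 'd, 'q, 'c) dgfun \<Rightarrow> bool" where
  "homotopy_pullback R W B C D F H G S \<longleftrightarrow>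
     dg_functor R W B F \<and> dg_functor R W D H \<and> dg_functor R B C G \<and> dg_functor R D C S
     \<and> dgfun_eq W (dgfun_comp G F) (dgfun_comp S H)
     \<and> (\<exists>(E :: ('p \<times> 'q \<times> 'c, 'r, 'd \<times> 'c \<times> 'c) dgcat) J Q.
          quasi_equivalence R D E J \<and> dg_fibration R E C Q \<and> dgfun_eq D (dgfun_comp Q J) S
          \<and> quasi_equivalence R W (pullback B E G Q) (dgfun_pair F (dgfun_comp J H)))"

text \<open>\<open>over_map R X B P C Q F\<close>: \<open>F\<close> is a morphism from \<open>(B, P)\<close> to \<open>(C, Q)\<close> in the category of
  dg categories over \<open>X\<close>.\<close>

definition over_map :: "('r, 'x) ring_scheme \<Rightarrow> ('p, 'r, 'd) dgcat \<Rightarrow>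
    ('o, 'r, 'b) dgcat \<Rightarrow> ('o, 'b, 'p, 'd) dgfun \<Rightarrow>
    ('q, 'r, 'c) dgcat \<Rightarrow> ('q, 'c, 'p, 'd) dgfun \<Rightarrow> ('o, 'b, 'q, 'c) dgfun \<Rightarrow> bool" where
  "over_map R X B P C Q F \<longleftrightarrow> dg_functor R B X P \<and> dg_functor R C X Q \<and> dg_functor R B C F
     \<and> dgfun_eq B (dgfun_comp Q F) P"

text \<open>A sequence \<open>(W, P\<^sub>W) \<rightarrow> (B, P\<^sub>B) \<rightarrow> (C, P\<^sub>C)\<close> over \<open>X\<close> is a homotopy fiber sequence, with
  respect to the point \<open>S : (X, id) \<rightarrow> (C, P\<^sub>C)\<close> of \<open>C\<close>, if \<open>W\<close> is the homotopy pullback over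
  \<open>X\<close> of \<open>G\<close> along \<open>S\<close>. Homotopy pullbacks over \<open>X\<close> are computed on underlying dg categories;
  the object \<open>E\<close> in the factorization of \<open>S\<close> lies over \<open>X\<close> via \<open>E \<rightarrow> C \<rightarrow> X\<close>.\<close>

definition homotopy_fiber_sequence :: "('r, 'x) ring_scheme \<Rightarrow> ('p, 'r, 'd) dgcat \<Rightarrow>
    ('w, 'r, 'v) dgcat \<Rightarrow> ('w, 'v, 'p, 'd) dgfun \<Rightarrow>
    ('o, 'r, 'b) dgcat \<Rightarrow> ('o, 'b, 'p, 'd) dgfun \<Rightarrow>
    ('q, 'r, 'c) dgcat \<Rightarrow> ('q, 'c, 'p, 'd) dgfun \<Rightarrow>
    ('w, 'v, 'o, 'b) dgfun \<Rightarrow> ('o, 'b, 'q, 'c) dgfun \<Rightarrow> ('p, 'd, 'q, 'c) dgfun \<Rightarrow> bool" where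
  "homotopy_fiber_sequence R X W PW B PB C PC F G S \<longleftrightarrow>
     over_map R X W PW B PB F \<and> over_map R X B PB C PC G \<and> over_map R X X dgfun_id C PC S
     \<and> homotopy_pullback R W B C X F PW G S"


section \<open>Truncations, small Postnikov sections and square zero extensions\<close>

definition homologically_connective :: "('o, 'r, 'a) dgcat \<Rightarrow> bool" where
  "homologically_connective A \<longleftrightarrow> (\<forall>x\<in>Obj A. \<forall>y\<in>Obj A. \<forall>i<0.
     carrier (homology (Mor A x y) i) = {\<zero>\<^bsub>homology (Mor A x y) i\<^esub>})"

definition positively_graded :: "('o, 'r, 'a) dgcat \<Rightarrow> bool" where
  "positively_graded A \<longleftrightarrow>
     (\<forall>x\<in>Obj A. \<forall>y\<in>Obj A. \<forall>i<0. hom_set A x y i = {\<zero>\<^bsub>hom_mod A x y i\<^esub>})"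

definition tau_ge0 :: "('o, 'r, 'a) dgcat \<Rightarrow> ('o, 'r, 'a) dgcat" where
  "tau_ge0 A = A\<lparr>Mor := (\<lambda>x y. trunc_ge0 (Mor A x y))\<rparr>"

lemma positively_graded_tau_ge0: "positively_graded (tau_ge0 A)"
  by (simp add: positively_graded_def tau_ge0_def trunc_ge0_def zero_sub_def)

definition small_class :: "nat \<Rightarrow> ('o, 'r, 'a) dgcat \<Rightarrow> 'o \<Rightarrow> 'o \<Rightarrow> int \<Rightarrow> 'a \<Rightarrow> 'a set" where
  "small_class n A x y i a = trunc_kernel (int n) (Mor A x y) i +>\<^bsub>hom_mod A x y i\<^esub> a"

definition small_postnikov :: "nat \<Rightarrow> ('o, 'r, 'a) dgcat \<Rightarrow> ('o, 'r, 'a set) dgcat" where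
  "small_postnikov n A = \<lparr>Obj = Obj A, Mor = (\<lambda>x y. trunc_le (int n) (Mor A x y)),
     Cmp = (\<lambda>x y z i j G F. \<Union>g\<in>G. \<Union>f\<in>F. small_class n A x z (i + j) (Cmp A x y z i j g f)),
     Idt = (\<lambda>x. small_class n A x x 0 (Idt A x))\<rparr>"

definition small_proj :: "nat \<Rightarrow> ('o, 'r, 'a) dgcat \<Rightarrow> ('o, 'a, 'o, 'a set) dgfun" where
  "small_proj n A = \<lparr>fob = (\<lambda>x. x), fmor = small_class n A\<rparr>"

text \<open>A \<open>B\<close>-\<open>B\<close>-bimodule \<open>N\<close>, i.e. a dg functor from \<open>B\<^sup>o\<^sup>p \<otimes> B\<close> to complexes, is written as a
  family of complexes \<open>N(x, y)\<close> with a left and a right action: \<open>Lact N x y z i j g v\<close> is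
  \<open>g \<cdot> v\<close> in \<open>N(x, z)\<close>, for \<open>g\<close> in \<open>B(y, z)\<close> of degree \<open>i\<close> and \<open>v\<close> in \<open>N(x, y)\<close> of degree \<open>j\<close>,
  and \<open>Ract N x y z i j v f\<close> is \<open>v \<cdot> f\<close> in \<open>N(x, z)\<close>, for \<open>v\<close> in \<open>N(y, z)\<close> of degree \<open>i\<close> and
  \<open>f\<close> in \<open>B(x, y)\<close> of degree \<open>j\<close>. The value of the dg functor on \<open>f \<otimes> g\<close> maps \<open>v\<close> to
  \<open>g \<cdot> v \<cdot> f\<close> up to the Koszul sign.\<close>

record ('o, 'r, 'a, 'm) bimod =
  Bcpx :: "'o \<Rightarrow> 'o \<Rightarrow> ('r, 'm) complex"
  Lact :: "'o \<Rightarrow> 'o \<Rightarrow> 'o \<Rightarrow> int \<Rightarrow> int \<Rightarrow> 'a \<Rightarrow> 'm \<Rightarrow> 'm"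
  Ract :: "'o \<Rightarrow> 'o \<Rightarrow> 'o \<Rightarrow> int \<Rightarrow> int \<Rightarrow> 'm \<Rightarrow> 'a \<Rightarrow> 'm"

definition square_zero :: "('o, 'r, 'a) dgcat \<Rightarrow> ('o, 'r, 'a, 'm) bimod \<Rightarrow>
    ('o, 'r, 'a \<times> 'm) dgcat" where
  "square_zero B N = \<lparr>Obj = Obj B, Mor = (\<lambda>x y. prod_complex (Mor B x y) (Bcpx N x y)),
     Cmp = (\<lambda>x y z i j (g, v) (f, u). (Cmp B x y z i j g f,
        Lact N x y z i j g u \<oplus>\<^bsub>cmod (Bcpx N x z) (i + j)\<^esub> Ract N x y z i j v f)),
     Idt = (\<lambda>x. (Idt B x, \<zero>\<^bsub>cmod (Bcpx N x x) 0\<^esub>))\<rparr>"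

definition square_zero_incl :: "('o, 'r, 'a, 'm) bimod \<Rightarrow> ('o, 'a, 'o, 'a \<times> 'm) dgfun" where
  "square_zero_incl N = \<lparr>fob = (\<lambda>x. x), fmor = (\<lambda>x y i a. (a, \<zero>\<^bsub>cmod (Bcpx N x y) i\<^esub>))\<rparr>"

definition square_zero_proj :: "('o, 'a \<times> 'm, 'o, 'a) dgfun" where
  "square_zero_proj = \<lparr>fob = (\<lambda>x. x), fmor = (\<lambda>x y i. fst)\<rparr>"

text \<open>The \<open>H\<^sub>0(A)\<close>-bimodule \<open>H\<^sub>k(A)\<close>, placed in degree \<open>d\<close>. The category \<open>H\<^sub>0(A)\<close> is concentrated
  in degree \<open>0\<close>, so that no signs occur.\<close>

definition homology_bimod :: "('o, 'r, 'a) dgcat \<Rightarrow> int \<Rightarrow> int \<Rightarrow>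
    ('o, 'r, 'a set, 'a set) bimod" where
  "homology_bimod A k d = \<lparr>
     Bcpx = (\<lambda>x y. \<lparr>cmod = (\<lambda>i. if i = d then homology (Mor A x y) k else zero_sub (homology (Mor A x y) k)),
                    cdiff = (\<lambda>i v. \<zero>\<^bsub>homology (Mor A x y) k\<^esub>)\<rparr>),
     Lact = (\<lambda>x y z i j g v. if i = 0 \<and> j = d
        then \<Union>a\<in>g. \<Union>b\<in>v. hclass (Mor A x z) k (Cmp A x y z 0 k a b)
        else \<zero>\<^bsub>homology (Mor A x z) k\<^esub>),
     Ract = (\<lambda>x y z i j v f. if i = d \<and> j = 0
        then \<Union>b\<in>v. \<Union>a\<in>f. hclass (Mor A x z) k (Cmp A x y z k 0 b a)
        else \<zero>\<^bsub>homology (Mor A x z) k\<^esub>)\<rparr>"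

definition restrict_bimod :: "('o, 'a, 'o, 'b) dgfun \<Rightarrow> ('o, 'r, 'b, 'm) bimod \<Rightarrow>
    ('o, 'r, 'a, 'm) bimod" where
  "restrict_bimod F N = \<lparr>Bcpx = (\<lambda>x y. Bcpx N (fob F x) (fob F y)),
     Lact = (\<lambda>x y z i j g v. Lact N (fob F x) (fob F y) (fob F z) i j (fmor F y z i g) v),
     Ract = (\<lambda>x y z i j v f. Ract N (fob F x) (fob F y) (fob F z) i j v (fmor F x y j f))\<rparr>"

definition small_to_H0 :: "('o, 'r, 'a) dgcat \<Rightarrow> ('o, 'a set, 'o, 'a set) dgfun" where
  "small_to_H0 A = \<lparr>fob = (\<lambda>x. x), fmor = (\<lambda>x y i X. \<Union>a\<in>X. small_class 0 A x y i a)\<rparr>"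

definition k_bimod :: "nat \<Rightarrow> ('o, 'r, 'a) dgcat \<Rightarrow> ('o, 'r, 'a set, 'a set) bimod" where
  "k_bimod n A = restrict_bimod (small_to_H0 A) (homology_bimod A (int n + 1) (int n + 2))"

definition k_target :: "nat \<Rightarrow> ('o, 'r, 'a) dgcat \<Rightarrow> ('o, 'r, 'a set \<times> 'a set) dgcat" where
  "k_target n A = square_zero (small_postnikov n A) (k_bimod n A)"


section \<open>The generating cofibrations and the attachment of cells\<close>

text \<open>The dg functor \<open>S(m) : C(m) \<rightarrow> D(m + 1)\<close>. Every nonzero module of morphisms of \<open>C(m)\<close> and of
  \<open>D(m + 1)\<close> is a copy of \<open>R\<close> in each degree where it lives, and composition is multiplication
  in \<open>R\<close>.\<close>

definition ring_module :: "('r, 'x) ring_scheme \<Rightarrow> bool \<Rightarrow> ('r, 'r) module" where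
  "ring_module R p = \<lparr>carrier = (if p then carrier R else {\<zero>\<^bsub>R\<^esub>}), mult = undefined, one = undefined,
     zero = \<zero>\<^bsub>R\<^esub>, add = (\<oplus>\<^bsub>R\<^esub>), smult = (\<otimes>\<^bsub>R\<^esub>)\<rparr>"

definition sphere_cat :: "('r, 'x) ring_scheme \<Rightarrow> int \<Rightarrow> (nat, 'r, 'r) dgcat" where
  "sphere_cat R m = \<lparr>Obj = {1, 2},
     Mor = (\<lambda>x y. \<lparr>cmod = (\<lambda>i. ring_module R (x = y \<and> i = 0 \<or> x = 1 \<and> y = 2 \<and> i = m)),
                   cdiff = (\<lambda>i a. \<zero>\<^bsub>R\<^esub>)\<rparr>),
     Cmp = (\<lambda>x y z i j g f. g \<otimes>\<^bsub>R\<^esub> f), Idt = (\<lambda>x. \<one>\<^bsub>R\<^esub>)\<rparr>"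

definition disk_cat :: "('r, 'x) ring_scheme \<Rightarrow> int \<Rightarrow> (nat, 'r, 'r) dgcat" where
  "disk_cat R k = \<lparr>Obj = {3, 4},
     Mor = (\<lambda>x y. \<lparr>cmod = (\<lambda>i. ring_module R (x = y \<and> i = 0 \<or> x = 3 \<and> y = 4 \<and> (i = k \<or> i = k - 1))),
                   cdiff = (\<lambda>i a. if x = 3 \<and> y = 4 \<and> i = k then a else \<zero>\<^bsub>R\<^esub>)\<rparr>),
     Cmp = (\<lambda>x y z i j g f. g \<otimes>\<^bsub>R\<^esub> f), Idt = (\<lambda>x. \<one>\<^bsub>R\<^esub>)\<rparr>"

definition sphere_to_disk :: "(nat, 'r, nat, 'r) dgfun" where
  "sphere_to_disk = \<lparr>fob = (\<lambda>x. x + 2), fmor = (\<lambda>x y i a. a)\<rparr>"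

text \<open>The pushout of a dg category \<open>B\<close> along the coproduct of the \<open>S(m)\<close> over all \<open>m > k\<close> and all
  dg functors \<open>T : C(m) \<rightarrow> B\<close> is given by generators and relations; that this is
  the pushout is proved as \<open>attach_pushout\<close> at the end. The morphisms of \<open>B\<close> and of the pushout have the same type, so that the
  construction can be iterated. A morphism of the pushout is an expression over the morphisms
  of \<open>B\<close> (\<open>Old\<close>) and the adjoined bounding chains: \<open>Bound m x y c\<close>, of degree \<open>m + 1\<close>, is the
  one adjoined for the dg functor \<open>T\<close> with \<open>T(1) = x\<close>, \<open>T(2) = y\<close> and \<open>T(\<one>\<^sub>m) = c\<close>. The
  constructor \<open>Base\<close> serves for the first stage of the iteration. \<open>Comp y i j g f\<close> is the
  composite, through the object \<open>y\<close>, of \<open>g\<close> of degree \<open>i\<close> and \<open>f\<close> of degree \<open>j\<close>.\<close>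

datatype ('o, 'r, 'a) expr =
    Base 'a
  | Old "('o, 'r, 'a) expr"
  | Bound int 'o 'o "('o, 'r, 'a) expr"
  | Zero
  | Plus "('o, 'r, 'a) expr" "('o, 'r, 'a) expr"
  | Scale 'r "('o, 'r, 'a) expr"
  | Comp 'o int int "('o, 'r, 'a) expr" "('o, 'r, 'a) expr"

type_synonym ('o, 'r, 'a) edgcat = "('o, 'r, ('o, 'r, 'a) expr) dgcat"

primrec wf_expr :: "('r, 'x) ring_scheme \<Rightarrow> int \<Rightarrow> ('o, 'r, 'a) edgcat \<Rightarrow>
    ('o, 'r, 'a) expr \<Rightarrow> 'o \<Rightarrow> 'o \<Rightarrow> int \<Rightarrow> bool" where
  "wf_expr R k B (Base a) x y d = False"
| "wf_expr R k B (Old e) x y d = (x \<in> Obj B \<and> y \<in> Obj B \<and> e \<in> hom_set B x y d)"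
| "wf_expr R k B (Bound m u v c) x y d = (x = u \<and> y = v \<and> d = m + 1 \<and> x \<in> Obj B \<and> y \<in> Obj B
     \<and> m > k \<and> c \<in> cycles (Mor B x y) m)"
| "wf_expr R k B Zero x y d = (x \<in> Obj B \<and> y \<in> Obj B)"
| "wf_expr R k B (Plus e e') x y d = (wf_expr R k B e x y d \<and> wf_expr R k B e' x y d)"
| "wf_expr R k B (Scale r e) x y d = (r \<in> carrier R \<and> wf_expr R k B e x y d)"
| "wf_expr R k B (Comp w i j g f) x y d =
     (w \<in> Obj B \<and> d = i + j \<and> wf_expr R k B g w y i \<and> wf_expr R k B f x w j)"

definition sign :: "('r, 'x) ring_scheme \<Rightarrow> int \<Rightarrow> 'r" where
  "sign R i = (if even i then \<one>\<^bsub>R\<^esub> else \<ominus>\<^bsub>R\<^esub> \<one>\<^bsub>R\<^esub>)"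

primrec expr_diff :: "('r, 'x) ring_scheme \<Rightarrow> ('o, 'r, 'a) edgcat \<Rightarrow>
    ('o, 'r, 'a) expr \<Rightarrow> 'o \<Rightarrow> 'o \<Rightarrow> int \<Rightarrow> ('o, 'r, 'a) expr" where
  "expr_diff R B (Base a) x y d = Zero"
| "expr_diff R B (Old e) x y d = Old (hom_diff B x y d e)"
| "expr_diff R B (Bound m u v c) x y d = Old c"
| "expr_diff R B Zero x y d = Zero"
| "expr_diff R B (Plus e e') x y d = Plus (expr_diff R B e x y d) (expr_diff R B e' x y d)"
| "expr_diff R B (Scale r e) x y d = Scale r (expr_diff R B e x y d)"
| "expr_diff R B (Comp w i j g f) x y d = Plus (Comp w (i - 1) j (expr_diff R B g w y i) f)
     (Scale (sign R i) (Comp w i (j - 1) g (expr_diff R B f x w j)))"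

text \<open>The relations: those of a category enriched in graded modules, and that \<open>Old\<close> is a functor.\<close>

inductive expr_eq :: "('r, 'x) ring_scheme \<Rightarrow> int \<Rightarrow> ('o, 'r, 'a) edgcat \<Rightarrow>
    'o \<Rightarrow> 'o \<Rightarrow> int \<Rightarrow> ('o, 'r, 'a) expr \<Rightarrow> ('o, 'r, 'a) expr \<Rightarrow> bool"
  for R :: "('r, 'x) ring_scheme" and k :: int and B :: "('o, 'r, 'a) edgcat" where
  refl: "wf_expr R k B e x y d \<Longrightarrow> expr_eq R k B x y d e e"
| sym: "expr_eq R k B x y d e e' \<Longrightarrow> expr_eq R k B x y d e' e"
| trans: "\<lbrakk>expr_eq R k B x y d e e'; expr_eq R k B x y d e' e''\<rbrakk> \<Longrightarrow> expr_eq R k B x y d e e''"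
| plus_cong: "\<lbrakk>expr_eq R k B x y d e e'; expr_eq R k B x y d f f'\<rbrakk> \<Longrightarrow>
    expr_eq R k B x y d (Plus e f) (Plus e' f')"
| scale_cong: "\<lbrakk>r \<in> carrier R; expr_eq R k B x y d e e'\<rbrakk> \<Longrightarrow>
    expr_eq R k B x y d (Scale r e) (Scale r e')"
| comp_cong: "\<lbrakk>y \<in> Obj B; expr_eq R k B y z i g g'; expr_eq R k B x y j f f'\<rbrakk> \<Longrightarrow>
    expr_eq R k B x z (i + j) (Comp y i j g f) (Comp y i j g' f')"
| plus_assoc: "\<lbrakk>wf_expr R k B e x y d; wf_expr R k B e' x y d; wf_expr R k B e'' x y d\<rbrakk> \<Longrightarrow>
    expr_eq R k B x y d (Plus (Plus e e') e'') (Plus e (Plus e' e''))"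
| plus_comm: "\<lbrakk>wf_expr R k B e x y d; wf_expr R k B e' x y d\<rbrakk> \<Longrightarrow>
    expr_eq R k B x y d (Plus e e') (Plus e' e)"
| plus_zero: "wf_expr R k B e x y d \<Longrightarrow> expr_eq R k B x y d (Plus Zero e) e"
| scale_plus_left: "\<lbrakk>r \<in> carrier R; s \<in> carrier R; wf_expr R k B e x y d\<rbrakk> \<Longrightarrow>
    expr_eq R k B x y d (Scale (r \<oplus>\<^bsub>R\<^esub> s) e) (Plus (Scale r e) (Scale s e))"
| scale_plus_right: "\<lbrakk>r \<in> carrier R; wf_expr R k B e x y d; wf_expr R k B e' x y d\<rbrakk> \<Longrightarrow>
    expr_eq R k B x y d (Scale r (Plus e e')) (Plus (Scale r e) (Scale r e'))"
| scale_scale: "\<lbrakk>r \<in> carrier R; s \<in> carrier R; wf_expr R k B e x y d\<rbrakk> \<Longrightarrow>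
    expr_eq R k B x y d (Scale (r \<otimes>\<^bsub>R\<^esub> s) e) (Scale r (Scale s e))"
| scale_one: "wf_expr R k B e x y d \<Longrightarrow> expr_eq R k B x y d (Scale \<one>\<^bsub>R\<^esub> e) e"
| scale_zero: "wf_expr R k B e x y d \<Longrightarrow> expr_eq R k B x y d (Scale \<zero>\<^bsub>R\<^esub> e) Zero"
| comp_plus_left: "\<lbrakk>y \<in> Obj B; wf_expr R k B g y z i; wf_expr R k B g' y z i; wf_expr R k B f x y j\<rbrakk> \<Longrightarrow>
    expr_eq R k B x z (i + j) (Comp y i j (Plus g g') f) (Plus (Comp y i j g f) (Comp y i j g' f))"
| comp_plus_right: "\<lbrakk>y \<in> Obj B; wf_expr R k B g y z i; wf_expr R k B f x y j; wf_expr R k B f' x y j\<rbrakk> \<Longrightarrow>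
    expr_eq R k B x z (i + j) (Comp y i j g (Plus f f')) (Plus (Comp y i j g f) (Comp y i j g f'))"
| comp_scale_left: "\<lbrakk>y \<in> Obj B; r \<in> carrier R; wf_expr R k B g y z i; wf_expr R k B f x y j\<rbrakk> \<Longrightarrow>
    expr_eq R k B x z (i + j) (Comp y i j (Scale r g) f) (Scale r (Comp y i j g f))"
| comp_scale_right: "\<lbrakk>y \<in> Obj B; r \<in> carrier R; wf_expr R k B g y z i; wf_expr R k B f x y j\<rbrakk> \<Longrightarrow>
    expr_eq R k B x z (i + j) (Comp y i j g (Scale r f)) (Scale r (Comp y i j g f))"
| comp_assoc: "\<lbrakk>x \<in> Obj B; y \<in> Obj B; wf_expr R k B h y z i; wf_expr R k B g x y j;
      wf_expr R k B f w x l\<rbrakk> \<Longrightarrow>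
    expr_eq R k B w z (i + j + l) (Comp x (i + j) l (Comp y i j h g) f)
      (Comp y i (j + l) h (Comp x j l g f))"
| comp_id_left: "wf_expr R k B f x y d \<Longrightarrow> expr_eq R k B x y d (Comp y 0 d (Old (Idt B y)) f) f"
| comp_id_right: "wf_expr R k B f x y d \<Longrightarrow> expr_eq R k B x y d (Comp x d 0 f (Old (Idt B x))) f"
| old_plus: "\<lbrakk>x \<in> Obj B; y \<in> Obj B; a \<in> hom_set B x y d; b \<in> hom_set B x y d\<rbrakk> \<Longrightarrow>
    expr_eq R k B x y d (Old (a \<oplus>\<^bsub>hom_mod B x y d\<^esub> b)) (Plus (Old a) (Old b))"
| old_scale: "\<lbrakk>x \<in> Obj B; y \<in> Obj B; r \<in> carrier R; a \<in> hom_set B x y d\<rbrakk> \<Longrightarrow>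
    expr_eq R k B x y d (Old (r \<odot>\<^bsub>hom_mod B x y d\<^esub> a)) (Scale r (Old a))"
| old_comp: "\<lbrakk>x \<in> Obj B; y \<in> Obj B; z \<in> Obj B; g \<in> hom_set B y z i; f \<in> hom_set B x y j\<rbrakk> \<Longrightarrow>
    expr_eq R k B x z (i + j) (Old (Cmp B x y z i j g f)) (Comp y i j (Old g) (Old f))"

text \<open>Equivalence classes of expressions are replaced by chosen representatives, so that the
  morphisms of the pushout are again of type \<open>expr\<close>.\<close>

definition repr :: "('r, 'x) ring_scheme \<Rightarrow> int \<Rightarrow> ('o, 'r, 'a) edgcat \<Rightarrow>
    'o \<Rightarrow> 'o \<Rightarrow> int \<Rightarrow> ('o, 'r, 'a) expr \<Rightarrow> ('o, 'r, 'a) expr" where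
  "repr R k B x y d e = (SOME e'. expr_eq R k B x y d e e')"

definition attach :: "('r, 'x) ring_scheme \<Rightarrow> int \<Rightarrow> ('o, 'r, 'a) edgcat \<Rightarrow> ('o, 'r, 'a) edgcat" where
  "attach R k B = \<lparr>Obj = Obj B,
     Mor = (\<lambda>x y. \<lparr>cmod = (\<lambda>d. \<lparr>carrier = repr R k B x y d ` {e. wf_expr R k B e x y d},
           mult = undefined, one = undefined, zero = repr R k B x y d Zero,
           add = (\<lambda>e e'. repr R k B x y d (Plus e e')), smult = (\<lambda>r e. repr R k B x y d (Scale r e))\<rparr>),
         cdiff = (\<lambda>d e. repr R k B x y (d - 1) (expr_diff R B e x y d))\<rparr>),
     Cmp = (\<lambda>x y z i j g f. repr R k B x z (i + j) (Comp y i j g f)),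
     Idt = (\<lambda>x. repr R k B x x 0 (Old (Idt B x)))\<rparr>"

definition attach_incl :: "('r, 'x) ring_scheme \<Rightarrow> int \<Rightarrow> ('o, 'r, 'a) edgcat \<Rightarrow>
    ('o, ('o, 'r, 'a) expr, 'o, ('o, 'r, 'a) expr) dgfun" where
  "attach_incl R k B = \<lparr>fob = (\<lambda>x. x), fmor = (\<lambda>x y d e. repr R k B x y d (Old e))\<rparr>"

definition bounding_chain :: "('r, 'x) ring_scheme \<Rightarrow> int \<Rightarrow> ('o, 'r, 'a) edgcat \<Rightarrow>
    int \<Rightarrow> 'o \<Rightarrow> 'o \<Rightarrow> ('o, 'r, 'a) expr \<Rightarrow> ('o, 'r, 'a) expr" where
  "bounding_chain R k B m x y c = repr R k B x y (m + 1) (Bound m x y c)"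

text \<open>The extension of a dg functor \<open>F : B \<rightarrow> X\<close> to the pushout which sends the bounding chain
  \<open>Bound m x y c\<close> to \<open>\<phi> m x y c\<close>.\<close>

primrec expr_ext :: "('p, 'r, 'b) dgcat \<Rightarrow> ('o, ('o, 'r, 'a) expr, 'p, 'b) dgfun \<Rightarrow>
    (int \<Rightarrow> 'o \<Rightarrow> 'o \<Rightarrow> ('o, 'r, 'a) expr \<Rightarrow> 'b) \<Rightarrow>
    ('o, 'r, 'a) expr \<Rightarrow> 'o \<Rightarrow> 'o \<Rightarrow> int \<Rightarrow> 'b" where
  "expr_ext X F \<phi> (Base a) x y d = undefined"
| "expr_ext X F \<phi> (Old e) x y d = fmor F x y d e"
| "expr_ext X F \<phi> (Bound m u v c) x y d = \<phi> m u v c"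
| "expr_ext X F \<phi> Zero x y d = \<zero>\<^bsub>hom_mod X (fob F x) (fob F y) d\<^esub>"
| "expr_ext X F \<phi> (Plus e e') x y d =
     expr_ext X F \<phi> e x y d \<oplus>\<^bsub>hom_mod X (fob F x) (fob F y) d\<^esub> expr_ext X F \<phi> e' x y d"
| "expr_ext X F \<phi> (Scale r e) x y d =
     r \<odot>\<^bsub>hom_mod X (fob F x) (fob F y) d\<^esub> expr_ext X F \<phi> e x y d"
| "expr_ext X F \<phi> (Comp w i j g f) x y d = Cmp X (fob F x) (fob F w) (fob F y) i j
     (expr_ext X F \<phi> g w y i) (expr_ext X F \<phi> f x w j)"

definition attach_ext :: "('p, 'r, 'b) dgcat \<Rightarrow> ('o, ('o, 'r, 'a) expr, 'p, 'b) dgfun \<Rightarrow>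
    (int \<Rightarrow> 'o \<Rightarrow> 'o \<Rightarrow> ('o, 'r, 'a) expr \<Rightarrow> 'b) \<Rightarrow> ('o, ('o, 'r, 'a) expr, 'p, 'b) dgfun" where
  "attach_ext X F \<phi> = \<lparr>fob = fob F, fmor = (\<lambda>x y d e. expr_ext X F \<phi> e x y d)\<rparr>"


section \<open>Colimits of sequences\<close>

text \<open>The colimit of a sequence \<open>D 0 \<rightarrow> D 1 \<rightarrow> \<dots>\<close> of dg categories with the same objects and dg
  functors \<open>J i\<close> which are the identity on objects.\<close>

primrec push :: "(nat \<Rightarrow> ('o, 'a, 'o, 'a) dgfun) \<Rightarrow> 'o \<Rightarrow> 'o \<Rightarrow> int \<Rightarrow> nat \<Rightarrow> nat \<Rightarrow> 'a \<Rightarrow> 'a" where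
  "push J x y d i 0 a = a"
| "push J x y d i (Suc l) a = fmor (J (i + l)) x y d (push J x y d i l a)"

definition colim_class :: "(nat \<Rightarrow> ('o, 'r, 'a) dgcat) \<Rightarrow> (nat \<Rightarrow> ('o, 'a, 'o, 'a) dgfun) \<Rightarrow>
    'o \<Rightarrow> 'o \<Rightarrow> int \<Rightarrow> nat \<Rightarrow> 'a \<Rightarrow> (nat \<times> 'a) set" where
  "colim_class D J x y d i a = {(j, b). b \<in> hom_set (D j) x y d
     \<and> (\<exists>l. i \<le> l \<and> j \<le> l \<and> push J x y d i (l - i) a = push J x y d j (l - j) b)}"

definition colim_module :: "(nat \<Rightarrow> ('o, 'r, 'a) dgcat) \<Rightarrow> (nat \<Rightarrow> ('o, 'a, 'o, 'a) dgfun) \<Rightarrow>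
    'o \<Rightarrow> 'o \<Rightarrow> int \<Rightarrow> ('r, (nat \<times> 'a) set) module" where
  "colim_module D J x y d = \<lparr>carrier = (\<Union>i. colim_class D J x y d i ` hom_set (D i) x y d),
     mult = undefined, one = undefined,
     zero = colim_class D J x y d 0 \<zero>\<^bsub>hom_mod (D 0) x y d\<^esub>,
     add = (\<lambda>U V. \<Union>(i, a)\<in>U. \<Union>(j, b)\<in>V. let l = max i j in colim_class D J x y d l
        (push J x y d i (l - i) a \<oplus>\<^bsub>hom_mod (D l) x y d\<^esub> push J x y d j (l - j) b)),
     smult = (\<lambda>r U. \<Union>(i, a)\<in>U. colim_class D J x y d i (r \<odot>\<^bsub>hom_mod (D i) x y d\<^esub> a))\<rparr>"

definition colim_dgcat :: "(nat \<Rightarrow> ('o, 'r, 'a) dgcat) \<Rightarrow> (nat \<Rightarrow> ('o, 'a, 'o, 'a) dgfun) \<Rightarrow>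
    ('o, 'r, (nat \<times> 'a) set) dgcat" where
  "colim_dgcat D J = \<lparr>Obj = Obj (D 0),
     Mor = (\<lambda>x y. \<lparr>cmod = colim_module D J x y,
        cdiff = (\<lambda>d U. \<Union>(i, a)\<in>U. colim_class D J x y (d - 1) i (hom_diff (D i) x y d a))\<rparr>),
     Cmp = (\<lambda>x y z d e U V. \<Union>(i, g)\<in>U. \<Union>(j, f)\<in>V. let l = max i j in colim_class D J x z (d + e) l
        (Cmp (D l) x y z d e (push J y z d i (l - i) g) (push J x y e j (l - j) f))),
     Idt = (\<lambda>x. colim_class D J x x 0 0 (Idt (D 0) x))\<rparr>"

definition colim_incl :: "(nat \<Rightarrow> ('o, 'r, 'a) dgcat) \<Rightarrow> (nat \<Rightarrow> ('o, 'a, 'o, 'a) dgfun) \<Rightarrow>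
    nat \<Rightarrow> ('o, 'a, 'o, (nat \<times> 'a) set) dgfun" where
  "colim_incl D J i = \<lparr>fob = (\<lambda>x. x), fmor = (\<lambda>x y d a. colim_class D J x y d i a)\<rparr>"

definition colim_map :: "(nat \<Rightarrow> ('o, 'a, 'p, 'b) dgfun) \<Rightarrow> ('o, (nat \<times> 'a) set, 'p, 'b) dgfun" where
  "colim_map F = \<lparr>fob = fob (F 0),
     fmor = (\<lambda>x y d U. let (i, a) = (SOME p. p \<in> U) in fmor (F i) x y d a)\<rparr>"


section \<open>Big Postnikov sections and the k-invariant\<close>

primrec unBase :: "('o, 'r, 'a) expr \<Rightarrow> 'a" where
  "unBase (Base a) = a"

definition base_cat :: "('o, 'r, 'a) dgcat \<Rightarrow> ('o, 'r, 'a) edgcat" where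
  "base_cat A = \<lparr>Obj = Obj A,
     Mor = (\<lambda>x y. \<lparr>cmod = (\<lambda>d. \<lparr>carrier = Base ` hom_set A x y d, mult = undefined, one = undefined,
           zero = Base \<zero>\<^bsub>hom_mod A x y d\<^esub>,
           add = (\<lambda>e e'. Base (unBase e \<oplus>\<^bsub>hom_mod A x y d\<^esub> unBase e')),
           smult = (\<lambda>r e. Base (r \<odot>\<^bsub>hom_mod A x y d\<^esub> unBase e))\<rparr>),
         cdiff = (\<lambda>d e. Base (hom_diff A x y d (unBase e)))\<rparr>),
     Cmp = (\<lambda>x y z i j g f. Base (Cmp A x y z i j (unBase g) (unBase f))),
     Idt = (\<lambda>x. Base (Idt A x))\<rparr>"

definition base_fun :: "('o, 'a, 'o, ('o, 'r, 'a) expr) dgfun" where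
  "base_fun = \<lparr>fob = (\<lambda>x. x), fmor = (\<lambda>x y d. Base)\<rparr>"

definition unbase_fun :: "('o, ('o, 'r, 'a) expr, 'o, 'a) dgfun" where
  "unbase_fun = \<lparr>fob = (\<lambda>x. x), fmor = (\<lambda>x y d. unBase)\<rparr>"

text \<open>\<open>stage R n A i\<close> is \<open>P\<^sub>n(A)\<^sup>i\<close>, with \<open>P\<^sub>n(A)\<^sup>0 = A\<close> up to the renaming \<open>Base\<close> of
  morphisms.\<close>

primrec stage :: "('r, 'x) ring_scheme \<Rightarrow> nat \<Rightarrow> ('o, 'r, 'a) dgcat \<Rightarrow> nat \<Rightarrow> ('o, 'r, 'a) edgcat" where
  "stage R n A 0 = base_cat A"
| "stage R n A (Suc i) = attach R (int n) (stage R n A i)"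

definition stage_incl :: "('r, 'x) ring_scheme \<Rightarrow> nat \<Rightarrow> ('o, 'r, 'a) dgcat \<Rightarrow> nat \<Rightarrow>
    ('o, ('o, 'r, 'a) expr, 'o, ('o, 'r, 'a) expr) dgfun" where
  "stage_incl R n A i = attach_incl R (int n) (stage R n A i)"

primrec to_stage :: "('r, 'x) ring_scheme \<Rightarrow> nat \<Rightarrow> ('o, 'r, 'a) dgcat \<Rightarrow> nat \<Rightarrow>
    ('o, 'a, 'o, ('o, 'r, 'a) expr) dgfun" where
  "to_stage R n A 0 = base_fun"
| "to_stage R n A (Suc i) = dgfun_comp (stage_incl R n A i) (to_stage R n A i)"

definition big_postnikov :: "('r, 'x) ring_scheme \<Rightarrow> nat \<Rightarrow> ('o, 'r, 'a) dgcat \<Rightarrow>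
    ('o, 'r, (nat \<times> ('o, 'r, 'a) expr) set) dgcat" where
  "big_postnikov R n A = colim_dgcat (stage R n A) (stage_incl R n A)"

text \<open>The natural dg functor \<open>P\<^sub>n\<^sub>+\<^sub>1(A) \<rightarrow> P\<^sub>n(A)\<close> sends the bounding chain adjoined for \<open>T\<close> to the one
  adjoined for the composite of \<open>T\<close> with \<open>P\<^sub>n\<^sub>+\<^sub>1(A)\<^sup>i \<rightarrow> P\<^sub>n(A)\<^sup>i\<close>.\<close>

primrec tower_stage :: "('r, 'x) ring_scheme \<Rightarrow> nat \<Rightarrow> ('o, 'r, 'a) dgcat \<Rightarrow> nat \<Rightarrow>
    ('o, ('o, 'r, 'a) expr, 'o, ('o, 'r, 'a) expr) dgfun" where
  "tower_stage R n A 0 = dgfun_id"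
| "tower_stage R n A (Suc i) = attach_ext (stage R n A (Suc i))
     (dgfun_comp (stage_incl R n A i) (tower_stage R n A i))
     (\<lambda>m x y c. bounding_chain R (int n) (stage R n A i) m x y (fmor (tower_stage R n A i) x y m c))"

definition tower_map :: "('r, 'x) ring_scheme \<Rightarrow> nat \<Rightarrow> ('o, 'r, 'a) dgcat \<Rightarrow>
    ('o, (nat \<times> ('o, 'r, 'a) expr) set, 'o, (nat \<times> ('o, 'r, 'a) expr) set) dgfun" where
  "tower_map R n A = colim_map (\<lambda>i.
     dgfun_comp (colim_incl (stage R n A) (stage_incl R n A) i) (tower_stage R n A i))"

primrec M_stage :: "('r, 'x) ring_scheme \<Rightarrow> nat \<Rightarrow> ('o, 'r, 'a) dgcat \<Rightarrow> nat \<Rightarrow>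
    ('o, ('o, 'r, 'a) expr, 'o, 'a set) dgfun" where
  "M_stage R n A 0 = dgfun_comp (small_proj n A) unbase_fun"
| "M_stage R n A (Suc i) = attach_ext (small_postnikov n A) (M_stage R n A i)
     (\<lambda>m x y c. \<zero>\<^bsub>hom_mod (small_postnikov n A) x y (m + 1)\<^esub>)"

definition M_map :: "('r, 'x) ring_scheme \<Rightarrow> nat \<Rightarrow> ('o, 'r, 'a) dgcat \<Rightarrow>
    ('o, (nat \<times> ('o, 'r, 'a) expr) set, 'o, 'a set) dgfun" where
  "M_map R n A = colim_map (M_stage R n A)"

text \<open>For positively graded \<open>A\<close>, the map \<open>A(x, y) \<rightarrow> P\<^sub>n(A)\<^sup>i(x, y)\<close> is bijective in degree \<open>n + 1\<close>;
  \<open>descend\<close> is its inverse.\<close>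

definition descend :: "('r, 'x) ring_scheme \<Rightarrow> nat \<Rightarrow> ('o, 'r, 'a) dgcat \<Rightarrow> nat \<Rightarrow>
    'o \<Rightarrow> 'o \<Rightarrow> ('o, 'r, 'a) expr \<Rightarrow> 'a" where
  "descend R n A i x y c =
     (THE a. a \<in> hom_set A x y (int n + 1) \<and> fmor (to_stage R n A i) x y (int n + 1) a = c)"

primrec gamma_stage :: "('r, 'x) ring_scheme \<Rightarrow> nat \<Rightarrow> ('o, 'r, 'a) dgcat \<Rightarrow> nat \<Rightarrow>
    ('o, ('o, 'r, 'a) expr, 'o, 'a set \<times> 'a set) dgfun" where
  "gamma_stage R n A 0 =
     dgfun_comp (square_zero_incl (k_bimod n A)) (dgfun_comp (small_proj n A) unbase_fun)"
| "gamma_stage R n A (Suc i) = attach_ext (k_target n A) (gamma_stage R n A i)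
     (\<lambda>m x y c. if m = int n + 1
        then (\<zero>\<^bsub>hom_mod (small_postnikov n A) x y (m + 1)\<^esub>,
              hclass (Mor A x y) (int n + 1) (descend R n A i x y c))
        else \<zero>\<^bsub>hom_mod (k_target n A) x y (m + 1)\<^esub>)"

definition gamma_map :: "('r, 'x) ring_scheme \<Rightarrow> nat \<Rightarrow> ('o, 'r, 'a) dgcat \<Rightarrow>
    ('o, (nat \<times> ('o, 'r, 'a) expr) set, 'o, 'a set \<times> 'a set) dgfun" where
  "gamma_map R n A = colim_map (gamma_stage R n A)"


section \<open>The attachment of cells is a pushout\<close>


lemma linear_mapD:
  assumes "linear_map R M N f"
  shows "a \<in> carrier M \<Longrightarrow> f a \<in> carrier N"
    and "\<lbrakk>a \<in> carrier M; b \<in> carrier M\<rbrakk> \<Longrightarrow> f (a \<oplus>\<^bsub>M\<^esub> b) = f a \<oplus>\<^bsub>N\<^esub> f b"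
    and "\<lbrakk>r \<in> carrier R; a \<in> carrier M\<rbrakk> \<Longrightarrow> f (r \<odot>\<^bsub>M\<^esub> a) = r \<odot>\<^bsub>N\<^esub> f a"
  using assms by (auto simp: linear_map_def)

lemma linear_map_zero:
  assumes "linear_map R M N f" "module R M" "module R N"
  shows "f \<zero>\<^bsub>M\<^esub> = \<zero>\<^bsub>N\<^esub>"
proof -
  interpret M: module R M by fact
  interpret N: module R N by fact
  have "f \<zero>\<^bsub>M\<^esub> = f (\<zero>\<^bsub>R\<^esub> \<odot>\<^bsub>M\<^esub> \<zero>\<^bsub>M\<^esub>)" by simp
  also have "\<dots> = \<zero>\<^bsub>R\<^esub> \<odot>\<^bsub>N\<^esub> f \<zero>\<^bsub>M\<^esub>" by (rule linear_mapD[OF assms(1)]) auto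
  also have "\<dots> = \<zero>\<^bsub>N\<^esub>" using linear_mapD(1)[OF assms(1)] by simp
  finally show ?thesis .
qed

lemma signed_eq:
  assumes "module R M" "a \<in> carrier M"
  shows "signed M i a = sign R i \<odot>\<^bsub>M\<^esub> a"
proof -
  interpret M: module R M by fact
  show ?thesis using assms(2) by (auto simp: signed_def sign_def M.smult_l_minus)
qed

lemma sign_closed: "cring R \<Longrightarrow> sign R i \<in> carrier R"
  unfolding sign_def by (simp add: cring.cring_simprules)

lemma sign_Suc: "cring R \<Longrightarrow> sign R (i - 1) = \<ominus>\<^bsub>R\<^esub> sign R i"
  unfolding sign_def by (auto simp add: cring.cring_simprules ring.ring_simprules cring.axioms)

context dg_category
begin

lemma hom_module: "\<lbrakk>x \<in> Obj A; y \<in> Obj A\<rbrakk> \<Longrightarrow> module R (hom_mod A x y i)"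
  by (rule chain_complex.module[OF complex])

lemma hom_diff_linear: "\<lbrakk>x \<in> Obj A; y \<in> Obj A\<rbrakk> \<Longrightarrow>
    linear_map R (hom_mod A x y i) (hom_mod A x y (i - 1)) (hom_diff A x y i)"
  by (rule chain_complex.diff_linear[OF complex])

lemma hom_diff_diff: "\<lbrakk>x \<in> Obj A; y \<in> Obj A; a \<in> hom_set A x y i\<rbrakk> \<Longrightarrow>
    hom_diff A x y (i - 1) (hom_diff A x y i a) = \<zero>\<^bsub>hom_mod A x y (i - 2)\<^esub>"
  by (rule chain_complex.diff_diff[OF complex])

lemma Cmp_closed: "\<lbrakk>x \<in> Obj A; y \<in> Obj A; z \<in> Obj A; g \<in> hom_set A y z i; f \<in> hom_set A x y j\<rbrakk> \<Longrightarrow>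
    Cmp A x y z i j g f \<in> hom_set A x z (i + j)"
  by (rule linear_mapD(1)[OF Cmp_linear_left])

lemma diff_Idt: assumes "x \<in> Obj A" shows "hom_diff A x x 0 (Idt A x) = \<zero>\<^bsub>hom_mod A x x (- 1)\<^esub>"
proof -
  interpret M: module R "hom_mod A x x (-1)" by (rule hom_module[OF assms assms])
  let ?u = "hom_diff A x x 0 (Idt A x)"
  have u: "?u \<in> hom_set A x x (-1)"
    using linear_mapD(1)[OF hom_diff_linear[OF assms assms, of 0] Idt_closed[OF assms]] by simp
  have "hom_diff A x x (0 + 0) (Cmp A x x x 0 0 (Idt A x) (Idt A x)) = ?u \<oplus>\<^bsub>hom_mod A x x (-1)\<^esub> ?u"
    by (subst Cmp_diff) (use assms u in \<open>simp_all add: Idt_closed signed_def Cmp_Idt_left Cmp_Idt_right\<close>)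
  then have "?u = ?u \<oplus>\<^bsub>hom_mod A x x (-1)\<^esub> ?u" using assms by (simp add: Idt_closed Cmp_Idt_left)
  then show ?thesis using u by (metis M.add.l_cancel_one')
qed

lemma Cmp_zero_left: assumes "x \<in> Obj A" "y \<in> Obj A" "z \<in> Obj A" "f \<in> hom_set A x y j"
  shows "Cmp A x y z i j \<zero>\<^bsub>hom_mod A y z i\<^esub> f = \<zero>\<^bsub>hom_mod A x z (i + j)\<^esub>"
  by (rule linear_map_zero[OF Cmp_linear_left[OF assms] hom_module hom_module]) (use assms in auto)

lemma Cmp_zero_right: assumes "x \<in> Obj A" "y \<in> Obj A" "z \<in> Obj A" "g \<in> hom_set A y z i"
  shows "Cmp A x y z i j g \<zero>\<^bsub>hom_mod A x y j\<^esub> = \<zero>\<^bsub>hom_mod A x z (i + j)\<^esub>"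
  by (rule linear_map_zero[OF Cmp_linear_right[OF assms] hom_module hom_module]) (use assms in auto)

end

locale attach_cells = dg_category R B for R (structure) and B :: "('o, 'b, 'a) edgcat" + fixes k :: int
begin

abbreviation wf where "wf e x y d \<equiv> wf_expr R k B e x y d"
abbreviation eq where "eq x y d e e' \<equiv> expr_eq R k B x y d e e'"
abbreviation rp where "rp x y d e \<equiv> repr R k B x y d e"
abbreviation df where "df e x y d \<equiv> expr_diff R B e x y d"

lemma wf_Obj: "wf e x y d \<Longrightarrow> x \<in> Obj B \<and> y \<in> Obj B"
  by (induction e arbitrary: x y d) auto

lemma eq_wf: "eq x y d e e' \<Longrightarrow> wf e x y d \<and> wf e' x y d"
proof (induction rule: expr_eq.induct)
  case (old_plus x y a d b)
  then interpret M: module R "hom_mod B x y d" by (simp add: hom_module)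
  show ?case using old_plus by auto
next
  case (old_scale x y r a d)
  then interpret M: module R "hom_mod B x y d" by (simp add: hom_module)
  show ?case using old_scale by auto
next
  case (comp_id_left f x y d) then show ?case using wf_Obj by (simp add: Idt_closed)
next
  case (comp_id_right f x y d) then show ?case using wf_Obj by (simp add: Idt_closed)
next
  case (plus_zero e x y d) then show ?case using wf_Obj by simp
next
  case (scale_zero e x y d) then show ?case using wf_Obj by simp
next
  case (old_comp x y z g i f j) then show ?case by (simp add: Cmp_closed)
qed simp_all

lemma eq_refl: "wf e x y d \<Longrightarrow> eq x y d e e" by (rule expr_eq.refl)

lemma repr_eq: "wf e x y d \<Longrightarrow> eq x y d e (rp x y d e)"
  unfolding repr_def by (rule someI[of _ e]) (rule eq_refl)

lemma repr_eq': "wf e x y d \<Longrightarrow> eq x y d (rp x y d e) e"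
  by (rule expr_eq.sym[OF repr_eq])

lemma repr_wf: "wf e x y d \<Longrightarrow> wf (rp x y d e) x y d"
  using eq_wf[OF repr_eq] by simp

lemma repr_cong: assumes "eq x y d e e'" shows "rp x y d e = rp x y d e'"
proof -
  have "eq x y d e f \<longleftrightarrow> eq x y d e' f" for f
    using expr_eq.trans[OF assms] expr_eq.trans[OF expr_eq.sym[OF assms]] by auto
  then show ?thesis unfolding repr_def by presburger
qed

lemma repr_iff: assumes "wf e x y d" "wf e' x y d"
  shows "rp x y d e = rp x y d e' \<longleftrightarrow> eq x y d e e'"
proof
  assume "rp x y d e = rp x y d e'"
  then have "eq x y d e (rp x y d e')" using repr_eq[OF assms(1)] by simp
  then show "eq x y d e e'" using repr_eq'[OF assms(2)] by (rule expr_eq.trans)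
qed (rule repr_cong)

lemma repr_repr: "wf e x y d \<Longrightarrow> rp x y d (rp x y d e) = rp x y d e"
  by (rule repr_cong[OF repr_eq'])

lemma old_zero: assumes "x \<in> Obj B" "y \<in> Obj B" shows "eq x y d (Old \<zero>\<^bsub>hom_mod B x y d\<^esub>) Zero"
proof -
  interpret M: module R "hom_mod B x y d" using assms by (rule hom_module)
  have 1: "eq x y d (Old (\<zero> \<odot>\<^bsub>hom_mod B x y d\<^esub> \<zero>\<^bsub>hom_mod B x y d\<^esub>)) (Scale \<zero> (Old \<zero>\<^bsub>hom_mod B x y d\<^esub>))"
    by (rule expr_eq.old_scale) (use assms in auto)
  have 2: "eq x y d (Scale \<zero> (Old \<zero>\<^bsub>hom_mod B x y d\<^esub>)) Zero"
    by (rule expr_eq.scale_zero) (use assms in auto)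
  have "\<zero> \<odot>\<^bsub>hom_mod B x y d\<^esub> \<zero>\<^bsub>hom_mod B x y d\<^esub> = \<zero>\<^bsub>hom_mod B x y d\<^esub>" by simp
  then show ?thesis using expr_eq.trans[OF 1 2] by (simp only:)
qed

lemma eq_neg: assumes "wf e x y d" shows "eq x y d (Plus (Scale (\<ominus> \<one>) e) e) Zero"
proof -
  have 1: "eq x y d (Plus (Scale (\<ominus> \<one>) e) e) (Plus (Scale (\<ominus> \<one>) e) (Scale \<one> e))"
    using assms by (intro expr_eq.plus_cong eq_refl expr_eq.sym[OF expr_eq.scale_one]) auto
  have 2: "eq x y d (Plus (Scale (\<ominus> \<one>) e) (Scale \<one> e)) (Scale (\<ominus> \<one> \<oplus> \<one>) e)"
    using assms by (intro expr_eq.sym[OF expr_eq.scale_plus_left]) auto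
  have 3: "eq x y d (Scale (\<ominus> \<one> \<oplus> \<one>) e) Zero" using expr_eq.scale_zero[of R k B, OF assms] by (simp add: l_neg)
  show ?thesis by (rule expr_eq.trans[OF expr_eq.trans[OF 1 2] 3])
qed

lemma attach_simps:
  "Obj (attach R k B) = Obj B"
  "hom_set (attach R k B) x y d = rp x y d ` {e. wf e x y d}"
  "\<zero>\<^bsub>hom_mod (attach R k B) x y d\<^esub> = rp x y d Zero"
  "e \<oplus>\<^bsub>hom_mod (attach R k B) x y d\<^esub> e' = rp x y d (Plus e e')"
  "r \<odot>\<^bsub>hom_mod (attach R k B) x y d\<^esub> e = rp x y d (Scale r e)"
  "hom_diff (attach R k B) x y d e = rp x y (d - 1) (df e x y d)"
  "Cmp (attach R k B) x y z i j g f = rp x z (i + j) (Comp y i j g f)"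
  "Idt (attach R k B) x = rp x x 0 (Old (Idt B x))"
  by (simp_all add: attach_def)

lemma rp_plus: "\<lbrakk>wf e x y d; wf e' x y d\<rbrakk> \<Longrightarrow> 
   rp x y d (Plus (rp x y d e) (rp x y d e')) = rp x y d (Plus e e')"
  by (intro repr_cong expr_eq.plus_cong repr_eq')

lemma rp_scale: "\<lbrakk>r \<in> carrier R; wf e x y d\<rbrakk> \<Longrightarrow> 
   rp x y d (Scale r (rp x y d e)) = rp x y d (Scale r e)"
  by (intro repr_cong expr_eq.scale_cong repr_eq')

lemma rp_comp: "\<lbrakk>y \<in> Obj B; wf g y z i; wf f x y j\<rbrakk> \<Longrightarrow> 
   rp x z (i + j) (Comp y i j (rp y z i g) (rp x y j f)) = rp x z (i + j) (Comp y i j g f)"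
  by (intro repr_cong expr_eq.comp_cong repr_eq')

lemma rp_plus_l: "\<lbrakk>wf e x y d; wf e' x y d\<rbrakk> \<Longrightarrow> 
   rp x y d (Plus (rp x y d e) e') = rp x y d (Plus e e')"
  by (intro repr_cong expr_eq.plus_cong repr_eq' eq_refl)
lemma rp_plus_r: "\<lbrakk>wf e x y d; wf e' x y d\<rbrakk> \<Longrightarrow> 
   rp x y d (Plus e (rp x y d e')) = rp x y d (Plus e e')"
  by (intro repr_cong expr_eq.plus_cong repr_eq' eq_refl)
lemma rp_comp_l: "\<lbrakk>y \<in> Obj B; wf g y z i; wf f x y j\<rbrakk> \<Longrightarrow> 
   rp x z (i + j) (Comp y i j (rp y z i g) f) = rp x z (i + j) (Comp y i j g f)"
  by (intro repr_cong expr_eq.comp_cong repr_eq' eq_refl)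
lemma rp_comp_r: "\<lbrakk>y \<in> Obj B; wf g y z i; wf f x y j\<rbrakk> \<Longrightarrow> 
   rp x z (i + j) (Comp y i j g (rp x y j f)) = rp x z (i + j) (Comp y i j g f)"
  by (intro repr_cong expr_eq.comp_cong repr_eq' eq_refl)

lemmas rps = rp_plus rp_scale rp_plus_l rp_plus_r repr_repr

lemma attach_module: assumes "x \<in> Obj B" "y \<in> Obj B" shows "module R (hom_mod (attach R k B) x y d)"
proof (rule moduleI)
  show "cring R" by (rule is_cring)
  show "abelian_group (hom_mod (attach R k B) x y d)"
  proof (rule abelian_groupI, goal_cases)
    case (3 a b c) then show ?case by (clarsimp simp: attach_simps rps) (intro repr_cong expr_eq.plus_assoc)
  next
    case (4 a b) then show ?case by (clarsimp simp: attach_simps rps) (intro repr_cong expr_eq.plus_comm)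
  next
    case (5 a) then show ?case using assms
      by (clarsimp simp: attach_simps rps) (intro repr_cong expr_eq.plus_zero)
  next
    case (6 a) 
    then obtain e where e: "wf e x y d" "a = rp x y d e" by (auto simp: attach_simps)
    have "rp x y d (Plus (Scale (\<ominus> \<one>) e) e) = rp x y d Zero" by (intro repr_cong eq_neg e)
    then show ?case
      apply (intro bexI[of _ "rp x y d (Scale (\<ominus> \<one>) e)"])
      using e by (simp_all add: attach_simps rps)
  qed (use assms in \<open>auto simp: attach_simps rps\<close>)
next
  fix r a assume "r \<in> carrier R" "a \<in> hom_set (attach R k B) x y d"
  then show "r \<odot>\<^bsub>hom_mod (attach R k B) x y d\<^esub> a \<in> hom_set (attach R k B) x y d"
    by (auto simp: attach_simps rps)
next
  fix r s a assume "r \<in> carrier R" "s \<in> carrier R" "a \<in> hom_set (attach R k B) x y d"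
  then show "(r \<oplus> s) \<odot>\<^bsub>hom_mod (attach R k B) x y d\<^esub> a = r \<odot>\<^bsub>hom_mod (attach R k B) x y d\<^esub> a
    \<oplus>\<^bsub>hom_mod (attach R k B) x y d\<^esub> s \<odot>\<^bsub>hom_mod (attach R k B) x y d\<^esub> a"
    by (clarsimp simp: attach_simps rps) (intro repr_cong expr_eq.scale_plus_left)
next
  fix r a b assume "r \<in> carrier R" "a \<in> hom_set (attach R k B) x y d" "b \<in> hom_set (attach R k B) x y d"
  then show "r \<odot>\<^bsub>hom_mod (attach R k B) x y d\<^esub> (a \<oplus>\<^bsub>hom_mod (attach R k B) x y d\<^esub> b) =
    r \<odot>\<^bsub>hom_mod (attach R k B) x y d\<^esub> a \<oplus>\<^bsub>hom_mod (attach R k B) x y d\<^esub> r \<odot>\<^bsub>hom_mod (attach R k B) x y d\<^esub> b"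
    by (clarsimp simp: attach_simps rps) (intro repr_cong expr_eq.scale_plus_right)
next
  fix r s a assume "r \<in> carrier R" "s \<in> carrier R" "a \<in> hom_set (attach R k B) x y d"
  then show "(r \<otimes> s) \<odot>\<^bsub>hom_mod (attach R k B) x y d\<^esub> a =
    r \<odot>\<^bsub>hom_mod (attach R k B) x y d\<^esub> (s \<odot>\<^bsub>hom_mod (attach R k B) x y d\<^esub> a)"
    by (clarsimp simp: attach_simps rps) (intro repr_cong expr_eq.scale_scale)
next
  fix a assume "a \<in> hom_set (attach R k B) x y d"
  then show "\<one> \<odot>\<^bsub>hom_mod (attach R k B) x y d\<^esub> a = a"
    by (clarsimp simp: attach_simps rps) (intro repr_cong expr_eq.scale_one)
qed

lemma df_wf: "wf e x y d \<Longrightarrow> wf (df e x y d) x y (d - 1)"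
proof (induction e arbitrary: x y d)
  case (Old e)
  then show ?case using linear_mapD(1)[OF hom_diff_linear] by auto
next
  case (Comp w i j g f)
  have "wf (df g w y i) w y (i - 1)" "wf (df f x w j) x w (j - 1)" using Comp by auto
  then show ?case using Comp.prems by (auto simp: sign_closed is_cring)
qed (auto simp: cycles_def)


abbreviation M where "M x y d \<equiv> hom_mod (attach R k B) x y d"

lemma rp_closed: "wf e x y d \<Longrightarrow> rp x y d e \<in> carrier (M x y d)"
  by (simp add: attach_simps)

lemma cl_plus: "\<lbrakk>wf e x y d; wf e' x y d\<rbrakk> \<Longrightarrow> rp x y d (Plus e e') = rp x y d e \<oplus>\<^bsub>M x y d\<^esub> rp x y d e'"
  by (simp add: attach_simps rps)

lemma cl_scale: "\<lbrakk>r \<in> carrier R; wf e x y d\<rbrakk> \<Longrightarrow> rp x y d (Scale r e) = r \<odot>\<^bsub>M x y d\<^esub> rp x y d e"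
  by (simp add: attach_simps rps)

lemma cl_zero: "rp x y d Zero = \<zero>\<^bsub>M x y d\<^esub>" by (simp add: attach_simps)

lemma cl_comp_plus_l: "\<lbrakk>y \<in> Obj B; wf g y z i; wf g' y z i; wf f x y j; d = i + j\<rbrakk> \<Longrightarrow>
  rp x z d (Comp y i j (Plus g g') f) = rp x z d (Comp y i j g f) \<oplus>\<^bsub>M x z d\<^esub> rp x z d (Comp y i j g' f)"
  by (simp add: cl_plus[symmetric]) (intro repr_cong expr_eq.comp_plus_left)

lemma cl_comp_plus_r: "\<lbrakk>y \<in> Obj B; wf g y z i; wf f x y j; wf f' x y j; d = i + j\<rbrakk> \<Longrightarrow>
  rp x z d (Comp y i j g (Plus f f')) = rp x z d (Comp y i j g f) \<oplus>\<^bsub>M x z d\<^esub> rp x z d (Comp y i j g f')"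
  by (simp add: cl_plus[symmetric]) (intro repr_cong expr_eq.comp_plus_right)

lemma cl_comp_scale_l: "\<lbrakk>y \<in> Obj B; r \<in> carrier R; wf g y z i; wf f x y j; d = i + j\<rbrakk> \<Longrightarrow>
  rp x z d (Comp y i j (Scale r g) f) = r \<odot>\<^bsub>M x z d\<^esub> rp x z d (Comp y i j g f)"
  by (simp add: cl_scale[symmetric]) (intro repr_cong expr_eq.comp_scale_left)

lemma cl_comp_scale_r: "\<lbrakk>y \<in> Obj B; r \<in> carrier R; wf g y z i; wf f x y j; d = i + j\<rbrakk> \<Longrightarrow>
  rp x z d (Comp y i j g (Scale r f)) = r \<odot>\<^bsub>M x z d\<^esub> rp x z d (Comp y i j g f)"
  by (simp add: cl_scale[symmetric]) (intro repr_cong expr_eq.comp_scale_right)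

lemma cl_comp_zero_l: assumes "y \<in> Obj B" "z \<in> Obj B" "wf f x y j" "d = i + j"
  shows "rp x z d (Comp y i j Zero f) = \<zero>\<^bsub>M x z d\<^esub>"
proof -
  have x: "x \<in> Obj B" using assms(3) wf_Obj by blast
  interpret M: module R "M x z d" by (rule attach_module) (use x assms in auto)
  have "rp x z d (Comp y i j Zero f) = rp x z d (Comp y i j (Scale \<zero> Zero) f)"
    unfolding assms(4)
    by (intro repr_cong expr_eq.comp_cong expr_eq.sym[OF expr_eq.scale_zero] eq_refl) (use assms in auto)
  also have "\<dots> = \<zero> \<odot>\<^bsub>M x z d\<^esub> rp x z d (Comp y i j Zero f)"
    by (rule cl_comp_scale_l) (use assms in auto)
  also have "\<dots> = \<zero>\<^bsub>M x z d\<^esub>" by (rule M.smult_l_null, rule rp_closed) (use assms in auto)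
  finally show ?thesis .
qed

lemma cl_comp_zero_r: assumes "y \<in> Obj B" "x \<in> Obj B" "wf g y z i" "d = i + j"
  shows "rp x z d (Comp y i j g Zero) = \<zero>\<^bsub>M x z d\<^esub>"
proof -
  have z: "z \<in> Obj B" using assms(3) wf_Obj by blast
  interpret M: module R "M x z d" by (rule attach_module) (use z assms in auto)
  have "rp x z d (Comp y i j g Zero) = rp x z d (Comp y i j g (Scale \<zero> Zero))"
    unfolding assms(4)
    by (intro repr_cong expr_eq.comp_cong expr_eq.sym[OF expr_eq.scale_zero] eq_refl) (use assms in auto)
  also have "\<dots> = \<zero> \<odot>\<^bsub>M x z d\<^esub> rp x z d (Comp y i j g Zero)"
    by (rule cl_comp_scale_r) (use assms in auto)
  also have "\<dots> = \<zero>\<^bsub>M x z d\<^esub>" by (rule M.smult_l_null, rule rp_closed) (use assms in auto)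
  finally show ?thesis .
qed

lemma cl_assoc: "\<lbrakk>x \<in> Obj B; y \<in> Obj B; wf h y z i; wf g x y j; wf f w x l; ij = i + j; jl = j + l; d = i + j + l\<rbrakk> \<Longrightarrow>
    rp w z d (Comp x ij l (Comp y i j h g) f) = rp w z d (Comp y i jl h (Comp x j l g f))"
  using repr_cong[OF expr_eq.comp_assoc[of x B y R k h z i g j f w l]] by simp

lemma cl_comp_cong: "\<lbrakk>y \<in> Obj B; eq y z i g g'; eq x y j f f'; d = i + j\<rbrakk> \<Longrightarrow>
    rp x z d (Comp y i j g f) = rp x z d (Comp y i j g' f')"
  using repr_cong[OF expr_eq.comp_cong] by simp

lemmas cls = cl_plus cl_scale cl_comp_plus_l cl_comp_plus_r cl_comp_scale_l cl_comp_scale_r cl_zero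
  cl_comp_zero_l cl_comp_zero_r

lemma eqI: "\<lbrakk>wf e x y d; wf e' x y d; rp x y d e = rp x y d e'\<rbrakk> \<Longrightarrow> eq x y d e e'"
  using repr_iff by simp

lemma sign_simps: "sign R i \<in> carrier R" "sign R (i + j) = sign R i \<otimes> sign R j" "sign R i \<otimes> sign R i = \<one>"
  "sign R 0 = \<one>"
  by (auto simp: sign_def l_minus r_minus)

lemma df_Old_Idt: assumes "x \<in> Obj B" shows "eq x x (-1) (Old (hom_diff B x x 0 (Idt B x))) Zero"
  unfolding diff_Idt[OF assms] by (rule old_zero[OF assms assms])

lemma df_cong: "eq x y d e e' \<Longrightarrow> eq x y (d - 1) (df e x y d) (df e' x y d)"
proof (induction rule: expr_eq.induct)
  case (refl e x y d)
  then show ?case by (intro eq_refl df_wf)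
next
  case (sym x y d e e')
  from sym.IH show ?case by (rule expr_eq.sym)
next
  case (trans x y d e e' e'')
  from trans.IH show ?case by (rule expr_eq.trans)
next
  case (plus_cong x y d e e' f f')
  then show ?case by (auto intro: expr_eq.plus_cong)
next
  case (scale_cong r x y d e e')
  then show ?case by (auto intro: expr_eq.scale_cong)
next
  case (comp_cong y z i g g' x j f f')
  have *: "i + j - 1 = (i - 1) + j" "i + j - 1 = i + (j - 1)" by auto
  have "eq x z (i + j - 1) (Comp y (i - 1) j (df g y z i) f) (Comp y (i - 1) j (df g' y z i) f')"
    unfolding *(1) using comp_cong by (intro expr_eq.comp_cong)
  moreover have "eq x z (i + j - 1) (Comp y i (j - 1) g (df f x y j)) (Comp y i (j - 1) g' (df f' x y j))"
    unfolding *(2) using comp_cong by (intro expr_eq.comp_cong)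
  ultimately show ?case by (auto intro!: expr_eq.plus_cong expr_eq.scale_cong simp: sign_simps)
next
  case (plus_assoc e x y d e' e'')
  then show ?case by (auto intro!: expr_eq.plus_assoc df_wf)
next
  case (plus_comm e x y d e')
  then show ?case by (auto intro!: expr_eq.plus_comm df_wf)
next
  case (plus_zero e x y d)
  then show ?case by (auto intro!: expr_eq.plus_zero df_wf)
next
  case (scale_plus_left r s e x y d)
  then show ?case by (auto intro!: expr_eq.scale_plus_left df_wf)
next
  case (scale_plus_right r e x y d e')
  then show ?case by (auto intro!: expr_eq.scale_plus_right df_wf)
next
  case (scale_scale r s e x y d)
  then show ?case by (auto intro!: expr_eq.scale_scale df_wf)
next
  case (scale_one e x y d)
  then show ?case by (auto intro!: expr_eq.scale_one df_wf)
next
  case (scale_zero e x y d)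
  then show ?case by (auto intro!: expr_eq.scale_zero df_wf)
next
  case (comp_plus_left y g z i g' f x j)
  note w = comp_plus_left comp_plus_left(2-4)[THEN df_wf] comp_plus_left(2-4)[THEN wf_Obj]
  interpret M: module R "M x z (i + j - 1)" by (rule attach_module) (use w in auto)
  show ?case
    by (rule eqI) (use w in \<open>auto simp: cls sign_simps rp_closed M.a_ac M.smult_r_distr\<close>)
next
  case (comp_plus_right y g z i f x j f')
  note w = comp_plus_right comp_plus_right(2-4)[THEN df_wf] comp_plus_right(2-4)[THEN wf_Obj]
  interpret M: module R "M x z (i + j - 1)" by (rule attach_module) (use w in auto)
  show ?case
    by (rule eqI) (use w in \<open>auto simp: cls sign_simps rp_closed M.a_ac M.smult_r_distr\<close>)
next
  case (comp_scale_left y r g z i f x j)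
  note w = comp_scale_left comp_scale_left(3-4)[THEN df_wf] comp_scale_left(3-4)[THEN wf_Obj]
  interpret M: module R "M x z (i + j - 1)" by (rule attach_module) (use w in auto)
  show ?case
    by (rule eqI) (use w in \<open>auto simp: cls sign_simps rp_closed M.smult_r_distr M.smult_assoc1[symmetric] m_comm\<close>)
next
  case (comp_scale_right y r g z i f x j)
  note w = comp_scale_right comp_scale_right(3-4)[THEN df_wf] comp_scale_right(3-4)[THEN wf_Obj]
  interpret M: module R "M x z (i + j - 1)" by (rule attach_module) (use w in auto)
  show ?case
    by (rule eqI) (use w in \<open>auto simp: cls sign_simps rp_closed M.smult_r_distr M.smult_assoc1[symmetric] m_comm\<close>)
next
  case (comp_assoc x y h z i g j f w l)
  note w = comp_assoc comp_assoc(3-5)[THEN df_wf] comp_assoc(3-5)[THEN wf_Obj]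
  interpret M: module R "M w z (i + j + l - 1)" by (rule attach_module) (use w in auto)
  have 1: "rp w z (i + j + l - 1) (Comp x (i + j - 1) l (Comp y (i - 1) j (df h y z i) g) f)
    = rp w z (i + j + l - 1) (Comp y (i - 1) (j + l) (df h y z i) (Comp x j l g f))"
    by (rule cl_assoc) (use w in auto)
  have 2: "rp w z (i + j + l - 1) (Comp x (i + j - 1) l (Comp y i (j - 1) h (df g x y j)) f)
    = rp w z (i + j + l - 1) (Comp y i (j + l - 1) h (Comp x (j - 1) l (df g x y j) f))"
    by (rule cl_assoc) (use w in auto)
  have 3: "rp w z (i + j + l - 1) (Comp x (i + j) (l - 1) (Comp y i j h g) (df f w x l))
    = rp w z (i + j + l - 1) (Comp y i (j + l - 1) h (Comp x j (l - 1) g (df f w x l)))"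
    by (rule cl_assoc) (use w in auto)
  show ?case
    by (rule eqI) (use w in \<open>auto simp: cls sign_simps rp_closed 1 2 3 M.a_ac M.smult_r_distr M.smult_assoc1[symmetric]\<close>)
next
  case (comp_id_left f x y d)
  note w = comp_id_left comp_id_left[THEN df_wf] comp_id_left[THEN wf_Obj]
  interpret M: module R "M x y (d - 1)" by (rule attach_module) (use w in auto)
  have 1: "rp x y (d - 1) (Comp y (-1) d (Old (hom_diff B y y 0 (Idt B y))) f) = \<zero>\<^bsub>M x y (d - 1)\<^esub>"
    by (subst cl_comp_cong[OF _ df_Old_Idt eq_refl]) (use w in \<open>auto simp: cl_comp_zero_l\<close>)
  have 2: "rp x y (d - 1) (Comp y 0 (d - 1) (Old (Idt B y)) (df f x y d)) = rp x y (d - 1) (df f x y d)"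
    by (rule repr_cong[OF expr_eq.comp_id_left]) (use w in auto)
  have 3: "wf (Old (hom_diff B y y 0 (Idt B y))) y y (-1)" using w by (auto dest: eq_wf[OF df_Old_Idt])
  show ?case
    by (rule eqI) (use w 3 in \<open>auto simp: cls sign_simps rp_closed 1 2 Idt_closed\<close>)
next
  case (comp_id_right f x y d)
  note w = comp_id_right comp_id_right[THEN df_wf] comp_id_right[THEN wf_Obj]
  interpret M: module R "M x y (d - 1)" by (rule attach_module) (use w in auto)
  have 1: "rp x y (d - 1) (Comp x d (-1) f (Old (hom_diff B x x 0 (Idt B x)))) = \<zero>\<^bsub>M x y (d - 1)\<^esub>"
    by (subst cl_comp_cong[OF _ eq_refl df_Old_Idt]) (use w in \<open>auto simp: cl_comp_zero_r\<close>)
  have 2: "rp x y (d - 1) (Comp x (d - 1) 0 (df f x y d) (Old (Idt B x))) = rp x y (d - 1) (df f x y d)"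
    by (rule repr_cong[OF expr_eq.comp_id_right]) (use w in auto)
  have 3: "wf (Old (hom_diff B x x 0 (Idt B x))) x x (-1)" using w by (auto dest: eq_wf[OF df_Old_Idt])
  show ?case
    by (rule eqI) (use w 3 in \<open>auto simp: cls sign_simps rp_closed 1 2 Idt_closed\<close>)
next
  case (old_plus x y a d b)
  note L = hom_diff_linear[OF old_plus(1,2), of d]
  show ?case using old_plus linear_mapD[OF L]
    by (simp) (intro expr_eq.old_plus, auto)
next
  case (old_scale x y r a d)
  note L = hom_diff_linear[OF old_scale(1,2), of d]
  show ?case using old_scale linear_mapD[OF L]
    by (simp) (intro expr_eq.old_scale, auto)
next
  case (old_comp x y z g i f j)
  note o = old_comp
  note dg = linear_mapD(1)[OF hom_diff_linear[OF o(2,3)] o(4)]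
  note df = linear_mapD(1)[OF hom_diff_linear[OF o(1,2)] o(5)]
  interpret H: module R "hom_mod B x z (i + j - 1)" by (rule hom_module[OF o(1,3)])
  have c: "Cmp B x y z (i - 1) j (hom_diff B y z i g) f \<in> hom_set B x z (i + j - 1)"
      "Cmp B x y z i (j - 1) g (hom_diff B x y j f) \<in> hom_set B x z (i + j - 1)"
    using Cmp_closed[OF o(1-3) dg o(5)] Cmp_closed[OF o(1-3) o(4) df] by (simp_all add: algebra_simps)
  have e: "i + j - 1 = (i - 1) + j" "i + j - 1 = i + (j - 1)" by auto
  have 1: "eq x z (i + j - 1) (Old (Cmp B x y z (i - 1) j (hom_diff B y z i g) f))
      (Comp y (i - 1) j (Old (hom_diff B y z i g)) (Old f))"
    unfolding e(1) by (rule expr_eq.old_comp) (use o dg in auto)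
  have 2: "eq x z (i + j - 1) (Old (Cmp B x y z i (j - 1) g (hom_diff B x y j f)))
      (Comp y i (j - 1) (Old g) (Old (hom_diff B x y j f)))"
    unfolding e(2) by (rule expr_eq.old_comp) (use o df in auto)
  have 3: "eq x z (i + j - 1) (Old (sign R i \<odot>\<^bsub>hom_mod B x z (i + j - 1)\<^esub> Cmp B x y z i (j - 1) g (hom_diff B x y j f)))
     (Scale (sign R i) (Comp y i (j - 1) (Old g) (Old (hom_diff B x y j f))))"
    by (rule expr_eq.trans[OF expr_eq.old_scale expr_eq.scale_cong[OF _ 2]]) (use o c in \<open>auto simp: sign_simps\<close>)
  have "hom_diff B x z (i + j) (Cmp B x y z i j g f) = Cmp B x y z (i - 1) j (hom_diff B y z i g) f
     \<oplus>\<^bsub>hom_mod B x z (i + j - 1)\<^esub> (sign R i \<odot>\<^bsub>hom_mod B x z (i + j - 1)\<^esub> Cmp B x y z i (j - 1) g (hom_diff B x y j f))"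
    using Cmp_diff[OF o] signed_eq[OF H.module_axioms c(2)] by simp
  then show ?case 
    using expr_eq.trans[OF expr_eq.old_plus expr_eq.plus_cong[OF 1 3], OF o(1,3)] c by (simp add: sign_simps)
qed

lemma df_df: "wf e x y d \<Longrightarrow> rp x y (d - 2) (df (df e x y d) x y (d - 1)) = \<zero>\<^bsub>M x y (d - 2)\<^esub>"
proof (induction e arbitrary: x y d)
  case (Old e)
  then show ?case using repr_cong[OF old_zero] by (simp add: hom_diff_diff cl_zero)
next
  case (Bound m u v c)
  then have "hom_diff B x y m c = \<zero>\<^bsub>hom_mod B x y (m - 1)\<^esub>" by (auto simp: cycles_def)
  then show ?case using Bound repr_cong[OF old_zero, of x y "m - 1"] by (auto simp add: cl_zero)
next
  case Zero
  then show ?case by (simp add: cl_zero)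
next
  case (Plus e e')
  then interpret M: module R "M x y (d - 2)" using wf_Obj by (intro attach_module) auto
  have w: "wf (df (df a x y d) x y (d - 1)) x y (d - 2)" if "wf a x y d" for a
    using df_wf[OF df_wf[OF that]] by simp
  show ?case using Plus w by (simp add: cls)
next
  case (Scale r e)
  then interpret M: module R "M x y (d - 2)" using wf_Obj by (intro attach_module) auto
  have w: "wf (df (df a x y d) x y (d - 1)) x y (d - 2)" if "wf a x y d" for a
    using df_wf[OF df_wf[OF that]] by simp
  show ?case using Scale w by (simp add: cls)
next
  case (Comp v i j g f)
  then have w: "v \<in> Obj B" "d = i + j" "wf g v y i" "wf f x v j" "x \<in> Obj B" "y \<in> Obj B" using wf_Obj by auto
  interpret M: module R "M x y (i + j - 2)" by (rule attach_module) (use w in auto)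
  note w' = w df_wf[OF w(3)] df_wf[OF w(4)]
  have dd: "wf (df (df g v y i) v y (i - 1)) v y (i - 2)" "wf (df (df f x v j) x v (j - 1)) x v (j - 2)"
    using df_wf[OF w'(7)] df_wf[OF w'(8)] by simp_all
  have g: "eq v y (i - 2) (df (df g v y i) v y (i - 1)) Zero"
    by (rule eqI) (use w dd Comp.IH(1)[OF w(3)] in \<open>auto simp: cl_zero\<close>)
  have f: "eq x v (j - 2) (df (df f x v j) x v (j - 1)) Zero"
    by (rule eqI) (use w dd Comp.IH(2)[OF w(4)] in \<open>auto simp: cl_zero\<close>)
  have 1: "rp x y (i + j - 2) (Comp v (i - 2) j (df (df g v y i) v y (i - 1)) f) = \<zero>\<^bsub>M x y (i + j - 2)\<^esub>"
    by (subst cl_comp_cong[OF w(1) g eq_refl]) (use w in \<open>auto simp: cl_comp_zero_l\<close>)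
  have 2: "rp x y (i + j - 2) (Comp v i (j - 2) g (df (df f x v j) x v (j - 1))) = \<zero>\<^bsub>M x y (i + j - 2)\<^esub>"
    by (subst cl_comp_cong[OF w(1) eq_refl f]) (use w in \<open>auto simp: cl_comp_zero_r\<close>)
  let ?X = "rp x y (i + j - 2) (Comp v (i - 1) (j - 1) (df g v y i) (df f x v j))"
  have X: "?X \<in> carrier (M x y (i + j - 2))" by (rule rp_closed) (use w' in auto)
  have s: "sign R (i - 1) \<odot>\<^bsub>M x y (i + j - 2)\<^esub> ?X = \<ominus>\<^bsub>M x y (i + j - 2)\<^esub> (sign R i \<odot>\<^bsub>M x y (i + j - 2)\<^esub> ?X)"
    using X by (simp add: sign_Suc[OF is_cring] M.smult_l_minus sign_simps)
  have e: "i - 1 - 1 = i - 2" "j - 1 - 1 = j - 2" by auto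
  show ?case unfolding w(2) using w' dd X 1 2 s by (simp add: cls sign_simps rp_closed e M.l_neg)
qed simp

lemma attach_complex: assumes "x \<in> Obj B" "y \<in> Obj B" shows "chain_complex R (Mor (attach R k B) x y)"
proof (intro chain_complex.intro[OF is_cring] chain_complex_axioms.intro, goal_cases)
  case (1 i) show ?case by (rule attach_module[OF assms])
next
  case (2 i) 
  have c: "rp x y (i - 1) (df (rp x y i e) x y i) = rp x y (i - 1) (df e x y i)" if "wf e x y i" for e
    by (rule repr_cong[OF df_cong[OF repr_eq'[OF that]]])
  show ?case 
    by (auto simp: linear_map_def attach_simps c rps df_wf)
next
  case (3 a i) 
  then obtain e where e: "wf e x y i" "a = rp x y i e" by (auto simp: attach_simps)
  have "eq x y (i - 1) (rp x y (i - 1) (df a x y i)) (df e x y i)"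
    unfolding e(2) by (rule expr_eq.trans[OF repr_eq'[OF df_wf] df_cong[OF repr_eq']]) (use e repr_wf in auto)
  then have "rp x y (i - 2) (df (rp x y (i - 1) (df a x y i)) x y (i - 1)) = rp x y (i - 2) (df (df e x y i) x y (i - 1))"
    using repr_cong[OF df_cong, of x y "i - 1"] by simp
  then show ?case using df_df[OF e(1)] by (simp add: attach_simps)
qed


lemma attach_dg_category: "dg_category R (attach R k B)"
proof (intro dg_category.intro[OF is_cring] dg_category_axioms.intro, goal_cases)
  case (1 x y) then show ?case by (simp add: attach_complex attach_simps)
next
  case (2 x) then show ?case by (simp add: attach_simps Idt_closed)
next
  case (3 x y z f j i)
  then obtain e where f: "wf e x y j" "f = rp x y j e" and o: "x \<in> Obj B" "y \<in> Obj B" "z \<in> Obj B" by (auto simp: attach_simps)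
  show ?case unfolding linear_map_def
  proof (safe, goal_cases)
    case (1 g) then show ?case using f o by (auto simp: attach_simps rp_comp)
  next
    case (2 a b) then obtain a' b' where *: "wf a' y z i" "a = rp y z i a'" "wf b' y z i" "b = rp y z i b'"
      by (auto simp: attach_simps)
    have "rp x z (i + j) (Comp y i j (rp y z i (Plus a' b')) (rp x y j e)) = rp x z (i + j) (Comp y i j (Plus a' b') e)"
      by (rule rp_comp) (use * f o in auto)
    also have "\<dots> = rp x z (i + j) (Plus (Comp y i j a' e) (Comp y i j b' e))"
      by (intro repr_cong expr_eq.comp_plus_left) (use * f o in auto)
    finally show ?case using * f o by (simp add: attach_simps rps rp_comp)
  next
    case (3 r a) then obtain a' where *: "wf a' y z i" "a = rp y z i a'" by (auto simp: attach_simps)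
    have "rp x z (i + j) (Comp y i j (rp y z i (Scale r a')) (rp x y j e)) = rp x z (i + j) (Comp y i j (Scale r a') e)"
      by (rule rp_comp) (use * f o 3 in auto)
    also have "\<dots> = rp x z (i + j) (Scale r (Comp y i j a' e))"
      by (intro repr_cong expr_eq.comp_scale_left) (use * f o 3 in auto)
    finally show ?case using * f o 3 by (simp add: attach_simps rps rp_comp)
  qed
next
  case (4 x y z g i j)
  then obtain e where g: "wf e y z i" "g = rp y z i e" and o: "x \<in> Obj B" "y \<in> Obj B" "z \<in> Obj B" by (auto simp: attach_simps)
  show ?case unfolding linear_map_def
  proof (safe, goal_cases)
    case (1 f) then show ?case using g o by (auto simp: attach_simps rp_comp)
  next
    case (2 a b) then obtain a' b' where *: "wf a' x y j" "a = rp x y j a'" "wf b' x y j" "b = rp x y j b'"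
      by (auto simp: attach_simps)
    have "rp x z (i + j) (Comp y i j (rp y z i e) (rp x y j (Plus a' b'))) = rp x z (i + j) (Comp y i j e (Plus a' b'))"
      by (rule rp_comp) (use * g o in auto)
    also have "\<dots> = rp x z (i + j) (Plus (Comp y i j e a') (Comp y i j e b'))"
      by (intro repr_cong expr_eq.comp_plus_right) (use * g o in auto)
    finally show ?case using * g o by (simp add: attach_simps rps rp_comp)
  next
    case (3 r a) then obtain a' where *: "wf a' x y j" "a = rp x y j a'" by (auto simp: attach_simps)
    have "rp x z (i + j) (Comp y i j (rp y z i e) (rp x y j (Scale r a'))) = rp x z (i + j) (Comp y i j e (Scale r a'))"
      by (rule rp_comp) (use * g o 3 in auto)
    also have "\<dots> = rp x z (i + j) (Scale r (Comp y i j e a'))"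
      by (intro repr_cong expr_eq.comp_scale_right) (use * g o 3 in auto)
    finally show ?case using * g o 3 by (simp add: attach_simps rps rp_comp)
  qed
next
  case (5 x y z g i f j)
  then obtain a b where *: "wf a y z i" "g = rp y z i a" "wf b x y j" "f = rp x y j b"
    and o: "x \<in> Obj B" "y \<in> Obj B" "z \<in> Obj B" by (auto simp: attach_simps)
  have ij: "i - 1 + j = i + j - 1" "i + (j - 1) = i + j - 1" by auto
  let ?g = "df a y z i" and ?f = "df b x y j"
  have w: "wf ?g y z (i - 1)" "wf ?f x y (j - 1)" "wf (Comp y (i - 1) j ?g b) x z (i + j - 1)" "wf (Comp y i (j - 1) a ?f) x z (i + j - 1)"
    using * o df_wf[OF *(1)] df_wf[OF *(3)] by auto
  have dg: "hom_diff (attach R k B) y z i g = rp y z (i - 1) ?g" "hom_diff (attach R k B) x y j f = rp x y (j - 1) ?f"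
    using * by (simp_all add: attach_simps repr_cong[OF df_cong[OF repr_eq']])
  have "hom_diff (attach R k B) x z (i + j) (Cmp (attach R k B) x y z i j g f)
     = rp x z (i + j - 1) (df (Comp y i j a b) x z (i + j))"
    using * o repr_cong[OF df_cong[OF repr_eq'], of "Comp y i j a b" x z "i + j"] by (simp add: attach_simps rp_comp)
  also have "\<dots> = rp x z (i + j - 1) (Comp y (i - 1) j ?g b) \<oplus>\<^bsub>M x z (i + j - 1)\<^esub>
      sign R i \<odot>\<^bsub>M x z (i + j - 1)\<^esub> rp x z (i + j - 1) (Comp y i (j - 1) a ?f)"
    using w by (simp add: cl_plus cl_scale sign_simps)
  also have "\<dots> = Cmp (attach R k B) x y z (i - 1) j (hom_diff (attach R k B) y z i g) f \<oplus>\<^bsub>M x z (i + j - 1)\<^esub>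
      sign R i \<odot>\<^bsub>M x z (i + j - 1)\<^esub> Cmp (attach R k B) x y z i (j - 1) g (hom_diff (attach R k B) x y j f)"
    unfolding dg using rp_comp[OF o(2) w(1) *(3)] rp_comp[OF o(2) *(1) w(2)] *(2,4) ij
    by (simp add: attach_simps(7) ij)
  also have "sign R i \<odot>\<^bsub>M x z (i + j - 1)\<^esub> Cmp (attach R k B) x y z i (j - 1) g (hom_diff (attach R k B) x y j f)
     = signed (M x z (i + j - 1)) i (Cmp (attach R k B) x y z i (j - 1) g (hom_diff (attach R k B) x y j f))"
  proof (rule signed_eq[symmetric, OF attach_module[OF o(1,3)]])
    show "Cmp (attach R k B) x y z i (j - 1) g (hom_diff (attach R k B) x y j f) \<in> carrier (M x z (i + j - 1))"
      unfolding dg using rp_comp[OF o(2) *(1) w(2)] *(2) w(4) by (simp add: attach_simps ij)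
  qed
  finally show ?case .
next
  case (6 v x y z h i g j f l)
  then obtain a b c where *: "wf a y z i" "h = rp y z i a" "wf b x y j" "g = rp x y j b" "wf c v x l" "f = rp v x l c"
    and o: "v \<in> Obj B" "x \<in> Obj B" "y \<in> Obj B" "z \<in> Obj B" by (auto simp: attach_simps)
  have "rp v z (i + j + l) (Comp x (i + j) l (Comp y i j a b) c) = rp v z (i + j + l) (Comp y i (j + l) a (Comp x j l b c))"
    by (rule cl_assoc) (use * o in auto)
  then show ?case using * o rp_comp[OF o(2), of "Comp y i j a b" z "i + j" c v l] rp_comp[OF o(3), of a z i "Comp x j l b c" v "j + l"]
    by (simp add: attach_simps rp_comp add.assoc)
next
  case (7 x y f i)
  then show ?case using rp_comp[of y "Old (Idt B y)" y 0 _ x i] repr_cong[OF expr_eq.comp_id_left]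
    by (auto simp: attach_simps Idt_closed)
next
  case (8 x y f i)
  then show ?case using rp_comp[of x _ y i "Old (Idt B x)" x 0] repr_cong[OF expr_eq.comp_id_right]
    by (auto simp: attach_simps Idt_closed)
qed

lemma attach_incl_functor: "dg_functor R B (attach R k B) (attach_incl R k B)"
proof -
  have c: "rp x y (i - 1) (Old (hom_diff B x y i a)) = rp x y (i - 1) (df (rp x y i (Old a)) x y i)"
    if "x \<in> Obj B" "y \<in> Obj B" "a \<in> hom_set B x y i" for x y i a
    using repr_cong[OF df_cong[OF repr_eq], of "Old a" x y i] that by simp
  have p: "rp x y i (Old (a \<oplus>\<^bsub>hom_mod B x y i\<^esub> b)) = rp x y i (Plus (Old a) (Old b))"
    if "x \<in> Obj B" "y \<in> Obj B" "a \<in> hom_set B x y i" "b \<in> hom_set B x y i" for x y i a b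
    by (rule repr_cong[OF expr_eq.old_plus[OF that]])
  have s: "rp x y i (Old (r \<odot>\<^bsub>hom_mod B x y i\<^esub> a)) = rp x y i (Scale r (Old a))"
    if "x \<in> Obj B" "y \<in> Obj B" "r \<in> carrier R" "a \<in> hom_set B x y i" for x y i a r
    by (rule repr_cong[OF expr_eq.old_scale[OF that]])
  have q: "rp x z (i + j) (Old (Cmp B x y z i j g f)) = rp x z (i + j) (Comp y i j (Old g) (Old f))"
    if "x \<in> Obj B" "y \<in> Obj B" "z \<in> Obj B" "g \<in> hom_set B y z i" "f \<in> hom_set B x y j" for x y z i j g f
    by (rule repr_cong[OF expr_eq.old_comp[OF that]])
  show ?thesis
    unfolding dg_functor_def chain_map_def linear_map_def
    using dg_category_axioms attach_dg_category
    by (auto simp: attach_incl_def attach_simps c p s q rp_plus rp_scale rp_comp)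
qed

lemma bounding_chain_closed: "\<lbrakk>m > k; x \<in> Obj B; y \<in> Obj B; c \<in> cycles (Mor B x y) m\<rbrakk> \<Longrightarrow>
  bounding_chain R k B m x y c \<in> carrier (M x y (m + 1))"
  by (simp add: bounding_chain_def attach_simps)

lemma bounding_chain_diff: assumes "m > k" "x \<in> Obj B" "y \<in> Obj B" "c \<in> cycles (Mor B x y) m"
  shows "hom_diff (attach R k B) x y (m + 1) (bounding_chain R k B m x y c) = fmor (attach_incl R k B) x y m c"
  using repr_cong[OF df_cong[OF repr_eq'], of "Bound m x y c" x y "m + 1"] assms
  by (simp add: attach_simps bounding_chain_def attach_incl_def)

end

lemma dg_functorD:
  assumes "dg_functor R A B F"
  shows "dg_category R A" "dg_category R B" "x \<in> Obj A \<Longrightarrow> fob F x \<in> Obj B"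
    and "\<lbrakk>x \<in> Obj A; y \<in> Obj A\<rbrakk> \<Longrightarrow>
      linear_map R (hom_mod A x y i) (hom_mod B (fob F x) (fob F y) i) (fmor F x y i)"
    and "\<lbrakk>x \<in> Obj A; y \<in> Obj A; a \<in> hom_set A x y i\<rbrakk> \<Longrightarrow>
      fmor F x y (i - 1) (hom_diff A x y i a) = hom_diff B (fob F x) (fob F y) i (fmor F x y i a)"
    and "x \<in> Obj A \<Longrightarrow> fmor F x x 0 (Idt A x) = Idt B (fob F x)"
    and "\<lbrakk>x \<in> Obj A; y \<in> Obj A; z \<in> Obj A; g \<in> hom_set A y z i; f \<in> hom_set A x y j\<rbrakk> \<Longrightarrow>
      fmor F x z (i + j) (Cmp A x y z i j g f) =
      Cmp B (fob F x) (fob F y) (fob F z) i j (fmor F y z i g) (fmor F x y j f)"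
  using assms by (auto simp: dg_functor_def chain_map_def)

locale attach_extension = attach_cells R B k for R :: "('b, 'x) ring_scheme" (structure) and B :: "('o, 'b, 'a) edgcat" and k +
  fixes X :: "('p, 'b, 'c) dgcat" and F and \<phi>
  assumes F: "dg_functor R B X F"
    and \<phi>: "\<lbrakk>m > k; x \<in> Obj B; y \<in> Obj B; c \<in> cycles (Mor B x y) m\<rbrakk> \<Longrightarrow>
      \<phi> m x y c \<in> hom_set X (fob F x) (fob F y) (m + 1)
      \<and> hom_diff X (fob F x) (fob F y) (m + 1) (\<phi> m x y c) = fmor F x y m c"
begin

abbreviation ev where "ev e x y d \<equiv> expr_ext X F \<phi> e x y d"

lemma X: "dg_category R X" using F by (rule dg_functorD)

lemmas Fob = dg_functorD(3)[OF F]
lemmas Flin = dg_functorD(4)[OF F]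

lemma X_module: "\<lbrakk>x \<in> Obj B; y \<in> Obj B\<rbrakk> \<Longrightarrow> module R (hom_mod X (fob F x) (fob F y) i)"
  by (intro dg_category.hom_module[OF X] Fob)

lemma ev_closed: "wf e x y d \<Longrightarrow> ev e x y d \<in> hom_set X (fob F x) (fob F y) d"
proof (induction e arbitrary: x y d)
  case (Old e) then show ?case using linear_mapD(1)[OF Flin] by auto
next
  case (Bound m u v c) then show ?case using \<phi> by auto
next
  case Zero then interpret H: module R "hom_mod X (fob F x) (fob F y) d" by (simp add: X_module)
  show ?case by simp
next
  case (Plus e1 e2)
  then interpret H: module R "hom_mod X (fob F x) (fob F y) d" using wf_Obj by (intro X_module) auto
  show ?case using Plus by simp
next
  case (Scale r e)
  then interpret H: module R "hom_mod X (fob F x) (fob F y) d" using wf_Obj by (intro X_module) auto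
  show ?case using Scale by simp
next
  case (Comp w i j g f)
  then have "x \<in> Obj B" "y \<in> Obj B" using wf_Obj by auto
  then show ?case using Comp by (auto intro!: dg_category.Cmp_closed[OF X] Fob)
qed simp

lemma ev_cong: "eq x y d e e' \<Longrightarrow> ev e x y d = ev e' x y d"
proof (induction rule: expr_eq.induct)
  case (plus_assoc e x y d e' e'')
  then interpret H: module R "hom_mod X (fob F x) (fob F y) d" using wf_Obj by (intro X_module) auto
  show ?case using plus_assoc by (simp add: ev_closed H.a_assoc)
next
  case (plus_comm e x y d e')
  then interpret H: module R "hom_mod X (fob F x) (fob F y) d" using wf_Obj by (intro X_module) auto
  show ?case using plus_comm by (simp add: ev_closed H.a_comm)
next
  case (plus_zero e x y d)
  then interpret H: module R "hom_mod X (fob F x) (fob F y) d" using wf_Obj by (intro X_module) auto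
  show ?case using plus_zero by (simp add: ev_closed)
next
  case (scale_plus_left r s e x y d)
  then interpret H: module R "hom_mod X (fob F x) (fob F y) d" using wf_Obj by (intro X_module) auto
  show ?case using scale_plus_left by (simp add: ev_closed H.smult_l_distr)
next
  case (scale_plus_right r e x y d e')
  then interpret H: module R "hom_mod X (fob F x) (fob F y) d" using wf_Obj by (intro X_module) auto
  show ?case using scale_plus_right by (simp add: ev_closed H.smult_r_distr)
next
  case (scale_scale r s e x y d)
  then interpret H: module R "hom_mod X (fob F x) (fob F y) d" using wf_Obj by (intro X_module) auto
  show ?case using scale_scale by (simp add: ev_closed H.smult_assoc1)
next
  case (scale_one e x y d)
  then interpret H: module R "hom_mod X (fob F x) (fob F y) d" using wf_Obj by (intro X_module) auto
  show ?case using scale_one by (simp add: ev_closed)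
next
  case (scale_zero e x y d)
  then interpret H: module R "hom_mod X (fob F x) (fob F y) d" using wf_Obj by (intro X_module) auto
  show ?case using scale_zero by (simp add: ev_closed)
next
  case (comp_plus_left y g z i g' f x j)
  then have o: "x \<in> Obj B" "z \<in> Obj B" using wf_Obj by auto
  show ?case using comp_plus_left o
    by (simp add: linear_mapD(2)[OF dg_category.Cmp_linear_left[OF X]] ev_closed Fob)
next
  case (comp_plus_right y g z i f x j f')
  then have o: "x \<in> Obj B" "z \<in> Obj B" using wf_Obj by auto
  show ?case using comp_plus_right o
    by (simp add: linear_mapD(2)[OF dg_category.Cmp_linear_right[OF X]] ev_closed Fob)
next
  case (comp_scale_left y r g z i f x j)
  then have o: "x \<in> Obj B" "z \<in> Obj B" using wf_Obj by auto
  show ?case using comp_scale_left o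
    by (simp add: linear_mapD(3)[OF dg_category.Cmp_linear_left[OF X]] ev_closed Fob)
next
  case (comp_scale_right y r g z i f x j)
  then have o: "x \<in> Obj B" "z \<in> Obj B" using wf_Obj by auto
  show ?case using comp_scale_right o
    by (simp add: linear_mapD(3)[OF dg_category.Cmp_linear_right[OF X]] ev_closed Fob)
next
  case (comp_assoc x y h z i g j f w l)
  then have o: "w \<in> Obj B" "z \<in> Obj B" using wf_Obj by auto
  show ?case using comp_assoc o
    by (simp add: dg_category.Cmp_assoc[OF X] ev_closed Fob)
next
  case (comp_id_left f x y d)
  then have o: "x \<in> Obj B" "y \<in> Obj B" using wf_Obj by auto
  show ?case using comp_id_left o
    by (simp add: dg_category.Cmp_Idt_left[OF X] dg_functorD(6)[OF F] ev_closed Fob)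
next
  case (comp_id_right f x y d)
  then have o: "x \<in> Obj B" "y \<in> Obj B" using wf_Obj by auto
  show ?case using comp_id_right o
    by (simp add: dg_category.Cmp_Idt_right[OF X] dg_functorD(6)[OF F] ev_closed Fob)
next
  case (old_plus x y a d b) then show ?case by (simp add: linear_mapD(2)[OF Flin])
next
  case (old_scale x y r a d) then show ?case by (simp add: linear_mapD(3)[OF Flin])
next
  case (old_comp x y z g i f j) then show ?case by (simp add: dg_functorD(7)[OF F])
qed simp_all

lemma ev_repr: "wf e x y d \<Longrightarrow> ev (rp x y d e) x y d = ev e x y d"
  by (rule ev_cong[OF repr_eq'])

lemma ev_diff: "wf e x y d \<Longrightarrow> ev (df e x y d) x y (d - 1) = hom_diff X (fob F x) (fob F y) d (ev e x y d)"
proof (induction e arbitrary: x y d)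
  case (Old e) then show ?case by (simp add: dg_functorD(5)[OF F])
next
  case (Bound m u v c) then show ?case using \<phi> by auto
next
  case Zero
  then show ?case using linear_map_zero[OF dg_category.hom_diff_linear[OF X] X_module X_module] by (simp add: Fob)
next
  case (Plus e1 e2)
  then have o: "x \<in> Obj B" "y \<in> Obj B" using wf_Obj by auto
  show ?case using Plus o
    by (simp add: linear_mapD(2)[OF dg_category.hom_diff_linear[OF X]] ev_closed Fob)
next
  case (Scale r e)
  then have o: "x \<in> Obj B" "y \<in> Obj B" using wf_Obj by auto
  show ?case using Scale o
    by (simp add: linear_mapD(3)[OF dg_category.hom_diff_linear[OF X]] ev_closed Fob)
next
  case (Comp w i j g f)
  then have o: "w \<in> Obj B" "x \<in> Obj B" "y \<in> Obj B" and d: "d = i + j" using wf_Obj by auto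
  note c = dg_category.Cmp_closed[OF X Fob[OF o(2)] Fob[OF o(1)] Fob[OF o(3)]]
  have "wf (df f x w j) x w (j - 1)" using Comp by (intro df_wf) auto
  then have "Cmp X (fob F x) (fob F w) (fob F y) i (j - 1) (ev g w y i) (ev (df f x w j) x w (j - 1))
      \<in> hom_set X (fob F x) (fob F y) (i + (j - 1))" using Comp.prems by (intro c ev_closed) auto
  moreover have "i + (j - 1) = i + j - 1" by simp
  ultimately have s: "Cmp X (fob F x) (fob F w) (fob F y) i (j - 1) (ev g w y i) (ev (df f x w j) x w (j - 1))
      \<in> hom_set X (fob F x) (fob F y) (i + j - 1)" by simp
  show ?case using Comp o d signed_eq[OF X_module s]
    by (simp add: dg_category.Cmp_diff[OF X] ev_closed Fob)
qed simp

lemma attach_ext_functor: "dg_functor R (attach R k B) X (attach_ext X F \<phi>)"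
  unfolding dg_functor_def chain_map_def linear_map_def
  using X attach_dg_category
  by (auto simp: attach_ext_def attach_simps ev_repr ev_closed Fob rps rp_comp ev_diff df_wf repr_wf Idt_closed
      dg_functorD(6)[OF F])

lemma attach_ext_incl: "dgfun_eq B (dgfun_comp (attach_ext X F \<phi>) (attach_incl R k B)) F"
  by (auto simp: dgfun_eq_def dgfun_comp_def attach_ext_def attach_incl_def ev_repr)

lemma attach_ext_bounding_chain: "\<lbrakk>m > k; x \<in> Obj B; y \<in> Obj B; c \<in> cycles (Mor B x y) m\<rbrakk> \<Longrightarrow>
   fmor (attach_ext X F \<phi>) x y (m + 1) (bounding_chain R k B m x y c) = \<phi> m x y c"
  by (simp add: attach_ext_def bounding_chain_def ev_repr)

lemma attach_ext_unique:
  assumes H: "dg_functor R (attach R k B) X H" and i: "dgfun_eq B (dgfun_comp H (attach_incl R k B)) F"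
    and b: "\<And>m x y c. \<lbrakk>m > k; x \<in> Obj B; y \<in> Obj B; c \<in> cycles (Mor B x y) m\<rbrakk> \<Longrightarrow>
      fmor H x y (m + 1) (bounding_chain R k B m x y c) = \<phi> m x y c"
  shows "dgfun_eq (attach R k B) H (attach_ext X F \<phi>)"
proof -
  have ob: "fob H x = fob F x" if "x \<in> Obj B" for x
    using i that by (auto simp: dgfun_eq_def dgfun_comp_def attach_incl_def)
  have old: "fmor H x y d (rp x y d (Old a)) = fmor F x y d a"
    if "x \<in> Obj B" "y \<in> Obj B" "a \<in> hom_set B x y d" for x y d a
    using i that by (auto simp: dgfun_eq_def dgfun_comp_def attach_incl_def)
  note lin = dg_functorD(4)[OF H, unfolded attach_simps(1)]
  have "fmor H x y d (rp x y d e) = ev e x y d" if "wf e x y d" for e x y d using that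
  proof (induction e arbitrary: x y d)
    case (Old e) then show ?case using old by simp
  next
    case (Bound m u v c) then show ?case using b by (auto simp: bounding_chain_def)
  next
    case Zero
    then have "fmor H x y d \<zero>\<^bsub>M x y d\<^esub> = \<zero>\<^bsub>hom_mod X (fob H x) (fob H y) d\<^esub>"
      by (intro linear_map_zero[OF lin attach_module]) (auto simp: ob X_module)
    then show ?case using Zero by (simp add: cl_zero ob)
  next
    case (Plus e1 e2)
    then have o: "x \<in> Obj B" "y \<in> Obj B" using wf_Obj by auto
    show ?case using Plus o by (simp add: cl_plus linear_mapD(2)[OF lin] rp_closed ob)
  next
    case (Scale r e)
    then have o: "x \<in> Obj B" "y \<in> Obj B" using wf_Obj by auto
    show ?case using Scale o by (simp add: cl_scale linear_mapD(3)[OF lin] rp_closed ob)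
  next
    case (Comp w i j g f)
    then have o: "w \<in> Obj B" "x \<in> Obj B" "y \<in> Obj B" using wf_Obj by auto
    have "rp x y d (Comp w i j g f) = Cmp (attach R k B) x w y i j (rp w y i g) (rp x w j f)"
      using Comp by (simp add: attach_simps(7) rp_comp)
    then show ?case using Comp o dg_functorD(7)[OF H, of x w y "rp w y i g" i "rp x w j f" j]
      by (simp add: attach_simps(1) rp_closed ob del: attach_simps(2))
  qed simp
  then show ?thesis
    by (auto simp: dgfun_eq_def attach_simps attach_ext_def ob ev_repr)
qed

end

lemma dg_functor_comp:
  assumes F: "dg_functor R A B F" and G: "dg_functor R B C G"
  shows "dg_functor R A C (dgfun_comp G F)"
  unfolding dg_functor_def
proof (intro conjI ballI allI funcsetI)
  fix x y assume o: "x \<in> Obj A" "y \<in> Obj A"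
  note o' = dg_functorD(3)[OF F o(1)] dg_functorD(3)[OF F o(2)]
  note lF = linear_mapD[OF dg_functorD(4)[OF F o]] and lG = linear_mapD[OF dg_functorD(4)[OF G o']]
  show "chain_map R (Mor A x y) (Mor C (fob (dgfun_comp G F) x) (fob (dgfun_comp G F) y)) (fmor (dgfun_comp G F) x y)"
    by (auto simp: chain_map_def linear_map_def dgfun_comp_def lF lG dg_functorD(5)[OF F o] dg_functorD(5)[OF G o'])
qed (use F G in \<open>simp_all add: dgfun_comp_def dg_functorD(1-3,6,7) linear_mapD(1)[OF dg_functorD(4)]\<close>)

lemma ring_module_simps:
  "carrier (ring_module R p) = (if p then carrier R else {\<zero>\<^bsub>R\<^esub>})"
  "\<zero>\<^bsub>ring_module R p\<^esub> = \<zero>\<^bsub>R\<^esub>"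
  "a \<oplus>\<^bsub>ring_module R p\<^esub> b = a \<oplus>\<^bsub>R\<^esub> b"
  "a \<odot>\<^bsub>ring_module R p\<^esub> b = a \<otimes>\<^bsub>R\<^esub> b"
  by (simp_all add: ring_module_def)

lemma ring_module: assumes "cring R" shows "module R (ring_module R p)"
proof -
  interpret cring R by fact
  show ?thesis
    by (rule moduleI, rule assms, rule abelian_groupI)
      (auto simp: ring_module_simps a_assoc a_comm a_lcomm l_distr r_distr m_assoc split: if_splits intro: bexI[of _ "\<ominus>\<^bsub>R\<^esub> _"] l_neg)
qed

lemma signed_ring: assumes "cring R" "a \<in> carrier (ring_module R p)" shows "signed (ring_module R p) i a = sign R i \<otimes>\<^bsub>R\<^esub> a"
  using signed_eq[OF ring_module[OF assms(1)] assms(2)] by (simp add: ring_module_simps)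

lemma sphere_simps:
  "Obj (sphere_cat R m) = {1, 2}"
  "hom_mod (sphere_cat R m) x y i = ring_module R (x = y \<and> i = 0 \<or> x = 1 \<and> y = 2 \<and> i = m)"
  "hom_diff (sphere_cat R m) x y i a = \<zero>\<^bsub>R\<^esub>"
  "Cmp (sphere_cat R m) x y z i j g f = g \<otimes>\<^bsub>R\<^esub> f"
  "Idt (sphere_cat R m) x = \<one>\<^bsub>R\<^esub>"
  by (simp_all add: sphere_cat_def)

lemma disk_simps:
  "Obj (disk_cat R k) = {3, 4}"
  "hom_mod (disk_cat R k) x y i = ring_module R (x = y \<and> i = 0 \<or> x = 3 \<and> y = 4 \<and> (i = k \<or> i = k - 1))"
  "hom_diff (disk_cat R k) x y i a = (if x = 3 \<and> y = 4 \<and> i = k then a else \<zero>\<^bsub>R\<^esub>)"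
  "Cmp (disk_cat R k) x y z i j g f = g \<otimes>\<^bsub>R\<^esub> f"
  "Idt (disk_cat R k) x = \<one>\<^bsub>R\<^esub>"
  by (simp_all add: disk_cat_def)

lemma ring_module_carrier: "\<lbrakk>cring R; a \<in> carrier (ring_module R p)\<rbrakk> \<Longrightarrow> a \<in> carrier R"
  by (auto simp: ring_module_simps cring.cring_simprules split: if_splits)

lemma ring_module_mult:
  assumes "cring R" "a \<in> carrier (ring_module R p)" "b \<in> carrier (ring_module R q)" "p \<and> q \<longrightarrow> s"
  shows "a \<otimes>\<^bsub>R\<^esub> b \<in> carrier (ring_module R s)"
proof -
  interpret cring R by fact
  show ?thesis using assms(2-) by (auto simp: ring_module_simps split: if_splits)
qed

lemma ring_module_linear:
  assumes "cring R" "a \<in> carrier (ring_module R q)" "p \<and> q \<longrightarrow> s"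
  shows "linear_map R (ring_module R p) (ring_module R s) (\<lambda>b. b \<otimes>\<^bsub>R\<^esub> a)"
    and "linear_map R (ring_module R p) (ring_module R s) (\<lambda>b. a \<otimes>\<^bsub>R\<^esub> b)"
proof -
  interpret cring R by fact
  note c = ring_module_carrier[OF assms(1)]
  note c2 = c[OF assms(2)]
  show "linear_map R (ring_module R p) (ring_module R s) (\<lambda>b. b \<otimes>\<^bsub>R\<^esub> a)"
    unfolding linear_map_def
  proof (intro conjI ballI funcsetI)
    show "b \<otimes>\<^bsub>R\<^esub> a \<in> carrier (ring_module R s)" if "b \<in> carrier (ring_module R p)" for b
      by (rule ring_module_mult[OF assms(1) that assms(2,3)])
  qed (use c c2 in \<open>simp_all add: ring_module_simps(2-) l_distr m_assoc\<close>)
  show "linear_map R (ring_module R p) (ring_module R s) (\<lambda>b. a \<otimes>\<^bsub>R\<^esub> b)"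
    unfolding linear_map_def
  proof (intro conjI ballI funcsetI)
    show "a \<otimes>\<^bsub>R\<^esub> b \<in> carrier (ring_module R s)" if "b \<in> carrier (ring_module R p)" for b
      by (rule ring_module_mult[OF assms(1,2) that]) (use assms(3) in auto)
  qed (use c c2 in \<open>simp_all add: ring_module_simps(2-) r_distr m_lcomm\<close>)
qed

lemma sphere_dg_category: assumes "cring R" shows "dg_category R (sphere_cat R m)"
proof -
  interpret cring R by fact
  note c = ring_module_carrier[OF assms]
  have cc: "chain_complex R (Mor (sphere_cat R m) x y)" for x y
    by (intro chain_complex.intro[OF assms] chain_complex_axioms.intro)
      (auto simp: sphere_simps ring_module[OF assms] linear_map_def ring_module_simps)
  show ?thesis
  proof (intro dg_category.intro[OF assms] dg_category_axioms.intro, unfold sphere_simps, goal_cases)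
    case (1 x y) show ?case by (rule cc)
  next
    case (2 x) show ?case by (simp add: ring_module_simps)
  next
    case (3 x y z f j i) show ?case by (rule ring_module_linear(1)[OF assms 3(4)]) (clarify, elim disjE conjE, simp_all)
  next
    case (4 x y z g i j) show ?case by (rule ring_module_linear(2)[OF assms 4(4)]) (clarify, elim disjE conjE, simp_all)
  next
    case (5 x y z g i f j)
    have gf: "g \<in> carrier R" "f \<in> carrier R" by (rule c[OF 5(4)], rule c[OF 5(5)])
    have "signed (ring_module R p) i \<zero>\<^bsub>R\<^esub> = \<zero>\<^bsub>R\<^esub>" for p
      by (subst signed_ring[OF assms]) (auto simp: ring_module_simps sign_def)
    then show ?case using gf by (simp add: ring_module_simps)
  next
    case (6 w x y z h i g j f l)
    then show ?case by (intro m_assoc) (rule c, assumption)+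
  next
    case (7 x y f i) then show ?case by (intro l_one) (rule c, assumption)
  next
    case (8 x y f i) then show ?case by (intro r_one) (rule c, assumption)
  qed
qed

lemma disk_dg_category: assumes "cring R" shows "dg_category R (disk_cat R k)"
proof -
  interpret cring R by fact
  note c = ring_module_carrier[OF assms]
  have cc: "chain_complex R (Mor (disk_cat R k) x y)" for x y
    by (intro chain_complex.intro[OF assms] chain_complex_axioms.intro)
      (auto simp: disk_simps ring_module[OF assms] linear_map_def ring_module_simps)
  show ?thesis
  proof (intro dg_category.intro[OF assms] dg_category_axioms.intro, unfold disk_simps, goal_cases)
    case (1 x y) show ?case by (rule cc)
  next
    case (2 x) show ?case by (simp add: ring_module_simps)
  next
    case (3 x y z f j i) show ?case by (rule ring_module_linear(1)[OF assms 3(4)]) (clarify, elim disjE conjE, simp_all)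
  next
    case (4 x y z g i j) show ?case by (rule ring_module_linear(2)[OF assms 4(4)]) (clarify, elim disjE conjE, simp_all)
  next
    case (5 x y z g i f j)
    have gf: "g \<in> carrier R" "f \<in> carrier R" by (rule c[OF 5(4)], rule c[OF 5(5)])
    have z: "signed (ring_module R p) i \<zero>\<^bsub>R\<^esub> = \<zero>\<^bsub>R\<^esub>" for p
      by (subst signed_ring[OF assms]) (auto simp: ring_module_simps sign_def)
    consider "x = 3 \<and> y = 3 \<and> z = 4" | "x = 3 \<and> y = 4 \<and> z = 4" | "\<not> (x = 3 \<and> z = 4)" using 5 by auto
    then show ?case
    proof cases
      case 1
      show ?thesis
      proof (cases "j = 0")
        case True then show ?thesis using 1 gf z by (simp add: ring_module_simps(2-))
      next
        case False
        then have "f = \<zero>\<^bsub>R\<^esub>" using 5 1 by (simp add: ring_module_simps)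
        then show ?thesis using 1 gf z by (simp add: ring_module_simps(2-))
      qed
    next
      case 2
      show ?thesis
      proof (cases "i = 0")
        case True then show ?thesis using 2 gf z by (simp add: ring_module_simps(2-) signed_def)
      next
        case False
        then have "g = \<zero>\<^bsub>R\<^esub>" using 5 2 by (simp add: ring_module_simps)
        then show ?thesis using 2 gf z by (simp add: ring_module_simps(2-))
      qed
    next
      case 3
      then have "g \<otimes>\<^bsub>R\<^esub> f = \<zero>\<^bsub>R\<^esub> \<or> x = y \<and> y = z" using 5 gf by (auto simp: ring_module_simps)
      moreover have "g = \<zero>\<^bsub>R\<^esub> \<or> f = \<zero>\<^bsub>R\<^esub> \<or> x = y \<and> y = z" using 5 3 by (auto simp: ring_module_simps)
      ultimately show ?thesis using 3 gf z by (auto simp: ring_module_simps(2-))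
    qed
  next
    case (6 w x y z h i g j f l)
    then show ?case by (intro m_assoc) (rule c, assumption)+
  next
    case (7 x y f i) then show ?case by (intro l_one) (rule c, assumption)
  next
    case (8 x y f i) then show ?case by (intro r_one) (rule c, assumption)
  qed
qed

lemma sphere_to_disk_functor: assumes "cring R" shows "dg_functor R (sphere_cat R m) (disk_cat R (m + 1)) sphere_to_disk"
proof -
  interpret cring R by fact
  show ?thesis
    using sphere_dg_category[OF assms] disk_dg_category[OF assms]
    by (auto simp: dg_functor_def chain_map_def linear_map_def sphere_simps disk_simps ring_module_simps sphere_to_disk_def)
qed

lemma ring_basis_functor:
  assumes K: "dg_category R K" and X: "dg_category R X"
    and Kh: "\<And>s t i. hom_mod K s t i = ring_module R (p s t i)"
    and Kd: "\<And>s t i a. hom_diff K s t i a = (if q s t i then a else \<zero>\<^bsub>R\<^esub>)"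
    and KC: "\<And>s t u i j g f. Cmp K s t u i j g f = g \<otimes>\<^bsub>R\<^esub> f" and KI: "\<And>s. Idt K s = \<one>\<^bsub>R\<^esub>"
    and ob: "\<And>s. s \<in> Obj K \<Longrightarrow> ob s \<in> Obj X"
    and e: "\<And>s t i. \<lbrakk>s \<in> Obj K; t \<in> Obj K\<rbrakk> \<Longrightarrow> e s t i \<in> hom_set X (ob s) (ob t) i"
    and eI: "\<And>s. s \<in> Obj K \<Longrightarrow> e s s 0 = Idt X (ob s)"
    and eC: "\<And>s t u i j. \<lbrakk>s \<in> Obj K; t \<in> Obj K; u \<in> Obj K; p t u i; p s t j\<rbrakk> \<Longrightarrow>
      Cmp X (ob s) (ob t) (ob u) i j (e t u i) (e s t j) = e s u (i + j)"
    and ed: "\<And>s t i. \<lbrakk>s \<in> Obj K; t \<in> Obj K; p s t i\<rbrakk> \<Longrightarrow> hom_diff X (ob s) (ob t) i (e s t i) =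
      (if q s t i then e s t (i - 1) else \<zero>\<^bsub>hom_mod X (ob s) (ob t) (i - 1)\<^esub>)"
  shows "dg_functor R K X \<lparr>fob = ob, fmor = (\<lambda>s t i r. r \<odot>\<^bsub>hom_mod X (ob s) (ob t) i\<^esub> e s t i)\<rparr>"
proof -
  interpret X: dg_category R X by fact
  note R = X.is_cring
  note c = ring_module_carrier[OF R]
  have m: "module R (hom_mod X (ob s) (ob t) i)" if "s \<in> Obj K" "t \<in> Obj K" for s t i
    using that by (intro X.hom_module ob)
  have z: "r = \<zero>\<^bsub>R\<^esub>" if "r \<in> carrier (ring_module R b)" "\<not> b" for r b
    using that by (simp add: ring_module_simps)
  show ?thesis
    unfolding dg_functor_def
  proof (intro conjI ballI allI funcsetI K X, goal_cases)
    case (1 s) then show ?case by (simp add: ob)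
  next
    case (2 s t)
    have "linear_map R (hom_mod K s t i) (hom_mod X (ob s) (ob t) i) (\<lambda>r. r \<odot>\<^bsub>hom_mod X (ob s) (ob t) i\<^esub> e s t i)" for i
    proof -
      interpret H: module R "hom_mod X (ob s) (ob t) i" by (rule m) (use 2 in auto)
      show ?thesis using c e[OF 2, of i]
        by (auto simp: linear_map_def Kh ring_module_simps(2-) H.smult_l_distr H.smult_assoc1)
    qed
    moreover have "hom_diff K s t i r \<odot>\<^bsub>hom_mod X (ob s) (ob t) (i - 1)\<^esub> e s t (i - 1) =
        hom_diff X (ob s) (ob t) i (r \<odot>\<^bsub>hom_mod X (ob s) (ob t) i\<^esub> e s t i)" if "r \<in> hom_set K s t i" for i r
    proof -
      interpret H: module R "hom_mod X (ob s) (ob t) i" by (rule m) (use 2 in auto)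
      interpret H1: module R "hom_mod X (ob s) (ob t) (i - 1)" by (rule m) (use 2 in auto)
      note L = X.hom_diff_linear[OF ob[OF 2(1)] ob[OF 2(2)], of i]
      have r: "r \<in> carrier R" using that c unfolding Kh by auto
      have *: "hom_diff X (ob s) (ob t) i (r \<odot>\<^bsub>hom_mod X (ob s) (ob t) i\<^esub> e s t i)
        = r \<odot>\<^bsub>hom_mod X (ob s) (ob t) (i - 1)\<^esub> hom_diff X (ob s) (ob t) i (e s t i)"
        by (rule linear_mapD(3)[OF L r e[OF 2]])
      show ?thesis
      proof (cases "p s t i")
        case True then show ?thesis unfolding * ed[OF 2 True] Kd using r e[OF 2, of "i - 1"] by simp
      next
        case False
        then have "r = \<zero>\<^bsub>R\<^esub>" using that z unfolding Kh by blast
        then show ?thesis unfolding * Kd using linear_mapD(1)[OF L e[OF 2]] e[OF 2, of "i - 1"] by simp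
      qed
    qed
    ultimately show ?case by (simp add: chain_map_def)
  next
    case (3 s)
    interpret H: module R "hom_mod X (ob s) (ob s) 0" by (rule m) (use 3 in auto)
    show ?case using e[OF 3 3, of 0] by (simp add: KI eI[OF 3])
  next
    case (4 s t u i j g f)
    interpret H: module R "hom_mod X (ob s) (ob u) (i + j)" by (rule m) (use 4 in auto)
    have gf: "g \<in> carrier R" "f \<in> carrier R" using 4(4,5) c unfolding Kh by auto
    let ?e = "e t u i" and ?e' = "e s t j"
    have ee: "?e \<in> hom_set X (ob t) (ob u) i" "?e' \<in> hom_set X (ob s) (ob t) j" using 4 e by auto
    interpret H2: module R "hom_mod X (ob s) (ob t) j" by (rule m) (use 4 in auto)
    have "Cmp X (ob s) (ob t) (ob u) i j (g \<odot>\<^bsub>hom_mod X (ob t) (ob u) i\<^esub> ?e) (f \<odot>\<^bsub>hom_mod X (ob s) (ob t) j\<^esub> ?e')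
       = g \<odot>\<^bsub>hom_mod X (ob s) (ob u) (i + j)\<^esub> (f \<odot>\<^bsub>hom_mod X (ob s) (ob u) (i + j)\<^esub> Cmp X (ob s) (ob t) (ob u) i j ?e ?e')"
      using linear_mapD(3)[OF X.Cmp_linear_left[OF ob ob ob, of s t u "f \<odot>\<^bsub>hom_mod X (ob s) (ob t) j\<^esub> ?e'" j i] gf(1) ee(1)]
        linear_mapD(3)[OF X.Cmp_linear_right[OF ob ob ob ee(1), of s j] gf(2) ee(2)] 4 gf ee by simp
    also have "\<dots> = (g \<otimes>\<^bsub>R\<^esub> f) \<odot>\<^bsub>hom_mod X (ob s) (ob u) (i + j)\<^esub> Cmp X (ob s) (ob t) (ob u) i j ?e ?e'"
      using gf X.Cmp_closed[OF ob ob ob ee] 4 by (simp add: H.smult_assoc1)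
    also have "\<dots> = (g \<otimes>\<^bsub>R\<^esub> f) \<odot>\<^bsub>hom_mod X (ob s) (ob u) (i + j)\<^esub> e s u (i + j)"
    proof (cases "p t u i \<and> p s t j")
      case True then show ?thesis using 4 eC by simp
    next
      case False
      then have "g = \<zero>\<^bsub>R\<^esub> \<or> f = \<zero>\<^bsub>R\<^esub>" using 4(4,5) z unfolding Kh by blast
      then have "g \<otimes>\<^bsub>R\<^esub> f = \<zero>\<^bsub>R\<^esub>" using gf by auto
      then show ?thesis using X.Cmp_closed[OF ob ob ob ee] 4 e[of s u "i + j"] by simp
    qed
    finally show ?case by (simp add: KC)
  qed
qed

definition sphere_fun :: "('o, 'r, 'a) dgcat \<Rightarrow> int \<Rightarrow> 'o \<Rightarrow> 'o \<Rightarrow> 'a \<Rightarrow> (nat, 'r, 'o, 'a) dgfun" where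
  "sphere_fun X m x y c = (let ob = (\<lambda>s. if s = 1 then x else y) in \<lparr>fob = ob,
     fmor = (\<lambda>s t i r. r \<odot>\<^bsub>hom_mod X (ob s) (ob t) i\<^esub>
        (if s = t \<and> i = 0 then Idt X (ob s) else if s = 1 \<and> t = 2 \<and> i = m then c
         else \<zero>\<^bsub>hom_mod X (ob s) (ob t) i\<^esub>))\<rparr>)"

definition disk_fun :: "('o, 'r, 'a) dgcat \<Rightarrow> int \<Rightarrow> 'o \<Rightarrow> 'o \<Rightarrow> 'a \<Rightarrow> (nat, 'r, 'o, 'a) dgfun" where
  "disk_fun X k x y b = (let ob = (\<lambda>s. if s = 3 then x else y) in \<lparr>fob = ob,
     fmor = (\<lambda>s t i r. r \<odot>\<^bsub>hom_mod X (ob s) (ob t) i\<^esub>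
        (if s = t \<and> i = 0 then Idt X (ob s) else if s = 3 \<and> t = 4 \<and> i = k then b
         else if s = 3 \<and> t = 4 \<and> i = k - 1 then hom_diff X (ob s) (ob t) k b
         else \<zero>\<^bsub>hom_mod X (ob s) (ob t) i\<^esub>))\<rparr>)"

lemma sphere_fun_functor:
  assumes X: "dg_category R X" and xy: "x \<in> Obj X" "y \<in> Obj X" and c: "c \<in> cycles (Mor X x y) m"
  shows "dg_functor R (sphere_cat R m) X (sphere_fun X m x y c)"
proof -
  interpret X: dg_category R X by fact
  have c': "c \<in> hom_set X x y m" "hom_diff X x y m c = \<zero>\<^bsub>hom_mod X x y (m - 1)\<^esub>" using c by (auto simp: cycles_def)
  have z: "\<zero>\<^bsub>hom_mod X u v i\<^esub> \<in> hom_set X u v i" if "u \<in> Obj X" "v \<in> Obj X" for u v i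
  proof -
    interpret H: module R "hom_mod X u v i" by (rule X.hom_module[OF that])
    show ?thesis by simp
  qed
  show ?thesis unfolding sphere_fun_def Let_def
  proof (rule ring_basis_functor[where q = "\<lambda>_ _ _. False", OF sphere_dg_category[OF X.is_cring] X sphere_simps(2) _ sphere_simps(4,5)], goal_cases)
    case (5 s t u i j)
    then show ?case unfolding sphere_simps
      by (elim insertE emptyE) (simp_all add: X.Cmp_Idt_left X.Cmp_Idt_right X.Idt_closed xy c')
  next
    case (6 s t i)
    then show ?case unfolding sphere_simps
      by (elim insertE emptyE) (auto simp add: X.diff_Idt xy c')
  qed (use xy c' in \<open>auto simp: sphere_simps z X.Idt_closed\<close>)
qed

lemma disk_fun_functor:
  assumes X: "dg_category R X" and xy: "x \<in> Obj X" "y \<in> Obj X" and b: "b \<in> hom_set X x y k"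
  shows "dg_functor R (disk_cat R k) X (disk_fun X k x y b)"
proof -
  interpret X: dg_category R X by fact
  have b': "hom_diff X x y k b \<in> hom_set X x y (k - 1)"
    "hom_diff X x y (k - 1) (hom_diff X x y k b) = \<zero>\<^bsub>hom_mod X x y (k - 2)\<^esub>"
    using b linear_mapD(1)[OF X.hom_diff_linear[OF xy]] X.hom_diff_diff[OF xy] by auto
  have z: "\<zero>\<^bsub>hom_mod X u v i\<^esub> \<in> hom_set X u v i" if "u \<in> Obj X" "v \<in> Obj X" for u v i
  proof -
    interpret H: module R "hom_mod X u v i" by (rule X.hom_module[OF that])
    show ?thesis by simp
  qed
  show ?thesis unfolding disk_fun_def Let_def
  proof (rule ring_basis_functor[OF disk_dg_category[OF X.is_cring] X disk_simps(2,3,4,5)], goal_cases)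
    case (4 s t u i j)
    then show ?case unfolding disk_simps
      by (elim insertE emptyE) (auto simp add: X.Cmp_Idt_left X.Cmp_Idt_right X.Idt_closed xy b b')
  next
    case (5 s t i)
    then show ?case unfolding disk_simps
      by (elim insertE emptyE) (auto simp add: X.diff_Idt xy b b')
  qed (use xy b b' in \<open>auto simp: disk_simps z X.Idt_closed\<close>)
qed

lemma sphere_functor_eqI:
  assumes K: "dg_functor R (sphere_cat R m) X K" and K': "dg_functor R (sphere_cat R m) X K'"
    and ob: "fob K 1 = fob K' 1" "fob K 2 = fob K' 2" and mor: "fmor K 1 2 m \<one>\<^bsub>R\<^esub> = fmor K' 1 2 m \<one>\<^bsub>R\<^esub>"
  shows "dgfun_eq (sphere_cat R m) K K'"
proof -
  interpret cring R using dg_functorD(1)[OF K] by (rule dg_category.axioms)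
  note sc = sphere_dg_category[OF is_cring, of m]
  have o: "fob K s = fob K' s" if "s \<in> {1, 2}" for s using that ob by auto
  have "fmor K s t i r = fmor K' s t i r" if st: "s \<in> {1, 2}" "t \<in> {1, 2}" and r: "r \<in> hom_set (sphere_cat R m) s t i" for s t i r
  proof -
    have st': "s \<in> Obj (sphere_cat R m)" "t \<in> Obj (sphere_cat R m)" using st by (auto simp: sphere_simps)
    note L = dg_functorD(4)[OF K st', of i] and L' = dg_functorD(4)[OF K' st', of i]
    have rR: "r \<in> carrier R" using r ring_module_carrier[OF is_cring] unfolding sphere_simps by blast
    consider "s = t" "i = 0" | "s = 1" "t = 2" "i = m" | "r = \<zero>\<^bsub>R\<^esub>" using r by (auto simp: sphere_simps ring_module_simps split: if_splits)
    then show ?thesis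
    proof cases
      case 1
      then have "\<one>\<^bsub>R\<^esub> \<in> hom_set (sphere_cat R m) s t i" by (simp add: sphere_simps ring_module_simps)
      from linear_mapD(3)[OF L rR this] linear_mapD(3)[OF L' rR this] show ?thesis
        using 1 rR o st dg_functorD(6)[OF K st'(1)] dg_functorD(6)[OF K' st'(1)] by (simp add: sphere_simps ring_module_simps)
    next
      case 2
      then have "\<one>\<^bsub>R\<^esub> \<in> hom_set (sphere_cat R m) s t i" by (simp add: sphere_simps ring_module_simps)
      from linear_mapD(3)[OF L rR this] linear_mapD(3)[OF L' rR this] show ?thesis
        using 2 rR o st mor by (simp add: sphere_simps ring_module_simps)
    next
      case 3
      have "fmor K s t i \<zero>\<^bsub>hom_mod (sphere_cat R m) s t i\<^esub> = fmor K' s t i \<zero>\<^bsub>hom_mod (sphere_cat R m) s t i\<^esub>"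
        using linear_map_zero[OF L dg_category.hom_module[OF sc st'] dg_category.hom_module[OF dg_functorD(2)[OF K]]]
          linear_map_zero[OF L' dg_category.hom_module[OF sc st'] dg_category.hom_module[OF dg_functorD(2)[OF K']]]
          dg_functorD(3)[OF K] dg_functorD(3)[OF K'] st' o st by auto
      then show ?thesis using 3 by (simp add: sphere_simps ring_module_simps)
    qed
  qed
  then show ?thesis using o by (auto simp: dgfun_eq_def sphere_simps(1))
qed

lemma disk_functor_eqI:
  assumes K: "dg_functor R (disk_cat R k) X K" and K': "dg_functor R (disk_cat R k) X K'"
    and ob: "fob K 3 = fob K' 3" "fob K 4 = fob K' 4" and mor: "fmor K 3 4 k \<one>\<^bsub>R\<^esub> = fmor K' 3 4 k \<one>\<^bsub>R\<^esub>"
  shows "dgfun_eq (disk_cat R k) K K'"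
proof -
  interpret cring R using dg_functorD(1)[OF K] by (rule dg_category.axioms)
  note sc = disk_dg_category[OF is_cring, of k]
  have o: "fob K s = fob K' s" if "s \<in> {3, 4}" for s using that ob by auto
  have o34: "3 \<in> Obj (disk_cat R k)" "4 \<in> Obj (disk_cat R k)" by (auto simp: disk_simps)
  have "\<one>\<^bsub>R\<^esub> \<in> hom_set (disk_cat R k) 3 4 k" by (simp add: disk_simps ring_module_simps)
  from dg_functorD(5)[OF K o34 this] dg_functorD(5)[OF K' o34 this]
  have mor': "fmor K 3 4 (k - 1) \<one>\<^bsub>R\<^esub> = fmor K' 3 4 (k - 1) \<one>\<^bsub>R\<^esub>" using ob mor by (simp add: disk_simps)
  have "fmor K s t i r = fmor K' s t i r" if st: "s \<in> {3, 4}" "t \<in> {3, 4}" and r: "r \<in> hom_set (disk_cat R k) s t i" for s t i r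
  proof -
    have st': "s \<in> Obj (disk_cat R k)" "t \<in> Obj (disk_cat R k)" using st by (auto simp: disk_simps)
    note L = dg_functorD(4)[OF K st', of i] and L' = dg_functorD(4)[OF K' st', of i]
    have rR: "r \<in> carrier R" using r ring_module_carrier[OF is_cring] unfolding disk_simps by blast
    consider "s = t" "i = 0" | "s = 3" "t = 4" "i = k \<or> i = k - 1" | "r = \<zero>\<^bsub>R\<^esub>"
      using r by (auto simp: disk_simps ring_module_simps split: if_splits)
    then show ?thesis
    proof cases
      case 1
      then have "\<one>\<^bsub>R\<^esub> \<in> hom_set (disk_cat R k) s t i" by (simp add: disk_simps ring_module_simps)
      from linear_mapD(3)[OF L rR this] linear_mapD(3)[OF L' rR this] show ?thesis
        using 1 rR o st dg_functorD(6)[OF K st'(1)] dg_functorD(6)[OF K' st'(1)] by (simp add: disk_simps ring_module_simps)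
    next
      case 2
      then have "\<one>\<^bsub>R\<^esub> \<in> hom_set (disk_cat R k) s t i" by (simp add: disk_simps ring_module_simps)
      from linear_mapD(3)[OF L rR this] linear_mapD(3)[OF L' rR this] show ?thesis
        using 2 rR o st mor mor' by (auto simp add: disk_simps ring_module_simps)
    next
      case 3
      have "fmor K s t i \<zero>\<^bsub>hom_mod (disk_cat R k) s t i\<^esub> = fmor K' s t i \<zero>\<^bsub>hom_mod (disk_cat R k) s t i\<^esub>"
        using linear_map_zero[OF L dg_category.hom_module[OF sc st'] dg_category.hom_module[OF dg_functorD(2)[OF K]]]
          linear_map_zero[OF L' dg_category.hom_module[OF sc st'] dg_category.hom_module[OF dg_functorD(2)[OF K']]]
          dg_functorD(3)[OF K] dg_functorD(3)[OF K'] st' o st by auto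
      then show ?thesis using 3 by (simp add: disk_simps ring_module_simps)
    qed
  qed
  then show ?thesis using o by (auto simp: dgfun_eq_def disk_simps(1))
qed

lemma sphere_functor_cycle:
  assumes T: "dg_functor R (sphere_cat R m) B T"
  shows "fob T 1 \<in> Obj B" "fob T 2 \<in> Obj B" "fmor T 1 2 m \<one>\<^bsub>R\<^esub> \<in> cycles (Mor B (fob T 1) (fob T 2)) m"
proof -
  interpret cring R using dg_functorD(1)[OF T] by (rule dg_category.axioms)
  have o: "1 \<in> Obj (sphere_cat R m)" "2 \<in> Obj (sphere_cat R m)" by (simp_all add: sphere_simps)
  show ob: "fob T 1 \<in> Obj B" "fob T 2 \<in> Obj B" using dg_functorD(3)[OF T] o by auto
  have 1: "\<one>\<^bsub>R\<^esub> \<in> hom_set (sphere_cat R m) 1 2 m" by (simp add: sphere_simps ring_module_simps)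
  have "fmor T 1 2 (m - 1) \<zero>\<^bsub>hom_mod (sphere_cat R m) 1 2 (m - 1)\<^esub> = \<zero>\<^bsub>hom_mod B (fob T 1) (fob T 2) (m - 1)\<^esub>"
    by (rule linear_map_zero[OF dg_functorD(4)[OF T o] dg_category.hom_module[OF dg_functorD(1)[OF T] o]
      dg_category.hom_module[OF dg_functorD(2)[OF T] ob]])
  then show "fmor T 1 2 m \<one>\<^bsub>R\<^esub> \<in> cycles (Mor B (fob T 1) (fob T 2)) m"
    using dg_functorD(5)[OF T o 1] linear_mapD(1)[OF dg_functorD(4)[OF T o] 1]
    by (simp add: cycles_def sphere_simps ring_module_simps)
qed

definition attach_cell :: "('r, 'x) ring_scheme \<Rightarrow> int \<Rightarrow> ('o, 'r, 'a) edgcat \<Rightarrow> int \<Rightarrow>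
    (nat, 'r, 'o, ('o, 'r, 'a) expr) dgfun \<Rightarrow> (nat, 'r, 'o, ('o, 'r, 'a) expr) dgfun" where
  "attach_cell R k B m T = disk_fun (attach R k B) (m + 1) (fob T 1) (fob T 2)
     (bounding_chain R k B m (fob T 1) (fob T 2) (fmor T 1 2 m \<one>\<^bsub>R\<^esub>))"

lemma disk_fun_simps:
  assumes X: "dg_category R X" and xy: "x \<in> Obj X" "y \<in> Obj X" and b: "b \<in> hom_set X x y k"
  shows "fob (disk_fun X k x y b) 3 = x" "fob (disk_fun X k x y b) 4 = y"
    "fmor (disk_fun X k x y b) 3 4 k \<one>\<^bsub>R\<^esub> = b" "fmor (disk_fun X k x y b) 3 4 (k - 1) \<one>\<^bsub>R\<^esub> = hom_diff X x y k b"
proof -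
  interpret X: dg_category R X by fact
  interpret H: module R "hom_mod X x y k" by (rule X.hom_module[OF xy])
  interpret H1: module R "hom_mod X x y (k - 1)" by (rule X.hom_module[OF xy])
  show "fob (disk_fun X k x y b) 3 = x" "fob (disk_fun X k x y b) 4 = y"
    "fmor (disk_fun X k x y b) 3 4 k \<one>\<^bsub>R\<^esub> = b" "fmor (disk_fun X k x y b) 3 4 (k - 1) \<one>\<^bsub>R\<^esub> = hom_diff X x y k b"
    using b linear_mapD(1)[OF X.hom_diff_linear[OF xy] b] by (simp_all add: disk_fun_def)
qed

lemma sphere_fun_simps:
  assumes X: "dg_category R X" and xy: "x \<in> Obj X" "y \<in> Obj X" and c: "c \<in> hom_set X x y m"
  shows "fob (sphere_fun X m x y c) 1 = x" "fob (sphere_fun X m x y c) 2 = y"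
    "fmor (sphere_fun X m x y c) 1 2 m \<one>\<^bsub>R\<^esub> = c"
proof -
  interpret X: dg_category R X by fact
  interpret H: module R "hom_mod X x y m" by (rule X.hom_module[OF xy])
  show "fob (sphere_fun X m x y c) 1 = x" "fob (sphere_fun X m x y c) 2 = y"
    "fmor (sphere_fun X m x y c) 1 2 m \<one>\<^bsub>R\<^esub> = c"
    using c by (simp_all add: sphere_fun_def)
qed

text \<open>A dg functor out of the coproduct of the \<open>D(m + 1)\<close> over all \<open>m > k\<close> and \<open>T\<close> is a family
  \<open>G m T\<close>. Since \<open>T\<close> matters only through its values on \<open>C(m)\<close>, the family has to respect
  \<open>dgfun_eq\<close>. The test object \<open>X\<close> has arbitrary types.\<close>

theorem attach_pushout:
  fixes R :: "('b, 'x) ring_scheme" and B :: "('o, 'b, 'a) edgcat" and X :: "('p, 'b, 'c) dgcat"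
  assumes B: "dg_category R B"
  shows "dg_functor R B (attach R k B) (attach_incl R k B)"
    and "\<lbrakk>m > k; dg_functor R (sphere_cat R m) B T\<rbrakk> \<Longrightarrow>
      dg_functor R (disk_cat R (m + 1)) (attach R k B) (attach_cell R k B m T) \<and>
      dgfun_eq (sphere_cat R m) (dgfun_comp (attach_cell R k B m T) sphere_to_disk)
        (dgfun_comp (attach_incl R k B) T)"
    and "\<lbrakk>dg_functor R B X F;
        \<And>m T. \<lbrakk>m > k; dg_functor R (sphere_cat R m) B T\<rbrakk> \<Longrightarrow>
          dg_functor R (disk_cat R (m + 1)) X (G m T) \<and>
          dgfun_eq (sphere_cat R m) (dgfun_comp (G m T) sphere_to_disk) (dgfun_comp F T);
        \<And>m T T'. \<lbrakk>m > k; dg_functor R (sphere_cat R m) B T; dg_functor R (sphere_cat R m) B T';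
          dgfun_eq (sphere_cat R m) T T'\<rbrakk> \<Longrightarrow> dgfun_eq (disk_cat R (m + 1)) (G m T) (G m T')\<rbrakk> \<Longrightarrow>
      \<exists>H. (dg_functor R (attach R k B) X H \<and> dgfun_eq B (dgfun_comp H (attach_incl R k B)) F \<and>
          (\<forall>m T. m > k \<longrightarrow> dg_functor R (sphere_cat R m) B T \<longrightarrow>
            dgfun_eq (disk_cat R (m + 1)) (dgfun_comp H (attach_cell R k B m T)) (G m T))) \<and>
        (\<forall>H'. dg_functor R (attach R k B) X H' \<and> dgfun_eq B (dgfun_comp H' (attach_incl R k B)) F \<and>
          (\<forall>m T. m > k \<longrightarrow> dg_functor R (sphere_cat R m) B T \<longrightarrow>
            dgfun_eq (disk_cat R (m + 1)) (dgfun_comp H' (attach_cell R k B m T)) (G m T)) \<longrightarrow>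
          dgfun_eq (attach R k B) H' H)"
proof -
  interpret attach_cells R B k using B by (rule attach_cells.intro)
  note P = attach_dg_category
  have std: "fob sphere_to_disk (Suc 0) = 3" "fob sphere_to_disk 2 = 4" "fmor sphere_to_disk s t i r = (r :: 'b)" for s t i and r :: 'b
    by (simp_all add: sphere_to_disk_def)
  show incl: "dg_functor R B (attach R k B) (attach_incl R k B)" by (rule attach_incl_functor)
  have cell: "dg_functor R (disk_cat R (m + 1)) (attach R k B) (attach_cell R k B m T)"
      "fob (attach_cell R k B m T) 3 = fob T 1" "fob (attach_cell R k B m T) 4 = fob T 2"
      "fmor (attach_cell R k B m T) 3 4 (m + 1) \<one>\<^bsub>R\<^esub> = bounding_chain R k B m (fob T 1) (fob T 2) (fmor T 1 2 m \<one>\<^bsub>R\<^esub>)"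
      "fmor (attach_cell R k B m T) 3 4 m \<one>\<^bsub>R\<^esub> = fmor (attach_incl R k B) (fob T 1) (fob T 2) m (fmor T 1 2 m \<one>\<^bsub>R\<^esub>)"
    if "m > k" "dg_functor R (sphere_cat R m) B T" for m T
  proof -
    note c = sphere_functor_cycle[OF that(2)]
    note b = bounding_chain_closed[OF that(1) c]
    note d = disk_fun_simps[OF P c(1)[folded attach_simps(1)] c(2)[folded attach_simps(1)] b]
    show "dg_functor R (disk_cat R (m + 1)) (attach R k B) (attach_cell R k B m T)"
      unfolding attach_cell_def by (rule disk_fun_functor[OF P]) (use c b in \<open>simp_all add: attach_simps(1) del: attach_simps(2)\<close>)
    show "fob (attach_cell R k B m T) 3 = fob T 1" "fob (attach_cell R k B m T) 4 = fob T 2"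
      "fmor (attach_cell R k B m T) 3 4 (m + 1) \<one>\<^bsub>R\<^esub> = bounding_chain R k B m (fob T 1) (fob T 2) (fmor T 1 2 m \<one>\<^bsub>R\<^esub>)"
      "fmor (attach_cell R k B m T) 3 4 m \<one>\<^bsub>R\<^esub> = fmor (attach_incl R k B) (fob T 1) (fob T 2) m (fmor T 1 2 m \<one>\<^bsub>R\<^esub>)"
      unfolding attach_cell_def using d bounding_chain_diff[OF that(1) c] by simp_all
  qed
  show "dg_functor R (disk_cat R (m + 1)) (attach R k B) (attach_cell R k B m T) \<and>
      dgfun_eq (sphere_cat R m) (dgfun_comp (attach_cell R k B m T) sphere_to_disk)
        (dgfun_comp (attach_incl R k B) T)" if "m > k" "dg_functor R (sphere_cat R m) B T"
  proof
    show "dg_functor R (disk_cat R (m + 1)) (attach R k B) (attach_cell R k B m T)" by (rule cell[OF that])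
    show "dgfun_eq (sphere_cat R m) (dgfun_comp (attach_cell R k B m T) sphere_to_disk) (dgfun_comp (attach_incl R k B) T)"
      by (rule sphere_functor_eqI[OF dg_functor_comp[OF sphere_to_disk_functor[OF is_cring] cell(1)[OF that]]
          dg_functor_comp[OF that(2) incl]])
        (use cell(2-)[OF that] in \<open>simp_all add: dgfun_comp_def std attach_incl_def\<close>)
  qed
  assume F: "dg_functor R B X F"
    and G: "\<And>m T. \<lbrakk>m > k; dg_functor R (sphere_cat R m) B T\<rbrakk> \<Longrightarrow>
          dg_functor R (disk_cat R (m + 1)) X (G m T) \<and>
          dgfun_eq (sphere_cat R m) (dgfun_comp (G m T) sphere_to_disk) (dgfun_comp F T)"
    and Gc: "\<And>m T T'. \<lbrakk>m > k; dg_functor R (sphere_cat R m) B T; dg_functor R (sphere_cat R m) B T';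
          dgfun_eq (sphere_cat R m) T T'\<rbrakk> \<Longrightarrow> dgfun_eq (disk_cat R (m + 1)) (G m T) (G m T')"
  define \<phi> where "\<phi> m x y c = fmor (G m (sphere_fun B m x y c)) 3 4 (m + 1) \<one>\<^bsub>R\<^esub>" for m x y c
  have one: "\<one>\<^bsub>R\<^esub> \<in> hom_set (disk_cat R (m + 1)) 3 4 (m + 1)" "\<one>\<^bsub>R\<^esub> \<in> hom_set (sphere_cat R m) 1 2 m"
    and o34: "3 \<in> Obj (disk_cat R k')" "4 \<in> Obj (disk_cat R k')" "1 \<in> Obj (sphere_cat R m)" "2 \<in> Obj (sphere_cat R m)" for m k'
    by (auto simp: disk_simps sphere_simps ring_module_simps)
  have Gs: "fob (G m T) 3 = fob F (fob T 1)" "fob (G m T) 4 = fob F (fob T 2)"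
      "fmor (G m T) 3 4 m \<one>\<^bsub>R\<^esub> = fmor F (fob T 1) (fob T 2) m (fmor T 1 2 m \<one>\<^bsub>R\<^esub>)"
    if "m > k" "dg_functor R (sphere_cat R m) B T" for m T
  proof -
    note e = conjunct2[OF G[OF that], unfolded dgfun_eq_def]
    show "fob (G m T) 3 = fob F (fob T 1)" "fob (G m T) 4 = fob F (fob T 2)"
      using bspec[OF conjunct1[OF e] o34(3)] bspec[OF conjunct1[OF e] o34(4)] by (simp_all add: dgfun_comp_def std)
    show "fmor (G m T) 3 4 m \<one>\<^bsub>R\<^esub> = fmor F (fob T 1) (fob T 2) m (fmor T 1 2 m \<one>\<^bsub>R\<^esub>)"
      using bspec[OF spec[OF bspec[OF bspec[OF conjunct2[OF e] o34(3)] o34(4)]] one(2)] by (simp add: dgfun_comp_def std)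
  qed
  interpret E: attach_extension R B k X F \<phi>
  proof unfold_locales
    fix m x y c assume a: "m > k" "x \<in> Obj B" "y \<in> Obj B" "c \<in> cycles (Mor B x y) m"
    then have c: "c \<in> hom_set B x y m" by (simp add: cycles_def)
    note s = sphere_fun_functor[OF B a(2-4)] and ss = sphere_fun_simps[OF B a(2,3) c]
    note g = conjunct1[OF G[OF a(1) s]] and gs = Gs[OF a(1) s, unfolded ss]
    show "\<phi> m x y c \<in> hom_set X (fob F x) (fob F y) (m + 1)
      \<and> hom_diff X (fob F x) (fob F y) (m + 1) (\<phi> m x y c) = fmor F x y m c"
      using linear_mapD(1)[OF dg_functorD(4)[OF g o34(1,2)] one(1)] dg_functorD(5)[OF g o34(1,2) one(1)] gs
      by (simp add: \<phi>_def disk_simps)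
  qed (rule F)
  have \<phi>_eq: "\<phi> m (fob T 1) (fob T 2) (fmor T 1 2 m \<one>\<^bsub>R\<^esub>) = fmor (G m T) 3 4 (m + 1) \<one>\<^bsub>R\<^esub>"
    if "m > k" "dg_functor R (sphere_cat R m) B T" for m T
  proof -
    note c = sphere_functor_cycle[OF that(2)]
    then have c': "fmor T 1 2 m \<one>\<^bsub>R\<^esub> \<in> hom_set B (fob T 1) (fob T 2) m" by (simp add: cycles_def)
    note s = sphere_fun_functor[OF B c] and ss = sphere_fun_simps[OF B c(1,2) c']
    have "dgfun_eq (disk_cat R (m + 1)) (G m (sphere_fun B m (fob T 1) (fob T 2) (fmor T 1 2 m \<one>\<^bsub>R\<^esub>))) (G m T)"
      by (rule Gc[OF that(1) s that(2)], rule sphere_functor_eqI[OF s that(2)]) (use ss in auto)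
    then show ?thesis using one(1)[of m] o34(1,2) by (auto simp: dgfun_eq_def \<phi>_def)
  qed
  let ?H = "attach_ext X F \<phi>"
  show "\<exists>H. (dg_functor R (attach R k B) X H \<and> dgfun_eq B (dgfun_comp H (attach_incl R k B)) F \<and>
          (\<forall>m T. m > k \<longrightarrow> dg_functor R (sphere_cat R m) B T \<longrightarrow>
            dgfun_eq (disk_cat R (m + 1)) (dgfun_comp H (attach_cell R k B m T)) (G m T))) \<and>
        (\<forall>H'. dg_functor R (attach R k B) X H' \<and> dgfun_eq B (dgfun_comp H' (attach_incl R k B)) F \<and>
          (\<forall>m T. m > k \<longrightarrow> dg_functor R (sphere_cat R m) B T \<longrightarrow>
            dgfun_eq (disk_cat R (m + 1)) (dgfun_comp H' (attach_cell R k B m T)) (G m T)) \<longrightarrow>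
          dgfun_eq (attach R k B) H' H)"
  proof (rule exI[of _ ?H], intro conjI allI impI)
    show "dg_functor R (attach R k B) X ?H" by (rule E.attach_ext_functor)
    show "dgfun_eq B (dgfun_comp ?H (attach_incl R k B)) F" by (rule E.attach_ext_incl)
    fix m T assume a: "m > k" "dg_functor R (sphere_cat R m) B T"
    note c = sphere_functor_cycle[OF a(2)]
    show "dgfun_eq (disk_cat R (m + 1)) (dgfun_comp ?H (attach_cell R k B m T)) (G m T)"
    proof (rule disk_functor_eqI[OF dg_functor_comp[OF cell(1)[OF a] E.attach_ext_functor] conjunct1[OF G[OF a]]])
      show "fob (dgfun_comp ?H (attach_cell R k B m T)) 3 = fob (G m T) 3"
        "fob (dgfun_comp ?H (attach_cell R k B m T)) 4 = fob (G m T) 4"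
        by (simp_all add: dgfun_comp_def cell[OF a] Gs[OF a] attach_ext_def)
      show "fmor (dgfun_comp ?H (attach_cell R k B m T)) 3 4 (m + 1) \<one>\<^bsub>R\<^esub> = fmor (G m T) 3 4 (m + 1) \<one>\<^bsub>R\<^esub>"
        using E.attach_ext_bounding_chain[OF a(1) c] \<phi>_eq[OF a] by (simp add: dgfun_comp_def cell[OF a])
    qed
  next
    fix H' assume H': "dg_functor R (attach R k B) X H' \<and> dgfun_eq B (dgfun_comp H' (attach_incl R k B)) F \<and>
          (\<forall>m T. m > k \<longrightarrow> dg_functor R (sphere_cat R m) B T \<longrightarrow>
            dgfun_eq (disk_cat R (m + 1)) (dgfun_comp H' (attach_cell R k B m T)) (G m T))"
    show "dgfun_eq (attach R k B) H' ?H"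
    proof (rule E.attach_ext_unique)
      show "dg_functor R (attach R k B) X H'" "dgfun_eq B (dgfun_comp H' (attach_incl R k B)) F" using H' by auto
      fix m x y c assume a: "m > k" "x \<in> Obj B" "y \<in> Obj B" "c \<in> cycles (Mor B x y) m"
      then have c: "c \<in> hom_set B x y m" by (simp add: cycles_def)
      note s = sphere_fun_functor[OF B a(2-4)] and ss = sphere_fun_simps[OF B a(2,3) c]
      have "dgfun_eq (disk_cat R (m + 1)) (dgfun_comp H' (attach_cell R k B m (sphere_fun B m x y c))) (G m (sphere_fun B m x y c))"
        using H' a(1) s by blast
      then have "fmor (dgfun_comp H' (attach_cell R k B m (sphere_fun B m x y c))) 3 4 (m + 1) \<one>\<^bsub>R\<^esub> = \<phi> m x y c"
        using one(1)[of m] o34(1,2) by (auto simp: dgfun_eq_def \<phi>_def)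
      then show "fmor H' x y (m + 1) (bounding_chain R k B m x y c) = \<phi> m x y c"
        using cell[OF a(1) s] ss by (simp add: dgfun_comp_def)
    qed
  qed
qed


end

theory Submission
  imports Defs
begin

text \<open>The inclusion \<open>S\<close> of \<open>\<tau>\<^sub>\<le>\<^sub>n(A)\<close> into the square zero extension is the identity on objects and an
  isomorphism in degree \<open>0\<close>, so the part of its mapping path category on the objects
  \<open>(x, x, id)\<close> already factors it into a quasi-equivalence followed by a fibration. A cycle of
  the strict pullback with this fibration is, up to boundaries, a cycle \<open>b\<close> of \<open>P\<^sub>n(A)(x, y)\<close>
  together with a class \<open>h\<close> in \<open>H\<^sub>n\<^sub>+\<^sub>1(A(x, y))\<close>, which occurs only if \<open>b\<close> has degree \<open>n + 1\<close>.

  The comparison with \<open>P\<^sub>n\<^sub>+\<^sub>1(A)\<close> rests on three facts: \<open>A \<rightarrow> P\<^sub>n(A)\<close> is bijective in degrees at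
  most \<open>n + 1\<close>, because a product of degree at most \<open>n + 1\<close> cannot involve an attached cell; every
  cycle of \<open>P\<^sub>n(A)\<close> of degree above \<open>n\<close> is a boundary; and \<open>\<gamma>\<^sub>n\<close> maps a chain of degree
  \<open>n + 2\<close> to the homology class of its boundary in \<open>A\<close>. So in degree \<open>n + 1\<close> the classes \<open>h\<close>
  restore exactly the homology of \<open>A\<close> that the chains of degree \<open>n + 2\<close> kill in \<open>P\<^sub>n(A)\<close>, and
  above that degree both sides are acyclic.\<close>

section \<open>Modules\<close>

text \<open>The stages are given by generators and relations without normal forms, so nothing can be
  read off from an expression. Injectivity of \<open>A \<rightarrow> P_n(A)\<close> comes from
  evaluating expressions in a test category in which every old cycle bounds; the other facts about
  stages come from induction over expressions.

  The map \<open>\<gamma>\<close> has to be built while its key property is proved. Attaching a cell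
  to a cycle \<open>c\<close> of degree \<open>m > n\<close> forces \<open>\<gamma>(c)\<close> to be
  the boundary of the value chosen for the cell, and this boundary is zero. Above degree
  \<open>n\<close> the target consists of \<open>H_{n+1}\<close> in degree \<open>n + 2\<close>
  alone, so the only obstruction lies in cycles of degree \<open>n + 2\<close>; it vanishes because
  \<open>\<gamma>\<close> records the class of the boundary. Existence of \<open>\<gamma>\<close> on
  a stage and this formula are therefore established in one induction.

  Every dg functor that is shown to be a quasi-equivalence is bijective on objects, so equivalences
  on \<open>H_0\<close> reduce to bijections. The lifting of homotopy equivalences works because the
  bimodule sits in degree \<open>n + 2 > 0\<close> and is invisible in degree
  \<open>0\<close>.\<close>

lemma linear_mapI:
  assumes "\<And>a. a \<in> carrier M \<Longrightarrow> f a \<in> carrier N"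
    and "\<And>a b. \<lbrakk>a \<in> carrier M; b \<in> carrier M\<rbrakk> \<Longrightarrow> f (a \<oplus>\<^bsub>M\<^esub> b) = f a \<oplus>\<^bsub>N\<^esub> f b"
    and "\<And>r a. \<lbrakk>r \<in> carrier R; a \<in> carrier M\<rbrakk> \<Longrightarrow> f (r \<odot>\<^bsub>M\<^esub> a) = r \<odot>\<^bsub>N\<^esub> f a"
  shows "linear_map R M N f"
  using assms by (auto simp: linear_map_def)

lemma (in module) minus_eq_smult: "a \<in> carrier M \<Longrightarrow> \<ominus>\<^bsub>M\<^esub> a = (\<ominus> \<one>) \<odot>\<^bsub>M\<^esub> a"
  by (simp add: smult_l_minus)

lemma (in module) minus_eq_iff:
  assumes "a \<in> carrier M" "b \<in> carrier M" "c \<in> carrier M"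
  shows "a \<ominus>\<^bsub>M\<^esub> b = c \<longleftrightarrow> a = b \<oplus>\<^bsub>M\<^esub> c"
proof
  assume "a \<ominus>\<^bsub>M\<^esub> b = c"
  then have "b \<oplus>\<^bsub>M\<^esub> c = b \<oplus>\<^bsub>M\<^esub> (\<ominus>\<^bsub>M\<^esub> b \<oplus>\<^bsub>M\<^esub> a)" using assms by (simp add: a_minus_def M.a_comm)
  then show "a = b \<oplus>\<^bsub>M\<^esub> c" using assms M.r_neg2 by simp
next
  assume "a = b \<oplus>\<^bsub>M\<^esub> c"
  then have "a \<ominus>\<^bsub>M\<^esub> b = \<ominus>\<^bsub>M\<^esub> b \<oplus>\<^bsub>M\<^esub> (b \<oplus>\<^bsub>M\<^esub> c)" using assms by (simp add: a_minus_def M.a_comm)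
  then show "a \<ominus>\<^bsub>M\<^esub> b = c" using assms M.r_neg1 by simp
qed

lemma linear_map_minus:
  assumes "linear_map R M N f" "module R M" "module R N" "a \<in> carrier M"
  shows "f (\<ominus>\<^bsub>M\<^esub> a) = \<ominus>\<^bsub>N\<^esub> f a"
proof -
  interpret M: module R M by fact
  interpret N: module R N by fact
  show ?thesis using linear_mapD[OF assms(1)] assms(4) by (simp add: M.minus_eq_smult N.minus_eq_smult)
qed

lemma linear_map_diff:
  assumes "linear_map R M N f" "module R M" "module R N" "a \<in> carrier M" "b \<in> carrier M"
  shows "f (a \<ominus>\<^bsub>M\<^esub> b) = f a \<ominus>\<^bsub>N\<^esub> f b"
proof -
  interpret M: module R M by fact
  show ?thesis using linear_mapD[OF assms(1)] assms(4,5) linear_map_minus[OF assms(1-3)]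
    by (simp add: a_minus_def)
qed

text \<open>Negatives are scalings by \<open>\<ominus> \<one>\<close>, so closure under them follows
  from closure under scalars.\<close>

lemma (in module) submoduleI':
  assumes "H \<subseteq> carrier M" "\<zero>\<^bsub>M\<^esub> \<in> H" "\<And>a b. \<lbrakk>a \<in> H; b \<in> H\<rbrakk> \<Longrightarrow> a \<oplus>\<^bsub>M\<^esub> b \<in> H"
    "\<And>r a. \<lbrakk>r \<in> carrier R; a \<in> H\<rbrakk> \<Longrightarrow> r \<odot>\<^bsub>M\<^esub> a \<in> H"
  shows "submodule H R M"
proof (rule submoduleI)
  fix a assume "a \<in> H"
  then show "\<ominus>\<^bsub>M\<^esub> a \<in> H" using assms(1) assms(4)[of "\<ominus> \<one>" a] by (auto simp: minus_eq_smult)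
qed (use assms in auto)

lemma (in module) submoduleD:
  assumes "submodule H R M"
  shows "H \<subseteq> carrier M" "\<zero>\<^bsub>M\<^esub> \<in> H" "\<And>a b. \<lbrakk>a \<in> H; b \<in> H\<rbrakk> \<Longrightarrow> a \<oplus>\<^bsub>M\<^esub> b \<in> H"
    "\<And>r a. \<lbrakk>r \<in> carrier R; a \<in> H\<rbrakk> \<Longrightarrow> r \<odot>\<^bsub>M\<^esub> a \<in> H" "\<And>a. a \<in> H \<Longrightarrow> \<ominus>\<^bsub>M\<^esub> a \<in> H"
  using submoduleE[OF assms] subgroup.one_closed[OF submodule.axioms(1)[OF assms]] by auto

lemma (in module) zero_submodule: "submodule {\<zero>\<^bsub>M\<^esub>} R M"
  by (rule submoduleI') auto

text \<open>Applied with a constant family to quotients and with the stages to sequential colimits.\<close>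

lemma module_directed:
  fixes M :: "nat \<Rightarrow> ('b, 'a) module" and N :: "('b, 'c) module"
  assumes M: "\<And>l. module R (M l)"
    and car: "carrier N = (\<Union>l. p l ` carrier (M l))"
    and mono: "\<And>l. p l ` carrier (M l) \<subseteq> p (Suc l) ` carrier (M (Suc l))"
    and zero: "\<And>l. p l \<zero>\<^bsub>M l\<^esub> = \<zero>\<^bsub>N\<^esub>"
    and add: "\<And>l a b. \<lbrakk>a \<in> carrier (M l); b \<in> carrier (M l)\<rbrakk> \<Longrightarrow> p l (a \<oplus>\<^bsub>M l\<^esub> b) = p l a \<oplus>\<^bsub>N\<^esub> p l b"
    and smult: "\<And>l r a. \<lbrakk>r \<in> carrier R; a \<in> carrier (M l)\<rbrakk> \<Longrightarrow> p l (r \<odot>\<^bsub>M l\<^esub> a) = r \<odot>\<^bsub>N\<^esub> p l a"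
  shows "module R N"
proof -
  interpret M: module R "M l" for l by (rule M)
  have up: "p l ` carrier (M l) \<subseteq> p m ` carrier (M m)" if "l \<le> m" for l m
    using that mono by (rule lift_Suc_mono_le[of "\<lambda>l. p l ` carrier (M l)", rotated])
  have car1: "(\<And>l a. a \<in> carrier (M l) \<Longrightarrow> P (p l a)) \<Longrightarrow> U \<in> carrier N \<Longrightarrow> P U" for P U
    unfolding car by auto
  \<comment> \<open>Two elements are moved to the common index \<open>max i j\<close> along
    \<open>up\<close>, so that an axiom is checked on representatives in a single
    \<open>M l\<close>; \<open>car3\<close> does the same for three elements.\<close>
  have car2: "(\<And>l a b. \<lbrakk>a \<in> carrier (M l); b \<in> carrier (M l)\<rbrakk> \<Longrightarrow> P (p l a) (p l b)) \<Longrightarrow>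
      U \<in> carrier N \<Longrightarrow> V \<in> carrier N \<Longrightarrow> P U V" for P U V
  proof -
    assume P: "\<And>l a b. \<lbrakk>a \<in> carrier (M l); b \<in> carrier (M l)\<rbrakk> \<Longrightarrow> P (p l a) (p l b)"
      and "U \<in> carrier N" "V \<in> carrier N"
    then obtain i j where "U \<in> p i ` carrier (M i)" "V \<in> p j ` carrier (M j)" unfolding car by auto
    then have "U \<in> p (max i j) ` carrier (M (max i j))" "V \<in> p (max i j) ` carrier (M (max i j))"
      using up[of i "max i j"] up[of j "max i j"] by auto
    then show ?thesis using P by auto
  qed
  have car3: "(\<And>l a b c. \<lbrakk>a \<in> carrier (M l); b \<in> carrier (M l); c \<in> carrier (M l)\<rbrakk> \<Longrightarrow> P (p l a) (p l b) (p l c)) \<Longrightarrow>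
      U \<in> carrier N \<Longrightarrow> V \<in> carrier N \<Longrightarrow> W \<in> carrier N \<Longrightarrow> P U V W" for P U V W
  proof -
    assume P: "\<And>l a b c. \<lbrakk>a \<in> carrier (M l); b \<in> carrier (M l); c \<in> carrier (M l)\<rbrakk> \<Longrightarrow> P (p l a) (p l b) (p l c)"
      and "U \<in> carrier N" "V \<in> carrier N" "W \<in> carrier N"
    then obtain i j k where "U \<in> p i ` carrier (M i)" "V \<in> p j ` carrier (M j)" "W \<in> p k ` carrier (M k)"
      unfolding car by auto
    moreover define l where "l = max i (max j k)"
    ultimately have "U \<in> p l ` carrier (M l)" "V \<in> p l ` carrier (M l)" "W \<in> p l ` carrier (M l)"
      using up[of i l] up[of j l] up[of k l] by (auto simp: le_max_iff_disj)
    then show ?thesis using P by auto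
  qed
  note add' = add[symmetric] and smult' = smult[symmetric]
  have cl: "a \<in> carrier (M l) \<Longrightarrow> p l a \<in> carrier N" for a l unfolding car by auto
  show ?thesis
  proof (rule moduleI[OF M.is_cring], rule abelian_groupI, goal_cases)
    case (1 x y) then show ?case by (rule car2[rotated]) (simp add: add' cl)
  next
    case 2 show ?case using cl[OF M.zero_closed[of 0]] by (simp add: zero)
  next
    case (3 x y z) then show ?case by (rule car3[rotated]) (simp add: add' M.a_assoc)
  next
    case (4 x y) then show ?case by (rule car2[rotated]) (simp add: add' M.a_comm)
  next
    case (5 x) then show ?case by (rule car1[rotated]) (metis add zero M.l_zero M.zero_closed)
  next
    case (6 x) then show ?case by (rule car1[rotated]) (metis add zero cl M.l_neg M.a_inv_closed)
  next
    case (7 r x) show ?case by (rule car1[OF _ 7(2)]) (use 7 in \<open>simp add: smult' cl\<close>)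
  next
    case (8 r s x) show ?case by (rule car1[OF _ 8(3)]) (use 8 in \<open>simp add: smult' add' M.smult_l_distr\<close>)
  next
    case (9 r x y) show ?case by (rule car2[OF _ 9(2,3)]) (use 9 in \<open>simp add: smult' add' M.smult_r_distr\<close>)
  next
    case (10 r s x) show ?case by (rule car1[OF _ 10(3)]) (use 10 in \<open>simp add: smult' M.smult_assoc1\<close>)
  next
    case (11 x) then show ?case by (rule car1[rotated]) (simp add: smult')
  qed
qed

section \<open>Products and quotients of modules\<close>

lemma prod_module_simps [simp]:
  "carrier (prod_module M N) = carrier M \<times> carrier N"
  "\<zero>\<^bsub>prod_module M N\<^esub> = (\<zero>\<^bsub>M\<^esub>, \<zero>\<^bsub>N\<^esub>)"
  "(a, b) \<oplus>\<^bsub>prod_module M N\<^esub> (a', b') = (a \<oplus>\<^bsub>M\<^esub> a', b \<oplus>\<^bsub>N\<^esub> b')"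
  "r \<odot>\<^bsub>prod_module M N\<^esub> (a, b) = (r \<odot>\<^bsub>M\<^esub> a, r \<odot>\<^bsub>N\<^esub> b)"
  by (simp_all add: prod_module_def)

lemma prod_module: assumes "module R M" "module R N" shows "module R (prod_module M N)"
proof -
  interpret M: module R M by fact
  interpret N: module R N by fact
  show ?thesis
  proof (rule moduleI[OF M.is_cring], rule abelian_groupI, goal_cases)
    case (6 x)
    then show ?case by (intro bexI[of _ "(\<ominus>\<^bsub>M\<^esub> fst x, \<ominus>\<^bsub>N\<^esub> snd x)"]) (auto simp: M.l_neg N.l_neg)
  qed (auto simp: M.a_ac N.a_ac M.smult_l_distr N.smult_l_distr M.smult_r_distr N.smult_r_distr M.smult_assoc1 N.smult_assoc1)
qed

locale quotient_module = module R M for R (structure) and M :: "('b, 'a) module" + fixes K :: "'a set"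
  assumes K: "submodule K R M"
begin

sublocale abelian_subgroup K M
proof (rule abelian_subgroupI3)
  show "additive_subgroup K M" by (rule additive_subgroupI) (rule submodule.axioms(1)[OF K])
qed (rule M.abelian_group_axioms)

abbreviation cls where "cls a \<equiv> K +>\<^bsub>M\<^esub> a"

lemma cls_self: "a \<in> carrier M \<Longrightarrow> a \<in> cls a"
  by (rule a_rcos_self)

lemma cls_mem: "\<lbrakk>x \<in> cls a; a \<in> carrier M\<rbrakk> \<Longrightarrow> x \<in> carrier M \<and> cls x = cls a"
  using a_repr_independence' a_elemrcos_carrier by metis

lemma cls_iff: assumes "a \<in> carrier M" "b \<in> carrier M" shows "cls a = cls b \<longleftrightarrow> a \<ominus>\<^bsub>M\<^esub> b \<in> K"
proof -
  have "cls a = cls b \<longleftrightarrow> a \<in> cls b"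
    using cls_self[OF assms(1)] a_repr_independence'[of a b] assms by auto
  then show ?thesis using a_repr_independenceD assms a_rcos_module[OF assms(2,1)] by (simp add: a_minus_def)
qed

text \<open>Operations of a quotient are defined as unions over representatives. Once all
  representatives give the same value, the union is that value, because a coset is not
  empty.\<close>

lemma cls_cong: "\<lbrakk>a \<in> carrier M; \<And>x. x \<in> cls a \<Longrightarrow> f x = S\<rbrakk> \<Longrightarrow> (\<Union>x\<in>cls a. f x) = S"
  using cls_self by auto

lemma quot_simps:
  "carrier (quot_module M K) = cls ` carrier M"
  "\<zero>\<^bsub>quot_module M K\<^esub> = cls \<zero>\<^bsub>M\<^esub>"
  "\<lbrakk>a \<in> carrier M; b \<in> carrier M\<rbrakk> \<Longrightarrow> cls a \<oplus>\<^bsub>quot_module M K\<^esub> cls b = cls (a \<oplus>\<^bsub>M\<^esub> b)"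
  "\<lbrakk>r \<in> carrier R; a \<in> carrier M\<rbrakk> \<Longrightarrow> r \<odot>\<^bsub>quot_module M K\<^esub> cls a = cls (r \<odot>\<^bsub>M\<^esub> a)"
proof -
  show "carrier (quot_module M K) = cls ` carrier M" by (auto simp: quot_module_def A_RCOSETS_def')
  show "\<zero>\<^bsub>quot_module M K\<^esub> = cls \<zero>\<^bsub>M\<^esub>" using a_subset by (simp add: quot_module_def)
  show "cls a \<oplus>\<^bsub>quot_module M K\<^esub> cls b = cls (a \<oplus>\<^bsub>M\<^esub> b)" if "a \<in> carrier M" "b \<in> carrier M"
    using a_rcos_sum[OF that] by (simp add: quot_module_def)
  show "r \<odot>\<^bsub>quot_module M K\<^esub> cls a = cls (r \<odot>\<^bsub>M\<^esub> a)" if r: "r \<in> carrier R" and a: "a \<in> carrier M"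
  proof -
    have "cls (r \<odot>\<^bsub>M\<^esub> x) = cls (r \<odot>\<^bsub>M\<^esub> a)" if "x \<in> cls a" for x
    proof -
      have x: "x \<in> carrier M" "x \<ominus>\<^bsub>M\<^esub> a \<in> K" using cls_mem[OF that a] cls_iff[of x a] a by auto
      have "r \<odot>\<^bsub>M\<^esub> (x \<ominus>\<^bsub>M\<^esub> a) = r \<odot>\<^bsub>M\<^esub> x \<ominus>\<^bsub>M\<^esub> r \<odot>\<^bsub>M\<^esub> a"
        using x a r by (simp add: a_minus_def smult_r_distr smult_r_minus)
      then show ?thesis using submoduleD(4)[OF K r x(2)] cls_iff x a r by simp
    qed
    then have "(\<Union>x\<in>cls a. cls (r \<odot>\<^bsub>M\<^esub> x)) = cls (r \<odot>\<^bsub>M\<^esub> a)" by (rule cls_cong[OF a])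
    then show ?thesis by (simp add: quot_module_def)
  qed
qed

lemma quot_module: "module R (quot_module M K)"
  by (rule module_directed[where M = "\<lambda>_. M" and p = "\<lambda>_. cls"])
    (auto simp: quot_simps intro: module_axioms)

lemma cls_zero_iff: "a \<in> carrier M \<Longrightarrow> cls a = \<zero>\<^bsub>quot_module M K\<^esub> \<longleftrightarrow> a \<in> K"
  using cls_iff[of a "\<zero>\<^bsub>M\<^esub>"] minus_eq_iff[of a "\<zero>\<^bsub>M\<^esub>" a] by (simp add: quot_simps)

end

section \<open>Complexes and homology\<close>

lemma chain_complexI:
  assumes "\<And>i. module R (cmod M i)" "\<And>i. linear_map R (cmod M i) (cmod M (i - 1)) (cdiff M i)"
    "\<And>a i. a \<in> carrier (cmod M i) \<Longrightarrow> cdiff M (i - 1) (cdiff M i a) = \<zero>\<^bsub>cmod M (i - 2)\<^esub>"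
  shows "chain_complex R M"
  using assms module.axioms(1)[OF assms(1)] by (intro chain_complex.intro chain_complex_axioms.intro)

lemma chain_mapD:
  assumes "chain_map R M N \<phi>"
  shows "linear_map R (cmod M i) (cmod N i) (\<phi> i)"
    and "a \<in> carrier (cmod M i) \<Longrightarrow> \<phi> (i - 1) (cdiff M i a) = cdiff N i (\<phi> i a)"
  using assms by (auto simp: chain_map_def)

lemma chain_map_zero:
  "\<lbrakk>chain_map R M N \<phi>; chain_complex R M; chain_complex R N\<rbrakk> \<Longrightarrow> \<phi> i \<zero>\<^bsub>cmod M i\<^esub> = \<zero>\<^bsub>cmod N i\<^esub>"
  by (rule linear_map_zero) (auto simp: chain_map_def chain_complex.module)

context chain_complex
begin

lemma diff_closed: "a \<in> carrier (cmod M i) \<Longrightarrow> cdiff M i a \<in> carrier (cmod M (i - 1))"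
  by (rule linear_mapD(1)[OF diff_linear])

lemma diff_zero: "cdiff M i \<zero>\<^bsub>cmod M i\<^esub> = \<zero>\<^bsub>cmod M (i - 1)\<^esub>"
  by (rule linear_map_zero[OF diff_linear module module])

lemma cycles_submodule: "submodule (cycles M i) R (cmod M i)"
proof -
  interpret N: module R "cmod M i" by (rule module)
  interpret N1: module R "cmod M (i - 1)" by (rule module)
  note L = linear_mapD[OF diff_linear[of i]]
  show ?thesis by (rule N.submoduleI') (auto simp: cycles_def diff_zero L)
qed

lemma boundaries_subset_cycles: "boundaries M i \<subseteq> cycles M i"
  using diff_closed[of _ "i + 1"] diff_diff[of _ "i + 1"] by (auto simp: boundaries_def cycles_def)

lemma boundaries_submodule: "submodule (boundaries M i) R (cmod M i)"
proof -
  interpret N: module R "cmod M i" by (rule module)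
  interpret N1: module R "cmod M (i + 1)" by (rule module)
  note L = linear_mapD[OF diff_linear[of "i + 1"], simplified]
  show ?thesis
  proof (rule N.submoduleI')
    show "boundaries M i \<subseteq> carrier (cmod M i)" using boundaries_subset_cycles by (auto simp: cycles_def)
    show "\<zero>\<^bsub>cmod M i\<^esub> \<in> boundaries M i"
      using diff_zero[of "i + 1"] N1.zero_closed unfolding boundaries_def by (metis add_diff_cancel_right' image_eqI)
  next
    fix a b assume "a \<in> boundaries M i" "b \<in> boundaries M i"
    then show "a \<oplus>\<^bsub>cmod M i\<^esub> b \<in> boundaries M i" by (auto simp: boundaries_def L(2)[symmetric])
  next
    fix r a assume "r \<in> carrier R" "a \<in> boundaries M i"
    then show "r \<odot>\<^bsub>cmod M i\<^esub> a \<in> boundaries M i" by (auto simp: boundaries_def L(3)[symmetric])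
  qed
qed

lemma boundaries_submodule_cycles: "submodule (boundaries M i) R (cmod M i\<lparr>carrier := cycles M i\<rparr>)"
proof -
  interpret N: module R "cmod M i" by (rule module)
  interpret Z: module R "cmod M i\<lparr>carrier := cycles M i\<rparr>"
    by (rule submodule.submodule_is_module[OF cycles_submodule module])
  show ?thesis using N.submoduleD[OF boundaries_submodule[of i]] boundaries_subset_cycles
    by (intro Z.submoduleI') auto
qed

lemma homology_quotient: "quotient_module R (cmod M i\<lparr>carrier := cycles M i\<rparr>) (boundaries M i)"
  by (intro quotient_module.intro quotient_module_axioms.intro boundaries_submodule_cycles
      submodule.submodule_is_module[OF cycles_submodule module])

text \<open>A coset uses only the addition of the module, so restricting the carrier to the cycles
  does not change it. This makes the general theory of quotients available for homology
  classes.\<close>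

lemma hclass_eq: "hclass M i z = boundaries M i +>\<^bsub>cmod M i\<lparr>carrier := cycles M i\<rparr>\<^esub> z"
  by (simp add: hclass_def a_r_coset_def r_coset_def)

lemma homology_module: "module R (homology M i)"
  unfolding homology_def by (rule quotient_module.quot_module[OF homology_quotient])

lemma homology_simps:
  "carrier (homology M i) = hclass M i ` cycles M i"
  "\<zero>\<^bsub>homology M i\<^esub> = hclass M i \<zero>\<^bsub>cmod M i\<^esub>"
  "\<lbrakk>a \<in> cycles M i; b \<in> cycles M i\<rbrakk> \<Longrightarrow> hclass M i a \<oplus>\<^bsub>homology M i\<^esub> hclass M i b = hclass M i (a \<oplus>\<^bsub>cmod M i\<^esub> b)"
  "\<lbrakk>r \<in> carrier R; a \<in> cycles M i\<rbrakk> \<Longrightarrow> r \<odot>\<^bsub>homology M i\<^esub> hclass M i a = hclass M i (r \<odot>\<^bsub>cmod M i\<^esub> a)"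
  using quotient_module.quot_simps[OF homology_quotient[of i]] unfolding homology_def hclass_eq by simp_all

lemma cycles_zero: "\<zero>\<^bsub>cmod M i\<^esub> \<in> cycles M i"
  using module.submoduleD(2)[OF module cycles_submodule] .

lemma hclass_self: "z \<in> cycles M i \<Longrightarrow> z \<in> hclass M i z"
  using quotient_module.cls_self[OF homology_quotient[of i], of z] unfolding hclass_eq by simp

lemma hclass_mem: "\<lbrakk>x \<in> hclass M i z; z \<in> cycles M i\<rbrakk> \<Longrightarrow> x \<in> cycles M i \<and> hclass M i x = hclass M i z"
  using quotient_module.cls_mem[OF homology_quotient[of i], of x z] unfolding hclass_eq by simp

lemma hclass_zero_iff: "z \<in> cycles M i \<Longrightarrow> hclass M i z = \<zero>\<^bsub>homology M i\<^esub> \<longleftrightarrow> z \<in> boundaries M i"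
  using quotient_module.cls_zero_iff[OF homology_quotient[of i], of z] unfolding hclass_eq homology_def by simp

lemma hclass_minus_iff:
  assumes "a \<in> cycles M i" "b \<in> cycles M i"
  shows "hclass M i a = hclass M i b \<longleftrightarrow> a \<ominus>\<^bsub>cmod M i\<^esub> b \<in> boundaries M i"
proof -
  interpret N: module R "cmod M i" by (rule module)
  interpret Z: module R "cmod M i\<lparr>carrier := cycles M i\<rparr>"
    by (rule submodule.submodule_is_module[OF cycles_submodule module])
  \<comment> \<open>Inverses are taken with respect to the carrier, so the two differences are not
    equal by definition; both negatives are scalings by \<open>\<ominus> \<one>\<close>.\<close>
  have "a \<ominus>\<^bsub>cmod M i\<lparr>carrier := cycles M i\<rparr>\<^esub> b = a \<ominus>\<^bsub>cmod M i\<^esub> b"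
    using Z.minus_eq_smult[of b] N.minus_eq_smult[of b] assms(2) by (simp add: a_minus_def cycles_def)
  then show ?thesis
    using quotient_module.cls_iff[OF homology_quotient[of i], of a b] assms unfolding hclass_eq by simp
qed

lemma hclass_iff:
  assumes "a \<in> cycles M i" "b \<in> cycles M i"
  shows "hclass M i a = hclass M i b \<longleftrightarrow> (\<exists>c\<in>carrier (cmod M (i + 1)). a = b \<oplus>\<^bsub>cmod M i\<^esub> cdiff M (i + 1) c)"
proof -
  interpret N: module R "cmod M i" by (rule module)
  have ab: "a \<in> carrier (cmod M i)" "b \<in> carrier (cmod M i)" using assms by (auto simp: cycles_def)
  have "a \<ominus>\<^bsub>cmod M i\<^esub> b = cdiff M (i + 1) c \<longleftrightarrow> a = b \<oplus>\<^bsub>cmod M i\<^esub> cdiff M (i + 1) c"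
    if "c \<in> carrier (cmod M (i + 1))" for c
    using N.minus_eq_iff[OF ab] diff_closed[OF that] by simp
  then show ?thesis unfolding hclass_minus_iff[OF assms] boundaries_def by auto
qed

end

lemma chain_map_cycles:
  assumes "chain_map R M N \<phi>" "chain_complex R M" "chain_complex R N" "z \<in> cycles M i"
  shows "\<phi> i z \<in> cycles N i"
proof -
  have z: "z \<in> carrier (cmod M i)" "cdiff M i z = \<zero>\<^bsub>cmod M (i - 1)\<^esub>" using assms(4) by (auto simp: cycles_def)
  then have "cdiff N i (\<phi> i z) = \<phi> (i - 1) \<zero>\<^bsub>cmod M (i - 1)\<^esub>" using chain_mapD(2)[OF assms(1) z(1)] by simp
  also have "\<dots> = \<zero>\<^bsub>cmod N (i - 1)\<^esub>" using assms(1-3) by (rule chain_map_zero)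
  finally show ?thesis using z assms(1) by (auto simp: cycles_def chain_map_def linear_map_def)
qed

text \<open>Representatives of one class differ by a boundary, and a chain map sends boundaries to
  boundaries; the union defining \<open>homology_map\<close> therefore runs over a single
  class.\<close>

lemma homology_map_hclass:
  assumes \<phi>: "chain_map R M N \<phi>" and M: "chain_complex R M" and N: "chain_complex R N" and z: "z \<in> cycles M i"
  shows "homology_map N \<phi> i (hclass M i z) = hclass N i (\<phi> i z)"
proof -
  interpret M: chain_complex R M by fact
  interpret N: chain_complex R N by fact
  have "hclass N i (\<phi> i x) = hclass N i (\<phi> i z)" if x: "x \<in> hclass M i z" for x
  proof -
    note x' = M.hclass_mem[OF x z]
    obtain c where c: "c \<in> carrier (cmod M (i + 1))" "x = z \<oplus>\<^bsub>cmod M i\<^esub> cdiff M (i + 1) c"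
      using M.hclass_iff[of x i z] x' z by auto
    have "cdiff M (i + 1) c \<in> carrier (cmod M i)" using M.diff_closed[OF c(1)] by simp
    moreover have "\<phi> i (cdiff M (i + 1) c) = cdiff N (i + 1) (\<phi> (i + 1) c)"
      using chain_mapD(2)[OF \<phi> c(1)] by simp
    ultimately have "\<phi> i x = \<phi> i z \<oplus>\<^bsub>cmod N i\<^esub> cdiff N (i + 1) (\<phi> (i + 1) c)"
      using c z linear_mapD(2)[OF chain_mapD(1)[OF \<phi>]] by (simp add: cycles_def)
    moreover have "\<phi> (i + 1) c \<in> carrier (cmod N (i + 1))" by (rule linear_mapD(1)[OF chain_mapD(1)[OF \<phi>] c(1)])
    ultimately show ?thesis
      using N.hclass_iff[OF chain_map_cycles[OF \<phi> M N conjunct1[OF x']] chain_map_cycles[OF \<phi> M N z]] by blast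
  qed
  then show ?thesis using M.hclass_self[OF z] unfolding homology_map_def by blast
qed

text \<open>The hypotheses speak of explicit bounding chains instead of classes, which is the form
  in which lifts are constructed later. By linearity, injectivity only has to be tested on cycles
  whose image bounds.\<close>

lemma quasi_isomorphismI:
  assumes \<phi>: "chain_map R M N \<phi>" and M: "chain_complex R M" and N: "chain_complex R N"
    and surj: "\<And>i z. z \<in> cycles N i \<Longrightarrow>
      \<exists>y\<in>cycles M i. \<exists>c\<in>carrier (cmod N (i + 1)). z = \<phi> i y \<oplus>\<^bsub>cmod N i\<^esub> cdiff N (i + 1) c"
    and inj: "\<And>i z c. \<lbrakk>z \<in> cycles M i; c \<in> carrier (cmod N (i + 1)); \<phi> i z = cdiff N (i + 1) c\<rbrakk> \<Longrightarrow> z \<in> boundaries M i"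
  shows "quasi_isomorphism R M N \<phi>"
  unfolding quasi_isomorphism_def
proof (intro conjI allI \<phi>)
  interpret M: chain_complex R M by fact
  interpret N: chain_complex R N by fact
  fix i
  note h = homology_map_hclass[OF \<phi> M N]
  interpret Mi: module R "cmod M i" by (rule M.module)
  interpret Ni: module R "cmod N i" by (rule N.module)
  note L = chain_mapD(1)[OF \<phi>, of i]
  show "bij_betw (homology_map N \<phi> i) (carrier (homology M i)) (carrier (homology N i))"
    unfolding bij_betw_def
  proof
    show "inj_on (homology_map N \<phi> i) (carrier (homology M i))"
    proof (rule inj_onI, unfold M.homology_simps(1), clarify)
      fix x y assume a: "x \<in> cycles M i" "y \<in> cycles M i"
        "homology_map N \<phi> i (hclass M i x) = homology_map N \<phi> i (hclass M i y)"
      then obtain c where c: "c \<in> carrier (cmod N (i + 1))" "\<phi> i x = \<phi> i y \<oplus>\<^bsub>cmod N i\<^esub> cdiff N (i + 1) c"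
        using N.hclass_iff[OF chain_map_cycles[OF \<phi> M N] chain_map_cycles[OF \<phi> M N], of x i y] by (auto simp: h)
      have xy: "x \<in> carrier (cmod M i)" "y \<in> carrier (cmod M i)" using a by (auto simp: cycles_def)
      note p = linear_mapD(1)[OF L xy(1)] linear_mapD(1)[OF L xy(2)]
      have dc: "cdiff N (i + 1) c \<in> carrier (cmod N i)" using N.diff_closed[OF c(1)] by simp
      have "\<phi> i (x \<ominus>\<^bsub>cmod M i\<^esub> y) = \<phi> i x \<ominus>\<^bsub>cmod N i\<^esub> \<phi> i y" by (rule linear_map_diff[OF L M.module N.module xy])
      also have "\<dots> = cdiff N (i + 1) c" using Ni.minus_eq_iff[OF p dc] c(2) by simp
      finally have 1: "\<phi> i (x \<ominus>\<^bsub>cmod M i\<^esub> y) = cdiff N (i + 1) c" .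
      have "x \<ominus>\<^bsub>cmod M i\<^esub> y \<in> cycles M i"
        using Mi.submoduleD[OF M.cycles_submodule[of i]] a by (simp add: a_minus_def)
      from inj[OF this c(1) 1] obtain b where b: "b \<in> carrier (cmod M (i + 1))" "x \<ominus>\<^bsub>cmod M i\<^esub> y = cdiff M (i + 1) b"
        by (auto simp: boundaries_def)
      then have "x = y \<oplus>\<^bsub>cmod M i\<^esub> cdiff M (i + 1) b"
        using Mi.minus_eq_iff[OF xy, of "cdiff M (i + 1) b"] M.diff_closed[OF b(1)] by simp
      then show "hclass M i x = hclass M i y" using M.hclass_iff[OF a(1,2)] b by blast
    qed
    show "homology_map N \<phi> i ` carrier (homology M i) = carrier (homology N i)"
    proof (unfold M.homology_simps(1) N.homology_simps(1), safe)
      fix x assume "x \<in> cycles M i"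
      then show "homology_map N \<phi> i (hclass M i x) \<in> hclass N i ` cycles N i"
        using chain_map_cycles[OF \<phi> M N] by (simp add: h)
    next
      fix z assume z: "z \<in> cycles N i"
      obtain y c where y: "y \<in> cycles M i" "c \<in> carrier (cmod N (i + 1))" "z = \<phi> i y \<oplus>\<^bsub>cmod N i\<^esub> cdiff N (i + 1) c"
        using surj[OF z] by auto
      then have "hclass N i z = hclass N i (\<phi> i y)" using N.hclass_iff[OF z chain_map_cycles[OF \<phi> M N y(1)]] by blast
      then show "hclass N i z \<in> homology_map N \<phi> i ` hclass M i ` cycles M i" using y(1) h[OF y(1)] by (metis imageI)
    qed
  qed
qed

section \<open>Constructions of dg categories\<close>

text \<open>The Leibniz rule carries its sign as the scalar \<open>sign R i\<close> instead of
  through \<open>signed\<close>, so that signs can be moved through linear maps and multiplied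
  without distinguishing parities.\<close>

lemma dg_categoryI:
  assumes R: "cring R" and complex: "\<And>x y. \<lbrakk>x \<in> Obj A; y \<in> Obj A\<rbrakk> \<Longrightarrow> chain_complex R (Mor A x y)"
    and Idt: "\<And>x. x \<in> Obj A \<Longrightarrow> Idt A x \<in> hom_set A x x 0"
    and left: "\<And>x y z i j f. \<lbrakk>x \<in> Obj A; y \<in> Obj A; z \<in> Obj A; f \<in> hom_set A x y j\<rbrakk> \<Longrightarrow>
      linear_map R (hom_mod A y z i) (hom_mod A x z (i + j)) (\<lambda>g. Cmp A x y z i j g f)"
    and right: "\<And>x y z i j g. \<lbrakk>x \<in> Obj A; y \<in> Obj A; z \<in> Obj A; g \<in> hom_set A y z i\<rbrakk> \<Longrightarrow>
      linear_map R (hom_mod A x y j) (hom_mod A x z (i + j)) (\<lambda>f. Cmp A x y z i j g f)"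
    and diff: "\<And>x y z i j g f. \<lbrakk>x \<in> Obj A; y \<in> Obj A; z \<in> Obj A; g \<in> hom_set A y z i; f \<in> hom_set A x y j\<rbrakk> \<Longrightarrow>
      hom_diff A x z (i + j) (Cmp A x y z i j g f) =
        Cmp A x y z (i - 1) j (hom_diff A y z i g) f \<oplus>\<^bsub>hom_mod A x z (i + j - 1)\<^esub>
        sign R i \<odot>\<^bsub>hom_mod A x z (i + j - 1)\<^esub> Cmp A x y z i (j - 1) g (hom_diff A x y j f)"
    and assoc: "\<And>w x y z i j k h g f. \<lbrakk>w \<in> Obj A; x \<in> Obj A; y \<in> Obj A; z \<in> Obj A;
        h \<in> hom_set A y z i; g \<in> hom_set A x y j; f \<in> hom_set A w x k\<rbrakk> \<Longrightarrow>
      Cmp A w x z (i + j) k (Cmp A x y z i j h g) f = Cmp A w y z i (j + k) h (Cmp A w x y j k g f)"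
    and unit: "\<And>x y i f. \<lbrakk>x \<in> Obj A; y \<in> Obj A; f \<in> hom_set A x y i\<rbrakk> \<Longrightarrow> Cmp A x y y 0 i (Idt A y) f = f"
      "\<And>x y i f. \<lbrakk>x \<in> Obj A; y \<in> Obj A; f \<in> hom_set A x y i\<rbrakk> \<Longrightarrow> Cmp A x x y i 0 f (Idt A x) = f"
  shows "dg_category R A"
proof (intro dg_category.intro[OF R] dg_category_axioms.intro)
  fix x y z i j g f
  assume a: "x \<in> Obj A" "y \<in> Obj A" "z \<in> Obj A" "g \<in> hom_set A y z i" "f \<in> hom_set A x y j"
  have "hom_diff A x y j f \<in> hom_set A x y (j - 1)"
    using chain_complex.diff_closed[OF complex[OF a(1,2)] a(5)] .
  then have "Cmp A x y z i (j - 1) g (hom_diff A x y j f) \<in> hom_set A x z (i + (j - 1))"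
    by (rule linear_mapD(1)[OF right[OF a(1-4)]])
  moreover have "i + (j - 1) = i + j - 1" by simp
  ultimately have "Cmp A x y z i (j - 1) g (hom_diff A x y j f) \<in> hom_set A x z (i + j - 1)" by metis
  then show "hom_diff A x z (i + j) (Cmp A x y z i j g f) =
        Cmp A x y z (i - 1) j (hom_diff A y z i g) f \<oplus>\<^bsub>hom_mod A x z (i + j - 1)\<^esub>
        signed (hom_mod A x z (i + j - 1)) i (Cmp A x y z i (j - 1) g (hom_diff A x y j f))"
    unfolding diff[OF a] using signed_eq[OF chain_complex.module[OF complex[OF a(1,3)]]] by simp
qed (fact complex Idt left right assoc unit)+

section \<open>Composition of cycles, boundaries and homology classes\<close>

context dg_category
begin

lemma hom_zero_closed: "\<lbrakk>x \<in> Obj A; y \<in> Obj A\<rbrakk> \<Longrightarrow> \<zero>\<^bsub>hom_mod A x y i\<^esub> \<in> hom_set A x y i"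
  using chain_complex.cycles_zero[OF complex] by (auto simp: cycles_def)

lemma hom_diff_closed: "\<lbrakk>x \<in> Obj A; y \<in> Obj A; a \<in> hom_set A x y i\<rbrakk> \<Longrightarrow> hom_diff A x y i a \<in> hom_set A x y (i - 1)"
  by (rule chain_complex.diff_closed[OF complex])

lemma hom_diff_zero: "\<lbrakk>x \<in> Obj A; y \<in> Obj A\<rbrakk> \<Longrightarrow> hom_diff A x y i \<zero>\<^bsub>hom_mod A x y i\<^esub> = \<zero>\<^bsub>hom_mod A x y (i - 1)\<^esub>"
  by (rule chain_complex.diff_zero[OF complex])

text \<open>The degree of the composite is a variable with an equation, because sums such as
  \<open>i - 1 + j\<close> and \<open>i + j - 1\<close> do not match syntactically.\<close>

lemma Cmp_closed': "\<lbrakk>x \<in> Obj A; y \<in> Obj A; z \<in> Obj A; g \<in> hom_set A y z i; f \<in> hom_set A x y j; k = i + j\<rbrakk> \<Longrightarrow>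
    Cmp A x y z i j g f \<in> hom_set A x z k"
  using Cmp_closed by simp

lemma Cmp_diff_closed:
  assumes "x \<in> Obj A" "y \<in> Obj A" "z \<in> Obj A" "g \<in> hom_set A y z i" "f \<in> hom_set A x y j"
  shows "Cmp A x y z (i - 1) j (hom_diff A y z i g) f \<in> hom_set A x z (i + j - 1)"
    "Cmp A x y z i (j - 1) g (hom_diff A x y j f) \<in> hom_set A x z (i + j - 1)"
  using assms by (auto intro!: Cmp_closed' hom_diff_closed)

lemma Cmp_diff_sign:
  assumes "x \<in> Obj A" "y \<in> Obj A" "z \<in> Obj A" "g \<in> hom_set A y z i" "f \<in> hom_set A x y j"
  shows "hom_diff A x z (i + j) (Cmp A x y z i j g f) =
        Cmp A x y z (i - 1) j (hom_diff A y z i g) f \<oplus>\<^bsub>hom_mod A x z (i + j - 1)\<^esub>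
        sign R i \<odot>\<^bsub>hom_mod A x z (i + j - 1)\<^esub> Cmp A x y z i (j - 1) g (hom_diff A x y j f)"
  unfolding Cmp_diff[OF assms] signed_eq[OF hom_module[OF assms(1,3)] Cmp_diff_closed(2)[OF assms]] ..

lemma Cmp_add_left: "\<lbrakk>x \<in> Obj A; y \<in> Obj A; z \<in> Obj A; g \<in> hom_set A y z i; g' \<in> hom_set A y z i; f \<in> hom_set A x y j; k = i + j\<rbrakk> \<Longrightarrow>
    Cmp A x y z i j (g \<oplus>\<^bsub>hom_mod A y z i\<^esub> g') f = Cmp A x y z i j g f \<oplus>\<^bsub>hom_mod A x z k\<^esub> Cmp A x y z i j g' f"
  using linear_mapD(2)[OF Cmp_linear_left] by simp

lemma Cmp_add_right: "\<lbrakk>x \<in> Obj A; y \<in> Obj A; z \<in> Obj A; g \<in> hom_set A y z i; f \<in> hom_set A x y j; f' \<in> hom_set A x y j; k = i + j\<rbrakk> \<Longrightarrow>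
    Cmp A x y z i j g (f \<oplus>\<^bsub>hom_mod A x y j\<^esub> f') = Cmp A x y z i j g f \<oplus>\<^bsub>hom_mod A x z k\<^esub> Cmp A x y z i j g f'"
  using linear_mapD(2)[OF Cmp_linear_right] by simp

lemma Cmp_smult_left: "\<lbrakk>x \<in> Obj A; y \<in> Obj A; z \<in> Obj A; r \<in> carrier R; g \<in> hom_set A y z i; f \<in> hom_set A x y j; k = i + j\<rbrakk> \<Longrightarrow>
    Cmp A x y z i j (r \<odot>\<^bsub>hom_mod A y z i\<^esub> g) f = r \<odot>\<^bsub>hom_mod A x z k\<^esub> Cmp A x y z i j g f"
  using linear_mapD(3)[OF Cmp_linear_left] by simp

lemma Cmp_smult_right: "\<lbrakk>x \<in> Obj A; y \<in> Obj A; z \<in> Obj A; r \<in> carrier R; g \<in> hom_set A y z i; f \<in> hom_set A x y j; k = i + j\<rbrakk> \<Longrightarrow>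
    Cmp A x y z i j g (r \<odot>\<^bsub>hom_mod A x y j\<^esub> f) = r \<odot>\<^bsub>hom_mod A x z k\<^esub> Cmp A x y z i j g f"
  using linear_mapD(3)[OF Cmp_linear_right] by simp

lemma hom_diff_add: "\<lbrakk>x \<in> Obj A; y \<in> Obj A; a \<in> hom_set A x y i; b \<in> hom_set A x y i\<rbrakk> \<Longrightarrow>
    hom_diff A x y i (a \<oplus>\<^bsub>hom_mod A x y i\<^esub> b) = hom_diff A x y i a \<oplus>\<^bsub>hom_mod A x y (i - 1)\<^esub> hom_diff A x y i b"
  by (rule linear_mapD(2)[OF hom_diff_linear])

lemma hom_diff_smult: "\<lbrakk>x \<in> Obj A; y \<in> Obj A; r \<in> carrier R; a \<in> hom_set A x y i\<rbrakk> \<Longrightarrow>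
    hom_diff A x y i (r \<odot>\<^bsub>hom_mod A x y i\<^esub> a) = r \<odot>\<^bsub>hom_mod A x y (i - 1)\<^esub> hom_diff A x y i a"
  by (rule linear_mapD(3)[OF hom_diff_linear])

lemma Cmp_cycles:
  assumes o: "x \<in> Obj A" "y \<in> Obj A" "z \<in> Obj A" and "g \<in> cycles (Mor A y z) i" "f \<in> cycles (Mor A x y) j"
  shows "Cmp A x y z i j g f \<in> cycles (Mor A x z) (i + j)"
proof -
  interpret H: module R "hom_mod A x z (i + j - 1)" by (rule hom_module[OF o(1,3)])
  have gf: "g \<in> hom_set A y z i" "f \<in> hom_set A x y j" and
    d: "hom_diff A y z i g = \<zero>\<^bsub>hom_mod A y z (i - 1)\<^esub>" "hom_diff A x y j f = \<zero>\<^bsub>hom_mod A x y (j - 1)\<^esub>"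
    using assms(4,5) by (auto simp: cycles_def)
  have e: "i - 1 + j = i + j - 1" "i + (j - 1) = i + j - 1" by auto
  show ?thesis
    using Cmp_diff_sign[OF o gf] Cmp_closed[OF o gf] Cmp_zero_left[OF o gf(2), of "i - 1"] Cmp_zero_right[OF o gf(1), of "j - 1"]
    by (simp add: cycles_def d e sign_closed[OF is_cring])
qed

lemma Cmp_boundary_left:
  assumes o: "x \<in> Obj A" "y \<in> Obj A" "z \<in> Obj A" "g \<in> boundaries (Mor A y z) i" "f \<in> cycles (Mor A x y) j"
  shows "Cmp A x y z i j g f \<in> boundaries (Mor A x z) (i + j)"
proof -
  obtain c where c: "c \<in> hom_set A y z (i + 1)" "g = hom_diff A y z (i + 1) c" using o(4) by (auto simp: boundaries_def)
  interpret H: module R "hom_mod A x z (i + j)" by (rule hom_module[OF o(1,3)])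
  have f: "f \<in> hom_set A x y j" "hom_diff A x y j f = \<zero>\<^bsub>hom_mod A x y (j - 1)\<^esub>" using o(5) by (auto simp: cycles_def)
  have g: "g \<in> hom_set A y z i" using hom_diff_closed[OF o(2,3) c(1)] c(2) by simp
  have e: "i + 1 + j = i + j + 1" "i + 1 + (j - 1) = i + j" by auto
  have "hom_diff A x z (i + j + 1) (Cmp A x y z (i + 1) j c f) = Cmp A x y z i j g f"
    using Cmp_diff_sign[OF o(1-3) c(1) f(1)] Cmp_zero_right[OF o(1-3) c(1), of "j - 1"] Cmp_closed[OF o(1-3) g f(1)] c(2) f(2)
    by (simp add: sign_closed[OF is_cring] e)
  then show ?thesis using Cmp_closed[OF o(1-3) c(1) f(1)] by (auto simp: boundaries_def e intro!: rev_image_eqI)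
qed

lemma Cmp_boundary_right:
  assumes o: "x \<in> Obj A" "y \<in> Obj A" "z \<in> Obj A" "g \<in> cycles (Mor A y z) i" "f \<in> boundaries (Mor A x y) j"
  shows "Cmp A x y z i j g f \<in> boundaries (Mor A x z) (i + j)"
proof -
  obtain c where c: "c \<in> hom_set A x y (j + 1)" "f = hom_diff A x y (j + 1) c" using o(5) by (auto simp: boundaries_def)
  interpret H: module R "hom_mod A x z (i + j)" by (rule hom_module[OF o(1,3)])
  have g: "g \<in> hom_set A y z i" "hom_diff A y z i g = \<zero>\<^bsub>hom_mod A y z (i - 1)\<^esub>" using o(4) by (auto simp: cycles_def)
  have f: "f \<in> hom_set A x y j" using hom_diff_closed[OF o(1,2) c(1)] c(2) by simp
  have e: "i + (j + 1) = i + j + 1" "i - 1 + (j + 1) = i + j" by auto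
  note s = sign_closed[OF is_cring, of i]
  have ss: "sign R i \<otimes> sign R i = \<one>" by (auto simp: sign_def l_minus r_minus)
  \<comment> \<open>The Leibniz rule puts \<open>sign R i\<close> in front of the product of
    \<open>g\<close> with the boundary of \<open>c\<close>. Scaling the bounding chain by the same
    sign removes it, as its square is \<open>\<one>\<close>.\<close>
  let ?c = "sign R i \<odot>\<^bsub>hom_mod A x z (i + j + 1)\<^esub> Cmp A x y z i (j + 1) g c"
  have "hom_diff A x z (i + j + 1) (Cmp A x y z i (j + 1) g c) = sign R i \<odot>\<^bsub>hom_mod A x z (i + j)\<^esub> Cmp A x y z i j g f"
    using Cmp_diff_sign[OF o(1-3) g(1) c(1)] Cmp_zero_left[OF o(1-3) c(1), of "i - 1"] Cmp_closed[OF o(1-3) g(1) f] c(2) g(2)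
    by (simp add: s e)
  then have "hom_diff A x z (i + j + 1) ?c = Cmp A x y z i j g f"
    using hom_diff_smult[OF o(1,3) s Cmp_closed'[OF o(1-3) g(1) c(1)], of "i + j + 1"] Cmp_closed[OF o(1-3) g(1) f] s
    by (simp add: H.smult_assoc1[symmetric] ss)
  moreover have "?c \<in> hom_set A x z (i + j + 1)"
    using module.smult_closed[OF hom_module[OF o(1,3)] s Cmp_closed'[OF o(1-3) g(1) c(1), of "i + j + 1"]] by simp
  ultimately show ?thesis by (auto simp: boundaries_def intro!: rev_image_eqI)
qed

lemma hclass_Cmp_cong:
  assumes o: "x \<in> Obj A" "y \<in> Obj A" "z \<in> Obj A" and g: "g \<in> cycles (Mor A y z) i" and f: "f \<in> cycles (Mor A x y) j"
    and g': "g' \<in> hclass (Mor A y z) i g" and f': "f' \<in> hclass (Mor A x y) j f"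
  shows "hclass (Mor A x z) (i + j) (Cmp A x y z i j g' f') = hclass (Mor A x z) (i + j) (Cmp A x y z i j g f)"
proof -
  interpret G: chain_complex R "Mor A y z" by (rule complex[OF o(2,3)])
  interpret F: chain_complex R "Mor A x y" by (rule complex[OF o(1,2)])
  interpret H: chain_complex R "Mor A x z" by (rule complex[OF o(1,3)])
  note g'' = G.hclass_mem[OF g' g] and f'' = F.hclass_mem[OF f' f]
  have gb: "g' \<ominus>\<^bsub>hom_mod A y z i\<^esub> g \<in> boundaries (Mor A y z) i" using G.hclass_minus_iff g'' g by blast
  have fb: "f' \<ominus>\<^bsub>hom_mod A x y j\<^esub> f \<in> boundaries (Mor A x y) j" using F.hclass_minus_iff f'' f by blast
  have c: "g \<in> hom_set A y z i" "g' \<in> hom_set A y z i" "f \<in> hom_set A x y j" "f' \<in> hom_set A x y j"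
    using g f g'' f'' by (auto simp: cycles_def)
  \<comment> \<open>One factor is exchanged at a time, first \<open>g'\<close> for \<open>g\<close>,
    then \<open>f'\<close> for \<open>f\<close>; each difference is a product of a boundary and a
    cycle.\<close>
  have "Cmp A x y z i j g' f' \<ominus>\<^bsub>hom_mod A x z (i + j)\<^esub> Cmp A x y z i j g f' \<in> boundaries (Mor A x z) (i + j)"
    using Cmp_boundary_left[OF o gb conjunct1[OF f'']] linear_map_diff[OF Cmp_linear_left[OF o c(4)] hom_module hom_module c(2,1)] o by simp
  moreover have "Cmp A x y z i j g f' \<ominus>\<^bsub>hom_mod A x z (i + j)\<^esub> Cmp A x y z i j g f \<in> boundaries (Mor A x z) (i + j)"
    using Cmp_boundary_right[OF o g fb] linear_map_diff[OF Cmp_linear_right[OF o c(1)] hom_module hom_module c(4,3)] o by simp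
  ultimately show ?thesis
    using H.hclass_minus_iff[OF Cmp_cycles[OF o conjunct1[OF g''] conjunct1[OF f'']] Cmp_cycles[OF o g conjunct1[OF f'']]]
      H.hclass_minus_iff[OF Cmp_cycles[OF o g conjunct1[OF f'']] Cmp_cycles[OF o g f]] by simp
qed

text \<open>Composition in \<open>H0_cat\<close> and both actions of \<open>homology_bimod\<close>
  are defined as unions of this kind. All their terms agree by \<open>hclass_Cmp_cong\<close>, and
  homology classes are nonempty sets.\<close>

lemma UN_hclass_Cmp:
  assumes o: "x \<in> Obj A" "y \<in> Obj A" "z \<in> Obj A" and g: "g \<in> cycles (Mor A y z) i" and f: "f \<in> cycles (Mor A x y) j"
    and k: "k = i + j"
  shows "(\<Union>a\<in>hclass (Mor A y z) i g. \<Union>b\<in>hclass (Mor A x y) j f. hclass (Mor A x z) k (Cmp A x y z i j a b)) =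
    hclass (Mor A x z) k (Cmp A x y z i j g f)"
proof -
  have "(\<Union>b\<in>hclass (Mor A x y) j f. hclass (Mor A x z) k (Cmp A x y z i j a b)) = hclass (Mor A x z) k (Cmp A x y z i j g f)"
    if "a \<in> hclass (Mor A y z) i g" for a
    using hclass_Cmp_cong[OF o g f that] chain_complex.hclass_self[OF complex[OF o(1,2)] f] unfolding k
    by (intro SUP_eq_const) blast+
  then have "(\<Union>a\<in>hclass (Mor A y z) i g. \<Union>b\<in>hclass (Mor A x y) j f. hclass (Mor A x z) k (Cmp A x y z i j a b)) =
      (\<Union>a\<in>hclass (Mor A y z) i g. hclass (Mor A x z) k (Cmp A x y z i j g f))" by (rule SUP_cong[OF HOL.refl])
  moreover have "hclass (Mor A y z) i g \<noteq> {}" using chain_complex.hclass_self[OF complex[OF o(2,3)] g] by blast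
  ultimately show ?thesis by simp
qed

end

section \<open>Functors and directed unions of dg categories\<close>

lemma dg_functorI:
  assumes "dg_category R A" "dg_category R B" and ob: "\<And>x. x \<in> Obj A \<Longrightarrow> fob F x \<in> Obj B"
    and "\<And>x y i. \<lbrakk>x \<in> Obj A; y \<in> Obj A\<rbrakk> \<Longrightarrow>
      linear_map R (hom_mod A x y i) (hom_mod B (fob F x) (fob F y) i) (fmor F x y i)"
    and "\<And>x y i a. \<lbrakk>x \<in> Obj A; y \<in> Obj A; a \<in> hom_set A x y i\<rbrakk> \<Longrightarrow>
      fmor F x y (i - 1) (hom_diff A x y i a) = hom_diff B (fob F x) (fob F y) i (fmor F x y i a)"
    and "\<And>x. x \<in> Obj A \<Longrightarrow> fmor F x x 0 (Idt A x) = Idt B (fob F x)"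
    and "\<And>x y z i j g f. \<lbrakk>x \<in> Obj A; y \<in> Obj A; z \<in> Obj A; g \<in> hom_set A y z i; f \<in> hom_set A x y j\<rbrakk> \<Longrightarrow>
      fmor F x z (i + j) (Cmp A x y z i j g f) =
      Cmp B (fob F x) (fob F y) (fob F z) i j (fmor F y z i g) (fmor F x y j f)"
  shows "dg_functor R A B F"
  using assms by (auto simp: dg_functor_def chain_map_def)

lemma dg_functor_zero: "\<lbrakk>dg_functor R A B F; x \<in> Obj A; y \<in> Obj A\<rbrakk> \<Longrightarrow>
    fmor F x y i \<zero>\<^bsub>hom_mod A x y i\<^esub> = \<zero>\<^bsub>hom_mod B (fob F x) (fob F y) i\<^esub>"
  by (rule linear_map_zero[OF dg_functorD(4)]) (auto intro!: dg_category.hom_module dest: dg_functorD)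

lemma dg_functor_hom: "\<lbrakk>dg_functor R A B F; x \<in> Obj A; y \<in> Obj A; a \<in> hom_set A x y i\<rbrakk> \<Longrightarrow>
    fmor F x y i a \<in> hom_set B (fob F x) (fob F y) i"
  by (rule linear_mapD(1)[OF dg_functorD(4)])

lemma dg_functor_chain_map: "\<lbrakk>dg_functor R A B F; x \<in> Obj A; y \<in> Obj A\<rbrakk> \<Longrightarrow>
    chain_map R (Mor A x y) (Mor B (fob F x) (fob F y)) (fmor F x y)"
  by (simp add: dg_functor_def)

lemma dg_functor_cycles: "\<lbrakk>dg_functor R A B F; x \<in> Obj A; y \<in> Obj A; a \<in> cycles (Mor A x y) i\<rbrakk> \<Longrightarrow>
    fmor F x y i a \<in> cycles (Mor B (fob F x) (fob F y)) i"
  by (rule chain_map_cycles[OF dg_functor_chain_map])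
    (auto intro!: dg_category.complex dest: dg_functorD)

text \<open>The structure \<open>B\<close> is covered by images of dg categories \<open>D l\<close>
  under maps \<open>p l\<close> that preserve the operations but need not be injective. Each axiom
  of a dg category involves at most three morphisms, which come from one common \<open>D l\<close>,
  so \<open>B\<close> inherits all of them. The same locale serves for quotients, for the renaming
  \<open>Base\<close> and for sequential colimits.\<close>

locale dg_directed =
  fixes R :: "('b, 'x) ring_scheme" (structure) and D :: "nat \<Rightarrow> ('o, 'b, 'a) dgcat" and B :: "('o, 'b, 'c) dgcat"
    and p :: "nat \<Rightarrow> 'o \<Rightarrow> 'o \<Rightarrow> int \<Rightarrow> 'a \<Rightarrow> 'c"
  assumes D: "dg_category R (D l)" and Obj_D: "Obj (D l) = Obj B"
    and hom: "\<lbrakk>x \<in> Obj B; y \<in> Obj B\<rbrakk> \<Longrightarrow> hom_set B x y i = (\<Union>l. p l x y i ` hom_set (D l) x y i)"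
    and mono: "\<lbrakk>x \<in> Obj B; y \<in> Obj B\<rbrakk> \<Longrightarrow>
      p l x y i ` hom_set (D l) x y i \<subseteq> p (Suc l) x y i ` hom_set (D (Suc l)) x y i"
    and zero: "\<lbrakk>x \<in> Obj B; y \<in> Obj B\<rbrakk> \<Longrightarrow> p l x y i \<zero>\<^bsub>hom_mod (D l) x y i\<^esub> = \<zero>\<^bsub>hom_mod B x y i\<^esub>"
    and add: "\<lbrakk>x \<in> Obj B; y \<in> Obj B; a \<in> hom_set (D l) x y i; b \<in> hom_set (D l) x y i\<rbrakk> \<Longrightarrow>
      p l x y i (a \<oplus>\<^bsub>hom_mod (D l) x y i\<^esub> b) = p l x y i a \<oplus>\<^bsub>hom_mod B x y i\<^esub> p l x y i b"
    and smult: "\<lbrakk>x \<in> Obj B; y \<in> Obj B; r \<in> carrier R; a \<in> hom_set (D l) x y i\<rbrakk> \<Longrightarrow>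
      p l x y i (r \<odot>\<^bsub>hom_mod (D l) x y i\<^esub> a) = r \<odot>\<^bsub>hom_mod B x y i\<^esub> p l x y i a"
    and diff: "\<lbrakk>x \<in> Obj B; y \<in> Obj B; a \<in> hom_set (D l) x y i\<rbrakk> \<Longrightarrow>
      p l x y (i - 1) (hom_diff (D l) x y i a) = hom_diff B x y i (p l x y i a)"
    and Cmp: "\<lbrakk>x \<in> Obj B; y \<in> Obj B; z \<in> Obj B; g \<in> hom_set (D l) y z i; f \<in> hom_set (D l) x y j\<rbrakk> \<Longrightarrow>
      p l x z (i + j) (Cmp (D l) x y z i j g f) = Cmp B x y z i j (p l y z i g) (p l x y j f)"
    and Idt: "x \<in> Obj B \<Longrightarrow> p l x x 0 (Idt (D l) x) = Idt B x"
begin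

lemma is_cring: "cring R" using D by (rule dg_category.axioms)

lemma hom_closed: "\<lbrakk>x \<in> Obj B; y \<in> Obj B; a \<in> hom_set (D l) x y i\<rbrakk> \<Longrightarrow> p l x y i a \<in> hom_set B x y i"
  by (auto simp: hom)

lemma image_mono: "\<lbrakk>x \<in> Obj B; y \<in> Obj B; l \<le> m\<rbrakk> \<Longrightarrow> p l x y i ` hom_set (D l) x y i \<subseteq> p m x y i ` hom_set (D m) x y i"
  using lift_Suc_mono_le[of "\<lambda>l. p l x y i ` hom_set (D l) x y i"] mono by auto

lemma lift1: "\<lbrakk>x \<in> Obj B; y \<in> Obj B; a \<in> hom_set B x y i;
    \<And>l a'. \<lbrakk>a' \<in> hom_set (D l) x y i; a = p l x y i a'\<rbrakk> \<Longrightarrow> P\<rbrakk> \<Longrightarrow> P"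
  by (auto simp: hom)

lemma lift2:
  assumes "x \<in> Obj B" "y \<in> Obj B" "a \<in> hom_set B x y i" "u \<in> Obj B" "v \<in> Obj B" "b \<in> hom_set B u v j"
    "\<And>l a' b'. \<lbrakk>a' \<in> hom_set (D l) x y i; b' \<in> hom_set (D l) u v j; a = p l x y i a'; b = p l u v j b'\<rbrakk> \<Longrightarrow> P"
  shows P
proof -
  obtain l m where l: "a \<in> p l x y i ` hom_set (D l) x y i" "b \<in> p m u v j ` hom_set (D m) u v j"
    using assms(3,6) by (auto simp: hom assms)
  have "a \<in> p (max l m) x y i ` hom_set (D (max l m)) x y i" using image_mono[OF assms(1,2) max.cobounded1] l(1) by blast
  moreover have "b \<in> p (max l m) u v j ` hom_set (D (max l m)) u v j" using image_mono[OF assms(4,5) max.cobounded2] l(2) by blast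
  ultimately show ?thesis using assms(7) by blast
qed

lemma lift3:
  assumes "x \<in> Obj B" "y \<in> Obj B" "a \<in> hom_set B x y i" "u \<in> Obj B" "v \<in> Obj B" "b \<in> hom_set B u v j"
    "s \<in> Obj B" "t \<in> Obj B" "c \<in> hom_set B s t k"
    "\<And>l a' b' c'. \<lbrakk>a' \<in> hom_set (D l) x y i; b' \<in> hom_set (D l) u v j; c' \<in> hom_set (D l) s t k;
      a = p l x y i a'; b = p l u v j b'; c = p l s t k c'\<rbrakk> \<Longrightarrow> P"
  shows P
proof -
  obtain l a' b' where l: "a' \<in> hom_set (D l) x y i" "b' \<in> hom_set (D l) u v j" "a = p l x y i a'" "b = p l u v j b'"
    by (rule lift2[OF assms(1-6)])
  obtain m where m: "c \<in> p m s t k ` hom_set (D m) s t k" using assms(9) by (auto simp: hom assms)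
  let ?m = "max l m"
  have "a \<in> p ?m x y i ` hom_set (D ?m) x y i" using image_mono[OF assms(1,2) max.cobounded1] l by blast
  moreover have "b \<in> p ?m u v j ` hom_set (D ?m) u v j" using image_mono[OF assms(4,5) max.cobounded1] l by blast
  moreover have "c \<in> p ?m s t k ` hom_set (D ?m) s t k" using image_mono[OF assms(7,8) max.cobounded2] m by blast
  ultimately show ?thesis using assms(10) by blast
qed

lemma hom_module: assumes o: "x \<in> Obj B" "y \<in> Obj B" shows "module R (hom_mod B x y i)"
proof (rule module_directed[where M = "\<lambda>l. hom_mod (D l) x y i" and p = "\<lambda>l. p l x y i"])
  show "module R (hom_mod (D l) x y i)" for l
    by (rule dg_category.hom_module[OF D]) (use o in \<open>simp_all add: Obj_D\<close>)
  show "p l x y i ` hom_set (D l) x y i \<subseteq> p (Suc l) x y i ` hom_set (D (Suc l)) x y i" for l by (rule mono[OF o])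
qed (simp_all add: hom zero add smult o)

lemma complex: assumes xy: "x \<in> Obj B" "y \<in> Obj B" shows "chain_complex R (Mor B x y)"
proof (rule chain_complexI)
  note d = dg_category.hom_diff_closed[OF D, unfolded Obj_D, OF xy]
  show "linear_map R (hom_mod B x y i) (hom_mod B x y (i - 1)) (hom_diff B x y i)" for i
  proof (rule linear_mapI)
    fix a assume "a \<in> hom_set B x y i"
    then show "hom_diff B x y i a \<in> hom_set B x y (i - 1)"
      by (rule lift1[OF xy]) (use d xy in \<open>simp add: diff[symmetric] hom_closed\<close>)
  next
    fix a b assume ab: "a \<in> hom_set B x y i" "b \<in> hom_set B x y i"
    show "hom_diff B x y i (a \<oplus>\<^bsub>hom_mod B x y i\<^esub> b) = hom_diff B x y i a \<oplus>\<^bsub>hom_mod B x y (i - 1)\<^esub> hom_diff B x y i b"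
    proof (rule lift2[OF xy ab(1) xy ab(2)])
      fix l a' b' assume *: "a' \<in> hom_set (D l) x y i" "b' \<in> hom_set (D l) x y i" "a = p l x y i a'" "b = p l x y i b'"
      interpret Dl: dg_category R "D l" by (rule D)
      interpret H: module R "hom_mod (D l) x y i" by (rule Dl.hom_module) (use xy in \<open>auto simp: Obj_D\<close>)
      show ?thesis using * xy d[of _ l i] Dl.hom_diff_add[of x y a' i b']
        by (simp add: add[symmetric] diff[symmetric] Obj_D)
    qed
  next
    fix r a assume r: "r \<in> carrier R" and a: "a \<in> hom_set B x y i"
    show "hom_diff B x y i (r \<odot>\<^bsub>hom_mod B x y i\<^esub> a) = r \<odot>\<^bsub>hom_mod B x y (i - 1)\<^esub> hom_diff B x y i a"
    proof (rule lift1[OF xy a])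
      fix l a' assume *: "a' \<in> hom_set (D l) x y i" "a = p l x y i a'"
      interpret Dl: dg_category R "D l" by (rule D)
      interpret H: module R "hom_mod (D l) x y i" by (rule Dl.hom_module) (use xy in \<open>auto simp: Obj_D\<close>)
      show ?thesis using * xy r d[of _ l i] Dl.hom_diff_smult[of x y r a' i]
        by (simp add: smult[symmetric] diff[symmetric] Obj_D)
    qed
  qed
  fix a i assume a: "a \<in> hom_set B x y i"
  show "hom_diff B x y (i - 1) (hom_diff B x y i a) = \<zero>\<^bsub>hom_mod B x y (i - 2)\<^esub>"
  proof (rule lift1[OF xy a])
    fix l a' assume *: "a' \<in> hom_set (D l) x y i" "a = p l x y i a'"
    show ?thesis using * xy d[of _ l i] dg_category.hom_diff_diff[OF D, of x l y a' i] diff[of x y "hom_diff (D l) x y i a'" l "i - 1"] zero[of x y l "i - 2"]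
      by (simp add: diff[symmetric] Obj_D)
  qed
qed (use xy in \<open>rule hom_module\<close>)

theorem dg_category: "dg_category R B"
proof (rule dg_categoryI[OF is_cring])
  show "chain_complex R (Mor B x y)" if "x \<in> Obj B" "y \<in> Obj B" for x y by (rule complex[OF that])
  show "Idt B x \<in> hom_set B x x 0" if "x \<in> Obj B" for x
    using Idt[OF that, of 0, symmetric] hom_closed[OF that that dg_category.Idt_closed[OF D]] that by (simp add: Obj_D)
  have cl: "Cmp (D l) x y z i j g f \<in> hom_set (D l) x z (i + j)"
    if "x \<in> Obj B" "y \<in> Obj B" "z \<in> Obj B" "g \<in> hom_set (D l) y z i" "f \<in> hom_set (D l) x y j" for l x y z i j g f
    using dg_category.Cmp_closed[OF D] that by (simp add: Obj_D)
  have C: "Cmp B x y z i j g f \<in> hom_set B x z (i + j)"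
    if "x \<in> Obj B" "y \<in> Obj B" "z \<in> Obj B" "g \<in> hom_set B y z i" "f \<in> hom_set B x y j" for x y z i j g f
    by (rule lift2[OF that(2,3,4) that(1,2,5)]) (use that cl in \<open>simp add: Cmp[symmetric] hom_closed\<close>)
  show "linear_map R (hom_mod B y z i) (hom_mod B x z (i + j)) (\<lambda>g. Cmp B x y z i j g f)"
    if o: "x \<in> Obj B" "y \<in> Obj B" "z \<in> Obj B" "f \<in> hom_set B x y j" for x y z i j f
  proof (rule linear_mapI)
    fix a b assume ab: "a \<in> hom_set B y z i" "b \<in> hom_set B y z i"
    show "Cmp B x y z i j (a \<oplus>\<^bsub>hom_mod B y z i\<^esub> b) f = Cmp B x y z i j a f \<oplus>\<^bsub>hom_mod B x z (i + j)\<^esub> Cmp B x y z i j b f"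
    proof (rule lift3[OF o(2,3) ab(1) o(2,3) ab(2) o(1,2,4)])
      fix l a' b' f' assume *: "a' \<in> hom_set (D l) y z i" "b' \<in> hom_set (D l) y z i" "f' \<in> hom_set (D l) x y j"
        "a = p l y z i a'" "b = p l y z i b'" "f = p l x y j f'"
      interpret Dl: dg_category R "D l" by (rule D)
      interpret H: module R "hom_mod (D l) y z i" by (rule Dl.hom_module) (use o in \<open>auto simp: Obj_D\<close>)
      show ?thesis using * o cl Dl.Cmp_add_left[of x y z a' i b' f' j "i + j"]
        by (simp add: add[symmetric] Cmp[symmetric] Obj_D)
    qed
  next
    fix r a assume r: "r \<in> carrier R" and a: "a \<in> hom_set B y z i"
    show "Cmp B x y z i j (r \<odot>\<^bsub>hom_mod B y z i\<^esub> a) f = r \<odot>\<^bsub>hom_mod B x z (i + j)\<^esub> Cmp B x y z i j a f"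
    proof (rule lift2[OF o(2,3) a o(1,2,4)])
      fix l a' f' assume *: "a' \<in> hom_set (D l) y z i" "f' \<in> hom_set (D l) x y j" "a = p l y z i a'" "f = p l x y j f'"
      interpret Dl: dg_category R "D l" by (rule D)
      interpret H: module R "hom_mod (D l) y z i" by (rule Dl.hom_module) (use o in \<open>auto simp: Obj_D\<close>)
      show ?thesis using * o r cl Dl.Cmp_smult_left[of x y z r a' i f' j "i + j"]
        by (simp add: smult[symmetric] Cmp[symmetric] Obj_D)
    qed
  qed (use C o in auto)
  show "linear_map R (hom_mod B x y j) (hom_mod B x z (i + j)) (\<lambda>f. Cmp B x y z i j g f)"
    if o: "x \<in> Obj B" "y \<in> Obj B" "z \<in> Obj B" "g \<in> hom_set B y z i" for x y z i j g
  proof (rule linear_mapI)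
    fix a b assume ab: "a \<in> hom_set B x y j" "b \<in> hom_set B x y j"
    show "Cmp B x y z i j g (a \<oplus>\<^bsub>hom_mod B x y j\<^esub> b) = Cmp B x y z i j g a \<oplus>\<^bsub>hom_mod B x z (i + j)\<^esub> Cmp B x y z i j g b"
    proof (rule lift3[OF o(1,2) ab(1) o(1,2) ab(2) o(2,3,4)])
      fix l a' b' g' assume *: "a' \<in> hom_set (D l) x y j" "b' \<in> hom_set (D l) x y j" "g' \<in> hom_set (D l) y z i"
        "a = p l x y j a'" "b = p l x y j b'" "g = p l y z i g'"
      interpret Dl: dg_category R "D l" by (rule D)
      interpret H: module R "hom_mod (D l) x y j" by (rule Dl.hom_module) (use o in \<open>auto simp: Obj_D\<close>)
      show ?thesis using * o cl Dl.Cmp_add_right[of x y z g' i a' j b' "i + j"]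
        by (simp add: add[symmetric] Cmp[symmetric] Obj_D)
    qed
  next
    fix r a assume r: "r \<in> carrier R" and a: "a \<in> hom_set B x y j"
    show "Cmp B x y z i j g (r \<odot>\<^bsub>hom_mod B x y j\<^esub> a) = r \<odot>\<^bsub>hom_mod B x z (i + j)\<^esub> Cmp B x y z i j g a"
    proof (rule lift2[OF o(1,2) a o(2,3,4)])
      fix l a' g' assume *: "a' \<in> hom_set (D l) x y j" "g' \<in> hom_set (D l) y z i" "a = p l x y j a'" "g = p l y z i g'"
      interpret Dl: dg_category R "D l" by (rule D)
      interpret H: module R "hom_mod (D l) x y j" by (rule Dl.hom_module) (use o in \<open>auto simp: Obj_D\<close>)
      show ?thesis using * o r cl Dl.Cmp_smult_right[of x y z r g' i a' j "i + j"]
        by (simp add: smult[symmetric] Cmp[symmetric] Obj_D)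
    qed
  qed (use C o in auto)
next
  fix x y z i j g f
  assume a: "x \<in> Obj B" "y \<in> Obj B" "z \<in> Obj B" "g \<in> hom_set B y z i" "f \<in> hom_set B x y j"
  show "hom_diff B x z (i + j) (Cmp B x y z i j g f) =
        Cmp B x y z (i - 1) j (hom_diff B y z i g) f \<oplus>\<^bsub>hom_mod B x z (i + j - 1)\<^esub>
        sign R i \<odot>\<^bsub>hom_mod B x z (i + j - 1)\<^esub> Cmp B x y z i (j - 1) g (hom_diff B x y j f)"
  proof (rule lift2[OF a(2,3,4) a(1,2,5)])
    fix l g' f' assume *: "g' \<in> hom_set (D l) y z i" "f' \<in> hom_set (D l) x y j" "g = p l y z i g'" "f = p l x y j f'"
    interpret Dl: dg_category R "D l" by (rule D)
    note o = a(1-3)[folded Obj_D[of l]]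
    interpret H: module R "hom_mod (D l) x z (i + j - 1)" by (rule Dl.hom_module[OF o(1,3)])
    note c = Dl.hom_diff_closed[OF o(2,3) *(1)] Dl.hom_diff_closed[OF o(1,2) *(2)]
    note cc = Dl.Cmp_diff_closed[OF o *(1,2)]
    have 1: "Cmp B x y z (i - 1) j (hom_diff B y z i g) f = p l x z (i + j - 1) (Cmp (D l) x y z (i - 1) j (hom_diff (D l) y z i g') f')"
      using Cmp[OF a(1-3) c(1) *(2)] *(3,4) diff[OF a(2,3) *(1)] by (simp add: algebra_simps)
    have 2: "Cmp B x y z i (j - 1) g (hom_diff B x y j f) = p l x z (i + j - 1) (Cmp (D l) x y z i (j - 1) g' (hom_diff (D l) x y j f'))"
      using Cmp[OF a(1-3) *(1) c(2)] *(3,4) diff[OF a(1,2) *(2)] by (simp add: algebra_simps)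
    show ?thesis unfolding 1 2 unfolding *(3,4)
      using Dl.Cmp_diff_sign[OF o *(1,2)] cc sign_closed[OF is_cring] a Dl.Cmp_closed[OF o *(1,2)]
      by (simp add: Cmp[OF a(1-3) *(1,2), symmetric] diff[symmetric] smult[symmetric] add[symmetric])
  qed
next
  fix w x y z i j k h g f
  assume a: "w \<in> Obj B" "x \<in> Obj B" "y \<in> Obj B" "z \<in> Obj B"
        "h \<in> hom_set B y z i" "g \<in> hom_set B x y j" "f \<in> hom_set B w x k"
  show "Cmp B w x z (i + j) k (Cmp B x y z i j h g) f = Cmp B w y z i (j + k) h (Cmp B w x y j k g f)"
  proof (rule lift3[OF a(3,4,5) a(2,3,6) a(1,2,7)])
    fix l h' g' f' assume *: "h' \<in> hom_set (D l) y z i" "g' \<in> hom_set (D l) x y j" "f' \<in> hom_set (D l) w x k"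
      "h = p l y z i h'" "g = p l x y j g'" "f = p l w x k f'"
    interpret Dl: dg_category R "D l" by (rule D)
    note o = a(1-4)[folded Obj_D[of l]]
    note c = Dl.Cmp_closed[OF o(2-4) *(1,2)] Dl.Cmp_closed[OF o(1-3) *(2,3)]
    have "Cmp B w x z (i + j) k (Cmp B x y z i j h g) f = p l w z (i + j + k) (Cmp (D l) w x z (i + j) k (Cmp (D l) x y z i j h' g') f')"
      unfolding *(4-6) using Cmp[OF a(2-4) *(1,2)] Cmp[OF a(1,2,4) c(1) *(3)] by simp
    also have "\<dots> = p l w z (i + (j + k)) (Cmp (D l) w y z i (j + k) h' (Cmp (D l) w x y j k g' f'))"
      using Dl.Cmp_assoc[OF o *(1-3)] by (simp add: add.assoc)
    also have "\<dots> = Cmp B w y z i (j + k) h (Cmp B w x y j k g f)"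
      unfolding *(4-6) using Cmp[OF a(1-3) *(2,3)] Cmp[OF a(1,3,4) *(1) c(2)] by simp
    finally show ?thesis .
  qed
next
  fix x y i f assume a: "x \<in> Obj B" "y \<in> Obj B" "f \<in> hom_set B x y i"
  show "Cmp B x y y 0 i (Idt B y) f = f"
  proof (rule lift1[OF a])
    fix l f' assume *: "f' \<in> hom_set (D l) x y i" "f = p l x y i f'"
    interpret Dl: dg_category R "D l" by (rule D)
    note o = a(1,2)[folded Obj_D[of l]]
    show ?thesis using Cmp[OF a(1,2,2) Dl.Idt_closed[OF o(2)] *(1)] Dl.Cmp_Idt_left[OF o *(1)] *(2) Idt[OF a(2), of l] by simp
  qed
  show "Cmp B x x y i 0 f (Idt B x) = f"
  proof (rule lift1[OF a])
    fix l f' assume *: "f' \<in> hom_set (D l) x y i" "f = p l x y i f'"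
    interpret Dl: dg_category R "D l" by (rule D)
    note o = a(1,2)[folded Obj_D[of l]]
    show ?thesis using Cmp[OF a(1,1,2) *(1) Dl.Idt_closed[OF o(1)]] Dl.Cmp_Idt_right[OF o *(1)] *(2) Idt[OF a(1), of l] by simp
  qed
qed

definition cocone :: "nat \<Rightarrow> ('o, 'a, 'o, 'c) dgfun" where
  "cocone l = \<lparr>fob = (\<lambda>x. x), fmor = p l\<rparr>"

lemma cocone_functor: "dg_functor R (D l) B (cocone l)"
  by (rule dg_functorI[OF D dg_category])
    (auto simp: Obj_D cocone_def hom_closed add smult diff Idt Cmp intro!: linear_mapI)

text \<open>Each condition on \<open>F\<close> involves at most two morphisms of \<open>B\<close>.
  They come from a common \<open>D l\<close>, on which the composite of \<open>F\<close> with the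
  cocone is a dg functor.\<close>

lemma functor_out:
  assumes F: "\<And>l. dg_functor R (D l) X (dgfun_comp F (cocone l))"
  shows "dg_functor R B X F"
proof (rule dg_functorI[OF dg_category dg_functorD(2)[OF F]])
  have s: "fob (dgfun_comp F (cocone l)) x = fob F x" "fmor (dgfun_comp F (cocone l)) x y i a = fmor F x y i (p l x y i a)" for l x y i a
    by (simp_all add: dgfun_comp_def cocone_def)
  note f = dg_functorD(3-)[OF F, unfolded Obj_D s] linear_mapD[OF dg_functorD(4)[OF F, unfolded Obj_D s], unfolded s]
  show "fob F x \<in> Obj X" if "x \<in> Obj B" for x using f(1) that by simp
  show "fmor F x x 0 (Idt B x) = Idt X (fob F x)" if "x \<in> Obj B" for x using f(4)[OF that] Idt[OF that] by metis
  show "linear_map R (hom_mod B x y i) (hom_mod X (fob F x) (fob F y) i) (fmor F x y i)"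
    if o: "x \<in> Obj B" "y \<in> Obj B" for x y i
  proof (rule linear_mapI)
    fix a assume "a \<in> hom_set B x y i"
    then show "fmor F x y i a \<in> hom_set X (fob F x) (fob F y) i" by (rule lift1[OF o]) (use f(6)[OF o] in auto)
  next
    fix a b assume "a \<in> hom_set B x y i" "b \<in> hom_set B x y i"
    then show "fmor F x y i (a \<oplus>\<^bsub>hom_mod B x y i\<^esub> b) = fmor F x y i a \<oplus>\<^bsub>hom_mod X (fob F x) (fob F y) i\<^esub> fmor F x y i b"
      by (rule lift2[OF o _ o]) (use f(7)[OF o] in \<open>auto simp: add[OF o, symmetric]\<close>)
  next
    fix r a assume r: "r \<in> carrier R" and a: "a \<in> hom_set B x y i"
    show "fmor F x y i (r \<odot>\<^bsub>hom_mod B x y i\<^esub> a) = r \<odot>\<^bsub>hom_mod X (fob F x) (fob F y) i\<^esub> fmor F x y i a"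
      by (rule lift1[OF o a]) (use f(8)[OF o r] in \<open>auto simp: smult[OF o r, symmetric]\<close>)
  qed
  show "fmor F x y (i - 1) (hom_diff B x y i a) = hom_diff X (fob F x) (fob F y) i (fmor F x y i a)"
    if o: "x \<in> Obj B" "y \<in> Obj B" "a \<in> hom_set B x y i" for x y i a
    by (rule lift1[OF o]) (use f(3)[OF o(1,2)] in \<open>auto simp: diff[OF o(1,2), symmetric]\<close>)
  show "fmor F x z (i + j) (Cmp B x y z i j g h) = Cmp X (fob F x) (fob F y) (fob F z) i j (fmor F y z i g) (fmor F x y j h)"
    if o: "x \<in> Obj B" "y \<in> Obj B" "z \<in> Obj B" "g \<in> hom_set B y z i" "h \<in> hom_set B x y j" for x y z i j g h
    by (rule lift2[OF o(2,3,4) o(1,2,5)]) (use f(5)[OF o(1-3)] in \<open>auto simp: Cmp[OF o(1-3), symmetric]\<close>)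
qed

end

lemma (in module) a_inv_zero: "\<ominus>\<^bsub>M\<^esub> \<zero>\<^bsub>M\<^esub> = \<zero>\<^bsub>M\<^esub>"
  using M.r_neg[of "\<zero>\<^bsub>M\<^esub>"] by simp

text \<open>Declares the module laws to the method \<open>algebra\<close>, which settles the sums
  with several minus signs in the mapping path category.\<close>

lemmas (in module) module_simprules [algebra module "zero M" "add M" "a_inv M" "a_minus M" "smult M"] =
  M.a_closed M.zero_closed M.a_inv_closed M.minus_closed M.a_assoc M.l_zero M.l_neg M.a_comm M.minus_eq
  M.r_zero M.r_neg M.r_neg2 M.r_neg1 M.minus_add M.minus_minus a_inv_zero M.a_lcomm
  smult_closed smult_r_distr smult_r_minus

text \<open>The operations are literally those of \<open>A\<close> and only carriers shrink, so
  equations are inherited and closure is all that remains. Serves for the truncation and for strict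
  pullbacks inside products.\<close>

lemma sub_dg_category:
  assumes A: "dg_category R A" and Obj: "Obj A' \<subseteq> Obj A"
    and hom: "\<And>x y i. \<lbrakk>x \<in> Obj A'; y \<in> Obj A'\<rbrakk> \<Longrightarrow> hom_mod A' x y i = hom_mod A x y i\<lparr>carrier := S x y i\<rparr>"
    and diff: "\<And>x y. \<lbrakk>x \<in> Obj A'; y \<in> Obj A'\<rbrakk> \<Longrightarrow> cdiff (Mor A' x y) = cdiff (Mor A x y)"
    and Cmp: "Cmp A' = Cmp A" and Idt: "Idt A' = Idt A"
    and S: "\<And>x y i. \<lbrakk>x \<in> Obj A'; y \<in> Obj A'\<rbrakk> \<Longrightarrow> submodule (S x y i) R (hom_mod A x y i)"
    and S_diff: "\<And>x y i a. \<lbrakk>x \<in> Obj A'; y \<in> Obj A'; a \<in> S x y i\<rbrakk> \<Longrightarrow> hom_diff A x y i a \<in> S x y (i - 1)"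
    and S_Cmp: "\<And>x y z i j g f. \<lbrakk>x \<in> Obj A'; y \<in> Obj A'; z \<in> Obj A'; g \<in> S y z i; f \<in> S x y j\<rbrakk> \<Longrightarrow>
      Cmp A x y z i j g f \<in> S x z (i + j)"
    and S_Idt: "\<And>x. x \<in> Obj A' \<Longrightarrow> Idt A x \<in> S x x 0"
  shows "dg_category R A'"
proof -
  interpret A: dg_category R A by fact
  have o: "x \<in> Obj A' \<Longrightarrow> x \<in> Obj A" for x using Obj by auto
  have SA: "a \<in> S x y i \<Longrightarrow> a \<in> hom_set A x y i" if "x \<in> Obj A'" "y \<in> Obj A'" for a x y i
    using module.submoduleD(1)[OF A.hom_module S] o that by blast
  have car: "hom_set A' x y i = S x y i" if "x \<in> Obj A'" "y \<in> Obj A'" for x y i using hom[OF that] by simp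
  show ?thesis
  proof (rule dg_categoryI[OF A.is_cring], goal_cases)
    case (1 x y)
    have d: "linear_map R (hom_mod A' x y i) (hom_mod A' x y (i - 1)) (hom_diff A' x y i)" for i
      unfolding hom[OF 1] diff[OF 1]
      by (rule linear_mapI) (use 1 S_diff SA o in \<open>simp_all add: A.hom_diff_add A.hom_diff_smult\<close>)
    show ?case
    proof (rule chain_complexI[OF _ d])
      show "module R (hom_mod A' x y i)" for i unfolding hom[OF 1]
        by (rule submodule.submodule_is_module[OF S[OF 1] A.hom_module[OF o o, OF 1]])
    qed (use 1 SA o in \<open>simp_all add: hom diff A.hom_diff_diff\<close>)
  next
    case (2 x) then show ?case by (simp add: Idt S_Idt car)
  next
    case (3 x y z i j f)
    show ?case unfolding hom[OF 3(2,3)] hom[OF 3(1,3)] Cmp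
      by (rule linear_mapI) (use 3 S_Cmp SA o in \<open>simp_all add: car A.Cmp_add_left A.Cmp_smult_left\<close>)
  next
    case (4 x y z i j g)
    show ?case unfolding hom[OF 4(1,2)] hom[OF 4(1,3)] Cmp
      by (rule linear_mapI) (use 4 S_Cmp SA o in \<open>simp_all add: car A.Cmp_add_right A.Cmp_smult_right\<close>)
  next
    case (5 x y z i j g f)
    then have "g \<in> hom_set A y z i" "f \<in> hom_set A x y j" using SA car by auto
    then show ?case using A.Cmp_diff_sign[OF o[OF 5(1)] o[OF 5(2)] o[OF 5(3)]] 5 by (simp add: hom diff Cmp)
  next
    case (6 w x y z i j k h g f)
    then have "h \<in> hom_set A y z i" "g \<in> hom_set A x y j" "f \<in> hom_set A w x k" using SA car by auto
    then show ?case using A.Cmp_assoc[OF o[OF 6(1)] o[OF 6(2)] o[OF 6(3)] o[OF 6(4)]] by (simp add: Cmp)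
  next
    case (7 x y i f)
    then show ?case using A.Cmp_Idt_left[OF o[OF 7(1)] o[OF 7(2)] SA[OF 7(1,2)]] by (simp add: Cmp Idt car)
  next
    case (8 x y i f)
    then show ?case using A.Cmp_Idt_right[OF o[OF 8(1)] o[OF 8(2)] SA[OF 8(1,2)]] by (simp add: Cmp Idt car)
  qed
qed

lemma tau_ge0_dg_category:
  assumes "dg_category R A" shows "dg_category R (tau_ge0 A)"
proof -
  interpret A: dg_category R A by fact
  define S where "S x y i = (if i > 0 then hom_set A x y i else if i = 0 then cycles (Mor A x y) 0 else {\<zero>\<^bsub>hom_mod A x y i\<^esub>})" for x y i
  note Zs = chain_complex.cycles_submodule[OF A.complex]
  have sub: "submodule (S x y i) R (hom_mod A x y i)" if "x \<in> Obj A" "y \<in> Obj A" for x y i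
    using module.carrier_is_submodule[OF A.hom_module[OF that]] module.zero_submodule[OF A.hom_module[OF that]]
      Zs[OF that] by (auto simp: S_def)
  show ?thesis
  proof (rule sub_dg_category[OF assms, where S = S], goal_cases)
    case (2 x y i) show ?case by (simp add: tau_ge0_def trunc_ge0_def S_def zero_sub_def)
  next
    case (7 x y i a)
    then have o: "x \<in> Obj A" "y \<in> Obj A" by (simp_all add: tau_ge0_def)
    consider "i > 1" | "i = 1" | "i = 0" | "i < 0" by linarith
    then show ?case
    proof cases
      \<comment> \<open>The differential of an element of degree \<open>1\<close> lands where only
        cycles were kept, hence the use of \<open>d d = 0\<close>.\<close>
      case 2
      then show ?thesis using 7 o A.hom_diff_closed[of x y a 1] A.hom_diff_diff[of x y a 1] by (simp add: S_def cycles_def)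
    qed (use 7 o in \<open>auto simp: S_def A.hom_diff_closed A.hom_diff_zero cycles_def\<close>)
  next
    case (8 x y z i j g f)
    then have o: "x \<in> Obj A" "y \<in> Obj A" "z \<in> Obj A" by (simp_all add: tau_ge0_def)
    have gf: "g \<in> hom_set A y z i" "f \<in> hom_set A x y j"
      using 8 o module.submoduleD(1)[OF A.hom_module sub] by blast+
    interpret H: module R "hom_mod A x z (-1)" using o by (intro A.hom_module)
    \<comment> \<open>The cycle condition has to be checked only for two factors of degree
      \<open>0\<close>: a factor of negative degree vanishes, and nothing is required in positive
      total degree.\<close>
    consider "i < 0" | "j < 0" | "i = 0" "j = 0" | "i \<ge> 0" "j \<ge> 0" "i + j > 0" by linarith
    then show ?case
    proof cases
      case 1
      then have "Cmp A x y z i j g f = \<zero>\<^bsub>hom_mod A x z (i + j)\<^esub>" using 8 o gf A.Cmp_zero_left by (simp add: S_def)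
      then show ?thesis using module.submoduleD(2)[OF A.hom_module sub] o by simp
    next
      case 2
      then have "Cmp A x y z i j g f = \<zero>\<^bsub>hom_mod A x z (i + j)\<^esub>" using 8 o gf A.Cmp_zero_right by (simp add: S_def)
      then show ?thesis using module.submoduleD(2)[OF A.hom_module sub] o by simp
    next
      case 3
      then have d: "hom_diff A y z 0 g = \<zero>\<^bsub>hom_mod A y z (-1)\<^esub>" "hom_diff A x y 0 f = \<zero>\<^bsub>hom_mod A x y (-1)\<^esub>"
        and gf': "g \<in> hom_set A y z 0" "f \<in> hom_set A x y 0" using 8 by (auto simp: S_def cycles_def)
      have "hom_diff A x z 0 (Cmp A x y z 0 0 g f) = \<zero>\<^bsub>hom_mod A x z (-1)\<^esub>"
        using A.Cmp_diff_sign[OF o gf'] d A.Cmp_zero_left[OF o gf'(2), of "-1"] A.Cmp_zero_right[OF o gf'(1), of "-1"]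
        by (simp add: sign_def)
      then show ?thesis using A.Cmp_closed[OF o gf'] 3 by (simp add: S_def cycles_def)
    next
      case 4 then show ?thesis using A.Cmp_closed[OF o gf] by (simp add: S_def)
    qed
  next
    case (9 x)
    then show ?case using A.Idt_closed[of x] A.diff_Idt[of x] by (simp add: S_def cycles_def tau_ge0_def)
  qed (use sub in \<open>simp_all add: tau_ge0_def trunc_ge0_def\<close>)
qed

section \<open>Products and strict pullbacks\<close>

definition prod_dgcat :: "('o, 'r, 'a) dgcat \<Rightarrow> ('p, 'r, 'b) dgcat \<Rightarrow> ('o \<times> 'p, 'r, 'a \<times> 'b) dgcat" where
  "prod_dgcat A B = \<lparr>Obj = Obj A \<times> Obj B,
     Mor = (\<lambda>(x, y) (x', y'). prod_complex (Mor A x x') (Mor B y y')),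
     Cmp = (\<lambda>(x, y) (x', y') (x'', y'') i j (a, b) (a', b').
       (Cmp A x x' x'' i j a a', Cmp B y y' y'' i j b b')),
     Idt = (\<lambda>(x, y). (Idt A x, Idt B y))\<rparr>"

lemma prod_dgcat_simps:
  "Obj (prod_dgcat A B) = Obj A \<times> Obj B"
  "hom_mod (prod_dgcat A B) (x, y) (x', y') i = prod_module (hom_mod A x x' i) (hom_mod B y y' i)"
  "hom_diff (prod_dgcat A B) (x, y) (x', y') i (a, b) = (hom_diff A x x' i a, hom_diff B y y' i b)"
  "Cmp (prod_dgcat A B) (x, y) (x', y') (x'', y'') i j (a, b) (a', b') = (Cmp A x x' x'' i j a a', Cmp B y y' y'' i j b b')"
  "Idt (prod_dgcat A B) (x, y) = (Idt A x, Idt B y)"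
  by (simp_all add: prod_dgcat_def prod_complex_def)

lemma prod_dg_category: assumes "dg_category R A" "dg_category R B" shows "dg_category R (prod_dgcat A B)"
proof -
  interpret A: dg_category R A by fact
  interpret B: dg_category R B by fact
  show ?thesis
  proof (rule dg_categoryI[OF A.is_cring], goal_cases)
    case (1 x y)
    then show ?case
      by (cases x; cases y; intro chain_complexI linear_mapI)
        (auto simp: prod_dgcat_simps A.hom_module B.hom_module A.hom_diff_closed B.hom_diff_closed
          A.hom_diff_add B.hom_diff_add A.hom_diff_smult B.hom_diff_smult A.hom_diff_diff B.hom_diff_diff intro!: prod_module)
  next
    case (2 x) then show ?case by (cases x) (auto simp: prod_dgcat_simps A.Idt_closed B.Idt_closed)
  next
    case (3 x y z i j f) then show ?case
      by (cases x; cases y; cases z; intro linear_mapI)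
        (auto simp: prod_dgcat_simps A.Cmp_closed B.Cmp_closed A.Cmp_add_left B.Cmp_add_left A.Cmp_smult_left B.Cmp_smult_left)
  next
    case (4 x y z i j f) then show ?case
      by (cases x; cases y; cases z; intro linear_mapI)
        (auto simp: prod_dgcat_simps A.Cmp_closed B.Cmp_closed A.Cmp_add_right B.Cmp_add_right A.Cmp_smult_right B.Cmp_smult_right)
  next
    case (5 x y z i j g f) then show ?case
      by (cases x; cases y; cases z) (auto simp: prod_dgcat_simps A.Cmp_diff_sign B.Cmp_diff_sign)
  next
    case (6 w x y z i j k h g f) then show ?case
      by (cases w; cases x; cases y; cases z) (auto simp: prod_dgcat_simps A.Cmp_assoc B.Cmp_assoc)
  next
    case (7 x y i f) then show ?case
      by (cases x; cases y) (auto simp: prod_dgcat_simps A.Cmp_Idt_left B.Cmp_Idt_left)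
  next
    case (8 x y i f) then show ?case
      by (cases x; cases y) (auto simp: prod_dgcat_simps A.Cmp_Idt_right B.Cmp_Idt_right)
  qed
qed

lemma pullback_simps:
  "Obj (pullback A B F G) = {(x, y). x \<in> Obj A \<and> y \<in> Obj B \<and> fob F x = fob G y}"
  "hom_mod (pullback A B F G) (x, y) (x', y') i = prod_module (hom_mod A x x' i) (hom_mod B y y' i)
    \<lparr>carrier := {(a, b). a \<in> hom_set A x x' i \<and> b \<in> hom_set B y y' i \<and> fmor F x x' i a = fmor G y y' i b}\<rparr>"
  "hom_diff (pullback A B F G) (x, y) (x', y') i (a, b) = (hom_diff A x x' i a, hom_diff B y y' i b)"
  "Cmp (pullback A B F G) (x, y) (x', y') (x'', y'') i j (a, b) (a', b') = (Cmp A x x' x'' i j a a', Cmp B y y' y'' i j b b')"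
  "Idt (pullback A B F G) (x, y) = (Idt A x, Idt B y)"
  by (simp_all add: pullback_def prod_complex_def)

text \<open>The pullback is cut out of the product by the equation \<open>F a = G b\<close>, which
  all operations respect because \<open>F\<close> and \<open>G\<close> are dg functors.\<close>

lemma pullback_dg_category:
  assumes F: "dg_functor R A C F" and G: "dg_functor R B C G"
  shows "dg_category R (pullback A B F G)"
proof -
  define S where "S p q i = {(a, b). a \<in> hom_set A (fst p) (fst q) i \<and> b \<in> hom_set B (snd p) (snd q) i
    \<and> fmor F (fst p) (fst q) i a = fmor G (snd p) (snd q) i b}" for p q i
  have P: "dg_category R (prod_dgcat A B)" by (rule prod_dg_category[OF dg_functorD(1)[OF F] dg_functorD(1)[OF G]])
  interpret A: dg_category R A by (rule dg_functorD(1)[OF F])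
  interpret B: dg_category R B by (rule dg_functorD(1)[OF G])
  have linF: "linear_map R (hom_mod A x y i) (hom_mod C (fob F x) (fob F y) i) (fmor F x y i)" if "x \<in> Obj A" "y \<in> Obj A" for x y i
    by (rule dg_functorD(4)[OF F that])
  have linG: "linear_map R (hom_mod B x y i) (hom_mod C (fob G x) (fob G y) i) (fmor G x y i)" if "x \<in> Obj B" "y \<in> Obj B" for x y i
    by (rule dg_functorD(4)[OF G that])
  show ?thesis
  proof (rule sub_dg_category[OF P, where S = S], goal_cases)
    case (2 x y i) then show ?case by (cases x; cases y) (simp add: S_def pullback_simps prod_dgcat_simps)
  next
    case (3 x y) then show ?case by (cases x; cases y) (simp add: pullback_def prod_dgcat_def)
  next
    case (6 x y i)
    obtain x1 x2 y1 y2 where e: "x = (x1, x2)" "y = (y1, y2)" by (cases x; cases y) auto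
    have o: "x1 \<in> Obj A" "y1 \<in> Obj A" "x2 \<in> Obj B" "y2 \<in> Obj B" "fob F x1 = fob G x2" "fob F y1 = fob G y2"
      using 6 by (auto simp: e pullback_simps)
    interpret M: module R "hom_mod (prod_dgcat A B) x y i"
      by (rule dg_category.hom_module[OF P]) (use o in \<open>auto simp: prod_dgcat_simps e\<close>)
    show ?case
      by (rule M.submoduleI')
        (use o dg_functor_zero[OF F o(1,2)] dg_functor_zero[OF G o(3,4)] linear_mapD[OF linF[OF o(1,2)]] linear_mapD[OF linG[OF o(3,4)]] A.hom_zero_closed B.hom_zero_closed
        module.module_simprules(1,18)[OF A.hom_module[OF o(1,2)]] module.module_simprules(1,18)[OF B.hom_module[OF o(3,4)]]
         in \<open>auto simp: S_def e prod_dgcat_simps\<close>)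
  next
    case (7 x y i a) then show ?case
      by (cases x; cases y; cases a)
        (auto simp: S_def pullback_simps prod_dgcat_simps A.hom_diff_closed B.hom_diff_closed dg_functorD(5)[OF F] dg_functorD(5)[OF G])
  next
    case (8 x y z i j g f) then show ?case
      by (cases x; cases y; cases z; cases g; cases f)
        (auto simp: S_def pullback_simps prod_dgcat_simps A.Cmp_closed B.Cmp_closed dg_functorD(7)[OF F] dg_functorD(7)[OF G])
  next
    case (9 x) then show ?case
      by (cases x) (auto simp: S_def pullback_simps prod_dgcat_simps A.Idt_closed B.Idt_closed dg_functorD(6)[OF F] dg_functorD(6)[OF G])
  qed (auto simp: pullback_def prod_dgcat_def)
qed

lemma dgfun_pair_functor:
  assumes F: "dg_functor R A C F" and G: "dg_functor R B C G"
    and H: "dg_functor R W A H" and K: "dg_functor R W B K"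
    and eq: "dgfun_eq W (dgfun_comp F H) (dgfun_comp G K)"
  shows "dg_functor R W (pullback A B F G) (dgfun_pair H K)"
proof -
  have e: "fob F (fob H x) = fob G (fob K x)" if "x \<in> Obj W" for x
    using eq that by (auto simp: dgfun_eq_def dgfun_comp_def)
  have e': "fmor F (fob H x) (fob H y) i (fmor H x y i a) = fmor G (fob K x) (fob K y) i (fmor K x y i a)"
    if "x \<in> Obj W" "y \<in> Obj W" "a \<in> hom_set W x y i" for x y i a
    using eq that by (auto simp: dgfun_eq_def dgfun_comp_def)
  show ?thesis
    by (rule dg_functorI[OF dg_functorD(1)[OF H] pullback_dg_category[OF F G]])
      (auto simp: dgfun_pair_def pullback_simps e e' dg_functorD(3)[OF H] dg_functorD(3)[OF K] dg_functorD(5)[OF H] dg_functorD(5)[OF K]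
        dg_functorD(6)[OF H] dg_functorD(6)[OF K] dg_functorD(7)[OF H] dg_functorD(7)[OF K] dg_functor_hom[OF H] dg_functor_hom[OF K]
        linear_mapD(2,3)[OF dg_functorD(4)[OF H]] linear_mapD(2,3)[OF dg_functorD(4)[OF K]] intro!: linear_mapI)
qed

locale dg_ideal = dg_category R A for R (structure) and A :: "('o, 'b, 'a) dgcat" +
  fixes I :: "'o \<Rightarrow> 'o \<Rightarrow> int \<Rightarrow> 'a set"
  assumes I: "\<lbrakk>x \<in> Obj A; y \<in> Obj A\<rbrakk> \<Longrightarrow> submodule (I x y i) R (hom_mod A x y i)"
    and I_diff: "\<lbrakk>x \<in> Obj A; y \<in> Obj A; a \<in> I x y i\<rbrakk> \<Longrightarrow> hom_diff A x y i a \<in> I x y (i - 1)"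
    and I_left: "\<lbrakk>x \<in> Obj A; y \<in> Obj A; z \<in> Obj A; g \<in> hom_set A y z i; f \<in> I x y j\<rbrakk> \<Longrightarrow>
      Cmp A x y z i j g f \<in> I x z (i + j)"
    and I_right: "\<lbrakk>x \<in> Obj A; y \<in> Obj A; z \<in> Obj A; g \<in> I y z i; f \<in> hom_set A x y j\<rbrakk> \<Longrightarrow>
      Cmp A x y z i j g f \<in> I x z (i + j)"
begin

abbreviation icls where "icls x y i a \<equiv> I x y i +>\<^bsub>hom_mod A x y i\<^esub> a"

lemma quotient: "\<lbrakk>x \<in> Obj A; y \<in> Obj A\<rbrakk> \<Longrightarrow> quotient_module R (hom_mod A x y i) (I x y i)"
  by (intro quotient_module.intro quotient_module_axioms.intro hom_module I)

lemma icls_diff_cong: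
  assumes o: "x \<in> Obj A" "y \<in> Obj A" "a \<in> hom_set A x y i" and b: "b \<in> icls x y i a"
  shows "icls x y (i - 1) (hom_diff A x y i b) = icls x y (i - 1) (hom_diff A x y i a)"
proof -
  interpret Q: quotient_module R "hom_mod A x y i" "I x y i" by (rule quotient[OF o(1,2)])
  interpret Q1: quotient_module R "hom_mod A x y (i - 1)" "I x y (i - 1)" by (rule quotient[OF o(1,2)])
  have b': "b \<in> hom_set A x y i" "b \<ominus>\<^bsub>hom_mod A x y i\<^esub> a \<in> I x y i" using Q.cls_mem[OF b o(3)] Q.cls_iff[of b a] o(3) by auto
  have "hom_diff A x y i b \<ominus>\<^bsub>hom_mod A x y (i - 1)\<^esub> hom_diff A x y i a \<in> I x y (i - 1)"
    using I_diff[OF o(1,2) b'(2)] linear_map_diff[OF hom_diff_linear[OF o(1,2)] hom_module hom_module b'(1) o(3)] o by simp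
  then show ?thesis using Q1.cls_iff b' o by (simp add: hom_diff_closed)
qed

lemma icls_Cmp_cong:
  assumes o: "x \<in> Obj A" "y \<in> Obj A" "z \<in> Obj A" "g \<in> hom_set A y z i" "f \<in> hom_set A x y j"
    and g': "g' \<in> icls y z i g" and f': "f' \<in> icls x y j f"
  shows "icls x z (i + j) (Cmp A x y z i j g' f') = icls x z (i + j) (Cmp A x y z i j g f)"
proof -
  interpret Qg: quotient_module R "hom_mod A y z i" "I y z i" by (rule quotient[OF o(2,3)])
  interpret Qf: quotient_module R "hom_mod A x y j" "I x y j" by (rule quotient[OF o(1,2)])
  interpret Q: quotient_module R "hom_mod A x z (i + j)" "I x z (i + j)" by (rule quotient[OF o(1,3)])
  have g: "g' \<in> hom_set A y z i" "g' \<ominus>\<^bsub>hom_mod A y z i\<^esub> g \<in> I y z i" using Qg.cls_mem[OF g' o(4)] Qg.cls_iff[of g' g] o(4) by auto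
  have f: "f' \<in> hom_set A x y j" "f' \<ominus>\<^bsub>hom_mod A x y j\<^esub> f \<in> I x y j" using Qf.cls_mem[OF f' o(5)] Qf.cls_iff[of f' f] o(5) by auto
  have "Cmp A x y z i j g' f' \<ominus>\<^bsub>hom_mod A x z (i + j)\<^esub> Cmp A x y z i j g f' \<in> I x z (i + j)"
    using I_right[OF o(1-3) g(2) f(1)] linear_map_diff[OF Cmp_linear_left[OF o(1-3) f(1)] hom_module hom_module g(1) o(4)] o by simp
  moreover have "Cmp A x y z i j g f' \<ominus>\<^bsub>hom_mod A x z (i + j)\<^esub> Cmp A x y z i j g f \<in> I x z (i + j)"
    using I_left[OF o(1-4) f(2)] linear_map_diff[OF Cmp_linear_right[OF o(1-4)] hom_module hom_module f(1) o(5)] o by simp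
  ultimately show ?thesis
    using Q.cls_iff[of "Cmp A x y z i j g' f'" "Cmp A x y z i j g f'"] Q.cls_iff[of "Cmp A x y z i j g f'" "Cmp A x y z i j g f"]
      Cmp_closed[OF o] Cmp_closed[OF o(1-3) g(1) f(1)] Cmp_closed[OF o(1-4) f(1)] by simp
qed

text \<open>The hypotheses are the formulas by which \<open>small_postnikov\<close> is defined, each
  operation being a union over representatives. For an ideal these unions are single classes, and
  the constant family \<open>A\<close> with the coset maps covers the quotient.\<close>

lemma quotient_directed:
  assumes "Obj Q = Obj A" and "\<And>x y. Mor Q x y = quot_complex (Mor A x y) (I x y)"
    and "\<And>x y z i j G F. Cmp Q x y z i j G F = (\<Union>g\<in>G. \<Union>f\<in>F. icls x z (i + j) (Cmp A x y z i j g f))"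
    and "\<And>x. Idt Q x = icls x x 0 (Idt A x)"
  shows "dg_directed R (\<lambda>_. A) Q (\<lambda>_. icls)"
proof (unfold_locales, unfold assms(1,3,4), goal_cases)
  case (7 x y a l i)
  interpret Q: quotient_module R "hom_mod A x y i" "I x y i" by (rule quotient[OF 7(1,2)])
  show ?case using Q.cls_cong[OF 7(3) icls_diff_cong[OF 7]] by (simp add: assms quot_complex_def)
next
  case (8 x y z g l i f j)
  interpret Qg: quotient_module R "hom_mod A y z i" "I y z i" by (rule quotient[OF 8(2,3)])
  interpret Qf: quotient_module R "hom_mod A x y j" "I x y j" by (rule quotient[OF 8(1,2)])
  have "(\<Union>g\<in>Qg.cls g. \<Union>f\<in>Qf.cls f. icls x z (i + j) (Cmp A x y z i j g f)) = icls x z (i + j) (Cmp A x y z i j g f)"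
  proof (rule Qg.cls_cong[OF 8(4)])
    fix g' assume "g' \<in> Qg.cls g"
    then show "(\<Union>f\<in>Qf.cls f. icls x z (i + j) (Cmp A x y z i j g' f)) = icls x z (i + j) (Cmp A x y z i j g f)"
      by (intro Qf.cls_cong[OF 8(5)] icls_Cmp_cong[OF 8])
  qed
  then show ?case by simp
qed (simp_all add: assms quot_complex_def dg_category_axioms quotient_module.quot_simps[OF quotient])

end

section \<open>Positively graded dg categories and their Postnikov sections\<close>

locale positive_dg_category = dg_category R A for R (structure) and A :: "('o, 'b, 'a) dgcat" +
  assumes positive: "positively_graded A"
begin

lemma negative: "\<lbrakk>x \<in> Obj A; y \<in> Obj A; a \<in> hom_set A x y i; i < 0\<rbrakk> \<Longrightarrow> a = \<zero>\<^bsub>hom_mod A x y i\<^esub>"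
  using positive by (auto simp: positively_graded_def)

lemma degree_zero_cycle: "\<lbrakk>x \<in> Obj A; y \<in> Obj A; a \<in> hom_set A x y 0\<rbrakk> \<Longrightarrow> a \<in> cycles (Mor A x y) 0"
  using negative[OF _ _ hom_diff_closed] by (simp add: cycles_def)

abbreviation kernel where "kernel n x y \<equiv> trunc_kernel (int n) (Mor A x y)"

lemma kernel_submodule: "\<lbrakk>x \<in> Obj A; y \<in> Obj A\<rbrakk> \<Longrightarrow> submodule (kernel n x y i) R (hom_mod A x y i)"
  using module.carrier_is_submodule[OF hom_module] module.zero_submodule[OF hom_module]
    chain_complex.boundaries_submodule[OF complex] by (auto simp: trunc_kernel_def)

lemma kernel_subset: "\<lbrakk>x \<in> Obj A; y \<in> Obj A; a \<in> kernel n x y i\<rbrakk> \<Longrightarrow> a \<in> hom_set A x y i"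
  using module.submoduleD(1)[OF hom_module kernel_submodule] by blast

lemma zero_in_kernel: "\<lbrakk>x \<in> Obj A; y \<in> Obj A\<rbrakk> \<Longrightarrow> \<zero>\<^bsub>hom_mod A x y i\<^esub> \<in> kernel n x y i"
  by (rule module.submoduleD(2)[OF hom_module kernel_submodule])

text \<open>Nonnegativity of degrees makes the truncation kernel an ideal. Let an element of the
  kernel have degree \<open>j\<close> and the other factor degree \<open>i \<ge> 0\<close>. For
  \<open>j < n\<close> the kernel element is zero, and for \<open>i + j > n\<close> the kernel is
  everything. There remains \<open>i = 0\<close>, \<open>j = n\<close>, where the kernel consists of
  boundaries and the other factor is a cycle.\<close>

sublocale small: dg_ideal R A "kernel n" for n
proof (intro dg_ideal.intro dg_ideal_axioms.intro dg_category_axioms, goal_cases)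
  case (1 x y i) then show ?case by (rule kernel_submodule)
next
  case (2 x y a i)
  \<comment> \<open>The boundary case is at \<open>n\<close> and \<open>n + 1\<close>: boundaries of
    degree \<open>n\<close> are cycles, and an arbitrary element of degree \<open>n + 1\<close> has
    a boundary as its differential.\<close>
  consider "i < int n" | "i = int n" | "i = int n + 1" | "i > int n + 1" by linarith
  then show ?case
  proof cases
    case 1 then show ?thesis using 2 by (simp add: trunc_kernel_def hom_diff_zero)
  next
    case a: 2
    then have "a \<in> cycles (Mor A x y) i"
      using 2 chain_complex.boundaries_subset_cycles[OF complex[OF 2(1,2)], of i] by (auto simp: trunc_kernel_def)
    then show ?thesis using a by (simp add: trunc_kernel_def cycles_def)
  next
    case 3 then show ?thesis using 2 by (auto simp: trunc_kernel_def boundaries_def)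
  next
    case 4 then show ?thesis using 2 by (auto simp: trunc_kernel_def hom_diff_closed)
  qed
next
  case (3 x y z g i f j)
  note f = kernel_subset[OF 3(1,2,5)]
  note z = zero_in_kernel[OF 3(1,3), of "i + j" n]
  consider "i < 0" | "i \<ge> 0" "j < int n" | "i + j > int n" | "i = 0" "j = int n" by linarith
  then show ?case
  proof cases
    case 1 then show ?thesis using negative[OF 3(2-4)] Cmp_zero_left[OF 3(1-3) f] z by simp
  next
    case 2 then show ?thesis using 3(5) Cmp_zero_right[OF 3(1-4)] z by (simp add: trunc_kernel_def)
  next
    case c: 3 then show ?thesis using Cmp_closed[OF 3(1-4) f] by (simp add: trunc_kernel_def)
  next
    case 4 then show ?thesis using Cmp_boundary_right[OF 3(1-3) degree_zero_cycle] 3 4 by (simp add: trunc_kernel_def)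
  qed
next
  case (4 x y z g i f j)
  note g = kernel_subset[OF 4(2,3,4)]
  note z = zero_in_kernel[OF 4(1,3), of "i + j" n]
  consider "j < 0" | "j \<ge> 0" "i < int n" | "i + j > int n" | "j = 0" "i = int n" by linarith
  then show ?case
  proof cases
    case 1 then show ?thesis using negative[OF 4(1,2,5)] Cmp_zero_right[OF 4(1-3) g] z by simp
  next
    case 2 then show ?thesis using 4(4) Cmp_zero_left[OF 4(1-3,5)] z by (simp add: trunc_kernel_def)
  next
    case 3 then show ?thesis using Cmp_closed[OF 4(1-3) g 4(5)] by (simp add: trunc_kernel_def)
  next
    case c: 4 then show ?thesis using Cmp_boundary_left[OF 4(1-3) _ degree_zero_cycle] 4 c by (simp add: trunc_kernel_def)
  qed
qed

lemma small_directed: "dg_directed R (\<lambda>_. A) (small_postnikov n A) (\<lambda>_. small_class n A)"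
  unfolding small_class_def[abs_def]
  by (rule small.quotient_directed) (simp_all add: small_postnikov_def trunc_le_def small_class_def)

lemma small_dg_category: "dg_category R (small_postnikov n A)"
  by (rule dg_directed.dg_category[OF small_directed])

lemma small_proj_functor: "dg_functor R A (small_postnikov n A) (small_proj n A)"
  using dg_directed.cocone_functor[OF small_directed, of n]
  by (simp add: dg_directed.cocone_def[OF small_directed] small_proj_def)

lemma small_Obj [simp]: "Obj (small_postnikov n A) = Obj A"
  by (simp add: small_postnikov_def)

lemma small_hom: "\<lbrakk>x \<in> Obj A; y \<in> Obj A\<rbrakk> \<Longrightarrow> hom_set (small_postnikov n A) x y i = small_class n A x y i ` hom_set A x y i"
  using dg_directed.hom[OF small_directed] by simp

lemma small_zero_iff: "\<lbrakk>x \<in> Obj A; y \<in> Obj A; a \<in> hom_set A x y i\<rbrakk> \<Longrightarrow>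
    small_class n A x y i a = \<zero>\<^bsub>hom_mod (small_postnikov n A) x y i\<^esub> \<longleftrightarrow> a \<in> kernel n x y i"
  using quotient_module.cls_zero_iff[OF small.quotient] by (simp add: small_class_def small_postnikov_def trunc_le_def quot_complex_def)

lemma small_above: "\<lbrakk>x \<in> Obj A; y \<in> Obj A; i > int n; b \<in> hom_set (small_postnikov n A) x y i\<rbrakk> \<Longrightarrow>
    b = \<zero>\<^bsub>hom_mod (small_postnikov n A) x y i\<^esub>"
  using small_zero_iff[of x y _ i n] by (clarsimp simp: small_hom trunc_kernel_def)

end

section \<open>Quasi-equivalences\<close>

context dg_category
begin

lemma H0_simps:
  "CObj (H0_cat A) = Obj A"
  "\<lbrakk>x \<in> Obj A; y \<in> Obj A\<rbrakk> \<Longrightarrow> CHom (H0_cat A) x y = hclass (Mor A x y) 0 ` cycles (Mor A x y) 0"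
  "\<lbrakk>x \<in> Obj A; y \<in> Obj A; z \<in> Obj A; g \<in> cycles (Mor A y z) 0; f \<in> cycles (Mor A x y) 0\<rbrakk> \<Longrightarrow>
    CCmp (H0_cat A) x y z (hclass (Mor A y z) 0 g) (hclass (Mor A x y) 0 f) = hclass (Mor A x z) 0 (Cmp A x y z 0 0 g f)"
  "CIdt (H0_cat A) x = hclass (Mor A x x) 0 (Idt A x)"
  using UN_hclass_Cmp[of x y z g 0 f 0 0] by (simp_all add: H0_cat_def chain_complex.homology_simps(1)[OF complex])

lemma Idt_cycle: "x \<in> Obj A \<Longrightarrow> Idt A x \<in> cycles (Mor A x x) 0"
  by (simp add: cycles_def Idt_closed diff_Idt)

lemma H0_unit:
  assumes "x \<in> Obj A" "y \<in> Obj A" "f \<in> CHom (H0_cat A) x y"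
  shows "CCmp (H0_cat A) x y y (CIdt (H0_cat A) y) f = f" "CCmp (H0_cat A) x x y f (CIdt (H0_cat A) x) = f"
proof -
  obtain c where c: "c \<in> cycles (Mor A x y) 0" "f = hclass (Mor A x y) 0 c" using assms by (auto simp: H0_simps)
  then have "c \<in> hom_set A x y 0" by (simp add: cycles_def)
  then show "CCmp (H0_cat A) x y y (CIdt (H0_cat A) y) f = f" "CCmp (H0_cat A) x x y f (CIdt (H0_cat A) x) = f"
    using assms(1,2) c by (simp_all add: H0_simps Idt_cycle Cmp_Idt_left Cmp_Idt_right)
qed

lemma H0_Idt: "x \<in> Obj A \<Longrightarrow> CIdt (H0_cat A) x \<in> CHom (H0_cat A) x x"
  by (simp add: H0_simps Idt_cycle)

lemma H0_comp_closed:
  "\<lbrakk>x \<in> Obj A; y \<in> Obj A; z \<in> Obj A; g \<in> CHom (H0_cat A) y z; f \<in> CHom (H0_cat A) x y\<rbrakk> \<Longrightarrow>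
    CCmp (H0_cat A) x y z g f \<in> CHom (H0_cat A) x z"
  using Cmp_cycles[of x y z _ 0 _ 0] by (auto simp: H0_simps)

end

lemma H0_functor_hclass:
  assumes F: "dg_functor R A B F" and "x \<in> Obj A" "y \<in> Obj A" "z \<in> cycles (Mor A x y) 0"
  shows "snd (H0_functor B F) x y (hclass (Mor A x y) 0 z) = hclass (Mor B (fob F x) (fob F y)) 0 (fmor F x y 0 z)"
  using homology_map_hclass[OF dg_functor_chain_map[OF F assms(2,3)]] assms dg_functorD(1-3)[OF F]
  by (simp add: H0_functor_def dg_category.complex)

lemma H0_functor_cat_functor:
  assumes F: "dg_functor R A B F" shows "cat_functor (H0_cat A) (H0_cat B) (H0_functor B F)"
proof -
  interpret A: dg_category R A by (rule dg_functorD(1)[OF F])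
  interpret B: dg_category R B by (rule dg_functorD(2)[OF F])
  have f: "fst (H0_functor B F) = fob F" by (simp add: H0_functor_def)
  note o = dg_functorD(3)[OF F]
  have "snd (H0_functor B F) x z (CCmp (H0_cat A) x y z g h) =
      CCmp (H0_cat B) (fob F x) (fob F y) (fob F z) (snd (H0_functor B F) y z g) (snd (H0_functor B F) x y h)"
    if a: "x \<in> Obj A" "y \<in> Obj A" "z \<in> Obj A" "g \<in> CHom (H0_cat A) y z" "h \<in> CHom (H0_cat A) x y" for x y z g h
  proof -
    obtain c e where *: "c \<in> cycles (Mor A y z) 0" "g = hclass (Mor A y z) 0 c" "e \<in> cycles (Mor A x y) 0" "h = hclass (Mor A x y) 0 e"
      using a by (auto simp: A.H0_simps)
    have "c \<in> hom_set A y z 0" "e \<in> hom_set A x y 0" using * by (auto simp: cycles_def)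
    then show ?thesis using a * dg_functorD(7)[OF F, of x y z c 0 e 0] A.Cmp_cycles[of x y z c 0 e 0]
      by (simp add: A.H0_simps B.H0_simps H0_functor_hclass[OF F] dg_functor_cycles[OF F] o)
  qed
  then show ?thesis unfolding cat_functor_def f
    by (auto simp: A.H0_simps(1,2,4) B.H0_simps(1,2,4) o H0_functor_hclass[OF F] dg_functor_cycles[OF F] A.Idt_cycle
        dg_functorD(6)[OF F])
qed

lemma cat_iso_functor:
  assumes F: "cat_functor C D F" and "x \<in> CObj C" "y \<in> CObj C" "cat_iso C x y f"
  shows "cat_iso D (fst F x) (fst F y) (snd F x y f)"
proof -
  obtain g where g: "f \<in> CHom C x y" "g \<in> CHom C y x" "CCmp C x y x g f = CIdt C x" "CCmp C y x y f g = CIdt C y"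
    using assms(4) by (auto simp: cat_iso_def)
  have "snd F y x g \<in> CHom D (fst F y) (fst F x)" "snd F x y f \<in> CHom D (fst F x) (fst F y)"
    using F assms g unfolding cat_functor_def by blast+
  moreover have "CCmp D (fst F x) (fst F y) (fst F x) (snd F y x g) (snd F x y f) = CIdt D (fst F x)"
    using F assms g unfolding cat_functor_def by metis
  moreover have "CCmp D (fst F y) (fst F x) (fst F y) (snd F x y f) (snd F y x g) = CIdt D (fst F y)"
    using F assms g unfolding cat_functor_def by metis
  ultimately show ?thesis by (auto simp: cat_iso_def)
qed

lemma dg_functor_H0_invertible:
  assumes F: "dg_functor R A B F" and o: "x \<in> Obj A" "y \<in> Obj A" and u: "H0_invertible A x y u"
  shows "H0_invertible B (fob F x) (fob F y) (fmor F x y 0 u)"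
proof -
  have z: "u \<in> cycles (Mor A x y) 0" and i: "cat_iso (H0_cat A) x y (hclass (Mor A x y) 0 u)"
    using u by (auto simp: H0_invertible_def)
  have "cat_iso (H0_cat B) (fob F x) (fob F y) (snd (H0_functor B F) x y (hclass (Mor A x y) 0 u))"
    using cat_iso_functor[OF H0_functor_cat_functor[OF F] _ _ i] o dg_category.H0_simps(1)[OF dg_functorD(1)[OF F]]
    by (simp add: H0_functor_def)
  then show ?thesis using dg_functor_cycles[OF F o z] H0_functor_hclass[OF F o z] by (simp add: H0_invertible_def)
qed

text \<open>Inverting the bijections on objects and on morphisms gives a strict inverse functor, so
  that both natural isomorphisms are identities.\<close>

lemma cat_equivalence_bij:
  assumes F: "cat_functor C D F" and ob: "bij_betw (fst F) (CObj C) (CObj D)"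
    and mor: "\<And>x y. \<lbrakk>x \<in> CObj C; y \<in> CObj C\<rbrakk> \<Longrightarrow> bij_betw (snd F x y) (CHom C x y) (CHom D (fst F x) (fst F y))"
    and CI: "\<And>x. x \<in> CObj C \<Longrightarrow> CIdt C x \<in> CHom C x x"
    and CC: "\<And>x y z g f. \<lbrakk>x \<in> CObj C; y \<in> CObj C; z \<in> CObj C; g \<in> CHom C y z; f \<in> CHom C x y\<rbrakk> \<Longrightarrow> CCmp C x y z g f \<in> CHom C x z"
    and Cu: "\<And>x y f. \<lbrakk>x \<in> CObj C; y \<in> CObj C; f \<in> CHom C x y\<rbrakk> \<Longrightarrow> CCmp C x y y (CIdt C y) f = f \<and> CCmp C x x y f (CIdt C x) = f"
    and DI: "\<And>x. x \<in> CObj D \<Longrightarrow> CIdt D x \<in> CHom D x x"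
    and Du: "\<And>x y f. \<lbrakk>x \<in> CObj D; y \<in> CObj D; f \<in> CHom D x y\<rbrakk> \<Longrightarrow> CCmp D x y y (CIdt D y) f = f \<and> CCmp D x x y f (CIdt D x) = f"
  shows "cat_equivalence C D F"
proof -
  define g where "g = inv_into (CObj C) (fst F)"
  define G where "G u v = inv_into (CHom C (g u) (g v)) (snd F (g u) (g v))" for u v
  have g: "g u \<in> CObj C" "fst F (g u) = u" if "u \<in> CObj D" for u
    using ob that unfolding g_def bij_betw_def by (auto intro: inv_into_into f_inv_into_f)
  have gF: "g (fst F x) = x" if "x \<in> CObj C" for x
    using ob that unfolding g_def bij_betw_def by (simp add: inv_into_f_f)
  have G: "G u v h \<in> CHom C (g u) (g v)" "snd F (g u) (g v) (G u v h) = h"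
    if "u \<in> CObj D" "v \<in> CObj D" "h \<in> CHom D u v" for u v h
    using mor[of "g u" "g v"] g that unfolding G_def bij_betw_def by (auto intro: inv_into_into f_inv_into_f)
  have GF: "G u v (snd F (g u) (g v) f) = f" if "u \<in> CObj D" "v \<in> CObj D" "f \<in> CHom C (g u) (g v)" for u v f
    using mor[of "g u" "g v"] g that unfolding G_def bij_betw_def by (simp add: inv_into_f_f)
  have Fo: "fst F x \<in> CObj D" if "x \<in> CObj C" for x using F that by (auto simp: cat_functor_def)
  have FI: "snd F x x (CIdt C x) = CIdt D (fst F x)" if "x \<in> CObj C" for x using F that by (auto simp: cat_functor_def)
  have FC: "snd F x z (CCmp C x y z k h) = CCmp D (fst F x) (fst F y) (fst F z) (snd F y z k) (snd F x y h)"
    if "x \<in> CObj C" "y \<in> CObj C" "z \<in> CObj C" "k \<in> CHom C y z" "h \<in> CHom C x y" for x y z k h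
    using F that unfolding cat_functor_def by blast
  have FM: "snd F x y f \<in> CHom D (fst F x) (fst F y)" if "x \<in> CObj C" "y \<in> CObj C" "f \<in> CHom C x y" for x y f
    using F that unfolding cat_functor_def by blast
  have "cat_functor D C (g, G)"
    unfolding cat_functor_def fst_conv snd_conv
  proof (intro conjI ballI funcsetI)
    fix x assume x: "x \<in> CObj D"
    show "g x \<in> CObj C" by (rule g[OF x])
    show "G x x (CIdt D x) = CIdt C (g x)" using GF[OF x x CI] FI[of "g x"] g[OF x] by simp
  next
    fix x y f assume "x \<in> CObj D" "y \<in> CObj D" "f \<in> CHom D x y"
    then show "G x y f \<in> CHom C (g x) (g y)" by (rule G)
  next
    fix x y z k h assume a: "x \<in> CObj D" "y \<in> CObj D" "z \<in> CObj D" "k \<in> CHom D y z" "h \<in> CHom D x y"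
    show "G x z (CCmp D x y z k h) = CCmp C (g x) (g y) (g z) (G y z k) (G x y h)"
      using GF[OF a(1,3), of "CCmp C (g x) (g y) (g z) (G y z k) (G x y h)"] a
      by (simp add: FC g G CC)
  qed
  moreover have "natural_iso C C cfun_id (cfun_comp (g, G) F) (CIdt C)"
  proof -
    have "G (fst F x) (fst F y) (snd F x y f) = f" if "x \<in> CObj C" "y \<in> CObj C" "f \<in> CHom C x y" for x y f
      using GF[OF Fo[OF that(1)] Fo[OF that(2)]] that by (simp add: gF)
    then show ?thesis by (auto simp: natural_iso_def cfun_id_def cfun_comp_def cat_iso_def gF CI Cu intro!: bexI[of _ "CIdt C _"])
  qed
  moreover have "natural_iso D D (cfun_comp F (g, G)) cfun_id (CIdt D)"
    by (auto simp: natural_iso_def cfun_id_def cfun_comp_def cat_iso_def g G DI Du intro!: bexI[of _ "CIdt D _"])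
  ultimately show ?thesis using F unfolding cat_equivalence_def by blast
qed

text \<open>A bijection on objects settles essential surjectivity, and full faithfulness on
  \<open>H_0\<close> is the degree \<open>0\<close> part of the quasi-isomorphisms.\<close>

lemma quasi_equivalenceI:
  assumes F: "dg_functor R A B F" and ob: "bij_betw (fob F) (Obj A) (Obj B)"
    and q: "\<And>x y. \<lbrakk>x \<in> Obj A; y \<in> Obj A\<rbrakk> \<Longrightarrow>
      quasi_isomorphism R (Mor A x y) (Mor B (fob F x) (fob F y)) (fmor F x y)"
  shows "quasi_equivalence R A B F"
proof -
  interpret A: dg_category R A by (rule dg_functorD(1)[OF F])
  interpret B: dg_category R B by (rule dg_functorD(2)[OF F])
  have "cat_equivalence (H0_cat A) (H0_cat B) (H0_functor B F)"
  proof (rule cat_equivalence_bij[OF H0_functor_cat_functor[OF F]])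
    show "bij_betw (fst (H0_functor B F)) (CObj (H0_cat A)) (CObj (H0_cat B))"
      using ob by (simp add: H0_functor_def A.H0_simps B.H0_simps)
    show "bij_betw (snd (H0_functor B F) x y) (CHom (H0_cat A) x y) (CHom (H0_cat B) (fst (H0_functor B F) x) (fst (H0_functor B F) y))"
      if "x \<in> CObj (H0_cat A)" "y \<in> CObj (H0_cat A)" for x y
      using q[of x y] that by (simp add: H0_functor_def H0_cat_def quasi_isomorphism_def)
  qed (auto simp: A.H0_simps(1) B.H0_simps(1) A.H0_Idt B.H0_Idt A.H0_unit B.H0_unit A.H0_comp_closed)
  then show ?thesis using F q by (simp add: quasi_equivalence_def)
qed

section \<open>Square zero extensions\<close>

text \<open>The axioms are a matching set for associativity, units and the Leibniz rule of the
  square zero extension. In \<open>Ract_diff\<close> the sign is that of the degree of the bimodule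
  element, as for a composite; the actions thus enter the composition of the extension without
  further signs.\<close>

locale dg_bimodule = dg_category R B for R (structure) and B :: "('o, 'b, 'a) dgcat" +
  fixes N :: "('o, 'b, 'a, 'm) bimod"
  assumes N_complex: "\<lbrakk>x \<in> Obj B; y \<in> Obj B\<rbrakk> \<Longrightarrow> chain_complex R (Bcpx N x y)"
    and Lact_linear_left: "\<lbrakk>x \<in> Obj B; y \<in> Obj B; z \<in> Obj B; v \<in> carrier (cmod (Bcpx N x y) j)\<rbrakk> \<Longrightarrow>
      linear_map R (hom_mod B y z i) (cmod (Bcpx N x z) (i + j)) (\<lambda>g. Lact N x y z i j g v)"
    and Lact_linear_right: "\<lbrakk>x \<in> Obj B; y \<in> Obj B; z \<in> Obj B; g \<in> hom_set B y z i\<rbrakk> \<Longrightarrow>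
      linear_map R (cmod (Bcpx N x y) j) (cmod (Bcpx N x z) (i + j)) (Lact N x y z i j g)"
    and Ract_linear_left: "\<lbrakk>x \<in> Obj B; y \<in> Obj B; z \<in> Obj B; f \<in> hom_set B x y j\<rbrakk> \<Longrightarrow>
      linear_map R (cmod (Bcpx N y z) i) (cmod (Bcpx N x z) (i + j)) (\<lambda>v. Ract N x y z i j v f)"
    and Ract_linear_right: "\<lbrakk>x \<in> Obj B; y \<in> Obj B; z \<in> Obj B; v \<in> carrier (cmod (Bcpx N y z) i)\<rbrakk> \<Longrightarrow>
      linear_map R (hom_mod B x y j) (cmod (Bcpx N x z) (i + j)) (Ract N x y z i j v)"
    and Lact_diff: "\<lbrakk>x \<in> Obj B; y \<in> Obj B; z \<in> Obj B; g \<in> hom_set B y z i; v \<in> carrier (cmod (Bcpx N x y) j)\<rbrakk> \<Longrightarrow>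
      cdiff (Bcpx N x z) (i + j) (Lact N x y z i j g v) =
        Lact N x y z (i - 1) j (hom_diff B y z i g) v \<oplus>\<^bsub>cmod (Bcpx N x z) (i + j - 1)\<^esub>
        sign R i \<odot>\<^bsub>cmod (Bcpx N x z) (i + j - 1)\<^esub> Lact N x y z i (j - 1) g (cdiff (Bcpx N x y) j v)"
    and Ract_diff: "\<lbrakk>x \<in> Obj B; y \<in> Obj B; z \<in> Obj B; v \<in> carrier (cmod (Bcpx N y z) i); f \<in> hom_set B x y j\<rbrakk> \<Longrightarrow>
      cdiff (Bcpx N x z) (i + j) (Ract N x y z i j v f) =
        Ract N x y z (i - 1) j (cdiff (Bcpx N y z) i v) f \<oplus>\<^bsub>cmod (Bcpx N x z) (i + j - 1)\<^esub>
        sign R i \<odot>\<^bsub>cmod (Bcpx N x z) (i + j - 1)\<^esub> Ract N x y z i (j - 1) v (hom_diff B x y j f)"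
    and Lact_Lact: "\<lbrakk>w \<in> Obj B; x \<in> Obj B; y \<in> Obj B; z \<in> Obj B;
        h \<in> hom_set B y z i; g \<in> hom_set B x y j; v \<in> carrier (cmod (Bcpx N w x) k)\<rbrakk> \<Longrightarrow>
      Lact N w x z (i + j) k (Cmp B x y z i j h g) v = Lact N w y z i (j + k) h (Lact N w x y j k g v)"
    and Ract_Lact: "\<lbrakk>w \<in> Obj B; x \<in> Obj B; y \<in> Obj B; z \<in> Obj B;
        h \<in> hom_set B y z i; v \<in> carrier (cmod (Bcpx N x y) j); f \<in> hom_set B w x k\<rbrakk> \<Longrightarrow>
      Ract N w x z (i + j) k (Lact N x y z i j h v) f = Lact N w y z i (j + k) h (Ract N w x y j k v f)"
    and Ract_Ract: "\<lbrakk>w \<in> Obj B; x \<in> Obj B; y \<in> Obj B; z \<in> Obj B;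
        v \<in> carrier (cmod (Bcpx N y z) i); g \<in> hom_set B x y j; f \<in> hom_set B w x k\<rbrakk> \<Longrightarrow>
      Ract N w x z (i + j) k (Ract N x y z i j v g) f = Ract N w y z i (j + k) v (Cmp B w x y j k g f)"
    and Lact_Idt: "\<lbrakk>x \<in> Obj B; y \<in> Obj B; v \<in> carrier (cmod (Bcpx N x y) i)\<rbrakk> \<Longrightarrow> Lact N x y y 0 i (Idt B y) v = v"
    and Ract_Idt: "\<lbrakk>x \<in> Obj B; y \<in> Obj B; v \<in> carrier (cmod (Bcpx N x y) i)\<rbrakk> \<Longrightarrow> Ract N x x y i 0 v (Idt B x) = v"
begin

abbreviation NM where "NM x y i \<equiv> cmod (Bcpx N x y) i"

lemma N_module: "\<lbrakk>x \<in> Obj B; y \<in> Obj B\<rbrakk> \<Longrightarrow> module R (NM x y i)"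
  by (rule chain_complex.module[OF N_complex])

lemma Lact_closed: "\<lbrakk>x \<in> Obj B; y \<in> Obj B; z \<in> Obj B; g \<in> hom_set B y z i; v \<in> carrier (NM x y j); k = i + j\<rbrakk> \<Longrightarrow>
    Lact N x y z i j g v \<in> carrier (NM x z k)"
  using linear_mapD(1)[OF Lact_linear_right] by simp

lemma Ract_closed: "\<lbrakk>x \<in> Obj B; y \<in> Obj B; z \<in> Obj B; v \<in> carrier (NM y z i); f \<in> hom_set B x y j; k = i + j\<rbrakk> \<Longrightarrow>
    Ract N x y z i j v f \<in> carrier (NM x z k)"
  using linear_mapD(1)[OF Ract_linear_right] by simp

lemma Lact_zero: "\<lbrakk>x \<in> Obj B; y \<in> Obj B; z \<in> Obj B; g \<in> hom_set B y z i\<rbrakk> \<Longrightarrow>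
    Lact N x y z i j g \<zero>\<^bsub>NM x y j\<^esub> = \<zero>\<^bsub>NM x z (i + j)\<^esub>"
  by (rule linear_map_zero[OF Lact_linear_right N_module N_module])

lemma Ract_zero: "\<lbrakk>x \<in> Obj B; y \<in> Obj B; z \<in> Obj B; f \<in> hom_set B x y j\<rbrakk> \<Longrightarrow>
    Ract N x y z i j \<zero>\<^bsub>NM y z i\<^esub> f = \<zero>\<^bsub>NM x z (i + j)\<^esub>"
  by (rule linear_map_zero[OF Ract_linear_left N_module N_module])

lemma square_zero_simps:
  "Obj (square_zero B N) = Obj B"
  "hom_mod (square_zero B N) x y i = prod_module (hom_mod B x y i) (NM x y i)"
  "hom_diff (square_zero B N) x y i (a, v) = (hom_diff B x y i a, cdiff (Bcpx N x y) i v)"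
  "Cmp (square_zero B N) x y z i j (g, v) (f, u) =
    (Cmp B x y z i j g f, Lact N x y z i j g u \<oplus>\<^bsub>NM x z (i + j)\<^esub> Ract N x y z i j v f)"
  "Idt (square_zero B N) x = (Idt B x, \<zero>\<^bsub>NM x x 0\<^esub>)"
  by (simp_all add: square_zero_def prod_complex_def)

lemma square_zero_dg_category: "dg_category R (square_zero B N)"
proof (rule dg_categoryI[OF is_cring], unfold square_zero_simps(1), goal_cases)
  case (1 x y)
  interpret C: chain_complex R "Bcpx N x y" by (rule N_complex[OF 1])
  show ?case
    by (intro chain_complexI linear_mapI)
      (auto simp: square_zero_simps 1 hom_module C.module hom_diff_closed C.diff_closed
        hom_diff_add hom_diff_smult linear_mapD[OF C.diff_linear] hom_diff_diff C.diff_diff intro!: prod_module)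
next
  case (2 x)
  then show ?case using module.module_simprules(2)[OF N_module[OF 2 2]] by (simp add: square_zero_simps Idt_closed)
next
  case (3 x y z i j f)
  interpret H: module R "NM x z (i + j)" by (rule N_module[OF 3(1,3)])
  obtain f1 f2 where f: "f = (f1, f2)" "f1 \<in> hom_set B x y j" "f2 \<in> carrier (NM x y j)" using 3(4) by (auto simp: square_zero_simps)
  note c = Lact_closed[OF 3(1-3) _ f(3) HOL.refl] Ract_closed[OF 3(1-3) _ f(2) HOL.refl]
  show ?case
    by (intro linear_mapI)
      (auto simp: square_zero_simps f 3 Cmp_closed Cmp_add_left Cmp_smult_left c linear_mapD[OF Lact_linear_left[OF 3(1-3) f(3)]]
        linear_mapD[OF Ract_linear_left[OF 3(1-3) f(2)]] H.a_ac H.smult_r_distr)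
next
  case (4 x y z i j g)
  interpret H: module R "NM x z (i + j)" by (rule N_module[OF 4(1,3)])
  obtain f1 f2 where f: "g = (f1, f2)" "f1 \<in> hom_set B y z i" "f2 \<in> carrier (NM y z i)" using 4(4) by (auto simp: square_zero_simps)
  note c = Lact_closed[OF 4(1-3) f(2) _ HOL.refl] Ract_closed[OF 4(1-3) f(3) _ HOL.refl]
  show ?case
    by (intro linear_mapI)
      (auto simp: square_zero_simps f 4 Cmp_closed Cmp_add_right Cmp_smult_right c linear_mapD[OF Lact_linear_right[OF 4(1-3) f(2)]]
        linear_mapD[OF Ract_linear_right[OF 4(1-3) f(3)]] H.a_ac H.smult_r_distr)
next
  case (5 x y z i j g f)
  interpret H: module R "NM x z (i + j)" by (rule N_module[OF 5(1,3)])
  interpret H1: module R "NM x z (i + j - 1)" by (rule N_module[OF 5(1,3)])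
  obtain f1 f2 where f: "f = (f1, f2)" "f1 \<in> hom_set B x y j" "f2 \<in> carrier (NM x y j)" using 5 by (auto simp: square_zero_simps)
  obtain g1 g2 where g: "g = (g1, g2)" "g1 \<in> hom_set B y z i" "g2 \<in> carrier (NM y z i)" using 5 by (auto simp: square_zero_simps)
  note df = hom_diff_closed[OF 5(1,2) f(2)] chain_complex.diff_closed[OF N_complex[OF 5(1,2)] f(3)]
  note dg = hom_diff_closed[OF 5(2,3) g(2)] chain_complex.diff_closed[OF N_complex[OF 5(2,3)] g(3)]
  have e: "i - 1 + j = i + j - 1" "i + (j - 1) = i + j - 1" by auto
  have c: "Lact N x y z i j g1 f2 \<in> carrier (NM x z (i + j))" "Ract N x y z i j g2 f1 \<in> carrier (NM x z (i + j))"
    "Lact N x y z (i - 1) j (hom_diff B y z i g1) f2 \<in> carrier (NM x z (i + j - 1))"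
    "Lact N x y z i (j - 1) g1 (cdiff (Bcpx N x y) j f2) \<in> carrier (NM x z (i + j - 1))"
    "Ract N x y z (i - 1) j (cdiff (Bcpx N y z) i g2) f1 \<in> carrier (NM x z (i + j - 1))"
    "Ract N x y z i (j - 1) g2 (hom_diff B x y j f1) \<in> carrier (NM x z (i + j - 1))"
    using 5(1-3) f g df dg by (auto intro!: Lact_closed Ract_closed)
  show ?case using 5(1-3) f g c sign_closed[OF is_cring, of i]
      linear_mapD(2)[OF chain_complex.diff_linear[OF N_complex[OF 5(1,3)]] c(1,2)]
    by (simp add: square_zero_simps Cmp_diff_sign Lact_diff Ract_diff e H1.smult_r_distr H1.a_ac)
next
  case (6 w x y z i j k h g f)
  interpret H: module R "NM w z (i + j + k)" by (rule N_module[OF 6(1,4)])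
  obtain f1 f2 where f: "f = (f1, f2)" "f1 \<in> hom_set B w x k" "f2 \<in> carrier (NM w x k)" using 6 by (auto simp: square_zero_simps)
  obtain g1 g2 where g: "g = (g1, g2)" "g1 \<in> hom_set B x y j" "g2 \<in> carrier (NM x y j)" using 6 by (auto simp: square_zero_simps)
  obtain h1 h2 where h: "h = (h1, h2)" "h1 \<in> hom_set B y z i" "h2 \<in> carrier (NM y z i)" using 6 by (auto simp: square_zero_simps)
  note o = 6(1-4)
  have a: "i + (j + k) = i + j + k" by simp
  have c: "Lact N w y z i (j + k) h1 (Lact N w x y j k g1 f2) \<in> carrier (NM w z (i + j + k))"
    "Lact N w y z i (j + k) h1 (Ract N w x y j k g2 f1) \<in> carrier (NM w z (i + j + k))"
    "Ract N w y z i (j + k) h2 (Cmp B w x y j k g1 f1) \<in> carrier (NM w z (i + j + k))"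
    using o f g h by (auto intro!: Lact_closed Ract_closed Cmp_closed)
  have 1: "Ract N w x z (i + j) k (Lact N x y z i j h1 g2 \<oplus>\<^bsub>NM x z (i + j)\<^esub> Ract N x y z i j h2 g1) f1 =
      Lact N w y z i (j + k) h1 (Ract N w x y j k g2 f1) \<oplus>\<^bsub>NM w z (i + j + k)\<^esub> Ract N w y z i (j + k) h2 (Cmp B w x y j k g1 f1)"
    using linear_mapD(2)[OF Ract_linear_left[OF o(1,2,4) f(2)] Lact_closed[OF o(2-4) h(2) g(3) HOL.refl] Ract_closed[OF o(2-4) h(3) g(2) HOL.refl]]
      Ract_Lact[OF o h(2) g(3) f(2)] Ract_Ract[OF o h(3) g(2) f(2)] by simp
  have 2: "Lact N w y z i (j + k) h1 (Lact N w x y j k g1 f2 \<oplus>\<^bsub>NM w y (j + k)\<^esub> Ract N w x y j k g2 f1) =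
      Lact N w y z i (j + k) h1 (Lact N w x y j k g1 f2) \<oplus>\<^bsub>NM w z (i + j + k)\<^esub> Lact N w y z i (j + k) h1 (Ract N w x y j k g2 f1)"
    using linear_mapD(2)[OF Lact_linear_right[OF o(1,3,4) h(2)] Lact_closed[OF o(1-3) g(2) f(3) HOL.refl] Ract_closed[OF o(1-3) g(3) f(2) HOL.refl]]
    by (simp add: a)
  show ?case using o c Lact_Lact[OF o h(2) g(2) f(3)] Cmp_assoc[OF o h(2) g(2) f(2)]
    by (simp add: f(1) g(1) h(1) square_zero_simps 1 2 a H.a_ac)
next
  case (7 x y i f)
  interpret H: module R "NM x y i" by (rule N_module[OF 7(1,2)])
  obtain f1 f2 where f: "f = (f1, f2)" "f1 \<in> hom_set B x y i" "f2 \<in> carrier (NM x y i)" using 7 by (auto simp: square_zero_simps)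
  show ?case using Ract_zero[OF 7(1,2,2) f(2), of 0] 7 f by (simp add: square_zero_simps Cmp_Idt_left Lact_Idt)
next
  case (8 x y i f)
  interpret H: module R "NM x y i" by (rule N_module[OF 8(1,2)])
  obtain f1 f2 where f: "f = (f1, f2)" "f1 \<in> hom_set B x y i" "f2 \<in> carrier (NM x y i)" using 8 by (auto simp: square_zero_simps)
  show ?case using Lact_zero[OF 8(1,1,2) f(2), of 0] 8 f by (simp add: square_zero_simps Cmp_Idt_right Ract_Idt)
qed

lemma square_zero_incl_functor: "dg_functor R B (square_zero B N) (square_zero_incl N)"
proof (rule dg_functorI[OF dg_category_axioms square_zero_dg_category], unfold square_zero_simps(1), goal_cases)
  case (2 x y i)
  interpret H: module R "NM x y i" by (rule N_module[OF 2])
  show ?case by (rule linear_mapI) (auto simp: square_zero_simps square_zero_incl_def)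
next
  case (3 x y i a)
  then show ?case by (simp add: square_zero_simps square_zero_incl_def chain_complex.diff_zero[OF N_complex])
next
  case (5 x y z i j g f)
  interpret H: module R "NM x z (i + j)" by (rule N_module[OF 5(1,3)])
  show ?case using 5 by (simp add: square_zero_simps square_zero_incl_def Lact_zero Ract_zero)
qed (auto simp: square_zero_simps square_zero_incl_def)

lemma square_zero_proj_functor: "dg_functor R (square_zero B N) B square_zero_proj"
  by (rule dg_functorI[OF square_zero_dg_category dg_category_axioms])
    (auto simp: square_zero_simps square_zero_proj_def intro!: linear_mapI)

end

section \<open>The mapping path category\<close>

lemma sign_plus_one: "cring R \<Longrightarrow> sign R (i + 1) = \<ominus>\<^bsub>R\<^esub> sign R i"
  unfolding sign_def by (auto simp: cring.cring_simprules ring.ring_simprules cring.axioms)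

lemma sign_sign:
  assumes "cring R" shows "sign R i \<otimes>\<^bsub>R\<^esub> sign R i = \<one>\<^bsub>R\<^esub>" "sign R (i + j) = sign R i \<otimes>\<^bsub>R\<^esub> sign R j"
proof -
  interpret cring R by fact
  show "sign R i \<otimes>\<^bsub>R\<^esub> sign R i = \<one>\<^bsub>R\<^esub>" "sign R (i + j) = sign R i \<otimes>\<^bsub>R\<^esub> sign R j"
    by (auto simp: sign_def l_minus r_minus)
qed

lemma (in module) sign_smult: "a \<in> carrier M \<Longrightarrow> sign R i \<odot>\<^bsub>M\<^esub> (sign R i \<odot>\<^bsub>M\<^esub> a) = a"
  by (simp add: smult_assoc1[symmetric] sign_closed[OF is_cring] sign_sign[OF is_cring])

text \<open>In the Leibniz rule of the path category one product occurs with both signs and has to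
  disappear. Treating its negative as an atom \<open>n\<close> lets associativity and commutativity
  bring the two occurrences together.\<close>

lemma (in module) minus_cancel_middle:
  assumes "a \<in> carrier M" "b \<in> carrier M" "c \<in> carrier M" "w \<in> carrier M" "x \<in> carrier M" "y \<in> carrier M"
  shows "(a \<ominus>\<^bsub>M\<^esub> (w \<oplus>\<^bsub>M\<^esub> b) \<oplus>\<^bsub>M\<^esub> x) \<oplus>\<^bsub>M\<^esub> (y \<oplus>\<^bsub>M\<^esub> (w \<ominus>\<^bsub>M\<^esub> c)) = (a \<ominus>\<^bsub>M\<^esub> b \<oplus>\<^bsub>M\<^esub> x) \<oplus>\<^bsub>M\<^esub> (y \<ominus>\<^bsub>M\<^esub> c)"
proof -
  define n where "n = \<ominus>\<^bsub>M\<^esub> w"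
  have n: "n \<in> carrier M" "w \<oplus>\<^bsub>M\<^esub> n = \<zero>\<^bsub>M\<^esub>" using assms(4) by (auto simp: n_def M.r_neg)
  have "a \<ominus>\<^bsub>M\<^esub> (w \<oplus>\<^bsub>M\<^esub> b) = a \<oplus>\<^bsub>M\<^esub> (n \<ominus>\<^bsub>M\<^esub> b)" using assms by (simp add: n_def a_minus_def M.minus_add)
  then have "(a \<ominus>\<^bsub>M\<^esub> (w \<oplus>\<^bsub>M\<^esub> b) \<oplus>\<^bsub>M\<^esub> x) \<oplus>\<^bsub>M\<^esub> (y \<oplus>\<^bsub>M\<^esub> (w \<ominus>\<^bsub>M\<^esub> c)) =
      (w \<oplus>\<^bsub>M\<^esub> n) \<oplus>\<^bsub>M\<^esub> ((a \<ominus>\<^bsub>M\<^esub> b \<oplus>\<^bsub>M\<^esub> x) \<oplus>\<^bsub>M\<^esub> (y \<ominus>\<^bsub>M\<^esub> c))"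
    using assms n(1) by (simp add: a_minus_def M.a_ac)
  then show ?thesis using assms unfolding n(2) by simp
qed

text \<open>The full subcategory of the path object of \<open>S\<close> on the objects \<open>(x, x, id)\<close>. A morphism is a
  triple \<open>(a, c, h)\<close> in which \<open>h\<close> has degree one higher; for a cycle, \<open>h\<close> is a homotopy between
  \<open>c\<close> and \<open>S a\<close>. Since \<open>S\<close> is the identity on objects and induces an isomorphism on
  \<open>H\<^sub>0\<close> in the application, no further objects are needed.\<close>

definition path_dgcat :: "('r, 'x) ring_scheme \<Rightarrow> ('o, 'r, 'd) dgcat \<Rightarrow> ('o, 'r, 'c) dgcat \<Rightarrow>
    ('o, 'd, 'o, 'c) dgfun \<Rightarrow> ('o \<times> 'o \<times> 'c, 'r, 'd \<times> 'c \<times> 'c) dgcat" where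
  "path_dgcat R D C S = \<lparr>Obj = (\<lambda>x. (x, x, Idt C x)) ` Obj D,
     Mor = (\<lambda>p q. let x = fst p; y = fst q in
       \<lparr>cmod = (\<lambda>i. prod_module (hom_mod D x y i) (prod_module (hom_mod C x y i) (hom_mod C x y (i + 1)))),
        cdiff = (\<lambda>i (a, c, h). (hom_diff D x y i a, hom_diff C x y i c,
          fmor S x y i a \<ominus>\<^bsub>hom_mod C x y i\<^esub> (c \<oplus>\<^bsub>hom_mod C x y i\<^esub> hom_diff C x y (i + 1) h)))\<rparr>),
     Cmp = (\<lambda>p q r i j (a, c, h) (a', c', h'). let x = fst p; y = fst q; z = fst r in
       (Cmp D x y z i j a a', Cmp C x y z i j c c',
        Cmp C x y z (i + 1) j h (fmor S x y j a') \<oplus>\<^bsub>hom_mod C x z (i + j + 1)\<^esub>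
        sign R i \<odot>\<^bsub>hom_mod C x z (i + j + 1)\<^esub> Cmp C x y z i (j + 1) c h')),
     Idt = (\<lambda>p. (Idt D (fst p), Idt C (fst p), \<zero>\<^bsub>hom_mod C (fst p) (fst p) 1\<^esub>))\<rparr>"

definition path_incl :: "('o, 'r, 'c) dgcat \<Rightarrow> ('o, 'd, 'o, 'c) dgfun \<Rightarrow> ('o, 'd, 'o \<times> 'o \<times> 'c, 'd \<times> 'c \<times> 'c) dgfun" where
  "path_incl C S = \<lparr>fob = (\<lambda>x. (x, x, Idt C x)),
     fmor = (\<lambda>x y i a. (a, fmor S x y i a, \<zero>\<^bsub>hom_mod C x y (i + 1)\<^esub>))\<rparr>"

definition path_eval :: "('o \<times> 'o \<times> 'c, 'd \<times> 'c \<times> 'c, 'o, 'c) dgfun" where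
  "path_eval = \<lparr>fob = fst, fmor = (\<lambda>p q i. fst \<circ> snd)\<rparr>"

locale mapping_path =
  fixes R :: "('b, 'x) ring_scheme" (structure) and D :: "('o, 'b, 'd) dgcat" and C :: "('o, 'b, 'c) dgcat"
    and S :: "('o, 'd, 'o, 'c) dgfun"
  assumes S: "dg_functor R D C S" and Obj_C: "Obj C = Obj D" and fob_S: "x \<in> Obj D \<Longrightarrow> fob S x = x"
begin

sublocale D: dg_category R D by (rule dg_functorD(1)[OF S])
sublocale C: dg_category R C by (rule dg_functorD(2)[OF S])

abbreviation E where "E \<equiv> path_dgcat R D C S"

lemma path_simps:
  "Obj E = (\<lambda>x. (x, x, Idt C x)) ` Obj D"
  "hom_mod E p q i = prod_module (hom_mod D (fst p) (fst q) i) (prod_module (hom_mod C (fst p) (fst q) i) (hom_mod C (fst p) (fst q) (i + 1)))"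
  "hom_diff E p q i (a, c, h) = (hom_diff D (fst p) (fst q) i a, hom_diff C (fst p) (fst q) i c,
          fmor S (fst p) (fst q) i a \<ominus>\<^bsub>hom_mod C (fst p) (fst q) i\<^esub> (c \<oplus>\<^bsub>hom_mod C (fst p) (fst q) i\<^esub> hom_diff C (fst p) (fst q) (i + 1) h))"
  "Cmp E p q r i j (a, c, h) (a', c', h') = (Cmp D (fst p) (fst q) (fst r) i j a a', Cmp C (fst p) (fst q) (fst r) i j c c',
        Cmp C (fst p) (fst q) (fst r) (i + 1) j h (fmor S (fst p) (fst q) j a') \<oplus>\<^bsub>hom_mod C (fst p) (fst r) (i + j + 1)\<^esub>
        sign R i \<odot>\<^bsub>hom_mod C (fst p) (fst r) (i + j + 1)\<^esub> Cmp C (fst p) (fst q) (fst r) i (j + 1) c h')"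
  "Idt E p = (Idt D (fst p), Idt C (fst p), \<zero>\<^bsub>hom_mod C (fst p) (fst p) 1\<^esub>)"
  by (simp_all add: path_dgcat_def Let_def)

lemma S_closed: "\<lbrakk>x \<in> Obj D; y \<in> Obj D; a \<in> hom_set D x y i\<rbrakk> \<Longrightarrow> fmor S x y i a \<in> hom_set C x y i"
  using dg_functor_hom[OF S, of x y a i] by (simp add: fob_S)

lemma S_linear: "\<lbrakk>x \<in> Obj D; y \<in> Obj D\<rbrakk> \<Longrightarrow> linear_map R (hom_mod D x y i) (hom_mod C x y i) (fmor S x y i)"
  using dg_functorD(4)[OF S, of x y i] by (simp add: fob_S)

lemma S_diff: "\<lbrakk>x \<in> Obj D; y \<in> Obj D; a \<in> hom_set D x y i\<rbrakk> \<Longrightarrow> fmor S x y (i - 1) (hom_diff D x y i a) = hom_diff C x y i (fmor S x y i a)"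
  using dg_functorD(5)[OF S, of x y a i] by (simp add: fob_S)

lemma S_Cmp: "\<lbrakk>x \<in> Obj D; y \<in> Obj D; z \<in> Obj D; g \<in> hom_set D y z i; f \<in> hom_set D x y j\<rbrakk> \<Longrightarrow>
    fmor S x z (i + j) (Cmp D x y z i j g f) = Cmp C x y z i j (fmor S y z i g) (fmor S x y j f)"
  using dg_functorD(7)[OF S, of x y z g i f j] by (simp add: fob_S)

lemma S_Idt: "x \<in> Obj D \<Longrightarrow> fmor S x x 0 (Idt D x) = Idt C x"
  using dg_functorD(6)[OF S, of x] by (simp add: fob_S)

lemmas C_module = C.hom_module[unfolded Obj_C]
lemmas C_diff_closed = C.hom_diff_closed[unfolded Obj_C]
lemmas C_Cmp_closed = C.Cmp_closed'[unfolded Obj_C]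

text \<open>The homotopy component of the differential is \<open>S a - c - dh\<close>. Because of
  the minus sign before \<open>dh\<close>, applying the differential twice gives
  \<open>S(da) - dc - d(S a - c - dh)\<close>, which vanishes since \<open>S\<close> is a chain
  map.\<close>

lemma path_complex:
  assumes "p \<in> Obj E" "q \<in> Obj E" shows "chain_complex R (Mor E p q)"
proof (rule chain_complexI)
  obtain x y where o: "x \<in> Obj D" "y \<in> Obj D" and pq: "fst p = x" "fst q = y" using assms by (auto simp: path_simps)
  interpret H: module R "hom_mod C x y i" for i by (rule C_module[OF o])
  note oC = o[folded Obj_C]
  show "module R (hom_mod E p q i)" for i
    unfolding path_simps pq by (intro prod_module D.hom_module o H.module_axioms)
  show "linear_map R (hom_mod E p q i) (hom_mod E p q (i - 1)) (hom_diff E p q i)" for i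
  proof (rule linear_mapI)
    fix a assume "a \<in> hom_set E p q i"
    then show "hom_diff E p q i a \<in> hom_set E p q (i - 1)"
      using C_diff_closed[OF o, of _ "i + 1"] by (auto simp: path_simps pq D.hom_diff_closed C_diff_closed o S_closed)
  next
    fix a b assume "a \<in> hom_set E p q i" "b \<in> hom_set E p q i"
    then obtain a1 a2 a3 b1 b2 b3 where ab: "a = (a1, a2, a3)" "b = (b1, b2, b3)"
      "a1 \<in> hom_set D x y i" "a2 \<in> hom_set C x y i" "a3 \<in> hom_set C x y (i + 1)"
      "b1 \<in> hom_set D x y i" "b2 \<in> hom_set C x y i" "b3 \<in> hom_set C x y (i + 1)" by (auto simp: path_simps pq)
    note c = ab(4,7) S_closed[OF o ab(3)] S_closed[OF o ab(6)]
      C_diff_closed[OF o ab(5), simplified] C_diff_closed[OF o ab(8), simplified]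
    have "fmor S x y i a1 \<oplus>\<^bsub>hom_mod C x y i\<^esub> fmor S x y i b1 \<ominus>\<^bsub>hom_mod C x y i\<^esub> (a2 \<oplus>\<^bsub>hom_mod C x y i\<^esub> b2 \<oplus>\<^bsub>hom_mod C x y i\<^esub>
        (hom_diff C x y (i + 1) a3 \<oplus>\<^bsub>hom_mod C x y i\<^esub> hom_diff C x y (i + 1) b3)) =
      (fmor S x y i a1 \<ominus>\<^bsub>hom_mod C x y i\<^esub> (a2 \<oplus>\<^bsub>hom_mod C x y i\<^esub> hom_diff C x y (i + 1) a3)) \<oplus>\<^bsub>hom_mod C x y i\<^esub>
      (fmor S x y i b1 \<ominus>\<^bsub>hom_mod C x y i\<^esub> (b2 \<oplus>\<^bsub>hom_mod C x y i\<^esub> hom_diff C x y (i + 1) b3))"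
      using c by algebra
    then show "hom_diff E p q i (a \<oplus>\<^bsub>hom_mod E p q i\<^esub> b) = hom_diff E p q i a \<oplus>\<^bsub>hom_mod E p q (i - 1)\<^esub> hom_diff E p q i b"
      using ab o oC C.hom_diff_add[OF oC ab(5,8)] by (simp add: path_simps pq D.hom_diff_add C.hom_diff_add linear_mapD(2)[OF S_linear])
  next
    fix r a assume r: "r \<in> carrier R" and "a \<in> hom_set E p q i"
    then obtain a1 a2 a3 where ab: "a = (a1, a2, a3)"
      "a1 \<in> hom_set D x y i" "a2 \<in> hom_set C x y i" "a3 \<in> hom_set C x y (i + 1)" by (auto simp: path_simps pq)
    note c = r ab(3) S_closed[OF o ab(2)] C_diff_closed[OF o ab(4), simplified]
    have "r \<odot>\<^bsub>hom_mod C x y i\<^esub> fmor S x y i a1 \<ominus>\<^bsub>hom_mod C x y i\<^esub> (r \<odot>\<^bsub>hom_mod C x y i\<^esub> a2 \<oplus>\<^bsub>hom_mod C x y i\<^esub>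
        (r \<odot>\<^bsub>hom_mod C x y i\<^esub> hom_diff C x y (i + 1) a3)) =
      r \<odot>\<^bsub>hom_mod C x y i\<^esub> (fmor S x y i a1 \<ominus>\<^bsub>hom_mod C x y i\<^esub> (a2 \<oplus>\<^bsub>hom_mod C x y i\<^esub> hom_diff C x y (i + 1) a3))"
      using c by algebra
    then show "hom_diff E p q i (r \<odot>\<^bsub>hom_mod E p q i\<^esub> a) = r \<odot>\<^bsub>hom_mod E p q (i - 1)\<^esub> hom_diff E p q i a"
      using ab o oC r C.hom_diff_smult[OF oC r ab(4)] by (simp add: path_simps pq D.hom_diff_smult C.hom_diff_smult linear_mapD(3)[OF S_linear])
  qed
  fix a i assume "a \<in> hom_set E p q i"
  then obtain a1 a2 a3 where ab: "a = (a1, a2, a3)"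
      "a1 \<in> hom_set D x y i" "a2 \<in> hom_set C x y i" "a3 \<in> hom_set C x y (i + 1)" by (auto simp: path_simps pq)
  note d3 = C_diff_closed[OF o ab(4), simplified]
  note c = C_diff_closed[OF o S_closed[OF o ab(2)]] C_diff_closed[OF o ab(3)]
  have 1: "hom_diff C x y i (fmor S x y i a1 \<ominus>\<^bsub>hom_mod C x y i\<^esub> (a2 \<oplus>\<^bsub>hom_mod C x y i\<^esub> hom_diff C x y (i + 1) a3)) =
    hom_diff C x y i (fmor S x y i a1) \<ominus>\<^bsub>hom_mod C x y (i - 1)\<^esub> hom_diff C x y i a2"
    using linear_map_diff[OF C.hom_diff_linear[OF oC] H.module_axioms H.module_axioms S_closed[OF o ab(2)], of "a2 \<oplus>\<^bsub>hom_mod C x y i\<^esub> hom_diff C x y (i + 1) a3"]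
      C.hom_diff_add[OF oC ab(3) d3] C.hom_diff_diff[OF oC ab(4)] ab d3 c by simp
  have "hom_diff C x y i (fmor S x y i a1) \<ominus>\<^bsub>hom_mod C x y (i - 1)\<^esub> (hom_diff C x y i a2 \<oplus>\<^bsub>hom_mod C x y (i - 1)\<^esub>
      (hom_diff C x y i (fmor S x y i a1) \<ominus>\<^bsub>hom_mod C x y (i - 1)\<^esub> hom_diff C x y i a2)) = \<zero>\<^bsub>hom_mod C x y (i - 1)\<^esub>"
    using c by algebra
  then show "hom_diff E p q (i - 1) (hom_diff E p q i a) = \<zero>\<^bsub>hom_mod E p q (i - 2)\<^esub>"
    using ab o oC 1 by (simp add: path_simps pq D.hom_diff_diff C.hom_diff_diff S_diff)
qed

text \<open>Composition splices homotopies: \<open>h S(a')\<close> leads from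
  \<open>S(a) S(a')\<close> to \<open>c S(a')\<close>, and the term \<open>c h'\<close>, with the
  sign for moving the degree one shift past \<open>c\<close>, leads on to
  \<open>c c'\<close>.\<close>

lemma path_dg_category: "dg_category R E"
proof (rule dg_categoryI[OF D.is_cring path_complex], goal_cases)
  case (3 p)
  then show ?case by (auto simp: path_simps D.Idt_closed C.Idt_closed Obj_C C.hom_zero_closed)
next
  case (4 p q r i j f)
  then obtain x y z where o: "x \<in> Obj D" "y \<in> Obj D" "z \<in> Obj D" and pq: "fst p = x" "fst q = y" "fst r = z" by (auto simp: path_simps)
  note oC = o[folded Obj_C]
  interpret H: module R "hom_mod C x z (i + j + 1)" by (rule C_module[OF o(1,3)])
  obtain a' c' h' where f: "f = (a', c', h')" "a' \<in> hom_set D x y j" "c' \<in> hom_set C x y j" "h' \<in> hom_set C x y (j + 1)"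
    using 4 by (auto simp: path_simps pq)
  note Sf = S_closed[OF o(1,2) f(2)]
  note s = sign_closed[OF D.is_cring, of i]
  have cl: "g \<in> hom_set C y z (i + 1) \<Longrightarrow> Cmp C x y z (i + 1) j g (fmor S x y j a') \<in> hom_set C x z (i + j + 1)"
    "g' \<in> hom_set C y z i \<Longrightarrow> Cmp C x y z i (j + 1) g' h' \<in> hom_set C x z (i + j + 1)" for g g'
    using o Sf f by (auto intro!: C_Cmp_closed)
  show ?case
  proof (rule linear_mapI, goal_cases)
    case (1 a) then show ?case using o f s cl by (auto simp: path_simps pq D.Cmp_closed C.Cmp_closed oC)
  next
    case (2 a b)
    then show ?case using o oC f Sf s cl
      by (auto simp: path_simps pq D.Cmp_add_left C.Cmp_add_left[where k = "i + j + 1"] C.Cmp_add_left[where k = "i + j"] H.smult_r_distr H.a_ac)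
  next
    case (3 t a)
    then show ?case using o oC f Sf s cl
      by (auto simp: path_simps pq D.Cmp_smult_left C.Cmp_smult_left[where k = "i + j + 1"] C.Cmp_smult_left[where k = "i + j"]
        H.smult_r_distr H.smult_assoc1[symmetric] D.m_comm)
  qed
next
  case (5 p q r i j g)
  then obtain x y z where o: "x \<in> Obj D" "y \<in> Obj D" "z \<in> Obj D" and pq: "fst p = x" "fst q = y" "fst r = z" by (auto simp: path_simps)
  note oC = o[folded Obj_C]
  interpret H: module R "hom_mod C x z (i + j + 1)" by (rule C_module[OF o(1,3)])
  obtain a c h where g: "g = (a, c, h)" "a \<in> hom_set D y z i" "c \<in> hom_set C y z i" "h \<in> hom_set C y z (i + 1)"
    using 5 by (auto simp: path_simps pq)
  note s = sign_closed[OF D.is_cring, of i]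
  have cl: "f \<in> hom_set D x y j \<Longrightarrow> Cmp C x y z (i + 1) j h (fmor S x y j f) \<in> hom_set C x z (i + j + 1)"
    "f' \<in> hom_set C x y (j + 1) \<Longrightarrow> Cmp C x y z i (j + 1) c f' \<in> hom_set C x z (i + j + 1)" for f f'
    using o S_closed g by (auto intro!: C_Cmp_closed)
  show ?case
  proof (rule linear_mapI, goal_cases)
    case (1 a) then show ?case using o g s cl by (auto simp: path_simps pq D.Cmp_closed C.Cmp_closed oC)
  next
    case (2 a b)
    then show ?case using o oC g S_closed[OF o(1,2)] s cl
      by (auto simp: path_simps pq D.Cmp_add_right linear_mapD(2)[OF S_linear[OF o(1,2)]]
       C.Cmp_add_right[where k = "i + j + 1"] C.Cmp_add_right[where k = "i + j"] H.smult_r_distr H.a_ac)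
  next
    case (3 t a)
    then show ?case using o oC g S_closed[OF o(1,2)] s cl
      by (auto simp: path_simps pq D.Cmp_smult_right linear_mapD(3)[OF S_linear[OF o(1,2)]]
        C.Cmp_smult_right[where k = "i + j + 1"] C.Cmp_smult_right[where k = "i + j"]
        H.smult_r_distr H.smult_assoc1[symmetric] D.m_comm)
  qed
next
  case (6 p q r i j g f)
  then obtain x y z where o: "x \<in> Obj D" "y \<in> Obj D" "z \<in> Obj D" and pq: "fst p = x" "fst q = y" "fst r = z" by (auto simp: path_simps)
  note oC = o[folded Obj_C]
  interpret H: module R "hom_mod C x z (i + j)" by (rule C_module[OF o(1,3)])
  interpret Hf: module R "hom_mod C x y j" by (rule C_module[OF o(1,2)])
  interpret Hg: module R "hom_mod C y z i" by (rule C_module[OF o(2,3)])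
  obtain a' c' h' where f: "f = (a', c', h')" "a' \<in> hom_set D x y j" "c' \<in> hom_set C x y j" "h' \<in> hom_set C x y (j + 1)"
    using 6 by (auto simp: path_simps pq)
  obtain a c h where g: "g = (a, c, h)" "a \<in> hom_set D y z i" "c \<in> hom_set C y z i" "h \<in> hom_set C y z (i + 1)"
    using 6 by (auto simp: path_simps pq)
  note Sf = S_closed[OF o(1,2) f(2)] and Sg = S_closed[OF o(2,3) g(2)]
  note dh = C_diff_closed[OF o(2,3) g(4), simplified] and dh' = C_diff_closed[OF o(1,2) f(4), simplified]
  note s = sign_closed[OF D.is_cring, of i]
  \<comment> \<open>The products occurring on the two sides. Here \<open>u7 = c S(a')\<close> is the
    intermediate stage of the spliced homotopy; it enters once with each sign and is removed by
    \<open>minus_cancel_middle\<close>.\<close>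
  define u1 u2 u3 u4 u5 u6 u7 where u:
    "u1 = Cmp C x y z i j (fmor S y z i a) (fmor S x y j a')" "u2 = Cmp C x y z i j c c'"
    "u3 = Cmp C x y z i j (hom_diff C y z (i + 1) h) (fmor S x y j a')"
    "u4 = Cmp C x y z (i + 1) (j - 1) h (hom_diff C x y j (fmor S x y j a'))"
    "u5 = Cmp C x y z (i - 1) (j + 1) (hom_diff C y z i c) h'"
    "u6 = Cmp C x y z i j c (hom_diff C x y (j + 1) h')" "u7 = Cmp C x y z i j c (fmor S x y j a')"
  have uc: "u1 \<in> hom_set C x z (i + j)" "u2 \<in> hom_set C x z (i + j)" "u3 \<in> hom_set C x z (i + j)" "u4 \<in> hom_set C x z (i + j)"
    "u5 \<in> hom_set C x z (i + j)" "u6 \<in> hom_set C x z (i + j)" "u7 \<in> hom_set C x z (i + j)"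
    unfolding u using o f g Sf Sg dh dh' by (auto intro!: C_Cmp_closed C_diff_closed)
  have e: "i + 1 + j = i + j + 1" "i + (j + 1) = i + j + 1" "i - 1 + j = i + j - 1" "i + (j - 1) = i + j - 1" by auto
  have d1: "hom_diff C x z (i + j + 1) (Cmp C x y z (i + 1) j h (fmor S x y j a')) =
      u3 \<oplus>\<^bsub>hom_mod C x z (i + j)\<^esub> (\<ominus> sign R i) \<odot>\<^bsub>hom_mod C x z (i + j)\<^esub> u4"
    using C.Cmp_diff_sign[OF oC g(4) Sf] by (simp add: u e sign_plus_one[OF D.is_cring])
  have d2: "hom_diff C x z (i + j + 1) (Cmp C x y z i (j + 1) c h') =
      u5 \<oplus>\<^bsub>hom_mod C x z (i + j)\<^esub> sign R i \<odot>\<^bsub>hom_mod C x z (i + j)\<^esub> u6"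
    using C.Cmp_diff_sign[OF oC g(3) f(4)] by (simp add: u e)
  have cl: "Cmp C x y z (i + 1) j h (fmor S x y j a') \<in> hom_set C x z (i + j + 1)"
    "Cmp C x y z i (j + 1) c h' \<in> hom_set C x z (i + j + 1)"
    using o f g Sf by (auto intro!: C_Cmp_closed)
  interpret H1: module R "hom_mod C x z (i + j + 1)" by (rule C_module[OF o(1,3)])
  have L: "hom_diff C x z (i + j + 1) (Cmp C x y z (i + 1) j h (fmor S x y j a') \<oplus>\<^bsub>hom_mod C x z (i + j + 1)\<^esub>
      sign R i \<odot>\<^bsub>hom_mod C x z (i + j + 1)\<^esub> Cmp C x y z i (j + 1) c h') =
    (u3 \<oplus>\<^bsub>hom_mod C x z (i + j)\<^esub> (\<ominus> sign R i) \<odot>\<^bsub>hom_mod C x z (i + j)\<^esub> u4) \<oplus>\<^bsub>hom_mod C x z (i + j)\<^esub>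
      sign R i \<odot>\<^bsub>hom_mod C x z (i + j)\<^esub> (u5 \<oplus>\<^bsub>hom_mod C x z (i + j)\<^esub> sign R i \<odot>\<^bsub>hom_mod C x z (i + j)\<^esub> u6)"
    using C.hom_diff_add[OF oC(1,3) cl(1) H1.smult_closed[OF s cl(2)]] C.hom_diff_smult[OF oC(1,3) s cl(2)] d1 d2 by simp
  have R1: "Cmp C x y z i j (fmor S y z i a \<ominus>\<^bsub>hom_mod C y z i\<^esub> (c \<oplus>\<^bsub>hom_mod C y z i\<^esub> hom_diff C y z (i + 1) h)) (fmor S x y j a')
      = u1 \<ominus>\<^bsub>hom_mod C x z (i + j)\<^esub> (u7 \<oplus>\<^bsub>hom_mod C x z (i + j)\<^esub> u3)"
    using linear_map_diff[OF C.Cmp_linear_left[OF oC Sf] Hg.module_axioms H.module_axioms Sg Hg.M.a_closed[OF g(3) dh]]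
      C.Cmp_add_left[OF oC g(3) dh Sf HOL.refl] by (simp add: u)
  have R2: "Cmp C x y z i j c (fmor S x y j a' \<ominus>\<^bsub>hom_mod C x y j\<^esub> (c' \<oplus>\<^bsub>hom_mod C x y j\<^esub> hom_diff C x y (j + 1) h'))
      = u7 \<ominus>\<^bsub>hom_mod C x z (i + j)\<^esub> (u2 \<oplus>\<^bsub>hom_mod C x z (i + j)\<^esub> u6)"
    using linear_map_diff[OF C.Cmp_linear_right[OF oC g(3)] Hf.module_axioms H.module_axioms Sf Hf.M.a_closed[OF f(3) dh']]
      C.Cmp_add_right[OF oC g(3) f(3) dh' HOL.refl] by (simp add: u)
  let ?s = "\<lambda>v. sign R i \<odot>\<^bsub>hom_mod C x z (i + j)\<^esub> v"
  have su: "?s u4 \<in> hom_set C x z (i + j)" "?s u5 \<in> hom_set C x z (i + j)" using s uc by auto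
  have ss: "?s (?s u6) = u6" "?s (?s (u7 \<ominus>\<^bsub>hom_mod C x z (i + j)\<^esub> (u2 \<oplus>\<^bsub>hom_mod C x z (i + j)\<^esub> u6))) = u7 \<ominus>\<^bsub>hom_mod C x z (i + j)\<^esub> (u2 \<oplus>\<^bsub>hom_mod C x z (i + j)\<^esub> u6)"
    using uc by (simp_all add: H.sign_smult)
  have "u1 \<ominus>\<^bsub>hom_mod C x z (i + j)\<^esub> (u2 \<oplus>\<^bsub>hom_mod C x z (i + j)\<^esub> ((u3 \<oplus>\<^bsub>hom_mod C x z (i + j)\<^esub> \<ominus>\<^bsub>hom_mod C x z (i + j)\<^esub> ?s u4) \<oplus>\<^bsub>hom_mod C x z (i + j)\<^esub>
      (?s u5 \<oplus>\<^bsub>hom_mod C x z (i + j)\<^esub> u6))) =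
    (u1 \<ominus>\<^bsub>hom_mod C x z (i + j)\<^esub> (u7 \<oplus>\<^bsub>hom_mod C x z (i + j)\<^esub> u3) \<oplus>\<^bsub>hom_mod C x z (i + j)\<^esub> \<ominus>\<^bsub>hom_mod C x z (i + j)\<^esub> ?s u5) \<oplus>\<^bsub>hom_mod C x z (i + j)\<^esub>
      (?s u4 \<oplus>\<^bsub>hom_mod C x z (i + j)\<^esub> (u7 \<ominus>\<^bsub>hom_mod C x z (i + j)\<^esub> (u2 \<oplus>\<^bsub>hom_mod C x z (i + j)\<^esub> u6)))"
    unfolding H.minus_cancel_middle[OF uc(1,3) H.M.a_closed[OF uc(2,6)] uc(7) H.M.a_inv_closed[OF su(2)] su(1)]
    using uc(1,2,3,6) su by algebra
  then have "u1 \<ominus>\<^bsub>hom_mod C x z (i + j)\<^esub> (u2 \<oplus>\<^bsub>hom_mod C x z (i + j)\<^esub> ((u3 \<oplus>\<^bsub>hom_mod C x z (i + j)\<^esub> (\<ominus> sign R i) \<odot>\<^bsub>hom_mod C x z (i + j)\<^esub> u4) \<oplus>\<^bsub>hom_mod C x z (i + j)\<^esub>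
      ?s (u5 \<oplus>\<^bsub>hom_mod C x z (i + j)\<^esub> ?s u6))) =
    (u1 \<ominus>\<^bsub>hom_mod C x z (i + j)\<^esub> (u7 \<oplus>\<^bsub>hom_mod C x z (i + j)\<^esub> u3) \<oplus>\<^bsub>hom_mod C x z (i + j)\<^esub> sign R (i - 1) \<odot>\<^bsub>hom_mod C x z (i + j)\<^esub> u5) \<oplus>\<^bsub>hom_mod C x z (i + j)\<^esub>
      ?s (u4 \<oplus>\<^bsub>hom_mod C x z (i + j)\<^esub> ?s (u7 \<ominus>\<^bsub>hom_mod C x z (i + j)\<^esub> (u2 \<oplus>\<^bsub>hom_mod C x z (i + j)\<^esub> u6)))"
    using uc s ss by (simp add: H.smult_l_minus sign_Suc[OF D.is_cring] H.smult_r_distr[of _ u5] H.smult_r_distr[of _ u4])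
  then show ?case
    using D.Cmp_diff_sign[OF o g(2) f(2)] C.Cmp_diff_sign[OF oC g(3) f(3)] S_Cmp[OF o g(2) f(2)] L R1 R2
      S_diff[OF o(1,2) f(2)]
    by (simp add: path_simps pq f(1) g(1) u(1)[symmetric] u(2)[symmetric] u(4)[symmetric] u(5)[symmetric])
next
  case (7 w p q r i j k h g f)
  then obtain v x y z where o: "v \<in> Obj D" "x \<in> Obj D" "y \<in> Obj D" "z \<in> Obj D" and pq: "fst w = v" "fst p = x" "fst q = y" "fst r = z" by (auto simp: path_simps)
  note oC = o[folded Obj_C]
  obtain f1 f2 f3 where f: "f = (f1, f2, f3)" "f1 \<in> hom_set D v x k" "f2 \<in> hom_set C v x k" "f3 \<in> hom_set C v x (k + 1)"
    using 7 by (auto simp: path_simps pq)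
  obtain g1 g2 g3 where g: "g = (g1, g2, g3)" "g1 \<in> hom_set D x y j" "g2 \<in> hom_set C x y j" "g3 \<in> hom_set C x y (j + 1)"
    using 7 by (auto simp: path_simps pq)
  obtain h1 h2 h3 where h: "h = (h1, h2, h3)" "h1 \<in> hom_set D y z i" "h2 \<in> hom_set C y z i" "h3 \<in> hom_set C y z (i + 1)"
    using 7 by (auto simp: path_simps pq)
  note Sf = S_closed[OF o(1,2) f(2)] and Sg = S_closed[OF o(2,3) g(2)]
  interpret H: module R "hom_mod C v z (i + j + k + 1)" by (rule C_module[OF o(1,4)])
  interpret Hr: module R "hom_mod C v y (j + k + 1)" by (rule C_module[OF o(1,3)])
  interpret Hl: module R "hom_mod C x z (i + j + 1)" by (rule C_module[OF o(2,4)])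
  note s = sign_closed[OF D.is_cring]
  have e: "i + (j + k) = i + j + k" "i + 1 + j = i + j + 1" "j + 1 + k = j + k + 1" "i + (j + 1) = i + j + 1" "j + (k + 1) = j + k + 1" by auto
  \<comment> \<open>The homotopy of a triple product has three terms, with the homotopy taken from
    the left, middle or right factor; \<open>S\<close> is applied to the factors on its right, and
    the \<open>C\<close> components stand on its left.\<close>
  define u1 u2 u3 where u: "u1 = Cmp C v y z (i + 1) (j + k) h3 (Cmp C v x y j k (fmor S x y j g1) (fmor S v x k f1))"
    "u2 = Cmp C v y z i (j + k + 1) h2 (Cmp C v x y (j + 1) k g3 (fmor S v x k f1))"
    "u3 = Cmp C v y z i (j + k + 1) h2 (Cmp C v x y j (k + 1) g2 f3)"
  have uc: "u1 \<in> hom_set C v z (i + j + k + 1)" "u2 \<in> hom_set C v z (i + j + k + 1)" "u3 \<in> hom_set C v z (i + j + k + 1)"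
    unfolding u using o f g h Sf Sg by (auto intro!: C_Cmp_closed)
  have cl: "Cmp C x y z (i + 1) j h3 (fmor S x y j g1) \<in> hom_set C x z (i + j + 1)" "Cmp C x y z i (j + 1) h2 g3 \<in> hom_set C x z (i + j + 1)"
    "Cmp C v x y (j + 1) k g3 (fmor S v x k f1) \<in> hom_set C v y (j + k + 1)" "Cmp C v x y j (k + 1) g2 f3 \<in> hom_set C v y (j + k + 1)"
    using o f g h Sf Sg by (auto intro!: C_Cmp_closed)
  have 1: "Cmp C v x z (i + j + 1) k (Cmp C x y z (i + 1) j h3 (fmor S x y j g1)) (fmor S v x k f1) = u1"
    using C.Cmp_assoc[OF oC h(4) Sg Sf] by (simp add: u e)
  have 2: "Cmp C v x z (i + j + 1) k (Cmp C x y z i (j + 1) h2 g3) (fmor S v x k f1) = u2"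
    using C.Cmp_assoc[OF oC h(3) g(4) Sf] by (simp add: u e)
  have 3: "Cmp C v x z (i + j) (k + 1) (Cmp C x y z i j h2 g2) f3 = u3"
    using C.Cmp_assoc[OF oC h(3) g(3) f(4)] by (simp add: u e)
  have 4: "Cmp C v x z (i + j + 1) k (Cmp C x y z (i + 1) j h3 (fmor S x y j g1) \<oplus>\<^bsub>hom_mod C x z (i + j + 1)\<^esub>
      sign R i \<odot>\<^bsub>hom_mod C x z (i + j + 1)\<^esub> Cmp C x y z i (j + 1) h2 g3) (fmor S v x k f1) =
    u1 \<oplus>\<^bsub>hom_mod C v z (i + j + k + 1)\<^esub> sign R i \<odot>\<^bsub>hom_mod C v z (i + j + k + 1)\<^esub> u2"
    using C.Cmp_add_left[OF oC(1,2,4) cl(1) Hl.smult_closed[OF s cl(2)] Sf, of "i + j + k + 1"]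
      C.Cmp_smult_left[OF oC(1,2,4) s cl(2) Sf, of "i + j + k + 1"] 1 2 by simp
  have 5: "Cmp C v y z i (j + k + 1) h2 (Cmp C v x y (j + 1) k g3 (fmor S v x k f1) \<oplus>\<^bsub>hom_mod C v y (j + k + 1)\<^esub>
      sign R j \<odot>\<^bsub>hom_mod C v y (j + k + 1)\<^esub> Cmp C v x y j (k + 1) g2 f3) =
    u2 \<oplus>\<^bsub>hom_mod C v z (i + j + k + 1)\<^esub> sign R j \<odot>\<^bsub>hom_mod C v z (i + j + k + 1)\<^esub> u3"
    using C.Cmp_add_right[OF oC(1,3,4) h(3) cl(3) Hr.smult_closed[OF s cl(4)], of "i + j + k + 1"]
      C.Cmp_smult_right[OF oC(1,3,4) s h(3) cl(4), of "i + j + k + 1"] by (simp add: u)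
  show ?case
    using D.Cmp_assoc[OF o h(2) g(2) f(2)] C.Cmp_assoc[OF oC h(3) g(3) f(3)] S_Cmp[OF o(1-3) g(2) f(2)] uc s[of i] s[of j] 3 4 5
    by (simp add: path_simps pq f(1) g(1) h(1) e u(1)[symmetric] sign_sign(2)[OF D.is_cring] H.smult_r_distr H.smult_assoc1 H.a_assoc)
next
  case (8 p q i f)
  then obtain x y where o: "x \<in> Obj D" "y \<in> Obj D" and pq: "fst p = x" "fst q = y" by (auto simp: path_simps)
  note oC = o[folded Obj_C]
  obtain f1 f2 f3 where f: "f = (f1, f2, f3)" "f1 \<in> hom_set D x y i" "f2 \<in> hom_set C x y i" "f3 \<in> hom_set C x y (i + 1)"
    using 8 by (auto simp: path_simps pq)
  interpret H: module R "hom_mod C x y (i + 1)" by (rule C_module[OF o])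
  have e: "1 + i = i + 1" by simp
  show ?case using f o oC C.Cmp_zero_left[OF oC(1,2,2) S_closed[OF o f(2)], of 1]
    by (simp add: path_simps pq D.Cmp_Idt_left C.Cmp_Idt_left e sign_def)
next
  case (9 p q i f)
  then obtain x y where o: "x \<in> Obj D" "y \<in> Obj D" and pq: "fst p = x" "fst q = y" by (auto simp: path_simps)
  note oC = o[folded Obj_C]
  obtain f1 f2 f3 where f: "f = (f1, f2, f3)" "f1 \<in> hom_set D x y i" "f2 \<in> hom_set C x y i" "f3 \<in> hom_set C x y (i + 1)"
    using 9 by (auto simp: path_simps pq)
  interpret H: module R "hom_mod C x y (i + 1)" by (rule C_module[OF o])
  show ?case using f o oC C.Cmp_zero_right[OF oC(1,1,2) f(3), of 1]
    by (simp add: path_simps pq D.Cmp_Idt_right C.Cmp_Idt_right S_Idt sign_closed[OF D.is_cring])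
qed

lemma path_incl_functor: "dg_functor R D E (path_incl C S)"
proof (rule dg_functorI[OF D.dg_category_axioms path_dg_category])
  fix x y i assume o: "x \<in> Obj D" "y \<in> Obj D"
  interpret H: module R "hom_mod C x y (i + 1)" by (rule C_module[OF o])
  show "linear_map R (hom_mod D x y i) (hom_mod E (fob (path_incl C S) x) (fob (path_incl C S) y) i) (fmor (path_incl C S) x y i)"
    by (rule linear_mapI) (use linear_mapD[OF S_linear[OF o]] in \<open>auto simp: path_incl_def path_simps\<close>)
  fix a assume a: "a \<in> hom_set D x y i"
  interpret H0: module R "hom_mod C x y i" by (rule C_module[OF o])
  show "fmor (path_incl C S) x y (i - 1) (hom_diff D x y i a) =
      hom_diff E (fob (path_incl C S) x) (fob (path_incl C S) y) i (fmor (path_incl C S) x y i a)"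
    using S_diff[OF o a] S_closed[OF o a] C.hom_diff_zero[of x y "i + 1"] o
    by (simp add: path_incl_def path_simps Obj_C a_minus_def H0.M.r_neg)
next
  fix x y z i j g f
  assume o: "x \<in> Obj D" "y \<in> Obj D" "z \<in> Obj D" and gf: "g \<in> hom_set D y z i" "f \<in> hom_set D x y j"
  interpret H: module R "hom_mod C x z (i + j + 1)" by (rule C_module[OF o(1,3)])
  have e: "i + 1 + j = i + j + 1" "i + (j + 1) = i + j + 1" by auto
  show "fmor (path_incl C S) x z (i + j) (Cmp D x y z i j g f) = Cmp E (fob (path_incl C S) x) (fob (path_incl C S) y)
     (fob (path_incl C S) z) i j (fmor (path_incl C S) y z i g) (fmor (path_incl C S) x y j f)"
    using S_Cmp[OF o gf] C.Cmp_zero_left[OF o[folded Obj_C] S_closed[OF o(1,2) gf(2)], of "i + 1"]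
      C.Cmp_zero_right[OF o[folded Obj_C] S_closed[OF o(2,3) gf(1)], of "j + 1"]
    by (simp add: path_incl_def path_simps e sign_closed[OF D.is_cring])
qed (auto simp: path_incl_def path_simps S_Idt)

lemma path_eval_functor: "dg_functor R E C path_eval"
proof (rule dg_functorI[OF path_dg_category C.dg_category_axioms])
  fix p q i assume "p \<in> Obj E" "q \<in> Obj E"
  then show "linear_map R (hom_mod E p q i) (hom_mod C (fob path_eval p) (fob path_eval q) i) (fmor path_eval p q i)"
    by (intro linear_mapI) (auto simp: path_eval_def path_simps)
qed (auto simp: path_eval_def path_simps Obj_C)

lemma path_incl_quasi_equivalence: "quasi_equivalence R D E (path_incl C S)"
proof (rule quasi_equivalenceI[OF path_incl_functor])
  show "bij_betw (fob (path_incl C S)) (Obj D) (Obj E)"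
    by (auto simp: bij_betw_def inj_on_def path_incl_def path_simps)
  fix x y assume o: "x \<in> Obj D" "y \<in> Obj D"
  note oC = o[folded Obj_C]
  let ?p = "(x, x, Idt C x)" and ?q = "(y, y, Idt C y)"
  have pq: "?p \<in> Obj E" "?q \<in> Obj E" using o by (auto simp: path_simps)
  have J: "fob (path_incl C S) x = ?p" "fob (path_incl C S) y = ?q" by (simp_all add: path_incl_def)
  note ch = dg_functor_chain_map[OF path_incl_functor o, unfolded J]
  have "quasi_isomorphism R (Mor D x y) (Mor E ?p ?q) (fmor (path_incl C S) x y)"
  proof (rule quasi_isomorphismI[OF ch D.complex[OF o] path_complex[OF pq]])
    fix i z assume "z \<in> cycles (Mor E ?p ?q) i"
    then obtain a c h where z: "z = (a, c, h)" "a \<in> hom_set D x y i" "c \<in> hom_set C x y i" "h \<in> hom_set C x y (i + 1)"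
      "hom_diff D x y i a = \<zero>\<^bsub>hom_mod D x y (i - 1)\<^esub>"
      "fmor S x y i a \<ominus>\<^bsub>hom_mod C x y i\<^esub> (c \<oplus>\<^bsub>hom_mod C x y i\<^esub> hom_diff C x y (i + 1) h) = \<zero>\<^bsub>hom_mod C x y i\<^esub>"
      by (auto simp: cycles_def path_simps)
    interpret H: module R "hom_mod C x y i" by (rule C_module[OF o])
    interpret H1: module R "hom_mod C x y (i + 1)" by (rule C_module[OF o])
    interpret H2: module R "hom_mod C x y (i + 1 + 1)" by (rule C_module[OF o])
    interpret HD: module R "hom_mod D x y i" by (rule D.hom_module[OF o])
    interpret HD1: module R "hom_mod D x y (i + 1)" by (rule D.hom_module[OF o])
    \<comment> \<open>The boundary of \<open>(0, - h, 0)\<close> is \<open>(0, - dh, h)\<close>. A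
      cycle satisfies \<open>c = S a - dh\<close>, so this chain connects it with the image of
      \<open>a\<close>.\<close>
    let ?b = "(\<zero>\<^bsub>hom_mod D x y (i + 1)\<^esub>, \<ominus>\<^bsub>hom_mod C x y (i + 1)\<^esub> h, \<zero>\<^bsub>hom_mod C x y (i + 1 + 1)\<^esub>)"
    note dh = C_diff_closed[OF o z(4), simplified] and Sa = S_closed[OF o z(2)]
    have "fmor S x y i a = c \<oplus>\<^bsub>hom_mod C x y i\<^esub> hom_diff C x y (i + 1) h"
      using H.minus_eq_iff[OF Sa H.M.a_closed[OF z(3) dh] H.M.zero_closed] z(3,6) dh by simp
    then have c: "fmor S x y i a \<oplus>\<^bsub>hom_mod C x y i\<^esub> \<ominus>\<^bsub>hom_mod C x y i\<^esub> hom_diff C x y (i + 1) h = c"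
      using z(3) dh by (simp add: H.M.a_assoc H.M.r_neg)
    have S0: "fmor S x y (i + 1) \<zero>\<^bsub>hom_mod D x y (i + 1)\<^esub> = \<zero>\<^bsub>hom_mod C x y (i + 1)\<^esub>"
      by (rule linear_map_zero[OF S_linear[OF o] D.hom_module[OF o] C_module[OF o]])
    have dm: "hom_diff C x y (i + 1) (\<ominus>\<^bsub>hom_mod C x y (i + 1)\<^esub> h) = \<ominus>\<^bsub>hom_mod C x y i\<^esub> hom_diff C x y (i + 1) h"
      using linear_map_minus[OF C.hom_diff_linear[OF oC] C_module[OF o] C_module[OF o] z(4)] by simp
    have db: "hom_diff E ?p ?q (i + 1) ?b = (\<zero>\<^bsub>hom_mod D x y i\<^esub>, \<ominus>\<^bsub>hom_mod C x y i\<^esub> hom_diff C x y (i + 1) h, h)"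
      using z(4) S0 dm D.hom_diff_zero[OF o, of "i + 1"] C.hom_diff_zero[OF oC, of "i + 1 + 1"]
      by (simp add: path_simps a_minus_def add.commute[of 1 i])
    have "z = fmor (path_incl C S) x y i a \<oplus>\<^bsub>hom_mod E ?p ?q i\<^esub> hom_diff E ?p ?q (i + 1) ?b"
      unfolding db using z c by (simp add: path_simps path_incl_def)
    moreover have "a \<in> cycles (Mor D x y) i" using z by (simp add: cycles_def)
    moreover have "?b \<in> hom_set E ?p ?q (i + 1)" using z C.hom_zero_closed[OF oC] by (simp add: path_simps)
    ultimately show "\<exists>a\<in>cycles (Mor D x y) i. \<exists>b\<in>hom_set E ?p ?q (i + 1).
        z = fmor (path_incl C S) x y i a \<oplus>\<^bsub>hom_mod E ?p ?q i\<^esub> hom_diff E ?p ?q (i + 1) b" by blast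
  next
    fix i a b assume "a \<in> cycles (Mor D x y) i" "b \<in> hom_set E ?p ?q (i + 1)"
      "fmor (path_incl C S) x y i a = hom_diff E ?p ?q (i + 1) b"
    \<comment> \<open>The first component of a bounding chain already bounds \<open>a\<close> in
      \<open>D\<close>.\<close>
    then show "a \<in> boundaries (Mor D x y) i" by (auto simp: path_simps path_incl_def boundaries_def)
  qed
  then show "quasi_isomorphism R (Mor D x y) (Mor E (fob (path_incl C S) x) (fob (path_incl C S) y)) (fmor (path_incl C S) x y)"
    by (simp add: J)
qed

text \<open>In degree \<open>0\<close> each \<open>v\<close> equals \<open>S(P v)\<close>. If
  \<open>v\<close> is invertible in \<open>H_0(C)\<close>, then so is \<open>P v\<close> in
  \<open>H_0(D)\<close>, and the image of \<open>P v\<close> under \<open>path_incl\<close> is an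
  invertible lift whose target again has the form \<open>(y, y, id)\<close>.\<close>

lemma path_eval_fibration:
  assumes P: "dg_functor R C D P" and fob_P: "\<And>x. x \<in> Obj D \<Longrightarrow> fob P x = x"
    and SP: "\<And>x y v. \<lbrakk>x \<in> Obj D; y \<in> Obj D; v \<in> hom_set C x y 0\<rbrakk> \<Longrightarrow> fmor S x y 0 (fmor P x y 0 v) = v"
  shows "dg_fibration R E C path_eval"
  unfolding dg_fibration_def
proof (intro conjI ballI allI impI path_eval_functor)
  fix p q i assume "p \<in> Obj E" "q \<in> Obj E"
  then obtain x y where o: "x \<in> Obj D" "y \<in> Obj D" and pq: "fst p = x" "fst q = y" by (auto simp: path_simps)
  have "c \<in> fmor path_eval p q i ` hom_set E p q i" if "c \<in> hom_set C x y i" for c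
    using that o D.hom_zero_closed[OF o, of i] C.hom_zero_closed[OF o[folded Obj_C], of "i + 1"]
    by (intro rev_image_eqI[of "(\<zero>\<^bsub>hom_mod D x y i\<^esub>, c, \<zero>\<^bsub>hom_mod C x y (i + 1)\<^esub>)"]) (auto simp: path_simps path_eval_def pq)
  then show "fmor path_eval p q i ` hom_set E p q i = hom_set C (fob path_eval p) (fob path_eval q) i"
    by (auto simp: path_simps path_eval_def pq)
next
  fix p y v assume p: "p \<in> Obj E" and y: "y \<in> Obj C" and v: "H0_invertible C (fob path_eval p) y v"
  obtain x where x: "x \<in> Obj D" "p = (x, x, Idt C x)" using p by (auto simp: path_simps)
  have y': "y \<in> Obj D" using y Obj_C by simp
  have v': "H0_invertible C x y v" using v x by (simp add: path_eval_def)
  then have vc: "v \<in> hom_set C x y 0" by (simp add: H0_invertible_def cycles_def)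
  have "H0_invertible D x y (fmor P x y 0 v)"
    using dg_functor_H0_invertible[OF P _ _ v'] x(1) y' by (simp add: Obj_C fob_P)
  from dg_functor_H0_invertible[OF path_incl_functor x(1) y' this]
  have "H0_invertible E p (y, y, Idt C y) (fmor (path_incl C S) x y 0 (fmor P x y 0 v))" by (simp add: path_incl_def x)
  moreover have "fmor path_eval p (y, y, Idt C y) 0 (fmor (path_incl C S) x y 0 (fmor P x y 0 v)) = v"
    using SP[OF x(1) y' vc] by (simp add: path_eval_def path_incl_def)
  moreover have "fob path_eval (y, y, Idt C y) = y" "(y, y, Idt C y) \<in> Obj E" using y' by (auto simp: path_eval_def path_simps)
  ultimately show "\<exists>q\<in>Obj E. \<exists>u. fob path_eval q = y \<and> H0_invertible E p q u \<and> fmor path_eval p q 0 u = v" by blast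
qed

end

section \<open>The attachment of cells\<close>

text \<open>The tensor product of \<open>B\<close> with the acyclic dg algebra \<open>R[h]/(h\<^sup>2)\<close>, where \<open>h\<close> has degree \<open>1\<close>
  and \<open>dh = 1\<close>. The pair \<open>(a, b)\<close> stands for \<open>a + h b\<close>. Every dg functor \<open>B \<rightarrow> cone_dgcat R B\<close>
  extends to all attached cells, so that the inclusion \<open>a \<mapsto> (a, 0)\<close> shows that no morphism of
  \<open>B\<close> is killed by an attachment.\<close>

definition cone_dgcat :: "('r, 'x) ring_scheme \<Rightarrow> ('o, 'r, 'a) dgcat \<Rightarrow> ('o, 'r, 'a \<times> 'a) dgcat" where
  "cone_dgcat R B = \<lparr>Obj = Obj B,
     Mor = (\<lambda>x y. \<lparr>cmod = (\<lambda>i. prod_module (hom_mod B x y i) (hom_mod B x y (i - 1))),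
       cdiff = (\<lambda>i (a, b). (hom_diff B x y i a \<oplus>\<^bsub>hom_mod B x y (i - 1)\<^esub> b,
         \<ominus>\<^bsub>hom_mod B x y (i - 2)\<^esub> hom_diff B x y (i - 1) b))\<rparr>),
     Cmp = (\<lambda>x y z i j (a, b) (a', b'). (Cmp B x y z i j a a', Cmp B x y z (i - 1) j b a' \<oplus>\<^bsub>hom_mod B x z (i + j - 1)\<^esub>
       sign R i \<odot>\<^bsub>hom_mod B x z (i + j - 1)\<^esub> Cmp B x y z i (j - 1) a b')),
     Idt = (\<lambda>x. (Idt B x, \<zero>\<^bsub>hom_mod B x x (- 1)\<^esub>))\<rparr>"

definition cone_incl :: "('o, 'r, 'a) dgcat \<Rightarrow> ('o, 'a, 'o, 'a \<times> 'a) dgfun" where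
  "cone_incl B = \<lparr>fob = (\<lambda>x. x), fmor = (\<lambda>x y i a. (a, \<zero>\<^bsub>hom_mod B x y (i - 1)\<^esub>))\<rparr>"

context dg_category
begin

abbreviation "K \<equiv> cone_dgcat R A"

lemma cone_simps:
  "Obj K = Obj A"
  "hom_mod K x y i = prod_module (hom_mod A x y i) (hom_mod A x y (i - 1))"
  "hom_diff K x y i (a, b) = (hom_diff A x y i a \<oplus>\<^bsub>hom_mod A x y (i - 1)\<^esub> b, \<ominus>\<^bsub>hom_mod A x y (i - 2)\<^esub> hom_diff A x y (i - 1) b)"
  "Cmp K x y z i j (a, b) (a', b') = (Cmp A x y z i j a a', Cmp A x y z (i - 1) j b a' \<oplus>\<^bsub>hom_mod A x z (i + j - 1)\<^esub>
       sign R i \<odot>\<^bsub>hom_mod A x z (i + j - 1)\<^esub> Cmp A x y z i (j - 1) a b')"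
  "Idt K x = (Idt A x, \<zero>\<^bsub>hom_mod A x x (- 1)\<^esub>)"
  by (simp_all add: cone_dgcat_def)

text \<open>In terms of \<open>h\<close> the differential is
  \<open>d(a + h b) = (da + b) - h db\<close>. From \<open>a h = (-1)^i h a\<close>, for
  \<open>a\<close> of degree \<open>i\<close>, and \<open>h h = 0\<close> one gets the product
  \<open>a a' + h (b a' + (-1)^i a b')\<close>.\<close>

lemma cone_dg_category: "dg_category R K"
proof (rule dg_categoryI[OF is_cring], unfold cone_simps(1), goal_cases)
  case (1 x y)
  interpret H: module R "hom_mod A x y i" for i by (rule hom_module[OF 1])
  show ?case
  proof (rule chain_complexI, goal_cases)
    case (1 i) show ?case unfolding cone_simps by (intro prod_module H.module_axioms)
  next
    case (2 i)
    note c = hom_diff_closed[OF 1] hom_diff_closed[OF 1, of _ "i - 1", simplified]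
    show ?case
      by (rule linear_mapI)
        (use 1 c in \<open>auto simp: cone_simps hom_diff_add hom_diff_smult H.M.minus_add H.M.a_ac H.smult_r_distr H.smult_r_minus\<close>)
  next
    case (3 a i)
    then obtain a1 a2 where a: "a = (a1, a2)" "a1 \<in> hom_set A x y i" "a2 \<in> hom_set A x y (i - 1)" by (auto simp: cone_simps)
    note c = hom_diff_closed[OF 1 a(2)] hom_diff_closed[OF 1 a(3), simplified]
    note m = linear_map_minus[OF hom_diff_linear[OF 1] hom_module[OF 1] hom_module[OF 1] c(2)]
    show ?case using a c m hom_diff_diff[OF 1 a(2)] hom_diff_diff[OF 1 a(3)] 1
      by (simp add: cone_simps hom_diff_add H.M.r_neg H.a_inv_zero)
  qed
next
  case (2 x) then show ?case by (simp add: cone_simps Idt_closed hom_zero_closed)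
next
  case (3 x y z i j f)
  interpret H: module R "hom_mod A x z (i + j - 1)" by (rule hom_module[OF 3(1,3)])
  obtain f1 f2 where f: "f = (f1, f2)" "f1 \<in> hom_set A x y j" "f2 \<in> hom_set A x y (j - 1)" using 3 by (auto simp: cone_simps)
  note s = sign_closed[OF is_cring, of i]
  have c: "g1 \<in> hom_set A y z (i - 1) \<Longrightarrow> Cmp A x y z (i - 1) j g1 f1 \<in> hom_set A x z (i + j - 1)"
    "g2 \<in> hom_set A y z i \<Longrightarrow> Cmp A x y z i (j - 1) g2 f2 \<in> hom_set A x z (i + j - 1)" for g1 g2
    using 3(1-3) f by (auto intro!: Cmp_closed')
  show ?case
    by (rule linear_mapI)
      (use 3(1-3) f s c in \<open>auto simp: cone_simps Cmp_closed Cmp_add_left[where k = "i + j - 1"] Cmp_add_left[where k = "i + j"]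
        Cmp_smult_left[where k = "i + j - 1"] Cmp_smult_left[where k = "i + j"] H.smult_r_distr H.M.a_ac H.smult_assoc1[symmetric] m_comm\<close>)
next
  case (4 x y z i j g)
  interpret H: module R "hom_mod A x z (i + j - 1)" by (rule hom_module[OF 4(1,3)])
  obtain g1 g2 where g: "g = (g1, g2)" "g1 \<in> hom_set A y z i" "g2 \<in> hom_set A y z (i - 1)" using 4 by (auto simp: cone_simps)
  note s = sign_closed[OF is_cring, of i]
  have c: "f1 \<in> hom_set A x y j \<Longrightarrow> Cmp A x y z (i - 1) j g2 f1 \<in> hom_set A x z (i + j - 1)"
    "f2 \<in> hom_set A x y (j - 1) \<Longrightarrow> Cmp A x y z i (j - 1) g1 f2 \<in> hom_set A x z (i + j - 1)" for f1 f2
    using 4(1-3) g by (auto intro!: Cmp_closed')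
  show ?case
    by (rule linear_mapI)
      (use 4(1-3) g s c in \<open>auto simp: cone_simps Cmp_closed Cmp_add_right[where k = "i + j - 1"] Cmp_add_right[where k = "i + j"]
        Cmp_smult_right[where k = "i + j - 1"] Cmp_smult_right[where k = "i + j"] H.smult_r_distr H.M.a_ac H.smult_assoc1[symmetric] m_comm\<close>)
next
  case (5 x y z i j g f)
  note o = 5(1-3)
  interpret H1: module R "hom_mod A x z (i + j - 1)" by (rule hom_module[OF o(1,3)])
  interpret H: module R "hom_mod A x z (i + j - 2)" by (rule hom_module[OF o(1,3)])
  obtain f1 f2 where f: "f = (f1, f2)" "f1 \<in> hom_set A x y j" "f2 \<in> hom_set A x y (j - 1)" using 5 by (auto simp: cone_simps)
  obtain g1 g2 where g: "g = (g1, g2)" "g1 \<in> hom_set A y z i" "g2 \<in> hom_set A y z (i - 1)" using 5 by (auto simp: cone_simps)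
  note s = sign_closed[OF is_cring, of i]
  note df = hom_diff_closed[OF o(1,2) f(2)] hom_diff_closed[OF o(1,2) f(3), simplified]
  note dg = hom_diff_closed[OF o(2,3) g(2)] hom_diff_closed[OF o(2,3) g(3), simplified]
  have e: "i - 1 + j = i + j - 1" "i + (j - 1) = i + j - 1" "i - 1 + (j - 1) = i + j - 2" "i - 2 + j = i + j - 2" "i + (j - 2) = i + j - 2" by auto
  \<comment> \<open>The cross term \<open>w5 = b b'\<close> appears twice because
    \<open>d h = 1\<close> can hit either factor. Its coefficients are \<open>sign R (i - 1)\<close>
    and \<open>sign R i\<close>, so it cancels.\<close>
  define w1 w2 w3 w4 w5 where w: "w1 = Cmp A x y z (i - 2) j (hom_diff A y z (i - 1) g2) f1"
    "w2 = Cmp A x y z (i - 1) (j - 1) g2 (hom_diff A x y j f1)" "w3 = Cmp A x y z (i - 1) (j - 1) (hom_diff A y z i g1) f2"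
    "w4 = Cmp A x y z i (j - 2) g1 (hom_diff A x y (j - 1) f2)" "w5 = Cmp A x y z (i - 1) (j - 1) g2 f2"
  have wc: "w1 \<in> hom_set A x z (i + j - 2)" "w2 \<in> hom_set A x z (i + j - 2)" "w3 \<in> hom_set A x z (i + j - 2)"
    "w4 \<in> hom_set A x z (i + j - 2)" "w5 \<in> hom_set A x z (i + j - 2)"
    unfolding w using o f g df dg by (auto intro!: Cmp_closed')
  have c: "Cmp A x y z (i - 1) j g2 f1 \<in> hom_set A x z (i + j - 1)" "Cmp A x y z i (j - 1) g1 f2 \<in> hom_set A x z (i + j - 1)"
    "Cmp A x y z (i - 1) j (hom_diff A y z i g1) f1 \<in> hom_set A x z (i + j - 1)" "Cmp A x y z i (j - 1) g1 (hom_diff A x y j f1) \<in> hom_set A x z (i + j - 1)"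
    using o f g df dg by (auto intro!: Cmp_closed')
  have d1: "hom_diff A x z (i + j - 1) (Cmp A x y z (i - 1) j g2 f1) = w1 \<oplus>\<^bsub>hom_mod A x z (i + j - 2)\<^esub> \<ominus>\<^bsub>hom_mod A x z (i + j - 2)\<^esub> (sign R i \<odot>\<^bsub>hom_mod A x z (i + j - 2)\<^esub> w2)"
    using Cmp_diff_sign[OF o g(3) f(2)] wc s by (simp add: e w sign_Suc[OF is_cring] H.smult_l_minus)
  have d2: "hom_diff A x z (i + j - 1) (Cmp A x y z i (j - 1) g1 f2) = w3 \<oplus>\<^bsub>hom_mod A x z (i + j - 2)\<^esub> sign R i \<odot>\<^bsub>hom_mod A x z (i + j - 2)\<^esub> w4"
    using Cmp_diff_sign[OF o g(2) f(3)] by (simp add: e w)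
  have d3: "hom_diff A x z (i + j - 1) (Cmp A x y z (i - 1) j g2 f1 \<oplus>\<^bsub>hom_mod A x z (i + j - 1)\<^esub> sign R i \<odot>\<^bsub>hom_mod A x z (i + j - 1)\<^esub> Cmp A x y z i (j - 1) g1 f2) =
     (w1 \<oplus>\<^bsub>hom_mod A x z (i + j - 2)\<^esub> \<ominus>\<^bsub>hom_mod A x z (i + j - 2)\<^esub> (sign R i \<odot>\<^bsub>hom_mod A x z (i + j - 2)\<^esub> w2)) \<oplus>\<^bsub>hom_mod A x z (i + j - 2)\<^esub>
      (sign R i \<odot>\<^bsub>hom_mod A x z (i + j - 2)\<^esub> w3 \<oplus>\<^bsub>hom_mod A x z (i + j - 2)\<^esub> w4)"
    using hom_diff_add[OF o(1,3) c(1) H1.smult_closed[OF s c(2)]] hom_diff_smult[OF o(1,3) s c(2)] d1 d2 wc s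
    by (simp add: H.smult_r_distr H.sign_smult)
  have r1: "Cmp A x y z (i - 2) j (\<ominus>\<^bsub>hom_mod A y z (i - 2)\<^esub> hom_diff A y z (i - 1) g2) f1 = \<ominus>\<^bsub>hom_mod A x z (i + j - 2)\<^esub> w1"
    using linear_map_minus[OF Cmp_linear_left[OF o f(2)] hom_module[OF o(2,3)] hom_module[OF o(1,3)] dg(2)] by (simp add: e w)
  have r2: "Cmp A x y z (i - 1) (j - 1) (hom_diff A y z i g1 \<oplus>\<^bsub>hom_mod A y z (i - 1)\<^esub> g2) f2 = w3 \<oplus>\<^bsub>hom_mod A x z (i + j - 2)\<^esub> w5"
    using Cmp_add_left[OF o dg(1) g(3) f(3), of "i + j - 2"] by (simp add: w)
  have r3: "Cmp A x y z (i - 1) (j - 1) g2 (hom_diff A x y j f1 \<oplus>\<^bsub>hom_mod A x y (j - 1)\<^esub> f2) = w2 \<oplus>\<^bsub>hom_mod A x z (i + j - 2)\<^esub> w5"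
    using Cmp_add_right[OF o g(3) df(1) f(3), of "i + j - 2"] by (simp add: w)
  have r4: "Cmp A x y z i (j - 2) g1 (\<ominus>\<^bsub>hom_mod A x y (j - 2)\<^esub> hom_diff A x y (j - 1) f2) = \<ominus>\<^bsub>hom_mod A x z (i + j - 2)\<^esub> w4"
    using linear_map_minus[OF Cmp_linear_right[OF o g(2)] hom_module[OF o(1,2)] hom_module[OF o(1,3)] df(2)] by (simp add: e w)
  have r5: "Cmp A x y z (i - 1) j (hom_diff A y z i g1 \<oplus>\<^bsub>hom_mod A y z (i - 1)\<^esub> g2) f1 =
      Cmp A x y z (i - 1) j (hom_diff A y z i g1) f1 \<oplus>\<^bsub>hom_mod A x z (i + j - 1)\<^esub> Cmp A x y z (i - 1) j g2 f1"
    using Cmp_add_left[OF o dg(1) g(3) f(2), of "i + j - 1"] by simp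
  have r6: "Cmp A x y z i (j - 1) g1 (hom_diff A x y j f1 \<oplus>\<^bsub>hom_mod A x y (j - 1)\<^esub> f2) =
      Cmp A x y z i (j - 1) g1 (hom_diff A x y j f1) \<oplus>\<^bsub>hom_mod A x z (i + j - 1)\<^esub> Cmp A x y z i (j - 1) g1 f2"
    using Cmp_add_right[OF o g(2) df(1) f(3), of "i + j - 1"] by simp
  let ?s = "\<lambda>v. sign R i \<odot>\<^bsub>hom_mod A x z (i + j - 2)\<^esub> v"
  have sw: "?s w2 \<in> hom_set A x z (i + j - 2)" "?s w3 \<in> hom_set A x z (i + j - 2)" "?s w5 \<in> hom_set A x z (i + j - 2)"
    using wc s by auto
  define n where "n = \<ominus>\<^bsub>hom_mod A x z (i + j - 2)\<^esub> ?s w5"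
  have n: "n \<in> hom_set A x z (i + j - 2)" "?s w5 \<oplus>\<^bsub>hom_mod A x z (i + j - 2)\<^esub> n = \<zero>\<^bsub>hom_mod A x z (i + j - 2)\<^esub>"
    using sw by (auto simp: n_def H.M.r_neg)
  have "(\<ominus>\<^bsub>hom_mod A x z (i + j - 2)\<^esub> w1 \<oplus>\<^bsub>hom_mod A x z (i + j - 2)\<^esub> (\<ominus>\<^bsub>hom_mod A x z (i + j - 2)\<^esub> ?s w3 \<oplus>\<^bsub>hom_mod A x z (i + j - 2)\<^esub> n)) \<oplus>\<^bsub>hom_mod A x z (i + j - 2)\<^esub>
      ((?s w2 \<oplus>\<^bsub>hom_mod A x z (i + j - 2)\<^esub> ?s w5) \<oplus>\<^bsub>hom_mod A x z (i + j - 2)\<^esub> \<ominus>\<^bsub>hom_mod A x z (i + j - 2)\<^esub> w4) =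
    (?s w5 \<oplus>\<^bsub>hom_mod A x z (i + j - 2)\<^esub> n) \<oplus>\<^bsub>hom_mod A x z (i + j - 2)\<^esub> \<ominus>\<^bsub>hom_mod A x z (i + j - 2)\<^esub>
      ((w1 \<oplus>\<^bsub>hom_mod A x z (i + j - 2)\<^esub> \<ominus>\<^bsub>hom_mod A x z (i + j - 2)\<^esub> ?s w2) \<oplus>\<^bsub>hom_mod A x z (i + j - 2)\<^esub> (?s w3 \<oplus>\<^bsub>hom_mod A x z (i + j - 2)\<^esub> w4))"
    using wc sw n(1) by (simp add: H.M.minus_add H.M.a_ac)
  then have "\<ominus>\<^bsub>hom_mod A x z (i + j - 2)\<^esub> ((w1 \<oplus>\<^bsub>hom_mod A x z (i + j - 2)\<^esub> \<ominus>\<^bsub>hom_mod A x z (i + j - 2)\<^esub> ?s w2) \<oplus>\<^bsub>hom_mod A x z (i + j - 2)\<^esub> (?s w3 \<oplus>\<^bsub>hom_mod A x z (i + j - 2)\<^esub> w4)) =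
    (\<ominus>\<^bsub>hom_mod A x z (i + j - 2)\<^esub> w1 \<oplus>\<^bsub>hom_mod A x z (i + j - 2)\<^esub> sign R (i - 1) \<odot>\<^bsub>hom_mod A x z (i + j - 2)\<^esub> (w3 \<oplus>\<^bsub>hom_mod A x z (i + j - 2)\<^esub> w5)) \<oplus>\<^bsub>hom_mod A x z (i + j - 2)\<^esub>
      ?s ((w2 \<oplus>\<^bsub>hom_mod A x z (i + j - 2)\<^esub> w5) \<oplus>\<^bsub>hom_mod A x z (i + j - 2)\<^esub> ?s (\<ominus>\<^bsub>hom_mod A x z (i + j - 2)\<^esub> w4))"
    unfolding n(2) using wc sw s unfolding n_def
    by (simp add: sign_Suc[OF is_cring] H.smult_l_minus H.smult_r_distr H.sign_smult H.smult_r_minus)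
  then show ?case
    using Cmp_diff_sign[OF o g(2) f(2)] d3 c s
    by (simp add: cone_simps f(1) g(1) e r1 r2 r3 r4 r5 r6 H1.smult_r_distr H1.M.a_ac)
next
  case (6 v x y z i j k h g f)
  note o = 6(1-4)
  obtain f1 f2 where f: "f = (f1, f2)" "f1 \<in> hom_set A v x k" "f2 \<in> hom_set A v x (k - 1)" using 6 by (auto simp: cone_simps)
  obtain g1 g2 where g: "g = (g1, g2)" "g1 \<in> hom_set A x y j" "g2 \<in> hom_set A x y (j - 1)" using 6 by (auto simp: cone_simps)
  obtain h1 h2 where h: "h = (h1, h2)" "h1 \<in> hom_set A y z i" "h2 \<in> hom_set A y z (i - 1)" using 6 by (auto simp: cone_simps)
  interpret H: module R "hom_mod A v z (i + j + k - 1)" by (rule hom_module[OF o(1,4)])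
  interpret Hr: module R "hom_mod A v y (j + k - 1)" by (rule hom_module[OF o(1,3)])
  interpret Hl: module R "hom_mod A x z (i + j - 1)" by (rule hom_module[OF o(2,4)])
  note s = sign_closed[OF is_cring]
  have e: "i + (j + k) = i + j + k" "i - 1 + j = i + j - 1" "j - 1 + k = j + k - 1" "i + (j - 1) = i + j - 1" "j + (k - 1) = j + k - 1" by auto
  define u1 u2 u3 where u: "u1 = Cmp A v y z (i - 1) (j + k) h2 (Cmp A v x y j k g1 f1)"
    "u2 = Cmp A v y z i (j + k - 1) h1 (Cmp A v x y (j - 1) k g2 f1)"
    "u3 = Cmp A v y z i (j + k - 1) h1 (Cmp A v x y j (k - 1) g1 f2)"
  have uc: "u1 \<in> hom_set A v z (i + j + k - 1)" "u2 \<in> hom_set A v z (i + j + k - 1)" "u3 \<in> hom_set A v z (i + j + k - 1)"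
    unfolding u using o f g h by (auto intro!: Cmp_closed')
  have cl: "Cmp A x y z (i - 1) j h2 g1 \<in> hom_set A x z (i + j - 1)" "Cmp A x y z i (j - 1) h1 g2 \<in> hom_set A x z (i + j - 1)"
    "Cmp A v x y (j - 1) k g2 f1 \<in> hom_set A v y (j + k - 1)" "Cmp A v x y j (k - 1) g1 f2 \<in> hom_set A v y (j + k - 1)"
    using o f g h by (auto intro!: Cmp_closed')
  have 1: "Cmp A v x z (i + j - 1) k (Cmp A x y z (i - 1) j h2 g1) f1 = u1"
    using Cmp_assoc[OF o h(3) g(2) f(2)] by (simp add: u e)
  have 2: "Cmp A v x z (i + j - 1) k (Cmp A x y z i (j - 1) h1 g2) f1 = u2"
    using Cmp_assoc[OF o h(2) g(3) f(2)] by (simp add: u e)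
  have 3: "Cmp A v x z (i + j) (k - 1) (Cmp A x y z i j h1 g1) f2 = u3"
    using Cmp_assoc[OF o h(2) g(2) f(3)] by (simp add: u e)
  have 4: "Cmp A v x z (i + j - 1) k (Cmp A x y z (i - 1) j h2 g1 \<oplus>\<^bsub>hom_mod A x z (i + j - 1)\<^esub>
      sign R i \<odot>\<^bsub>hom_mod A x z (i + j - 1)\<^esub> Cmp A x y z i (j - 1) h1 g2) f1 =
    u1 \<oplus>\<^bsub>hom_mod A v z (i + j + k - 1)\<^esub> sign R i \<odot>\<^bsub>hom_mod A v z (i + j + k - 1)\<^esub> u2"
    using Cmp_add_left[OF o(1,2,4) cl(1) Hl.smult_closed[OF s cl(2)] f(2), of "i + j + k - 1"]
      Cmp_smult_left[OF o(1,2,4) s cl(2) f(2), of "i + j + k - 1"] 1 2 by simp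
  have 5: "Cmp A v y z i (j + k - 1) h1 (Cmp A v x y (j - 1) k g2 f1 \<oplus>\<^bsub>hom_mod A v y (j + k - 1)\<^esub>
      sign R j \<odot>\<^bsub>hom_mod A v y (j + k - 1)\<^esub> Cmp A v x y j (k - 1) g1 f2) =
    u2 \<oplus>\<^bsub>hom_mod A v z (i + j + k - 1)\<^esub> sign R j \<odot>\<^bsub>hom_mod A v z (i + j + k - 1)\<^esub> u3"
    using Cmp_add_right[OF o(1,3,4) h(2) cl(3) Hr.smult_closed[OF s cl(4)], of "i + j + k - 1"]
      Cmp_smult_right[OF o(1,3,4) s h(2) cl(4), of "i + j + k - 1"] by (simp add: u)
  show ?case
    using Cmp_assoc[OF o h(2) g(2) f(2)] uc s[of i] s[of j] 3 4 5
    by (simp add: cone_simps f(1) g(1) h(1) e u(1)[symmetric] sign_sign(2)[OF is_cring] H.smult_r_distr H.smult_assoc1 H.M.a_assoc)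
next
  case (7 x y i f)
  interpret H: module R "hom_mod A x y (i - 1)" by (rule hom_module[OF 7(1,2)])
  obtain f1 f2 where f: "f = (f1, f2)" "f1 \<in> hom_set A x y i" "f2 \<in> hom_set A x y (i - 1)" using 7 by (auto simp: cone_simps)
  show ?case using f 7(1,2) Cmp_zero_left[OF 7(1,2,2) f(2), of "-1"] by (simp add: cone_simps Cmp_Idt_left sign_def)
next
  case (8 x y i f)
  interpret H: module R "hom_mod A x y (i - 1)" by (rule hom_module[OF 8(1,2)])
  obtain f1 f2 where f: "f = (f1, f2)" "f1 \<in> hom_set A x y i" "f2 \<in> hom_set A x y (i - 1)" using 8 by (auto simp: cone_simps)
  show ?case using f 8(1,2) Cmp_zero_right[OF 8(1,1,2) f(2), of "-1"] by (simp add: cone_simps Cmp_Idt_right sign_closed[OF is_cring])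
qed

lemma cone_incl_functor: "dg_functor R A K (cone_incl A)"
proof (rule dg_functorI[OF dg_category_axioms cone_dg_category])
  fix x y i assume o: "x \<in> Obj A" "y \<in> Obj A"
  interpret H: module R "hom_mod A x y i" for i by (rule hom_module[OF o])
  show "linear_map R (hom_mod A x y i) (hom_mod K (fob (cone_incl A) x) (fob (cone_incl A) y) i) (fmor (cone_incl A) x y i)"
    by (rule linear_mapI) (auto simp: cone_incl_def cone_simps)
  fix a assume a: "a \<in> hom_set A x y i"
  show "fmor (cone_incl A) x y (i - 1) (hom_diff A x y i a) = hom_diff K (fob (cone_incl A) x) (fob (cone_incl A) y) i (fmor (cone_incl A) x y i a)"
    using o hom_diff_closed[OF o a] hom_diff_zero[OF o, of "i - 1"] by (simp add: cone_incl_def cone_simps H.a_inv_zero)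
next
  fix x y z i j g f
  assume o: "x \<in> Obj A" "y \<in> Obj A" "z \<in> Obj A" and gf: "g \<in> hom_set A y z i" "f \<in> hom_set A x y j"
  interpret H: module R "hom_mod A x z (i + j - 1)" by (rule hom_module[OF o(1,3)])
  have e: "i - 1 + j = i + j - 1" "i + (j - 1) = i + j - 1" by auto
  show "fmor (cone_incl A) x z (i + j) (Cmp A x y z i j g f) = Cmp K (fob (cone_incl A) x) (fob (cone_incl A) y)
     (fob (cone_incl A) z) i j (fmor (cone_incl A) y z i g) (fmor (cone_incl A) x y j f)"
    using Cmp_zero_left[OF o gf(2), of "i - 1"] Cmp_zero_right[OF o gf(1), of "j - 1"]
    by (simp add: cone_incl_def cone_simps e sign_closed[OF is_cring])
qed (auto simp: cone_incl_def cone_simps)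

end

section \<open>Injectivity and induction for attached cells\<close>

context attach_cells
begin

lemma attach_incl_inj:
  assumes o: "x \<in> Obj B" "y \<in> Obj B" and ab: "a \<in> hom_set B x y i" "b \<in> hom_set B x y i"
    and eq: "fmor (attach_incl R k B) x y i a = fmor (attach_incl R k B) x y i b"
  shows "a = b"
proof -
  \<comment> \<open>The cell on \<open>c\<close> is evaluated at \<open>(0, c)\<close>, that is
    \<open>h c\<close>, whose boundary is \<open>c\<close> because \<open>c\<close> is a cycle.
    Evaluation respects the relations, and the first component recovers an old morphism.\<close>
  interpret X: attach_extension R B k "cone_dgcat R B" "cone_incl B" "\<lambda>m x y c. (\<zero>\<^bsub>hom_mod B x y (m + 1)\<^esub>, c)"
  proof (unfold_locales, rule cone_incl_functor)
    fix m x y c assume a: "x \<in> Obj B" "y \<in> Obj B" "c \<in> cycles (Mor B x y) m"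
    interpret H: module R "hom_mod B x y i" for i by (rule hom_module[OF a(1,2)])
    show "(\<zero>\<^bsub>hom_mod B x y (m + 1)\<^esub>, c) \<in> hom_set (cone_dgcat R B) (fob (cone_incl B) x) (fob (cone_incl B) y) (m + 1) \<and>
      hom_diff (cone_dgcat R B) (fob (cone_incl B) x) (fob (cone_incl B) y) (m + 1) (\<zero>\<^bsub>hom_mod B x y (m + 1)\<^esub>, c) = fmor (cone_incl B) x y m c"
      using a hom_diff_zero[OF a(1,2), of "m + 1"] by (simp add: cone_incl_def cone_simps cycles_def H.a_inv_zero)
  qed
  have "wf_expr R k B (Old a) x y i" "wf_expr R k B (Old b) x y i" using o ab by auto
  then have "expr_eq R k B x y i (Old a) (Old b)" using eq by (simp add: attach_incl_def repr_iff)
  then show ?thesis using X.ev_cong by (force simp: cone_incl_def)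
qed

text \<open>Induction over expressions, transported to morphisms of the pushout so that no
  representative appears in \<open>P\<close>. The zero morphism is covered by the case of old
  morphisms.\<close>

lemma attach_hom_induct:
  assumes h: "h \<in> hom_set (attach R k B) x y d"
    and old: "\<And>x y d a. \<lbrakk>x \<in> Obj B; y \<in> Obj B; a \<in> hom_set B x y d\<rbrakk> \<Longrightarrow> P x y d (fmor (attach_incl R k B) x y d a)"
    and bound: "\<And>m x y c. \<lbrakk>m > k; x \<in> Obj B; y \<in> Obj B; c \<in> cycles (Mor B x y) m\<rbrakk> \<Longrightarrow> P x y (m + 1) (bounding_chain R k B m x y c)"
    and add: "\<And>x y d a b. \<lbrakk>x \<in> Obj B; y \<in> Obj B; a \<in> hom_set (attach R k B) x y d; b \<in> hom_set (attach R k B) x y d; P x y d a; P x y d b\<rbrakk> \<Longrightarrow>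
      P x y d (a \<oplus>\<^bsub>hom_mod (attach R k B) x y d\<^esub> b)"
    and smult: "\<And>x y d r a. \<lbrakk>x \<in> Obj B; y \<in> Obj B; r \<in> carrier R; a \<in> hom_set (attach R k B) x y d; P x y d a\<rbrakk> \<Longrightarrow>
      P x y d (r \<odot>\<^bsub>hom_mod (attach R k B) x y d\<^esub> a)"
    and comp: "\<And>x y z i j g f. \<lbrakk>x \<in> Obj B; y \<in> Obj B; z \<in> Obj B; g \<in> hom_set (attach R k B) y z i; f \<in> hom_set (attach R k B) x y j;
      P y z i g; P x y j f\<rbrakk> \<Longrightarrow> P x z (i + j) (Cmp (attach R k B) x y z i j g f)"
  shows "P x y d h"
proof -
  have "P x y d (rp x y d e)" if "wf e x y d" for e using that
  proof (induction e arbitrary: x y d)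
    case (Old e) then show ?case using old[of x y e d] by (simp add: attach_incl_def)
  next
    case (Bound m u v c) then show ?case using bound[of m u v c] by (auto simp: bounding_chain_def)
  next
    case Zero
    then show ?case using old[of x y "\<zero>\<^bsub>hom_mod B x y d\<^esub>" d] dg_functor_zero[OF attach_incl_functor, of x y d]
      by (simp add: attach_incl_def cl_zero hom_zero_closed)
  next
    case (Plus e1 e2)
    then show ?case using add[of x y "rp x y d e1" d "rp x y d e2"] wf_Obj[of e1 x y d] by (simp add: cl_plus rp_closed)
  next
    case (Scale r e)
    then show ?case using smult[of x y r "rp x y d e" d] wf_Obj[of e x y d] by (simp add: cl_scale rp_closed)
  next
    case (Comp v i j g f)
    then have "rp x y d (Comp v i j g f) = Cmp (attach R k B) x v y i j (rp v y i g) (rp x v j f)"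
      by (simp add: attach_simps(7) rp_comp)
    then show ?case using Comp comp[of x v y "rp v y i g" i "rp x v j f" j] wf_Obj[of g v y i] wf_Obj[of f x v j] by (simp add: rp_closed)
  qed simp
  then show ?thesis using h by (auto simp: attach_simps)
qed

end

section \<open>Colimits of sequences\<close>

lemma dgfun_id_functor: "dg_category R A \<Longrightarrow> dg_functor R A A dgfun_id"
  by (rule dg_functorI) (auto simp: dgfun_id_def dg_category.hom_diff_closed intro!: linear_mapI)

lemma dgfun_eqD:
  assumes "dgfun_eq A F G"
  shows "x \<in> Obj A \<Longrightarrow> fob F x = fob G x"
    and "\<lbrakk>x \<in> Obj A; y \<in> Obj A; a \<in> hom_set A x y i\<rbrakk> \<Longrightarrow> fmor F x y i a = fmor G x y i a"
  using assms by (auto simp: dgfun_eq_def)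

text \<open>The fields of a \<open>dgfun\<close> are total functions with arbitrary values outside
  the category, so two constructions of one functor agree only up to
  \<open>dgfun_eq\<close>.\<close>

lemma dg_functor_cong:
  assumes F: "dg_functor R A B F" and eq: "dgfun_eq A F G"
  shows "dg_functor R A B G"
proof -
  interpret A: dg_category R A by (rule dg_functorD(1)[OF F])
  have o: "fob G x = fob F x" if "x \<in> Obj A" for x using dgfun_eqD(1)[OF eq that] by simp
  have m: "fmor G x y i a = fmor F x y i a" if "x \<in> Obj A" "y \<in> Obj A" "a \<in> hom_set A x y i" for x y i a
    using dgfun_eqD(2)[OF eq that] by simp
  note L = linear_mapD[OF dg_functorD(4)[OF F]]
  show ?thesis
  proof (rule dg_functorI[OF dg_functorD(1,2)[OF F]], goal_cases)
    case (2 x y i)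
    note cl = module.module_simprules(1,18)[OF A.hom_module[OF 2]]
    show ?case by (rule linear_mapI) (use 2 L cl in \<open>simp_all add: o m\<close>)
  qed (simp_all add: o m dg_functorD[OF F] A.hom_diff_closed A.Idt_closed A.Cmp_closed)
qed

locale dg_sequence =
  fixes R :: "('b, 'x) ring_scheme" (structure) and D :: "nat \<Rightarrow> ('o, 'b, 'a) dgcat" and J :: "nat \<Rightarrow> ('o, 'a, 'o, 'a) dgfun"
  assumes J: "dg_functor R (D i) (D (Suc i)) (J i)" and fob_J: "fob (J i) x = x" and Obj_Suc: "Obj (D (Suc i)) = Obj (D i)"
begin

sublocale D: dg_category R "D i" for i by (rule dg_functorD(1)[OF J])

definition ob where "ob = Obj (D 0)"

lemma Obj_D: "Obj (D i) = ob"
  by (induction i) (simp_all add: ob_def Obj_Suc)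

abbreviation up where "up x y d i l a \<equiv> push J x y d i (l - i) a"
abbreviation cc where "cc x y d i a \<equiv> colim_class D J x y d i a"

lemmas J_hom = dg_functor_hom[OF J, unfolded Obj_D fob_J]
lemmas J_linear = dg_functorD(4)[OF J, unfolded Obj_D fob_J]
lemmas J_diff = dg_functorD(5)[OF J, unfolded Obj_D fob_J]
lemmas J_Idt = dg_functorD(6)[OF J, unfolded Obj_D fob_J]
lemmas J_Cmp = dg_functorD(7)[OF J, unfolded Obj_D fob_J]
lemmas D_module = D.hom_module[unfolded Obj_D]
lemmas D_diff_closed = D.hom_diff_closed[unfolded Obj_D]
lemma push_closed: "\<lbrakk>x \<in> ob; y \<in> ob; a \<in> hom_set (D i) x y d\<rbrakk> \<Longrightarrow> push J x y d i l a \<in> hom_set (D (i + l)) x y d"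
  by (induction l) (auto simp: J_hom)

lemma push_push: "push J x y d (i + l) m (push J x y d i l a) = push J x y d i (l + m) a"
  by (induction m) (auto simp: add.assoc)

lemma push_linear: assumes "x \<in> ob" "y \<in> ob" shows "linear_map R (hom_mod (D i) x y d) (hom_mod (D (i + l)) x y d) (push J x y d i l)"
proof (induction l)
  case 0 show ?case by (auto intro!: linear_mapI)
next
  case (Suc l)
  show ?case by (rule linear_mapI) (use linear_mapD[OF Suc] linear_mapD[OF J_linear[OF assms]] in auto)
qed

lemma push_diff: "\<lbrakk>x \<in> ob; y \<in> ob; a \<in> hom_set (D i) x y d\<rbrakk> \<Longrightarrow>
    push J x y (d - 1) i l (hom_diff (D i) x y d a) = hom_diff (D (i + l)) x y d (push J x y d i l a)"
  by (induction l) (auto simp: J_diff push_closed)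

lemma push_Idt: "x \<in> ob \<Longrightarrow> push J x x 0 i l (Idt (D i) x) = Idt (D (i + l)) x"
  by (induction l) (auto simp: J_Idt)

lemma push_Cmp: "\<lbrakk>x \<in> ob; y \<in> ob; z \<in> ob; g \<in> hom_set (D i) y z d; f \<in> hom_set (D i) x y e\<rbrakk> \<Longrightarrow>
    push J x z (d + e) i l (Cmp (D i) x y z d e g f) = Cmp (D (i + l)) x y z d e (push J y z d i l g) (push J x y e i l f)"
  by (induction l) (auto simp: J_Cmp push_closed)

lemma up_closed: "\<lbrakk>x \<in> ob; y \<in> ob; a \<in> hom_set (D i) x y d; i \<le> l\<rbrakk> \<Longrightarrow> up x y d i l a \<in> hom_set (D l) x y d"
  using push_closed[of x y a i d "l - i"] by simp

lemma up_up: "\<lbrakk>i \<le> l; l \<le> m\<rbrakk> \<Longrightarrow> up x y d l m (up x y d i l a) = up x y d i m a"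
  using push_push[of x y d i "l - i" "m - l" a] by simp

lemma up_linear: "\<lbrakk>x \<in> ob; y \<in> ob; i \<le> l\<rbrakk> \<Longrightarrow> linear_map R (hom_mod (D i) x y d) (hom_mod (D l) x y d) (up x y d i l)"
  using push_linear[of x y i d "l - i"] by simp

lemma up_diff: "\<lbrakk>x \<in> ob; y \<in> ob; a \<in> hom_set (D i) x y d; i \<le> l\<rbrakk> \<Longrightarrow>
    up x y (d - 1) i l (hom_diff (D i) x y d a) = hom_diff (D l) x y d (up x y d i l a)"
  using push_diff[of x y a i d "l - i"] by simp

lemma up_Cmp: "\<lbrakk>x \<in> ob; y \<in> ob; z \<in> ob; g \<in> hom_set (D i) y z d; f \<in> hom_set (D i) x y e; i \<le> l\<rbrakk> \<Longrightarrow>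
    up x z (d + e) i l (Cmp (D i) x y z d e g f) = Cmp (D l) x y z d e (up y z d i l g) (up x y e i l f)"
  using push_Cmp[of x y z g i d f e "l - i"] by simp

lemma class_mem_iff: "(j, b) \<in> cc x y d i a \<longleftrightarrow> b \<in> hom_set (D j) x y d \<and> (\<exists>l. i \<le> l \<and> j \<le> l \<and> up x y d i l a = up x y d j l b)"
  by (simp add: colim_class_def)

lemma class_self: "a \<in> hom_set (D i) x y d \<Longrightarrow> (i, a) \<in> cc x y d i a"
  by (auto simp: class_mem_iff)

lemma up_eq_mono: "\<lbrakk>up x y d i l a = up x y d j l b; i \<le> l; j \<le> l; l \<le> m\<rbrakk> \<Longrightarrow> up x y d i m a = up x y d j m b"
  using up_up[of i l m x y d a] up_up[of j l m x y d b] by simp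

lemma class_eqI: assumes "i \<le> l" "j \<le> l" "up x y d i l a = up x y d j l b" shows "cc x y d i a = cc x y d j b"
proof -
  have *: "cc x y d i a \<subseteq> cc x y d j b" if "i \<le> l" "j \<le> l" "up x y d i l a = up x y d j l b" for i j a b
  proof safe
    fix k c assume "(k, c) \<in> cc x y d i a"
    then obtain m where m: "c \<in> hom_set (D k) x y d" "i \<le> m" "k \<le> m" "up x y d i m a = up x y d k m c" by (auto simp: class_mem_iff)
    have "up x y d i (max l m) a = up x y d k (max l m) c" by (rule up_eq_mono[OF m(4)]) (use m in auto)
    moreover have "up x y d i (max l m) a = up x y d j (max l m) b" by (rule up_eq_mono[OF that(3)]) (use that in auto)
    ultimately show "(k, c) \<in> cc x y d j b" using m that unfolding class_mem_iff by (intro conjI exI[of _ "max l m"]) auto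
  qed
  show ?thesis using *[of i j a b] *[of j i b a] assms by auto
qed

lemma class_up: "i \<le> l \<Longrightarrow> cc x y d l (up x y d i l a) = cc x y d i a"
  by (rule class_eqI[of _ l]) auto

lemma UN_class:
  assumes "a \<in> hom_set (D i) x y d"
    and "\<And>j b l. \<lbrakk>b \<in> hom_set (D j) x y d; i \<le> l; j \<le> l; up x y d i l a = up x y d j l b\<rbrakk> \<Longrightarrow> f j b = T"
  shows "(\<Union>(j, b)\<in>cc x y d i a. f j b) = T"
proof -
  have "\<And>p. p \<in> cc x y d i a \<Longrightarrow> (case p of (j, b) \<Rightarrow> f j b) = T" using assms(2) by (auto simp: class_mem_iff)
  then have "(\<Union>(j, b)\<in>cc x y d i a. f j b) = (\<Union>p\<in>cc x y d i a. T)" by (rule SUP_cong[OF HOL.refl])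
  then show ?thesis using class_self[OF assms(1)] by auto
qed

text \<open>Addition and composition in a colimit are unions over pairs of representatives, formed
  at the later of the two stages. Compatibility of \<open>f\<close> with the transition maps makes
  every pair give the same class.\<close>

lemma UN_class2:
  assumes o: "x \<in> ob" "y \<in> ob" "u \<in> ob" "v \<in> ob" and a: "a \<in> hom_set (D i) x y d" and b: "b \<in> hom_set (D i) u v e"
    and f: "\<And>l m a b. \<lbrakk>l \<le> m; a \<in> hom_set (D l) x y d; b \<in> hom_set (D l) u v e\<rbrakk> \<Longrightarrow>
      up s t k l m (f l a b) = f m (up x y d l m a) (up u v e l m b)"
  shows "(\<Union>(j, a')\<in>cc x y d i a. \<Union>(j', b')\<in>cc u v e i b. let l = max j j' in
      cc s t k l (f l (up x y d j l a') (up u v e j' l b'))) = cc s t k i (f i a b)"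
proof (rule UN_class[OF a], rule UN_class[OF b])
  fix j a' l j' b' l'
  assume a': "a' \<in> hom_set (D j) x y d" "i \<le> l" "j \<le> l" "up x y d i l a = up x y d j l a'"
    and b': "b' \<in> hom_set (D j') u v e" "i \<le> l'" "j' \<le> l'" "up u v e i l' b = up u v e j' l' b'"
  define m where "m = max j j'"
  \<comment> \<open>The operation is formed at stage \<open>m\<close>; only at the possibly later
    stage \<open>M\<close> do both representatives agree with \<open>a\<close> and
    \<open>b\<close>.\<close>
  define M where "M = max l l'"
  have le: "i \<le> M" "j \<le> m" "j' \<le> m" "m \<le> M" "j \<le> M" "j' \<le> M" using a' b' by (auto simp: m_def M_def)
  have ea: "up x y d i M a = up x y d j M a'" by (rule up_eq_mono[OF a'(4)]) (use a' in \<open>auto simp: M_def\<close>)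
  have eb: "up u v e i M b = up u v e j' M b'" by (rule up_eq_mono[OF b'(4)]) (use b' in \<open>auto simp: M_def\<close>)
  have "up s t k m M (f m (up x y d j m a') (up u v e j' m b')) = f M (up x y d j M a') (up u v e j' M b')"
    using f[OF le(4) up_closed[OF o(1,2) a'(1) le(2)] up_closed[OF o(3,4) b'(1) le(3)]] le by (simp add: up_up)
  also have "\<dots> = up s t k i M (f i a b)" using f[OF le(1) a b] ea eb by simp
  finally have "cc s t k m (f m (up x y d j m a') (up u v e j' m b')) = cc s t k i (f i a b)"
    by (rule class_eqI[OF le(4,1)])
  then show "(let l = max j j' in cc s t k l (f l (up x y d j l a') (up u v e j' l b'))) = cc s t k i (f i a b)"
    by (simp add: Let_def m_def)
qed

abbreviation Colim where "Colim \<equiv> colim_dgcat D J"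

lemma colim_directed: "dg_directed R D Colim (\<lambda>l x y d. cc x y d l)"
proof (unfold_locales, goal_cases)
  case (1 l) show ?case by (simp add: colim_dgcat_def Obj_D)
next
  case (2 x y d) show ?case by (simp add: colim_dgcat_def colim_module_def)
next
  case (3 x y l d)
  then have "x \<in> ob" "y \<in> ob" by (auto simp: colim_dgcat_def Obj_D)
  then show ?case using up_closed[of x y _ l d "Suc l"] class_up[of l "Suc l" x y d]
    by (auto intro!: image_eqI[where x = "up x y d l (Suc l) _"])
next
  case (4 x y l d)
  then have "x \<in> ob" "y \<in> ob" by (auto simp: colim_dgcat_def Obj_D)
  then have "up x y d 0 l \<zero>\<^bsub>hom_mod (D 0) x y d\<^esub> = \<zero>\<^bsub>hom_mod (D l) x y d\<^esub>"
    by (intro linear_map_zero[OF up_linear D_module D_module]) auto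
  then show ?case using class_up[of 0 l x y d "\<zero>\<^bsub>hom_mod (D 0) x y d\<^esub>"] by (simp add: colim_dgcat_def colim_module_def)
next
  case (5 x y a l d b)
  then have o: "x \<in> ob" "y \<in> ob" by (auto simp: colim_dgcat_def Obj_D)
  show ?case
    using UN_class2[OF o o 5(3,4), of x y d "\<lambda>l a b. a \<oplus>\<^bsub>hom_mod (D l) x y d\<^esub> b"] linear_mapD(2)[OF up_linear[OF o]]
    by (simp add: colim_dgcat_def colim_module_def)
next
  case (6 x y r a l d)
  then have o: "x \<in> ob" "y \<in> ob" by (auto simp: colim_dgcat_def Obj_D)
  have "(\<Union>(j, b)\<in>cc x y d l a. cc x y d j (r \<odot>\<^bsub>hom_mod (D j) x y d\<^esub> b)) = cc x y d l (r \<odot>\<^bsub>hom_mod (D l) x y d\<^esub> a)"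
  proof (rule UN_class[OF 6(4)])
    fix j b m assume "b \<in> hom_set (D j) x y d" "l \<le> m" "j \<le> m" "up x y d l m a = up x y d j m b"
    then show "cc x y d j (r \<odot>\<^bsub>hom_mod (D j) x y d\<^esub> b) = cc x y d l (r \<odot>\<^bsub>hom_mod (D l) x y d\<^esub> a)"
      using linear_mapD(3)[OF up_linear[OF o] 6(3)] 6(4) by (intro class_eqI[of _ m]) auto
  qed
  then show ?case by (simp add: colim_dgcat_def colim_module_def)
next
  case (7 x y a l d)
  then have o: "x \<in> ob" "y \<in> ob" by (auto simp: colim_dgcat_def Obj_D)
  have "(\<Union>(j, b)\<in>cc x y d l a. cc x y (d - 1) j (hom_diff (D j) x y d b)) = cc x y (d - 1) l (hom_diff (D l) x y d a)"
  proof (rule UN_class[OF 7(3)])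
    fix j b m assume "b \<in> hom_set (D j) x y d" "l \<le> m" "j \<le> m" "up x y d l m a = up x y d j m b"
    then show "cc x y (d - 1) j (hom_diff (D j) x y d b) = cc x y (d - 1) l (hom_diff (D l) x y d a)"
      using up_diff[OF o] 7(3) by (intro class_eqI[of _ m]) auto
  qed
  then show ?case by (simp add: colim_dgcat_def)
next
  case (8 x y z g l d f e)
  then have o: "x \<in> ob" "y \<in> ob" "z \<in> ob" by (auto simp: colim_dgcat_def Obj_D)
  show ?case
    using UN_class2[OF o(2,3) o(1,2) 8(4,5), of x z "d + e" "\<lambda>l. Cmp (D l) x y z d e"] up_Cmp[OF o]
    by (simp add: colim_dgcat_def)
next
  case (9 x l)
  then have "x \<in> ob" by (auto simp: colim_dgcat_def Obj_D)
  then show ?case using class_up[of 0 l x x 0 "Idt (D 0) x"] push_Idt[of x 0 l] by (simp add: colim_dgcat_def)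
qed

sublocale colim: dg_directed R D Colim "\<lambda>l x y d. cc x y d l" by (rule colim_directed)

lemma colim_incl_functor: "dg_functor R (D i) Colim (colim_incl D J i)"
  using colim.cocone_functor[of i] by (simp add: colim.cocone_def colim_incl_def)

lemma colim_Obj [simp]: "Obj Colim = ob" by (simp add: colim_dgcat_def Obj_D)

text \<open>The definition of \<open>colim_map\<close> evaluates at a chosen representative. Two
  representatives agree at a later stage, and the compatible family takes the same value
  there.\<close>

lemma colim_map_class:
  assumes F: "\<And>i x y d a. \<lbrakk>x \<in> ob; y \<in> ob; a \<in> hom_set (D i) x y d\<rbrakk> \<Longrightarrow> fmor (F (Suc i)) x y d (fmor (J i) x y d a) = fmor (F i) x y d a"
    and o: "x \<in> ob" "y \<in> ob" and a: "a \<in> hom_set (D i) x y d"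
  shows "fmor (colim_map F) x y d (cc x y d i a) = fmor (F i) x y d a"
proof -
  have p: "fmor (F (i + l)) x y d (push J x y d i l a) = fmor (F i) x y d a" if "a \<in> hom_set (D i) x y d" for i l a
    by (induction l) (use that F o push_closed in auto)
  have u: "fmor (F l) x y d (up x y d i l a) = fmor (F i) x y d a" if "a \<in> hom_set (D i) x y d" "i \<le> l" for i l a
    using p[OF that(1), of "l - i"] that(2) by simp
  obtain j b where jb: "(SOME p. p \<in> cc x y d i a) = (j, b)" by (cases "SOME p. p \<in> cc x y d i a")
  have "(SOME p. p \<in> cc x y d i a) \<in> cc x y d i a" using class_self[OF a] by (rule someI)
  then obtain l where l: "b \<in> hom_set (D j) x y d" "i \<le> l" "j \<le> l" "up x y d i l a = up x y d j l b"
    unfolding jb class_mem_iff by auto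
  have "fmor (F j) x y d b = fmor (F i) x y d a" using u[OF l(1,3)] u[OF a l(2)] l(4) by simp
  then show ?thesis by (simp add: colim_map_def jb)
qed

lemma colim_map_functor:
  assumes F: "\<And>i. dg_functor R (D i) X (F i)" and fob_F: "\<And>i x. x \<in> ob \<Longrightarrow> fob (F i) x = fob (F 0) x"
    and compat: "\<And>i x y d a. \<lbrakk>x \<in> ob; y \<in> ob; a \<in> hom_set (D i) x y d\<rbrakk> \<Longrightarrow> fmor (F (Suc i)) x y d (fmor (J i) x y d a) = fmor (F i) x y d a"
  shows "dg_functor R Colim X (colim_map F)"
proof (rule colim.functor_out, rule dg_functor_cong[OF F])
  fix l
  have "fob (dgfun_comp (colim_map F) (colim.cocone l)) x = fob (F l) x" if "x \<in> ob" for x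
    using fob_F[OF that, of l] by (simp add: dgfun_comp_def colim.cocone_def colim_map_def)
  moreover have "fmor (dgfun_comp (colim_map F) (colim.cocone l)) x y d a = fmor (F l) x y d a"
    if "x \<in> ob" "y \<in> ob" "a \<in> hom_set (D l) x y d" for x y d a
    using colim_map_class[of F, OF compat that] by (simp add: dgfun_comp_def colim.cocone_def)
  ultimately show "dgfun_eq (D l) (F l) (dgfun_comp (colim_map F) (colim.cocone l))"
    unfolding dgfun_eq_def by (simp add: Obj_D)
qed

end

section \<open>The target of the k-invariant\<close>

lemma zero_sub_simps [simp]:
  "carrier (zero_sub M) = {\<zero>\<^bsub>M\<^esub>}" "\<zero>\<^bsub>zero_sub M\<^esub> = \<zero>\<^bsub>M\<^esub>"
  "a \<oplus>\<^bsub>zero_sub M\<^esub> b = a \<oplus>\<^bsub>M\<^esub> b" "r \<odot>\<^bsub>zero_sub M\<^esub> a = r \<odot>\<^bsub>M\<^esub> a"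
  by (simp_all add: zero_sub_def)

lemma zero_sub_module: "module R M \<Longrightarrow> module R (zero_sub M)"
  unfolding zero_sub_def by (rule submodule.submodule_is_module[OF module.zero_submodule])

lemma cycles_carrier: "z \<in> cycles M i \<Longrightarrow> z \<in> carrier (cmod M i)"
  by (simp add: cycles_def)

context positive_dg_category
begin

abbreviation Hk where "Hk n x y \<equiv> homology (Mor A x y) (int n + 1)"
abbreviation hk where "hk n x y \<equiv> hclass (Mor A x y) (int n + 1)"
abbreviation N where "N n \<equiv> k_bimod n A"
abbreviation NM where "NM n x y i \<equiv> cmod (Bcpx (N n) x y) i"
abbreviation P where "P n \<equiv> small_postnikov n A"
abbreviation pc where "pc n \<equiv> small_class n A"

lemma H_module: "\<lbrakk>x \<in> Obj A; y \<in> Obj A\<rbrakk> \<Longrightarrow> module R (Hk n x y)"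
  by (rule chain_complex.homology_module[OF complex])

lemmas H_simps = chain_complex.homology_simps[OF complex]

text \<open>In degree \<open>0\<close> the truncation kernel for \<open>n\<close> is contained in
  the boundaries, which form the kernel for \<open>0\<close>; a class modulo the former therefore
  determines a homology class.\<close>

lemma small_to_H0_class:
  assumes o: "x \<in> Obj A" "y \<in> Obj A" "a \<in> hom_set A x y 0"
  shows "fmor (small_to_H0 A) x y 0 (pc n x y 0 a) = hclass (Mor A x y) 0 a"
proof -
  interpret Qn: quotient_module R "hom_mod A x y 0" "kernel n x y 0" by (rule small.quotient[OF o(1,2)])
  interpret Q0: quotient_module R "hom_mod A x y 0" "kernel 0 x y 0" by (rule small.quotient[OF o(1,2)])
  have "kernel n x y 0 \<subseteq> kernel 0 x y 0"
    using zero_in_kernel[OF o(1,2), of 0 0] by (auto simp: trunc_kernel_def)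
  then have "pc 0 x y 0 b = hclass (Mor A x y) 0 a" if "b \<in> pc n x y 0 a" for b
    using that Qn.cls_mem[of b a] Qn.cls_iff[of b a] Q0.cls_iff[of b a] o(3)
    by (auto simp: small_class_def hclass_def trunc_kernel_def)
  then have "(\<Union>b\<in>pc n x y 0 a. pc 0 x y 0 b) = hclass (Mor A x y) 0 a"
    using Qn.cls_cong[OF o(3), of "pc 0 x y 0"] by (simp add: small_class_def)
  then show ?thesis by (simp add: small_to_H0_def)
qed

lemma k_bimod_simps:
  "NM n x y i = (if i = int n + 2 then Hk n x y else zero_sub (Hk n x y))"
  "cdiff (Bcpx (N n) x y) i v = \<zero>\<^bsub>Hk n x y\<^esub>"
  by (simp_all add: k_bimod_def restrict_bimod_def homology_bimod_def small_to_H0_def)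

text \<open>Away from degree \<open>n + 2\<close> the bimodule is the zero submodule of the same
  homology module, so its operations are given by one formula in all degrees.\<close>

lemma NM_ops:
  "\<zero>\<^bsub>NM n x y i\<^esub> = \<zero>\<^bsub>Hk n x y\<^esub>" "u \<oplus>\<^bsub>NM n x y i\<^esub> v = u \<oplus>\<^bsub>Hk n x y\<^esub> v" "r \<odot>\<^bsub>NM n x y i\<^esub> v = r \<odot>\<^bsub>Hk n x y\<^esub> v"
  by (simp_all add: k_bimod_simps)

lemma NM_carrier:
  "v \<in> carrier (NM n x y i) \<longleftrightarrow> (if i = int n + 2 then v \<in> carrier (Hk n x y) else v = \<zero>\<^bsub>Hk n x y\<^esub>)"
  by (simp add: k_bimod_simps)

lemma NM_zero: "\<lbrakk>x \<in> Obj A; y \<in> Obj A\<rbrakk> \<Longrightarrow> \<zero>\<^bsub>Hk n x y\<^esub> \<in> carrier (NM n x y i)"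
  using module.module_simprules(2)[OF H_module] by (simp add: NM_carrier)

lemma NM_module: "\<lbrakk>x \<in> Obj A; y \<in> Obj A\<rbrakk> \<Longrightarrow> module R (NM n x y i)"
  unfolding k_bimod_simps using H_module zero_sub_module[OF H_module] by auto

lemma Lact_else: "\<not> (i = 0 \<and> j = int n + 2) \<Longrightarrow> Lact (N n) x y z i j g v = \<zero>\<^bsub>Hk n x z\<^esub>"
  by (auto simp: k_bimod_def restrict_bimod_def homology_bimod_def small_to_H0_def)

lemma Ract_else: "\<not> (i = int n + 2 \<and> j = 0) \<Longrightarrow> Ract (N n) x y z i j v f = \<zero>\<^bsub>Hk n x z\<^esub>"
  by (auto simp: k_bimod_def restrict_bimod_def homology_bimod_def small_to_H0_def)

lemma Lact_class:
  assumes o: "x \<in> Obj A" "y \<in> Obj A" "z \<in> Obj A" "a \<in> hom_set A y z 0" "b \<in> cycles (Mor A x y) (int n + 1)"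
  shows "Lact (N n) x y z 0 (int n + 2) (pc n y z 0 a) (hk n x y b) = hk n x z (Cmp A x y z 0 (int n + 1) a b)"
  using UN_hclass_Cmp[OF o(1-3) degree_zero_cycle[OF o(2-4)] o(5), of "int n + 1"] small_to_H0_class[OF o(2-4), of n]
  by (simp add: k_bimod_def restrict_bimod_def homology_bimod_def) (simp add: small_to_H0_def)

lemma Ract_class:
  assumes o: "x \<in> Obj A" "y \<in> Obj A" "z \<in> Obj A" "b \<in> cycles (Mor A y z) (int n + 1)" "a \<in> hom_set A x y 0"
  shows "Ract (N n) x y z (int n + 2) 0 (hk n y z b) (pc n x y 0 a) = hk n x z (Cmp A x y z (int n + 1) 0 b a)"
  using UN_hclass_Cmp[OF o(1-4) degree_zero_cycle[OF o(1,2,5)], of "int n + 1"] small_to_H0_class[OF o(1,2,5), of n]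
  by (simp add: k_bimod_def restrict_bimod_def homology_bimod_def) (simp add: small_to_H0_def)

lemma P_E:
  assumes "x \<in> Obj A" "y \<in> Obj A" "g \<in> hom_set (P n) x y i"
  obtains a where "a \<in> hom_set A x y i" "g = pc n x y i a"
  using assms by (auto simp: small_hom)

lemma H_E:
  assumes "x \<in> Obj A" "y \<in> Obj A" "v \<in> carrier (NM n x y (int n + 2))"
  obtains b where "b \<in> cycles (Mor A x y) (int n + 1)" "v = hk n x y b"
  using assms by (auto simp: NM_carrier H_simps)

lemma class_in_H: "\<lbrakk>x \<in> Obj A; y \<in> Obj A; b \<in> cycles (Mor A x y) (int n + 1)\<rbrakk> \<Longrightarrow> hk n x y b \<in> carrier (Hk n x y)"
  by (simp add: H_simps)

lemmas pc_zero = dg_directed.zero[OF small_directed, simplified]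
lemmas pc_add = dg_directed.add[OF small_directed, simplified]
lemmas pc_smult = dg_directed.smult[OF small_directed, simplified]
lemmas pc_diff = dg_directed.diff[OF small_directed, simplified]
lemmas pc_Cmp = dg_directed.Cmp[OF small_directed, simplified]
lemmas pc_Idt = dg_directed.Idt[OF small_directed, simplified]

lemma act_cycles:
  assumes "x \<in> Obj A" "y \<in> Obj A" "z \<in> Obj A"
  shows "\<lbrakk>a \<in> hom_set A y z 0; b \<in> cycles (Mor A x y) k\<rbrakk> \<Longrightarrow> Cmp A x y z 0 k a b \<in> cycles (Mor A x z) k"
    and "\<lbrakk>b \<in> cycles (Mor A y z) k; a \<in> hom_set A x y 0\<rbrakk> \<Longrightarrow> Cmp A x y z k 0 b a \<in> cycles (Mor A x z) k"
  using Cmp_cycles[OF assms degree_zero_cycle[OF assms(2,3)], of a b k] Cmp_cycles[OF assms _ degree_zero_cycle[OF assms(1,2)], of b k a] by simp_all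

lemma act_zero_right:
  assumes o: "x \<in> Obj A" "y \<in> Obj A" "z \<in> Obj A"
  shows "g \<in> hom_set (P n) y z i \<Longrightarrow> Lact (N n) x y z i j g \<zero>\<^bsub>Hk n x y\<^esub> = \<zero>\<^bsub>Hk n x z\<^esub>"
    and "f \<in> hom_set (P n) x y j \<Longrightarrow> Ract (N n) x y z i j \<zero>\<^bsub>Hk n y z\<^esub> f = \<zero>\<^bsub>Hk n x z\<^esub>"
proof -
  show "Lact (N n) x y z i j g \<zero>\<^bsub>Hk n x y\<^esub> = \<zero>\<^bsub>Hk n x z\<^esub>" if g: "g \<in> hom_set (P n) y z i"
  proof (cases "i = 0 \<and> j = int n + 2")
    case True
    obtain a where a: "a \<in> hom_set A y z i" "g = pc n y z i a" by (rule P_E[OF o(2,3) g])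
    then show ?thesis using True Lact_class[OF o, of a "\<zero>\<^bsub>hom_mod A x y (int n + 1)\<^esub>" n]
        chain_complex.cycles_zero[OF complex[OF o(1,2)], of "int n + 1"] Cmp_zero_right[OF o, of a 0 "int n + 1"] o by (simp add: H_simps)
  qed (rule Lact_else)
  show "Ract (N n) x y z i j \<zero>\<^bsub>Hk n y z\<^esub> f = \<zero>\<^bsub>Hk n x z\<^esub>" if f: "f \<in> hom_set (P n) x y j"
  proof (cases "i = int n + 2 \<and> j = 0")
    case True
    obtain a where a: "a \<in> hom_set A x y j" "f = pc n x y j a" by (rule P_E[OF o(1,2) f])
    then show ?thesis using True Ract_class[OF o, of "\<zero>\<^bsub>hom_mod A y z (int n + 1)\<^esub>" n a]
        chain_complex.cycles_zero[OF complex[OF o(2,3)], of "int n + 1"] Cmp_zero_left[OF o, of a 0 "int n + 1"] o by (simp add: H_simps)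
  qed (rule Ract_else)
qed

text \<open>The actions factor through \<open>H_0(A)\<close>, where boundaries vanish. This is the
  content of the Leibniz rule for the actions, for an acting element of degree
  \<open>1\<close>.\<close>

lemma act_boundary:
  assumes o: "x \<in> Obj A" "y \<in> Obj A" "z \<in> Obj A"
  shows "\<lbrakk>a \<in> hom_set A y z 1; v \<in> carrier (NM n x y j)\<rbrakk> \<Longrightarrow>
      Lact (N n) x y z 0 j (pc n y z 0 (hom_diff A y z 1 a)) v = \<zero>\<^bsub>Hk n x z\<^esub>"
    and "\<lbrakk>v \<in> carrier (NM n y z i); a \<in> hom_set A x y 1\<rbrakk> \<Longrightarrow>
      Ract (N n) x y z i 0 v (pc n x y 0 (hom_diff A x y 1 a)) = \<zero>\<^bsub>Hk n x z\<^esub>"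
proof -
  show "Lact (N n) x y z 0 j (pc n y z 0 (hom_diff A y z 1 a)) v = \<zero>\<^bsub>Hk n x z\<^esub>"
    if a: "a \<in> hom_set A y z 1" and v: "v \<in> carrier (NM n x y j)"
  proof (cases "j = int n + 2")
    case True
    obtain b where b: "b \<in> cycles (Mor A x y) (int n + 1)" "v = hk n x y b" by (rule H_E[OF o(1,2) v[unfolded True]])
    have d: "hom_diff A y z 1 a \<in> boundaries (Mor A y z) 0" "hom_diff A y z 1 a \<in> hom_set A y z 0"
      using a hom_diff_closed[OF o(2,3) a] by (auto simp: boundaries_def)
    show ?thesis using True b d Cmp_boundary_left[OF o d(1) b(1)] chain_complex.hclass_zero_iff[OF complex[OF o(1,3)] act_cycles(1)[OF o d(2) b(1)]]
      by (simp add: Lact_class[OF o])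
  qed (simp add: Lact_else)
  show "Ract (N n) x y z i 0 v (pc n x y 0 (hom_diff A x y 1 a)) = \<zero>\<^bsub>Hk n x z\<^esub>"
    if v: "v \<in> carrier (NM n y z i)" and a: "a \<in> hom_set A x y 1"
  proof (cases "i = int n + 2")
    case True
    obtain b where b: "b \<in> cycles (Mor A y z) (int n + 1)" "v = hk n y z b" by (rule H_E[OF o(2,3) v[unfolded True]])
    have d: "hom_diff A x y 1 a \<in> boundaries (Mor A x y) 0" "hom_diff A x y 1 a \<in> hom_set A x y 0"
      using a hom_diff_closed[OF o(1,2) a] by (auto simp: boundaries_def)
    show ?thesis using True b d Cmp_boundary_right[OF o b(1) d(1)] chain_complex.hclass_zero_iff[OF complex[OF o(1,3)] act_cycles(2)[OF o b(1) d(2)]]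
      by (simp add: Ract_class[OF o])
  qed (simp add: Ract_else)
qed

text \<open>The zero of degree \<open>0\<close> is the boundary of zero, so
  \<open>act_boundary\<close> applies; in all other degrees the action vanishes by
  definition.\<close>

lemma act_zero_left:
  assumes o: "x \<in> Obj A" "y \<in> Obj A" "z \<in> Obj A"
  shows "v \<in> carrier (NM n x y j) \<Longrightarrow> Lact (N n) x y z i j \<zero>\<^bsub>hom_mod (P n) y z i\<^esub> v = \<zero>\<^bsub>Hk n x z\<^esub>"
    and "v \<in> carrier (NM n y z i) \<Longrightarrow> Ract (N n) x y z i j v \<zero>\<^bsub>hom_mod (P n) x y j\<^esub> = \<zero>\<^bsub>Hk n x z\<^esub>"
  using act_boundary(1)[OF o hom_zero_closed[OF o(2,3)], of v n j] hom_diff_zero[OF o(2,3), of 1] pc_zero[OF o(2,3), of n 0]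
    act_boundary(2)[OF o _ hom_zero_closed[OF o(1,2)], of v n i] hom_diff_zero[OF o(1,2), of 1] pc_zero[OF o(1,2), of n 0]
    Lact_else[of i j n x y z] Ract_else[of i n j x y z]
  by (cases "i = 0", simp_all) (cases "j = 0", simp_all)

text \<open>An action can be nonzero only for an element of degree \<open>0\<close> on one of degree
  \<open>n + 2\<close>. There it is computed on representatives and reduces to a law of composition
  in \<open>A\<close>; in all other degrees both sides are zero.\<close>

lemma k_bimodule: "dg_bimodule R (P n) (N n)"
proof (intro dg_bimodule.intro[OF small_dg_category] dg_bimodule_axioms.intro, unfold small_Obj, goal_cases)
  case (1 x y)
  interpret H: module R "Hk n x y" by (rule H_module[OF 1])
  show ?case
    by (intro chain_complexI linear_mapI) (use 1 in \<open>auto simp: NM_module NM_ops k_bimod_simps(2) NM_zero H.smult_r_null\<close>)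
next
  case (2 x y z v j i)
  note o = 2(1-3)
  interpret H: module R "Hk n x z" by (rule H_module[OF o(1,3)])
  show ?case
  proof (cases "i = 0 \<and> j = int n + 2")
    case True
    obtain b where b: "b \<in> cycles (Mor A x y) (int n + 1)" "v = hk n x y b" by (rule H_E[OF o(1,2)]) (use 2(4) True in auto)
    have b': "b \<in> hom_set A x y (int n + 1)" using b by (simp add: cycles_def)
    interpret Hg: module R "hom_mod A y z 0" by (rule hom_module[OF o(2,3)])
    note c = act_cycles(1)[OF o _ b(1)]
    have *: "Lact (N n) x y z 0 (int n + 2) (pc n y z 0 a) v = hk n x z (Cmp A x y z 0 (int n + 1) a b)" if "a \<in> hom_set A y z 0" for a
      using Lact_class[OF o that b(1)] b(2) by simp
    have "linear_map R (hom_mod (P n) y z 0) (NM n x z (int n + 2)) (\<lambda>g. Lact (N n) x y z 0 (int n + 2) g v)"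
    proof (rule linear_mapI)
      fix g assume "g \<in> hom_set (P n) y z 0"
      then show "Lact (N n) x y z 0 (int n + 2) g v \<in> carrier (NM n x z (int n + 2))"
        by (rule P_E[OF o(2,3)]) (use o c in \<open>simp add: * NM_carrier class_in_H\<close>)
    next
      fix g g' assume g: "g \<in> hom_set (P n) y z 0" "g' \<in> hom_set (P n) y z 0"
      obtain a where a: "a \<in> hom_set A y z 0" "g = pc n y z 0 a" by (rule P_E[OF o(2,3) g(1)])
      obtain a' where a': "a' \<in> hom_set A y z 0" "g' = pc n y z 0 a'" by (rule P_E[OF o(2,3) g(2)])
      show "Lact (N n) x y z 0 (int n + 2) (g \<oplus>\<^bsub>hom_mod (P n) y z 0\<^esub> g') v =
          Lact (N n) x y z 0 (int n + 2) g v \<oplus>\<^bsub>NM n x z (int n + 2)\<^esub> Lact (N n) x y z 0 (int n + 2) g' v"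
        using a a' o b' c Cmp_add_left[OF o a(1) a'(1) b', of "int n + 1"] by (simp add: pc_add[OF o(2,3), symmetric] * NM_ops H_simps)
    next
      fix r g assume r: "r \<in> carrier R" and g: "g \<in> hom_set (P n) y z 0"
      obtain a where a: "a \<in> hom_set A y z 0" "g = pc n y z 0 a" by (rule P_E[OF o(2,3) g])
      show "Lact (N n) x y z 0 (int n + 2) (r \<odot>\<^bsub>hom_mod (P n) y z 0\<^esub> g) v = r \<odot>\<^bsub>NM n x z (int n + 2)\<^esub> Lact (N n) x y z 0 (int n + 2) g v"
        using r a o b' c Cmp_smult_left[OF o r a(1) b', of "int n + 1"] by (simp add: pc_smult[OF o(2,3), symmetric] * NM_ops H_simps)
    qed
    then show ?thesis using True by simp
  next
    case False then show ?thesis by (intro linear_mapI) (use o NM_zero in \<open>simp_all add: Lact_else NM_ops H.smult_r_null\<close>)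
  qed
next
  case (3 x y z g i j)
  note o = 3(1-3)
  interpret H: module R "Hk n x z" by (rule H_module[OF o(1,3)])
  show ?case
  proof (cases "i = 0 \<and> j = int n + 2")
    case True
    obtain a where a: "a \<in> hom_set A y z 0" "g = pc n y z 0 a" by (rule P_E[OF o(2,3)]) (use 3(4) True in auto)
    note c = act_cycles(1)[OF o a(1)]
    have *: "Lact (N n) x y z 0 (int n + 2) g (hk n x y b) = hk n x z (Cmp A x y z 0 (int n + 1) a b)" if "b \<in> cycles (Mor A x y) (int n + 1)" for b
      using Lact_class[OF o a(1) that] a(2) by simp
    interpret Z: module R "hom_mod A x y (int n + 1)\<lparr>carrier := cycles (Mor A x y) (int n + 1)\<rparr>"
      by (rule submodule.submodule_is_module[OF chain_complex.cycles_submodule[OF complex[OF o(1,2)]] hom_module[OF o(1,2)]])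
    note cl = Z.module_simprules(1,18)[simplified]
    have "linear_map R (NM n x y (int n + 2)) (NM n x z (int n + 2)) (Lact (N n) x y z 0 (int n + 2) g)"
    proof (rule linear_mapI)
      fix v assume "v \<in> carrier (NM n x y (int n + 2))"
      then show "Lact (N n) x y z 0 (int n + 2) g v \<in> carrier (NM n x z (int n + 2))"
        by (rule H_E[OF o(1,2)]) (use o c in \<open>simp add: * NM_carrier class_in_H\<close>)
    next
      fix v v' assume v: "v \<in> carrier (NM n x y (int n + 2))" "v' \<in> carrier (NM n x y (int n + 2))"
      obtain b where b: "b \<in> cycles (Mor A x y) (int n + 1)" "v = hk n x y b" by (rule H_E[OF o(1,2) v(1)])
      obtain b' where b': "b' \<in> cycles (Mor A x y) (int n + 1)" "v' = hk n x y b'" by (rule H_E[OF o(1,2) v(2)])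
      show "Lact (N n) x y z 0 (int n + 2) g (v \<oplus>\<^bsub>NM n x y (int n + 2)\<^esub> v') =
          Lact (N n) x y z 0 (int n + 2) g v \<oplus>\<^bsub>NM n x z (int n + 2)\<^esub> Lact (N n) x y z 0 (int n + 2) g v'"
        using a(1) o b b' c cl Cmp_add_right[OF o a(1) cycles_carrier[OF b(1)] cycles_carrier[OF b'(1)], of "int n + 1"] by (simp add: * NM_ops H_simps)
    next
      fix r v assume r: "r \<in> carrier R" and v: "v \<in> carrier (NM n x y (int n + 2))"
      obtain b where b: "b \<in> cycles (Mor A x y) (int n + 1)" "v = hk n x y b" by (rule H_E[OF o(1,2) v])
      show "Lact (N n) x y z 0 (int n + 2) g (r \<odot>\<^bsub>NM n x y (int n + 2)\<^esub> v) = r \<odot>\<^bsub>NM n x z (int n + 2)\<^esub> Lact (N n) x y z 0 (int n + 2) g v"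
        using r a(1) o b c cl Cmp_smult_right[OF o r a(1) cycles_carrier[OF b(1)], of "int n + 1"] by (simp add: * NM_ops H_simps)
    qed
    then show ?thesis using True by simp
  next
    case False then show ?thesis by (intro linear_mapI) (use o NM_zero in \<open>simp_all add: Lact_else NM_ops H.smult_r_null\<close>)
  qed
next
  case (4 x y z f j i)
  note o = 4(1-3)
  interpret H: module R "Hk n x z" by (rule H_module[OF o(1,3)])
  show ?case
  proof (cases "i = int n + 2 \<and> j = 0")
    case True
    obtain a where a: "a \<in> hom_set A x y 0" "f = pc n x y 0 a" by (rule P_E[OF o(1,2)]) (use 4(4) True in auto)
    note c = act_cycles(2)[OF o _ a(1)]
    have *: "Ract (N n) x y z (int n + 2) 0 (hk n y z b) f = hk n x z (Cmp A x y z (int n + 1) 0 b a)" if "b \<in> cycles (Mor A y z) (int n + 1)" for b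
      using Ract_class[OF o that a(1)] a(2) by simp
    interpret Z: module R "hom_mod A y z (int n + 1)\<lparr>carrier := cycles (Mor A y z) (int n + 1)\<rparr>"
      by (rule submodule.submodule_is_module[OF chain_complex.cycles_submodule[OF complex[OF o(2,3)]] hom_module[OF o(2,3)]])
    note cl = Z.module_simprules(1,18)[simplified]
    have "linear_map R (NM n y z (int n + 2)) (NM n x z (int n + 2)) (\<lambda>v. Ract (N n) x y z (int n + 2) 0 v f)"
    proof (rule linear_mapI)
      fix v assume "v \<in> carrier (NM n y z (int n + 2))"
      then show "Ract (N n) x y z (int n + 2) 0 v f \<in> carrier (NM n x z (int n + 2))"
        by (rule H_E[OF o(2,3)]) (use o c in \<open>simp add: * NM_carrier class_in_H\<close>)
    next
      fix v v' assume v: "v \<in> carrier (NM n y z (int n + 2))" "v' \<in> carrier (NM n y z (int n + 2))"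
      obtain b where b: "b \<in> cycles (Mor A y z) (int n + 1)" "v = hk n y z b" by (rule H_E[OF o(2,3) v(1)])
      obtain b' where b': "b' \<in> cycles (Mor A y z) (int n + 1)" "v' = hk n y z b'" by (rule H_E[OF o(2,3) v(2)])
      show "Ract (N n) x y z (int n + 2) 0 (v \<oplus>\<^bsub>NM n y z (int n + 2)\<^esub> v') f =
          Ract (N n) x y z (int n + 2) 0 v f \<oplus>\<^bsub>NM n x z (int n + 2)\<^esub> Ract (N n) x y z (int n + 2) 0 v' f"
        using a(1) o b b' c cl Cmp_add_left[OF o cycles_carrier[OF b(1)] cycles_carrier[OF b'(1)] a(1), of "int n + 1"] by (simp add: * NM_ops H_simps)
    next
      fix r v assume r: "r \<in> carrier R" and v: "v \<in> carrier (NM n y z (int n + 2))"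
      obtain b where b: "b \<in> cycles (Mor A y z) (int n + 1)" "v = hk n y z b" by (rule H_E[OF o(2,3) v])
      show "Ract (N n) x y z (int n + 2) 0 (r \<odot>\<^bsub>NM n y z (int n + 2)\<^esub> v) f = r \<odot>\<^bsub>NM n x z (int n + 2)\<^esub> Ract (N n) x y z (int n + 2) 0 v f"
        using r a(1) o b c cl Cmp_smult_left[OF o r cycles_carrier[OF b(1)] a(1), of "int n + 1"] by (simp add: * NM_ops H_simps)
    qed
    then show ?thesis using True by simp
  next
    case False then show ?thesis by (intro linear_mapI) (use o NM_zero in \<open>simp_all add: Ract_else NM_ops H.smult_r_null\<close>)
  qed
next
  case (5 x y z v i j)
  note o = 5(1-3)
  interpret H: module R "Hk n x z" by (rule H_module[OF o(1,3)])
  show ?case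
  proof (cases "i = int n + 2 \<and> j = 0")
    case True
    obtain b where b: "b \<in> cycles (Mor A y z) (int n + 1)" "v = hk n y z b" by (rule H_E[OF o(2,3)]) (use 5(4) True in auto)
    have b': "b \<in> hom_set A y z (int n + 1)" using b by (simp add: cycles_def)
    interpret Hg: module R "hom_mod A x y 0" by (rule hom_module[OF o(1,2)])
    note c = act_cycles(2)[OF o b(1)]
    have *: "Ract (N n) x y z (int n + 2) 0 v (pc n x y 0 a) = hk n x z (Cmp A x y z (int n + 1) 0 b a)" if "a \<in> hom_set A x y 0" for a
      using Ract_class[OF o b(1) that] b(2) by simp
    have "linear_map R (hom_mod (P n) x y 0) (NM n x z (int n + 2)) (Ract (N n) x y z (int n + 2) 0 v)"
    proof (rule linear_mapI)
      fix g assume "g \<in> hom_set (P n) x y 0"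
      then show "Ract (N n) x y z (int n + 2) 0 v g \<in> carrier (NM n x z (int n + 2))"
        by (rule P_E[OF o(1,2)]) (use o c in \<open>simp add: * NM_carrier class_in_H\<close>)
    next
      fix g g' assume g: "g \<in> hom_set (P n) x y 0" "g' \<in> hom_set (P n) x y 0"
      obtain a where a: "a \<in> hom_set A x y 0" "g = pc n x y 0 a" by (rule P_E[OF o(1,2) g(1)])
      obtain a' where a': "a' \<in> hom_set A x y 0" "g' = pc n x y 0 a'" by (rule P_E[OF o(1,2) g(2)])
      show "Ract (N n) x y z (int n + 2) 0 v (g \<oplus>\<^bsub>hom_mod (P n) x y 0\<^esub> g') =
          Ract (N n) x y z (int n + 2) 0 v g \<oplus>\<^bsub>NM n x z (int n + 2)\<^esub> Ract (N n) x y z (int n + 2) 0 v g'"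
        using a a' o b' c Cmp_add_right[OF o b' a(1) a'(1), of "int n + 1"] by (simp add: pc_add[OF o(1,2), symmetric] * NM_ops H_simps)
    next
      fix r g assume r: "r \<in> carrier R" and g: "g \<in> hom_set (P n) x y 0"
      obtain a where a: "a \<in> hom_set A x y 0" "g = pc n x y 0 a" by (rule P_E[OF o(1,2) g])
      show "Ract (N n) x y z (int n + 2) 0 v (r \<odot>\<^bsub>hom_mod (P n) x y 0\<^esub> g) = r \<odot>\<^bsub>NM n x z (int n + 2)\<^esub> Ract (N n) x y z (int n + 2) 0 v g"
        using r a o b' c Cmp_smult_right[OF o r b' a(1), of "int n + 1"] by (simp add: pc_smult[OF o(1,2), symmetric] * NM_ops H_simps)
    qed
    then show ?thesis using True by simp
  next
    case False then show ?thesis by (intro linear_mapI) (use o NM_zero in \<open>simp_all add: Ract_else NM_ops H.smult_r_null\<close>)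
  qed
next
  case (6 x y z g i v j)
  note o = 6(1-3)
  interpret H: module R "Hk n x z" by (rule H_module[OF o(1,3)])
  obtain a where a: "a \<in> hom_set A y z i" "g = pc n y z i a" by (rule P_E[OF o(2,3) 6(4)])
  have "Lact (N n) x y z (i - 1) j (hom_diff (P n) y z i g) v = \<zero>\<^bsub>Hk n x z\<^esub>"
  proof (cases "i = 1")
    case True then show ?thesis using act_boundary(1)[OF o _ 6(5), of a] a pc_diff[OF o(2,3), of a 1 n] by simp
  qed (simp add: Lact_else)
  then show ?case using act_zero_right(1)[OF o 6(4)] by (simp add: NM_ops k_bimod_simps(2) H.smult_r_null sign_closed[OF is_cring])
next
  case (7 x y z v i f j)
  note o = 7(1-3)
  interpret H: module R "Hk n x z" by (rule H_module[OF o(1,3)])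
  obtain a where a: "a \<in> hom_set A x y j" "f = pc n x y j a" by (rule P_E[OF o(1,2) 7(5)])
  have "Ract (N n) x y z i (j - 1) v (hom_diff (P n) x y j f) = \<zero>\<^bsub>Hk n x z\<^esub>"
  proof (cases "j = 1")
    case True then show ?thesis using act_boundary(2)[OF o 7(4), of a] a pc_diff[OF o(1,2), of a 1 n] by simp
  qed (simp add: Ract_else)
  then show ?case using act_zero_right(2)[OF o 7(5)] by (simp add: NM_ops k_bimod_simps(2) H.smult_r_null sign_closed[OF is_cring])
next
  case (8 w x y z h i g j v k)
  note o = 8(1-4)
  obtain a where a: "a \<in> hom_set A y z i" "h = pc n y z i a" by (rule P_E[OF o(3,4) 8(5)])
  obtain a' where a': "a' \<in> hom_set A x y j" "g = pc n x y j a'" by (rule P_E[OF o(2,3) 8(6)])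
  \<comment> \<open>The middle case is the one in which the product \<open>h g\<close> acts but its
    factors do not: degrees \<open>i\<close> and \<open>j\<close> are opposite and nonzero, so one
    factor has negative degree and the product vanishes.\<close>
  consider "i = 0" "j = 0" "k = int n + 2" | "i + j = 0" "k = int n + 2" "i \<noteq> 0" | "\<not> (i + j = 0 \<and> k = int n + 2)" by linarith
  then show ?case
  proof cases
    case 1
    obtain b where b: "b \<in> cycles (Mor A w x) (int n + 1)" "v = hk n w x b" by (rule H_E[OF o(1,2)]) (use 8(7) 1 in auto)
    have b': "b \<in> hom_set A w x (int n + 1)" using b by (simp add: cycles_def)
    have aa: "a \<in> hom_set A y z 0" "a' \<in> hom_set A x y 0" using a a' 1 by auto
    show ?thesis using 1 a a' b Lact_class[OF o(1,3,4) aa(1) act_cycles(1)[OF o(1-3) aa(2) b(1)]] Lact_class[OF o(1-3) aa(2) b(1)]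
       Lact_class[OF o(1,2,4) _ b(1), of "Cmp A x y z 0 0 a a'"] pc_Cmp[OF o(2-4) aa, of n] Cmp_closed[OF o(2-4) aa] Cmp_assoc[OF o aa b']
      by simp
  next
    case 2
    have "Cmp (P n) x y z i j h g = \<zero>\<^bsub>hom_mod (P n) x z (i + j)\<^esub>"
    proof (cases "i < 0")
      case True then show ?thesis using negative[OF o(3,4) a(1)] a a' Cmp_zero_left[OF o(2-4) a'(1), of i]
        pc_Cmp[OF o(2-4) a(1) a'(1), of n] pc_zero[OF o(2,4), of n "i + j"] by simp
    next
      case False then show ?thesis using negative[OF o(2,3) a'(1)] 2 a a' Cmp_zero_right[OF o(2-4) a(1), of j]
        pc_Cmp[OF o(2-4) a(1) a'(1), of n] pc_zero[OF o(2,4), of n "i + j"] by simp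
    qed
    then show ?thesis using act_zero_left(1)[OF o(1,2,4) 8(7)] 2 by (simp add: Lact_else)
  next
    case 3
    then have "\<not> (i = 0 \<and> j = 0 \<and> k = int n + 2)" by auto
    then have "Lact (N n) w y z i (j + k) h (Lact (N n) w x y j k g v) = \<zero>\<^bsub>Hk n w z\<^esub>"
      using act_zero_right(1)[OF o(1,3,4) 8(5)] by (cases "j = 0 \<and> k = int n + 2") (auto simp: Lact_else)
    then show ?thesis using 3 by (simp add: Lact_else)
  qed
next
  case (9 w x y z h i v j f k)
  note o = 9(1-4)
  obtain a where a: "a \<in> hom_set A y z i" "h = pc n y z i a" by (rule P_E[OF o(3,4) 9(5)])
  obtain a' where a': "a' \<in> hom_set A w x k" "f = pc n w x k a'" by (rule P_E[OF o(1,2) 9(7)])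
  show ?case
  proof (cases "i = 0 \<and> j = int n + 2 \<and> k = 0")
    case True
    obtain b where b: "b \<in> cycles (Mor A x y) (int n + 1)" "v = hk n x y b" by (rule H_E[OF o(2,3)]) (use 9(6) True in auto)
    have b': "b \<in> hom_set A x y (int n + 1)" using b by (simp add: cycles_def)
    have aa: "a \<in> hom_set A y z 0" "a' \<in> hom_set A w x 0" using a a' True by auto
    show ?thesis using True a a' b Lact_class[OF o(2-4) aa(1) b(1)] Ract_class[OF o(1-3) b(1) aa(2)]
       Ract_class[OF o(1,2,4) act_cycles(1)[OF o(2-4) aa(1) b(1)] aa(2)] Lact_class[OF o(1,3,4) aa(1) act_cycles(2)[OF o(1-3) b(1) aa(2)]]
       Cmp_assoc[OF o aa(1) b' aa(2)]
      by simp
  next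
    case False
    have 1: "Ract (N n) w x z (i + j) k (Lact (N n) x y z i j h v) f = \<zero>\<^bsub>Hk n w z\<^esub>"
    proof (cases "i = 0 \<and> j = int n + 2")
      case True then show ?thesis using False by (simp add: Ract_else)
    next
      case F: False then show ?thesis using act_zero_right(2)[OF o(1,2,4) 9(7)] by (simp add: Lact_else[OF F])
    qed
    have 2: "Lact (N n) w y z i (j + k) h (Ract (N n) w x y j k v f) = \<zero>\<^bsub>Hk n w z\<^esub>"
    proof (cases "j = int n + 2 \<and> k = 0")
      case True then show ?thesis using False by (simp add: Lact_else)
    next
      case F: False then show ?thesis using act_zero_right(1)[OF o(1,3,4) 9(5)] by (simp add: Ract_else[OF F])
    qed
    show ?thesis by (simp only: 1 2)
  qed
next
  case (10 w x y z v i g j f k)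
  note o = 10(1-4)
  obtain a where a: "a \<in> hom_set A x y j" "g = pc n x y j a" by (rule P_E[OF o(2,3) 10(6)])
  obtain a' where a': "a' \<in> hom_set A w x k" "f = pc n w x k a'" by (rule P_E[OF o(1,2) 10(7)])
  consider "j = 0" "k = 0" "i = int n + 2" | "j + k = 0" "i = int n + 2" "j \<noteq> 0" | "\<not> (j + k = 0 \<and> i = int n + 2)" by linarith
  then show ?case
  proof cases
    case 1
    obtain b where b: "b \<in> cycles (Mor A y z) (int n + 1)" "v = hk n y z b" by (rule H_E[OF o(3,4)]) (use 10(5) 1 in auto)
    have b': "b \<in> hom_set A y z (int n + 1)" using b by (simp add: cycles_def)
    have aa: "a \<in> hom_set A x y 0" "a' \<in> hom_set A w x 0" using a a' 1 by auto
    show ?thesis using 1 a a' b Ract_class[OF o(1,2,4) act_cycles(2)[OF o(2-4) b(1) aa(1)] aa(2)] Ract_class[OF o(2-4) b(1) aa(1)]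
       Ract_class[OF o(1,3,4) b(1), of "Cmp A w x y 0 0 a a'"] pc_Cmp[OF o(1-3) aa, of n] Cmp_closed[OF o(1-3) aa] Cmp_assoc[OF o b' aa]
      by simp
  next
    case 2
    have "Cmp (P n) w x y j k g f = \<zero>\<^bsub>hom_mod (P n) w y (j + k)\<^esub>"
    proof (cases "j < 0")
      case True then show ?thesis using negative[OF o(2,3) a(1)] a a' Cmp_zero_left[OF o(1-3) a'(1), of j]
        pc_Cmp[OF o(1-3) a(1) a'(1), of n] pc_zero[OF o(1,3), of n "j + k"] by simp
    next
      case False then show ?thesis using negative[OF o(1,2) a'(1)] 2 a a' Cmp_zero_right[OF o(1-3) a(1), of k]
        pc_Cmp[OF o(1-3) a(1) a'(1), of n] pc_zero[OF o(1,3), of n "j + k"] by simp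
    qed
    then show ?thesis using act_zero_left(2)[OF o(1,3,4) 10(5)] act_zero_right(2)[OF o(1,2,4) 10(7)] 2 by (simp add: Ract_else)
  next
    case 3
    then have "\<not> (j = 0 \<and> k = 0 \<and> i = int n + 2)" by auto
    then have "Ract (N n) w x z (i + j) k (Ract (N n) x y z i j v g) f = \<zero>\<^bsub>Hk n w z\<^esub>"
      using act_zero_right(2)[OF o(1,2,4) 10(7)] by (cases "i = int n + 2 \<and> j = 0") (auto simp: Ract_else)
    moreover have "Ract (N n) w y z i (j + k) v (Cmp (P n) w x y j k g f) = \<zero>\<^bsub>Hk n w z\<^esub>"
      using 3 by (intro Ract_else) auto
    ultimately show ?thesis by simp
  qed
next
  case (11 x y v i)
  show ?case
  proof (cases "i = int n + 2")
    case True
    obtain b where b: "b \<in> cycles (Mor A x y) (int n + 1)" "v = hk n x y b" by (rule H_E[OF 11(1,2)]) (use 11 True in auto)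
    have b': "b \<in> hom_set A x y (int n + 1)" using b by (simp add: cycles_def)
    show ?thesis using True 11 b b' Lact_class[OF 11(1,2,2) Idt_closed[OF 11(2)] b(1)] pc_Idt[OF 11(2), of n] by (simp add: Cmp_Idt_left)
  next
    case False then show ?thesis using 11(3) by (simp add: Lact_else NM_carrier)
  qed
next
  case (12 x y v i)
  show ?case
  proof (cases "i = int n + 2")
    case True
    obtain b where b: "b \<in> cycles (Mor A x y) (int n + 1)" "v = hk n x y b" by (rule H_E[OF 12(1,2)]) (use 12 True in auto)
    have b': "b \<in> hom_set A x y (int n + 1)" using b by (simp add: cycles_def)
    show ?thesis using True 12 b b' Ract_class[OF 12(1,1,2) b(1) Idt_closed[OF 12(1)]] pc_Idt[OF 12(1), of n] by (simp add: Cmp_Idt_right)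
  next
    case False then show ?thesis using 12(3) by (simp add: Ract_else NM_carrier)
  qed
qed

end

lemma one_plus_int: "1 + int n = int n + 1"
  by simp

section \<open>The stages of the big Postnikov sections\<close>

lemma base_directed:
  assumes "dg_category R A" shows "dg_directed R (\<lambda>_. A) (base_cat A) (\<lambda>_ x y i. Base)"
  by (rule dg_directed.intro) (use assms in \<open>auto simp: base_cat_def\<close>)

lemma base_dg_category: "dg_category R A \<Longrightarrow> dg_category R (base_cat A)"
  by (rule dg_directed.dg_category[OF base_directed])

lemma base_fun_functor: assumes "dg_category R A" shows "dg_functor R A (base_cat A) base_fun"
  using dg_directed.cocone_functor[OF base_directed[OF assms], of undefined]
  by (simp add: dg_directed.cocone_def[OF base_directed[OF assms]] base_fun_def)

lemma unbase_fun_functor: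
  fixes A :: "('o, 'b, 'a) dgcat"
  assumes "dg_category R A" shows "dg_functor R (base_cat A) A unbase_fun"
proof (rule dg_directed.functor_out[OF base_directed[OF assms]], goal_cases)
  case (1 l)
  have "dgfun_comp unbase_fun (dg_directed.cocone (\<lambda>_ x y i. Base :: 'a \<Rightarrow> ('o, 'b, 'a) expr) l) = (dgfun_id :: ('o, 'a, 'o, 'a) dgfun)"
    using dg_directed.cocone_def[OF base_directed[OF assms], of l]
    by (simp add: dgfun_comp_def unbase_fun_def dgfun_id_def comp_def)
  then show ?case using dgfun_id_functor[OF assms] by simp
qed

context positive_dg_category
begin

abbreviation St where "St n i \<equiv> stage R n A i"
abbreviation ts where "ts n i \<equiv> fmor (to_stage R n A i)"

lemma stage_dg_category: "dg_category R (St n i)"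
proof (induction i)
  case 0 show ?case by (simp add: base_dg_category dg_category_axioms)
next
  case (Suc i) then show ?case by (simp add: attach_cells.attach_dg_category attach_cells.intro)
qed

lemma stage_cells: "attach_cells R (St n i)"
  by (rule attach_cells.intro[OF stage_dg_category])

lemma stage_Obj: "Obj (St n i) = Obj A"
  by (induction i) (simp_all add: base_cat_def attach_cells.attach_simps(1)[OF stage_cells])

lemma stage_sequence: "dg_sequence R (St n) (stage_incl R n A)"
proof (rule dg_sequence.intro)
  show "dg_functor R (St n i) (St n (Suc i)) (stage_incl R n A i)" for i
    using attach_cells.attach_incl_functor[OF stage_cells] by (simp add: stage_incl_def)
qed (simp_all only: stage_Obj, simp add: stage_incl_def attach_incl_def)

lemma stage_incl_functor: "dg_functor R (St n i) (St n (Suc i)) (stage_incl R n A i)"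
  by (rule dg_sequence.J[OF stage_sequence])

lemma fob_stage_incl: "fob (stage_incl R n A i) x = x"
  by (simp add: stage_incl_def attach_incl_def)

lemma to_stage_functor: "dg_functor R A (St n i) (to_stage R n A i)"
  by (induction i) (use base_fun_functor[OF dg_category_axioms] dg_functor_comp[OF _ stage_incl_functor] in auto)

lemma fob_to_stage: "fob (to_stage R n A i) x = x"
  by (induction i) (auto simp: base_fun_def dgfun_comp_def fob_stage_incl)

lemmas ts_hom = dg_functor_hom[OF to_stage_functor, unfolded fob_to_stage]
lemmas ts_linear = dg_functorD(4)[OF to_stage_functor, unfolded fob_to_stage]
lemmas ts_diff = dg_functorD(5)[OF to_stage_functor, unfolded fob_to_stage]
lemmas ts_Cmp = dg_functorD(7)[OF to_stage_functor, unfolded fob_to_stage]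
lemmas ts_zero = dg_functor_zero[OF to_stage_functor, unfolded fob_to_stage]
lemmas ts_cycles = dg_functor_cycles[OF to_stage_functor, unfolded fob_to_stage]

lemma ts_Suc: "ts n (Suc i) x y d a = fmor (stage_incl R n A i) x y d (ts n i x y d a)"
  by (simp add: dgfun_comp_def fob_to_stage)

lemma ts_inj:
  "\<lbrakk>x \<in> Obj A; y \<in> Obj A; a \<in> hom_set A x y d; b \<in> hom_set A x y d; ts n i x y d a = ts n i x y d b\<rbrakk> \<Longrightarrow> a = b"
proof (induction i)
  case 0 then show ?case by (simp add: base_fun_def)
next
  case (Suc i)
  have "ts n i x y d a = ts n i x y d b"
    by (rule attach_cells.attach_incl_inj[OF stage_cells])
      (use Suc.prems ts_hom in \<open>simp_all add: stage_Obj ts_Suc stage_incl_def del: to_stage.simps\<close>)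
  then show ?case using Suc by simp
qed

lemma cycle_iff_ts:
  assumes "x \<in> Obj A" "y \<in> Obj A" "a \<in> hom_set A x y d"
  shows "ts n i x y d a \<in> cycles (Mor (St n i) x y) d \<longleftrightarrow> a \<in> cycles (Mor A x y) d"
proof
  assume "ts n i x y d a \<in> cycles (Mor (St n i) x y) d"
  then have "ts n i x y (d - 1) (hom_diff A x y d a) = ts n i x y (d - 1) \<zero>\<^bsub>hom_mod A x y (d - 1)\<^esub>"
    using assms by (simp add: cycles_def ts_diff ts_zero)
  then have "hom_diff A x y d a = \<zero>\<^bsub>hom_mod A x y (d - 1)\<^esub>"
    using assms hom_diff_closed hom_zero_closed by (intro ts_inj[of x y _ "d - 1" _ n i]) auto
  then show "a \<in> cycles (Mor A x y) d" using assms by (simp add: cycles_def)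
qed (use assms ts_cycles in blast)

text \<open>Products with a factor of negative degree vanish, so a product of degree at most \<open>n + 1\<close>
  involves no attached cell.\<close>

lemma stage_low:
  "\<lbrakk>x \<in> Obj A; y \<in> Obj A; e \<in> hom_set (St n i) x y d; d \<le> int n + 1\<rbrakk> \<Longrightarrow> \<exists>a\<in>hom_set A x y d. e = ts n i x y d a"
proof (induction i arbitrary: x y d e)
  case 0 then show ?case by (auto simp: base_cat_def base_fun_def)
next
  case (Suc i)
  interpret B: attach_cells R "St n i" "int n" by (rule stage_cells)
  note lin = linear_mapD[OF ts_linear[of _ _ _ n "Suc i"]]
  have "d \<le> int n + 1 \<longrightarrow> (\<exists>a\<in>hom_set A x y d. e = ts n (Suc i) x y d a)"
  proof (rule B.attach_hom_induct[where P = "\<lambda>x y d e. d \<le> int n + 1 \<longrightarrow> (\<exists>a\<in>hom_set A x y d. e = ts n (Suc i) x y d a)"],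
      unfold stage_Obj, goal_cases)
    case 1 then show ?case using Suc.prems(3) by simp
  next
    case (2 x y d a)
    then show ?case using Suc.IH[of x y a d] by (auto simp: ts_Suc stage_incl_def simp del: to_stage.simps)
  next
    case (4 x y d a b)
    interpret H: module R "hom_mod A x y d" by (rule hom_module[OF 4(1,2)])
    show ?case using 4 lin(2)[OF 4(1,2), symmetric] by (auto simp del: to_stage.simps)
  next
    case (5 x y d r a)
    interpret H: module R "hom_mod A x y d" by (rule hom_module[OF 5(1,2)])
    show ?case using 5 lin(3)[OF 5(1,2,3), symmetric] by (auto simp del: to_stage.simps)
  next
    case (6 x y z p q g f)
    note o = 6(1-3)
    interpret S: dg_category R "St n (Suc i)" by (rule stage_dg_category)
    note oS = o[folded stage_Obj[of n "Suc i"]]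
    have z: "\<exists>a\<in>hom_set A x z (p + q). \<zero>\<^bsub>hom_mod (St n (Suc i)) x z (p + q)\<^esub> = ts n (Suc i) x z (p + q) a"
      using hom_zero_closed[OF o(1,3)] ts_zero[OF o(1,3), of n "Suc i" "p + q"] by metis
    show ?case
    proof
      assume d: "p + q \<le> int n + 1"
      \<comment> \<open>If neither degree is negative, then both are at most \<open>n + 1\<close>
        and both factors come from \<open>A\<close>.\<close>
      consider "p < 0" | "q < 0" | "p \<le> int n + 1" "q \<le> int n + 1" using d by linarith
      then show "\<exists>a\<in>hom_set A x z (p + q). Cmp (attach R (int n) (St n i)) x y z p q g f = ts n (Suc i) x z (p + q) a"
      proof cases
        case 1
        then obtain a where "a \<in> hom_set A y z p" "g = ts n (Suc i) y z p a" using 6(6) by auto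
        then have "g = \<zero>\<^bsub>hom_mod (St n (Suc i)) y z p\<^esub>" using negative[OF o(2,3)] 1 ts_zero[OF o(2,3)] by metis
        then show ?thesis using S.Cmp_zero_left[OF oS, of f q p] 6(5) z by simp
      next
        case 2
        then obtain a where "a \<in> hom_set A x y q" "f = ts n (Suc i) x y q a" using 6(7) by auto
        then have "f = \<zero>\<^bsub>hom_mod (St n (Suc i)) x y q\<^esub>" using negative[OF o(1,2)] 2 ts_zero[OF o(1,2)] by metis
        then show ?thesis using S.Cmp_zero_right[OF oS, of g p q] 6(4) z by simp
      next
        case 3
        then obtain a b where a: "a \<in> hom_set A y z p" "g = ts n (Suc i) y z p a" and b: "b \<in> hom_set A x y q" "f = ts n (Suc i) x y q b"
          using 6(6,7) by auto
        show ?thesis using ts_Cmp[OF o a(1) b(1), of n "Suc i"] Cmp_closed[OF o a(1) b(1)] unfolding a(2) b(2) stage.simps(2)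
          by (intro bexI[of _ "Cmp A x y z p q a b"]) (simp_all del: to_stage.simps)
      qed
    qed
  \<comment> \<open>The remaining generators are the bounding chains, whose degree
    \<open>m + 1\<close> exceeds \<open>n + 1\<close>.\<close>
  qed (auto simp del: to_stage.simps)
  then show ?case using Suc.prems(4) by simp
qed

lemma stage_negative:
  assumes "x \<in> Obj A" "y \<in> Obj A" "e \<in> hom_set (St n i) x y d" "d < 0"
  shows "e = \<zero>\<^bsub>hom_mod (St n i) x y d\<^esub>"
proof -
  obtain a where "a \<in> hom_set A x y d" "e = ts n i x y d a" using stage_low[OF assms(1-3)] assms(4) by auto
  then show ?thesis using negative[OF assms(1,2)] assms(4) ts_zero[OF assms(1,2)] by metis
qed

lemma descend:
  assumes "x \<in> Obj A" "y \<in> Obj A" "a \<in> hom_set A x y (int n + 1)"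
  shows "descend R n A i x y (ts n i x y (int n + 1) a) = a"
  unfolding descend_def by (rule the_equality) (use assms ts_inj in auto)

section \<open>The map \<open>\<gamma>\<close> on the stages\<close>

sublocale k: dg_bimodule R "small_postnikov n A" "k_bimod n A" for n by (rule k_bimodule)

lemma k_target_dg_category: "dg_category R (k_target n A)"
  unfolding k_target_def by (rule k.square_zero_dg_category)

lemma k_target_Obj: "Obj (k_target n A) = Obj A"
  by (simp add: k_target_def k.square_zero_simps)

lemma k_target_simps:
  "hom_mod (k_target n A) x y i = prod_module (hom_mod (P n) x y i) (NM n x y i)"
  "hom_diff (k_target n A) x y i (g, v) = (hom_diff (P n) x y i g, \<zero>\<^bsub>Hk n x y\<^esub>)"
  "Cmp (k_target n A) x y z i j (g, v) (f, u) =
    (Cmp (P n) x y z i j g f, Lact (N n) x y z i j g u \<oplus>\<^bsub>Hk n x z\<^esub> Ract (N n) x y z i j v f)"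
  by (simp_all add: k_target_def k.square_zero_simps k_bimod_simps(2) NM_ops)

text \<open>Above degree \<open>n\<close> the small Postnikov section vanishes and the bimodule
  lives only in degree \<open>n + 2\<close>, so the second component in that degree is all that can
  survive.\<close>

lemma k_target_zero_at:
  assumes "x \<in> Obj A" "y \<in> Obj A" "c \<in> hom_set (k_target n A) x y d" "d > int n" "d = int n + 2 \<longrightarrow> snd c = \<zero>\<^bsub>Hk n x y\<^esub>"
  shows "c = \<zero>\<^bsub>hom_mod (k_target n A) x y d\<^esub>"
  using assms small_above[OF assms(1,2,4)] by (cases c) (auto simp: k_target_simps NM_ops NM_carrier split: if_splits)

lemma gamma_zero_functor: "dg_functor R (St n 0) (k_target n A) (gamma_stage R n A 0)"
  using dg_functor_comp[OF dg_functor_comp[OF unbase_fun_functor[OF dg_category_axioms] small_proj_functor[of n]] k.square_zero_incl_functor[of n]]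
  by (simp add: k_target_def)

abbreviation gs where "gs n i \<equiv> fmor (gamma_stage R n A i)"

lemma gs_zero: "gs n 0 x y d (Base a) = (pc n x y d a, \<zero>\<^bsub>Hk n x y\<^esub>)"
  by (simp add: dgfun_comp_def unbase_fun_def small_proj_def square_zero_incl_def NM_ops)

lemma fob_gamma_stage: "fob (gamma_stage R n A i) x = x"
  by (induction i) (auto simp: dgfun_comp_def unbase_fun_def small_proj_def square_zero_incl_def attach_ext_def)

definition gphi where
  "gphi n i m x y c = (if m = int n + 1
        then (\<zero>\<^bsub>hom_mod (small_postnikov n A) x y (m + 1)\<^esub>, hk n x y (descend R n A i x y c))
        else \<zero>\<^bsub>hom_mod (k_target n A) x y (m + 1)\<^esub>)"

lemma gamma_stage_Suc: "gamma_stage R n A (Suc i) = attach_ext (k_target n A) (gamma_stage R n A i) (gphi n i)"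
  by (simp add: gphi_def[abs_def])

text \<open>On a chain of degree \<open>n + 2\<close> the second component of \<open>\<gamma>\<close> is the class of its boundary, which is
  a cycle of \<open>A\<close>. In particular \<open>\<gamma>\<close> kills the cycles of degree \<open>n + 2\<close>, which is what
  allows its extension to the next stage.\<close>

definition gamma_spec where
  "gamma_spec n i \<longleftrightarrow> (\<forall>x\<in>Obj A. \<forall>y\<in>Obj A. \<forall>e\<in>hom_set (St n i) x y (int n + 2). \<exists>a\<in>cycles (Mor A x y) (int n + 1).
    hom_diff (St n i) x y (int n + 2) e = ts n i x y (int n + 1) a \<and> snd (gs n i x y (int n + 2) e) = hk n x y a)"

text \<open>The value prescribed on a cell has zero boundary, so \<open>\<gamma>\<close> must kill
  every cycle of degree above \<open>n\<close>. This is automatic except in degree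
  \<open>n + 2\<close>, where \<open>gamma_spec\<close> is used.\<close>

lemma gamma_extension:
  assumes F: "dg_functor R (St n i) (k_target n A) (gamma_stage R n A i)" and s: "gamma_spec n i"
  shows "attach_extension R (St n i) (int n) (k_target n A) (gamma_stage R n A i) (gphi n i)"
proof (intro attach_extension.intro stage_cells attach_extension_axioms.intro F, unfold stage_Obj fob_gamma_stage)
  interpret T: dg_category R "k_target n A" by (rule k_target_dg_category)
  fix m x y c assume m: "m > int n" and o: "x \<in> Obj A" "y \<in> Obj A" and c: "c \<in> cycles (Mor (St n i) x y) m"
  note oT = o[folded k_target_Obj[of n]]
  have c': "c \<in> hom_set (St n i) x y m" using c by (rule cycles_carrier)
  have gc: "gs n i x y m c \<in> hom_set (k_target n A) x y m"
    using dg_functor_hom[OF F, of x y c m] o c' by (simp add: stage_Obj fob_gamma_stage)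
  show "gphi n i m x y c \<in> hom_set (k_target n A) x y (m + 1) \<and>
      hom_diff (k_target n A) x y (m + 1) (gphi n i m x y c) = gs n i x y m c"
  proof (cases "m = int n + 1")
    case True
    obtain a where a: "a \<in> hom_set A x y (int n + 1)" "c = ts n i x y (int n + 1) a"
      using stage_low[OF o c'] True by auto
    then have "a \<in> cycles (Mor A x y) (int n + 1)" using cycle_iff_ts[OF o a(1)] c True by simp
    then have h: "hk n x y (descend R n A i x y c) \<in> carrier (Hk n x y)" using descend[OF o a(1)] a(2) class_in_H[OF o] by simp
    have "gs n i x y m c = \<zero>\<^bsub>hom_mod (k_target n A) x y m\<^esub>" by (rule k_target_zero_at[OF o gc m]) (simp add: True)
    then show ?thesis using h True dg_category.hom_zero_closed[OF small_dg_category[of n], of x y "int n + 2"] o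
        dg_category.hom_diff_zero[OF small_dg_category[of n], of x y "int n + 2"]
      by (simp add: gphi_def k_target_simps NM_carrier NM_ops add.assoc one_plus_int)
  next
    case False
    have "snd (gs n i x y m c) = \<zero>\<^bsub>Hk n x y\<^esub>" if m2: "m = int n + 2"
    proof -
      have c2: "c \<in> hom_set (St n i) x y (int n + 2)" using c' m2 by simp
      obtain a where a: "a \<in> cycles (Mor A x y) (int n + 1)" "hom_diff (St n i) x y (int n + 2) c = ts n i x y (int n + 1) a"
        "snd (gs n i x y (int n + 2) c) = hk n x y a" using s[unfolded gamma_spec_def, rule_format, OF o c2] by blast
      \<comment> \<open>The cycle \<open>a\<close> of \<open>A\<close> is the boundary of
        \<open>c\<close>, which is zero; by injectivity \<open>a\<close> is zero already in
        \<open>A\<close>, and so is its class.\<close>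
      have "ts n i x y (int n + 1) a = ts n i x y (int n + 1) \<zero>\<^bsub>hom_mod A x y (int n + 1)\<^esub>"
        using a(2) c m2 ts_zero[OF o, of n i "int n + 1"] by (simp add: cycles_def one_plus_int)
      then have "a = \<zero>\<^bsub>hom_mod A x y (int n + 1)\<^esub>" using ts_inj[OF o cycles_carrier[OF a(1)] hom_zero_closed[OF o]] by blast
      then show ?thesis using a(3) m2 o by (simp add: H_simps)
    qed
    then have "gs n i x y m c = \<zero>\<^bsub>hom_mod (k_target n A) x y m\<^esub>" by (intro k_target_zero_at[OF o gc m]) simp
    then show ?thesis using False T.hom_zero_closed[OF oT] T.hom_diff_zero[OF oT, of "m + 1"] by (simp add: gphi_def)
  qed
qed

lemma gs_Suc_incl:
  assumes F: "dg_functor R (St n i) (k_target n A) (gamma_stage R n A i)" and s: "gamma_spec n i"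
    and o: "x \<in> Obj A" "y \<in> Obj A" "a \<in> hom_set (St n i) x y d"
  shows "gs n (Suc i) x y d (fmor (stage_incl R n A i) x y d a) = gs n i x y d a"
  using dgfun_eqD(2)[OF attach_extension.attach_ext_incl[OF gamma_extension[OF F s]], unfolded stage_Obj, OF o]
  unfolding gamma_stage_Suc by (simp add: dgfun_comp_def stage_incl_def attach_incl_def)

text \<open>Assumes functoriality and \<open>gamma_spec\<close> for the earlier stages only, since
  it is applied inside the induction that proves them.\<close>

lemma gs_ts_aux:
  assumes "\<And>j. j < i \<Longrightarrow> dg_functor R (St n j) (k_target n A) (gamma_stage R n A j) \<and> gamma_spec n j"
    and o: "x \<in> Obj A" "y \<in> Obj A" "a \<in> hom_set A x y d"
  shows "gs n i x y d (ts n i x y d a) = (pc n x y d a, \<zero>\<^bsub>Hk n x y\<^esub>)"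
  using assms(1)
proof (induction i)
  case 0 then show ?case by (simp only: to_stage.simps) (simp add: base_fun_def gs_zero[unfolded gamma_stage.simps])
next
  case (Suc i)
  have "gs n (Suc i) x y d (ts n (Suc i) x y d a) = gs n i x y d (ts n i x y d a)"
    unfolding ts_Suc using Suc.prems[of i] by (intro gs_Suc_incl[OF _ _ o(1,2) ts_hom[OF o]]) auto
  then show ?case using Suc.IH Suc.prems by simp
qed

text \<open>The formula has to survive composition. In total degree \<open>n + 2\<close>, with no
  negative factor, either one factor has degree \<open>0\<close> and the class is acted upon by it,
  or both factors come from \<open>A\<close> and so does the product; then its boundary has zero
  class, as has its image under \<open>\<gamma>\<close>.\<close>

lemma gamma_spec_Suc:
  assumes F: "dg_functor R (St n i) (k_target n A) (gamma_stage R n A i)" and s: "gamma_spec n i"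
    and G: "dg_functor R (St n (Suc i)) (k_target n A) (gamma_stage R n A (Suc i))"
    and gts: "\<And>x y d a. \<lbrakk>x \<in> Obj A; y \<in> Obj A; a \<in> hom_set A x y d\<rbrakk> \<Longrightarrow>
      gs n (Suc i) x y d (ts n (Suc i) x y d a) = (pc n x y d a, \<zero>\<^bsub>Hk n x y\<^esub>)"
  shows "gamma_spec n (Suc i)"
proof -
  interpret B: attach_cells R "St n i" "int n" by (rule stage_cells)
  interpret E: attach_extension R "St n i" "int n" "k_target n A" "gamma_stage R n A i" "gphi n i"
    by (rule gamma_extension[OF F s])
  interpret S: dg_category R "St n (Suc i)" by (rule stage_dg_category)
  note Glin = linear_mapD[OF dg_functorD(4)[OF G], unfolded stage_Obj fob_gamma_stage]
  note Gzero = dg_functor_zero[OF G, unfolded stage_Obj fob_gamma_stage]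
  note GCmp = dg_functorD(7)[OF G, unfolded stage_Obj fob_gamma_stage]
  note tlin = linear_mapD[OF ts_linear[of _ _ _ n "Suc i"]]
  \<comment> \<open>The induction passes through factors of arbitrary degree, so the condition is
    imposed only in degree \<open>n + 2\<close>.\<close>
  define Q where "Q x y d e \<longleftrightarrow> (d = int n + 2 \<longrightarrow> (\<exists>a\<in>cycles (Mor A x y) (int n + 1).
    hom_diff (St n (Suc i)) x y d e = ts n (Suc i) x y (int n + 1) a \<and> snd (gs n (Suc i) x y d e) = hk n x y a))" for x y d e
  have Q0: "Q x y d \<zero>\<^bsub>hom_mod (St n (Suc i)) x y d\<^esub>" if o: "x \<in> Obj A" "y \<in> Obj A" for x y d
    unfolding Q_def using chain_complex.cycles_zero[OF complex[OF o], of "int n + 1"]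
      S.hom_diff_zero[of x y d] o ts_zero[OF o, of n "Suc i" "int n + 1"] Gzero[OF o, of d]
    by (intro impI bexI[of _ "\<zero>\<^bsub>hom_mod A x y (int n + 1)\<^esub>"]) (auto simp: stage_Obj k_target_simps NM_ops H_simps one_plus_int simp del: stage.simps to_stage.simps gamma_stage.simps)
  have "Q x y d e" if "x \<in> Obj A" "y \<in> Obj A" "e \<in> hom_set (St n (Suc i)) x y d" for x y d e
  proof (rule B.attach_hom_induct[where P = Q], unfold stage_Obj stage.simps(2)[symmetric], goal_cases)
    case 1 show ?case by (rule that(3))
  next
    case (2 x y d b)
    show ?case unfolding Q_def
    proof
      assume d: "d = int n + 2"
      obtain a where a: "a \<in> cycles (Mor A x y) (int n + 1)" "hom_diff (St n i) x y d b = ts n i x y (int n + 1) a"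
        "snd (gs n i x y d b) = hk n x y a" using s[unfolded gamma_spec_def, rule_format, OF 2[unfolded d]] d by blast
      have "hom_diff (St n (Suc i)) x y d (fmor (stage_incl R n A i) x y d b) = ts n (Suc i) x y (int n + 1) a"
        unfolding ts_Suc a(2)[symmetric] using dg_functorD(5)[OF stage_incl_functor, of x n i y b d] 2 d
        by (simp add: stage_Obj fob_stage_incl one_plus_int del: stage.simps)
      then show "\<exists>a\<in>cycles (Mor A x y) (int n + 1). hom_diff (St n (Suc i)) x y d (fmor (attach_incl R (int n) (St n i)) x y d b) =
          ts n (Suc i) x y (int n + 1) a \<and> snd (gs n (Suc i) x y d (fmor (attach_incl R (int n) (St n i)) x y d b)) = hk n x y a"
        using a gs_Suc_incl[OF F s 2] unfolding stage_incl_def by (intro bexI[OF _ a(1)]) simp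
    qed
  next
    \<comment> \<open>A cell of degree \<open>n + 2\<close> bounds a cycle of degree
      \<open>n + 1\<close>, which comes from \<open>A\<close>; its class is the prescribed value of
      \<open>\<gamma>\<close>.\<close>
    case (3 m x y c)
    show ?case unfolding Q_def
    proof
      assume "m + 1 = int n + 2"
      then have m: "m = int n + 1" by simp
      have c': "c \<in> hom_set (St n i) x y m" using 3(4) by (rule cycles_carrier)
      obtain a where a: "a \<in> hom_set A x y (int n + 1)" "c = ts n i x y (int n + 1) a"
        using stage_low[OF 3(2,3) c'] m by auto
      then have az: "a \<in> cycles (Mor A x y) (int n + 1)" using cycle_iff_ts[OF 3(2,3) a(1)] 3(4) m by simp
      have "hom_diff (St n (Suc i)) x y (m + 1) (bounding_chain R (int n) (St n i) m x y c) = ts n (Suc i) x y (int n + 1) a"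
        using B.bounding_chain_diff[OF 3(1), of x y c] 3 a m by (simp add: stage_Obj ts_Suc stage_incl_def del: to_stage.simps)
      moreover have "snd (gs n (Suc i) x y (m + 1) (bounding_chain R (int n) (St n i) m x y c)) = hk n x y a"
        using E.attach_ext_bounding_chain[OF 3(1), of x y c] 3 a(2) m descend[OF 3(2,3) a(1), of i]
        unfolding gamma_stage_Suc by (simp add: stage_Obj gphi_def)
      ultimately show "\<exists>a\<in>cycles (Mor A x y) (int n + 1). hom_diff (St n (Suc i)) x y (m + 1) (bounding_chain R (int n) (St n i) m x y c) =
          ts n (Suc i) x y (int n + 1) a \<and> snd (gs n (Suc i) x y (m + 1) (bounding_chain R (int n) (St n i) m x y c)) = hk n x y a"
        using az by blast
    qed
  next
    case (4 x y d e e')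
    show ?case unfolding Q_def
    proof
      assume d: "d = int n + 2"
      obtain a a' where a: "a \<in> cycles (Mor A x y) (int n + 1)" "hom_diff (St n (Suc i)) x y d e = ts n (Suc i) x y (int n + 1) a"
          "snd (gs n (Suc i) x y d e) = hk n x y a"
        and a': "a' \<in> cycles (Mor A x y) (int n + 1)" "hom_diff (St n (Suc i)) x y d e' = ts n (Suc i) x y (int n + 1) a'"
          "snd (gs n (Suc i) x y d e') = hk n x y a'" using 4(5,6) d unfolding Q_def by blast
      have z: "a \<oplus>\<^bsub>hom_mod A x y (int n + 1)\<^esub> a' \<in> cycles (Mor A x y) (int n + 1)"
        by (rule module.submoduleD(3)[OF hom_module chain_complex.cycles_submodule[OF complex]]) (use 4 a a' in auto)
      have "hom_diff (St n (Suc i)) x y d (e \<oplus>\<^bsub>hom_mod (St n (Suc i)) x y d\<^esub> e') = ts n (Suc i) x y (int n + 1) (a \<oplus>\<^bsub>hom_mod A x y (int n + 1)\<^esub> a')"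
        using S.hom_diff_add[of x y e d e'] 4 d a(2) a'(2) tlin(2)[OF 4(1,2) cycles_carrier[OF a(1)] cycles_carrier[OF a'(1)]]
        by (simp add: stage_Obj one_plus_int del: stage.simps to_stage.simps)
      moreover have "snd (gs n (Suc i) x y d (e \<oplus>\<^bsub>hom_mod (St n (Suc i)) x y d\<^esub> e')) = hk n x y (a \<oplus>\<^bsub>hom_mod A x y (int n + 1)\<^esub> a')"
        using Glin(2)[OF 4(1-4)] a a' 4(1,2) by (cases "gs n (Suc i) x y d e"; cases "gs n (Suc i) x y d e'")
          (simp add: k_target_simps NM_ops H_simps del: stage.simps gamma_stage.simps)
      ultimately show "\<exists>a\<in>cycles (Mor A x y) (int n + 1). hom_diff (St n (Suc i)) x y d (e \<oplus>\<^bsub>hom_mod (St n (Suc i)) x y d\<^esub> e') =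
          ts n (Suc i) x y (int n + 1) a \<and> snd (gs n (Suc i) x y d (e \<oplus>\<^bsub>hom_mod (St n (Suc i)) x y d\<^esub> e')) = hk n x y a"
        using z by blast
    qed
  next
    case (5 x y d r e)
    show ?case unfolding Q_def
    proof
      assume d: "d = int n + 2"
      obtain a where a: "a \<in> cycles (Mor A x y) (int n + 1)" "hom_diff (St n (Suc i)) x y d e = ts n (Suc i) x y (int n + 1) a"
          "snd (gs n (Suc i) x y d e) = hk n x y a" using 5(5) d unfolding Q_def by blast
      have z: "r \<odot>\<^bsub>hom_mod A x y (int n + 1)\<^esub> a \<in> cycles (Mor A x y) (int n + 1)"
        by (rule module.submoduleD(4)[OF hom_module chain_complex.cycles_submodule[OF complex]]) (use 5 a in auto)
      have "hom_diff (St n (Suc i)) x y d (r \<odot>\<^bsub>hom_mod (St n (Suc i)) x y d\<^esub> e) = ts n (Suc i) x y (int n + 1) (r \<odot>\<^bsub>hom_mod A x y (int n + 1)\<^esub> a)"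
        using S.hom_diff_smult[of x y r e d] 5 d a(2) tlin(3)[OF 5(1,2,3) cycles_carrier[OF a(1)]]
        by (simp add: stage_Obj one_plus_int del: stage.simps to_stage.simps)
      moreover have "snd (gs n (Suc i) x y d (r \<odot>\<^bsub>hom_mod (St n (Suc i)) x y d\<^esub> e)) = hk n x y (r \<odot>\<^bsub>hom_mod A x y (int n + 1)\<^esub> a)"
        using Glin(3)[OF 5(1-4)] a 5(1,2,3) by (cases "gs n (Suc i) x y d e")
          (simp add: k_target_simps NM_ops H_simps del: stage.simps gamma_stage.simps)
      ultimately show "\<exists>a\<in>cycles (Mor A x y) (int n + 1). hom_diff (St n (Suc i)) x y d (r \<odot>\<^bsub>hom_mod (St n (Suc i)) x y d\<^esub> e) =
          ts n (Suc i) x y (int n + 1) a \<and> snd (gs n (Suc i) x y d (r \<odot>\<^bsub>hom_mod (St n (Suc i)) x y d\<^esub> e)) = hk n x y a"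
        using z by blast
    qed
  next
    case (6 x y z p q g f)
    note o = 6(1-3)
    note oS = o[folded stage_Obj[of n "Suc i"]]
    \<comment> \<open>Once no degree is negative and the sum is \<open>n + 2\<close>, either one
      degree is \<open>0\<close> or both are at most \<open>n + 1\<close>, where
      \<open>stage_low\<close> applies to both factors.\<close>
    consider "p < 0" | "q < 0" | "p + q \<noteq> int n + 2" | "p = 0" "q = int n + 2" | "p = int n + 2" "q = 0"
      | "p \<le> int n + 1" "q \<le> int n + 1" "p + q = int n + 2" by linarith
    then show ?case
    proof cases
      case 1
      then show ?thesis using stage_negative[OF o(2,3) 6(4)] S.Cmp_zero_left[OF oS 6(5), of p] Q0[OF o(1,3)] by simp
    next
      case 2
      then show ?thesis using stage_negative[OF o(1,2) 6(5)] S.Cmp_zero_right[OF oS 6(4), of q] Q0[OF o(1,3)] by simp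
    next
      case 3 then show ?thesis by (simp add: Q_def)
    next
      case 4
      obtain b where b: "b \<in> hom_set A y z 0" "g = ts n (Suc i) y z 0 b" using stage_low[OF o(2,3) 6(4)] 4 by auto
      obtain a where a: "a \<in> cycles (Mor A x y) (int n + 1)" "hom_diff (St n (Suc i)) x y q f = ts n (Suc i) x y (int n + 1) a"
        "snd (gs n (Suc i) x y q f) = hk n x y a" using 6(7) 4 unfolding Q_def by blast
      have g0: "g \<in> hom_set (St n (Suc i)) y z 0" using 6(4) 4 by simp
      interpret H: module R "hom_mod (St n (Suc i)) x z (int n + 1)" by (rule S.hom_module[OF oS(1,3)])
      have cl: "ts n (Suc i) x z (int n + 1) (Cmp A x y z 0 (int n + 1) b a) \<in> hom_set (St n (Suc i)) x z (int n + 1)"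
        using ts_hom[OF o(1,3)] Cmp_closed[OF o b(1) cycles_carrier[OF a(1)]] by (simp del: stage.simps to_stage.simps)
      \<comment> \<open>A factor of degree \<open>0\<close> is a cycle since there is nothing in
        degree \<open>-1\<close>; hence the boundary of the product is \<open>g\<close> times the
        boundary of \<open>f\<close>, without sign.\<close>
      have "hom_diff (St n (Suc i)) y z 0 g = \<zero>\<^bsub>hom_mod (St n (Suc i)) y z (-1)\<^esub>"
        using stage_negative[OF o(2,3), of _ n "Suc i" "-1"] S.hom_diff_closed[OF oS(2,3) g0] by simp
      then have "hom_diff (St n (Suc i)) x z (p + q) (Cmp (St n (Suc i)) x y z p q g f) = ts n (Suc i) x z (int n + 1) (Cmp A x y z 0 (int n + 1) b a)"
        using S.Cmp_diff_sign[OF oS 6(4,5)] S.Cmp_zero_left[OF oS 6(5), of "-1"] 4 a(2) b(2)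
          ts_Cmp[OF o b(1) cycles_carrier[OF a(1)], of n "Suc i"] cl
        by (simp add: sign_def one_plus_int del: stage.simps to_stage.simps)
      moreover have "snd (gs n (Suc i) x z (p + q) (Cmp (St n (Suc i)) x y z p q g f)) = hk n x z (Cmp A x y z 0 (int n + 1) b a)"
      proof -
        obtain f1 where f1: "gs n (Suc i) x y q f = (f1, hk n x y a)" using a(3) by (cases "gs n (Suc i) x y q f") simp
        have "f1 \<in> hom_set (P n) x y q" using dg_functor_hom[OF G, of x y f q] 6 f1
          by (simp add: stage_Obj fob_gamma_stage k_target_simps del: stage.simps gamma_stage.simps)
        moreover have "gs n (Suc i) y z p g = (pc n y z 0 b, \<zero>\<^bsub>Hk n y z\<^esub>)" using gts[OF o(2,3) b(1)] b(2) 4 by simp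
        ultimately show ?thesis
          using GCmp[OF o 6(4,5)] f1 4 Lact_class[OF o b(1) a(1)] act_zero_right(2)[OF o, of f1 n q p]
            module.module_simprules(10)[OF H_module[OF o(1,3)] class_in_H[OF o(1,3) act_cycles(1)[OF o b(1) a(1)]]]
          by (simp add: k_target_simps del: stage.simps gamma_stage.simps)
      qed
      ultimately show ?thesis unfolding Q_def using act_cycles(1)[OF o b(1) a(1)] by blast
    next
      case 5
      obtain b where b: "b \<in> hom_set A x y 0" "f = ts n (Suc i) x y 0 b" using stage_low[OF o(1,2) 6(5)] 5 by auto
      obtain a where a: "a \<in> cycles (Mor A y z) (int n + 1)" "hom_diff (St n (Suc i)) y z p g = ts n (Suc i) y z (int n + 1) a"
        "snd (gs n (Suc i) y z p g) = hk n y z a" using 6(6) 5 unfolding Q_def by blast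
      have f0: "f \<in> hom_set (St n (Suc i)) x y 0" using 6(5) 5 by simp
      interpret H: module R "hom_mod (St n (Suc i)) x z (int n + 1)" by (rule S.hom_module[OF oS(1,3)])
      have cl: "ts n (Suc i) x z (int n + 1) (Cmp A x y z (int n + 1) 0 a b) \<in> hom_set (St n (Suc i)) x z (int n + 1)"
        using ts_hom[OF o(1,3)] Cmp_closed[OF o cycles_carrier[OF a(1)] b(1)] by (simp del: stage.simps to_stage.simps)
      have "hom_diff (St n (Suc i)) x y 0 f = \<zero>\<^bsub>hom_mod (St n (Suc i)) x y (-1)\<^esub>"
        using stage_negative[OF o(1,2), of _ n "Suc i" "-1"] S.hom_diff_closed[OF oS(1,2) f0] by simp
      then have "hom_diff (St n (Suc i)) x z (p + q) (Cmp (St n (Suc i)) x y z p q g f) = ts n (Suc i) x z (int n + 1) (Cmp A x y z (int n + 1) 0 a b)"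
        using S.Cmp_diff_sign[OF oS 6(4,5)] S.Cmp_zero_right[OF oS 6(4), of "-1"] 5 a(2) b(2)
          ts_Cmp[OF o cycles_carrier[OF a(1)] b(1), of n "Suc i"] cl sign_closed[OF is_cring]
        by (simp add: one_plus_int del: stage.simps to_stage.simps)
      moreover have "snd (gs n (Suc i) x z (p + q) (Cmp (St n (Suc i)) x y z p q g f)) = hk n x z (Cmp A x y z (int n + 1) 0 a b)"
      proof -
        obtain g1 where g1: "gs n (Suc i) y z p g = (g1, hk n y z a)" using a(3) by (cases "gs n (Suc i) y z p g") simp
        have "g1 \<in> hom_set (P n) y z p" using dg_functor_hom[OF G, of y z g p] 6 g1
          by (simp add: stage_Obj fob_gamma_stage k_target_simps del: stage.simps gamma_stage.simps)
        moreover have "gs n (Suc i) x y q f = (pc n x y 0 b, \<zero>\<^bsub>Hk n x y\<^esub>)" using gts[OF o(1,2) b(1)] b(2) 5 by simp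
        ultimately show ?thesis
          using GCmp[OF o 6(4,5)] g1 5 Ract_class[OF o a(1) b(1)] act_zero_right(1)[OF o, of g1 n p q]
            module.module_simprules(6)[OF H_module[OF o(1,3)] class_in_H[OF o(1,3) act_cycles(2)[OF o a(1) b(1)]]]
          by (simp add: k_target_simps del: stage.simps gamma_stage.simps)
      qed
      ultimately show ?thesis unfolding Q_def using act_cycles(2)[OF o a(1) b(1)] by blast
    next
      \<comment> \<open>The boundary of the product bounds in \<open>A\<close>, so its class is
        zero, which matches the zero second component of \<open>\<gamma>\<close> on morphisms of
        \<open>A\<close>.\<close>
      case low: 6
      obtain a b where a: "a \<in> hom_set A y z p" "g = ts n (Suc i) y z p a" and b: "b \<in> hom_set A x y q" "f = ts n (Suc i) x y q b"
        using stage_low[OF o(2,3) 6(4)] stage_low[OF o(1,2) 6(5)] low by blast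
      note c = Cmp_closed[OF o a(1) b(1)]
      have e: "Cmp (St n (Suc i)) x y z p q g f = ts n (Suc i) x z (p + q) (Cmp A x y z p q a b)"
        using ts_Cmp[OF o a(1) b(1), of n "Suc i"] a b by simp
      have bd: "hom_diff A x z (p + q) (Cmp A x y z p q a b) \<in> boundaries (Mor A x z) (int n + 1)"
        using c low(3) by (auto simp: boundaries_def add.assoc intro!: imageI)
      then have bz: "hom_diff A x z (p + q) (Cmp A x y z p q a b) \<in> cycles (Mor A x z) (int n + 1)"
        using chain_complex.boundaries_subset_cycles[OF complex[OF o(1,3)]] by blast
      have "hom_diff (St n (Suc i)) x z (p + q) (Cmp (St n (Suc i)) x y z p q g f) = ts n (Suc i) x z (int n + 1) (hom_diff A x z (p + q) (Cmp A x y z p q a b))"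
        unfolding e using ts_diff[OF o(1,3) c, of n "Suc i"] low(3) by (simp add: one_plus_int del: stage.simps to_stage.simps)
      moreover have "snd (gs n (Suc i) x z (p + q) (Cmp (St n (Suc i)) x y z p q g f)) = hk n x z (hom_diff A x z (p + q) (Cmp A x y z p q a b))"
        unfolding e gts[OF o(1,3) c] using chain_complex.hclass_zero_iff[OF complex[OF o(1,3)] bz] bd by simp
      ultimately show ?thesis unfolding Q_def using bz by blast
    qed
  qed
  then show ?thesis unfolding gamma_spec_def Q_def by blast
qed

text \<open>Extending \<open>\<gamma>\<close> uses the formula on the previous stage, and the
  formula on the new stage uses that the extension is a dg functor. The induction is over all
  smaller stages because the value of \<open>\<gamma>\<close> on \<open>A\<close> is traced back
  through all of them.\<close>

lemma gamma_stage_functor_spec: "dg_functor R (St n i) (k_target n A) (gamma_stage R n A i) \<and> gamma_spec n i"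
proof (induction i rule: less_induct)
  case (less i)
  show ?case
  proof (cases i)
    case 0
    have "gamma_spec n 0"
      unfolding gamma_spec_def
    proof (intro ballI)
      fix x y e assume o: "x \<in> Obj A" "y \<in> Obj A" and "e \<in> hom_set (St n 0) x y (int n + 2)"
      then obtain b where b: "b \<in> hom_set A x y (int n + 2)" "e = Base b" by (auto simp: base_cat_def)
      \<comment> \<open>At stage \<open>0\<close> both sides of the formula vanish: a boundary of
        \<open>A\<close> has zero class, and \<open>\<gamma>\<close> has zero second component on
        \<open>A\<close>.\<close>
      have bd: "hom_diff A x y (int n + 2) b \<in> boundaries (Mor A x y) (int n + 1)"
        using b by (auto simp: boundaries_def add.assoc intro!: imageI)
      then have bz: "hom_diff A x y (int n + 2) b \<in> cycles (Mor A x y) (int n + 1)"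
        using chain_complex.boundaries_subset_cycles[OF complex[OF o]] by blast
      show "\<exists>a\<in>cycles (Mor A x y) (int n + 1). hom_diff (St n 0) x y (int n + 2) e = ts n 0 x y (int n + 1) a \<and>
          snd (gs n 0 x y (int n + 2) e) = hk n x y a"
        using bz chain_complex.hclass_zero_iff[OF complex[OF o] bz] bd b(2) gs_zero[of n x y "int n + 2" b]
        by (intro bexI[OF _ bz]) (auto simp: base_cat_def base_fun_def simp del: gamma_stage.simps)
    qed
    then show ?thesis using gamma_zero_functor 0 by simp
  next
    case (Suc j)
    note IH = less.IH[of j, unfolded Suc, simplified]
    have G: "dg_functor R (St n (Suc j)) (k_target n A) (gamma_stage R n A (Suc j))"
      unfolding gamma_stage_Suc using attach_extension.attach_ext_functor[OF gamma_extension] IH by simp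
    have "gamma_spec n (Suc j)"
    proof (rule gamma_spec_Suc[OF conjunct1[OF IH] conjunct2[OF IH] G])
      show "gs n (Suc j) x y d (ts n (Suc j) x y d a) = (pc n x y d a, \<zero>\<^bsub>Hk n x y\<^esub>)"
        if "x \<in> Obj A" "y \<in> Obj A" "a \<in> hom_set A x y d" for x y d a
        by (rule gs_ts_aux[OF _ that]) (use less.IH Suc in blast)
    qed
    then show ?thesis using G Suc by simp
  qed
qed

lemmas gamma_stage_functor = conjunct1[OF gamma_stage_functor_spec]
lemmas gs_incl = gs_Suc_incl[OF conjunct1[OF gamma_stage_functor_spec] conjunct2[OF gamma_stage_functor_spec]]
lemmas gs_ts = gs_ts_aux[OF gamma_stage_functor_spec]

section \<open>The projection to the small Postnikov section on the stages\<close>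

abbreviation ms where "ms n i \<equiv> fmor (M_stage R n A i)"

lemma fob_M_stage: "fob (M_stage R n A i) x = x"
  by (induction i) (auto simp: dgfun_comp_def unbase_fun_def small_proj_def attach_ext_def)

text \<open>A cycle to which a cell is attached has degree above \<open>n\<close>, where
  \<open>\<tau>\<close> is zero; sending the cell to zero is therefore consistent.\<close>

lemma M_extension:
  assumes F: "dg_functor R (St n i) (P n) (M_stage R n A i)"
  shows "attach_extension R (St n i) (int n) (P n) (M_stage R n A i) (\<lambda>m x y c. \<zero>\<^bsub>hom_mod (P n) x y (m + 1)\<^esub>)"
proof (intro attach_extension.intro stage_cells attach_extension_axioms.intro F, unfold stage_Obj fob_M_stage)
  fix m x y c assume m: "m > int n" and o: "x \<in> Obj A" "y \<in> Obj A" and c: "c \<in> cycles (Mor (St n i) x y) m"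
  have "ms n i x y m c \<in> hom_set (P n) x y m"
    using dg_functor_hom[OF F, of x y c m] o cycles_carrier[OF c] by (simp add: stage_Obj fob_M_stage)
  then have "ms n i x y m c = \<zero>\<^bsub>hom_mod (P n) x y m\<^esub>" by (rule small_above[OF o m])
  then show "\<zero>\<^bsub>hom_mod (P n) x y (m + 1)\<^esub> \<in> hom_set (P n) x y (m + 1) \<and>
      hom_diff (P n) x y (m + 1) \<zero>\<^bsub>hom_mod (P n) x y (m + 1)\<^esub> = ms n i x y m c"
    using k.hom_zero_closed[of x n y] k.hom_diff_zero[of x n y "m + 1"] o by simp
qed

lemma M_stage_functor: "dg_functor R (St n i) (P n) (M_stage R n A i)"
proof (induction i)
  case 0 show ?case using dg_functor_comp[OF unbase_fun_functor[OF dg_category_axioms] small_proj_functor[of n]] by simp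
next
  case (Suc i) show ?case using attach_extension.attach_ext_functor[OF M_extension[OF Suc]] by simp
qed

lemma ms_incl:
  assumes "x \<in> Obj A" "y \<in> Obj A" "a \<in> hom_set (St n i) x y d"
  shows "ms n (Suc i) x y d (fmor (stage_incl R n A i) x y d a) = ms n i x y d a"
  using dgfun_eqD(2)[OF attach_extension.attach_ext_incl[OF M_extension[OF M_stage_functor]], unfolded stage_Obj, OF assms]
  by (simp add: dgfun_comp_def stage_incl_def attach_incl_def)

text \<open>Both sides are extensions of the same functor, and both send every cell to zero; they
  agree by uniqueness of extensions.\<close>

lemma fst_gs: "\<lbrakk>x \<in> Obj A; y \<in> Obj A; e \<in> hom_set (St n i) x y d\<rbrakk> \<Longrightarrow> fst (gs n i x y d e) = ms n i x y d e"
proof (induction i arbitrary: x y d e)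
  case 0
  then obtain a where "e = Base a" by (auto simp: base_cat_def)
  then show ?case by (simp add: dgfun_comp_def unbase_fun_def small_proj_def square_zero_incl_def)
next
  case (Suc i)
  let ?H = "dgfun_comp square_zero_proj (gamma_stage R n A (Suc i))"
  have H: "dg_functor R (St n (Suc i)) (P n) ?H"
    using dg_functor_comp[OF gamma_stage_functor[of n "Suc i"]] k.square_zero_proj_functor[of n] by (simp add: k_target_def)
  have s: "fob (dgfun_comp square_zero_proj (gamma_stage R n A (Suc i))) x = x" "fmor (dgfun_comp square_zero_proj (gamma_stage R n A (Suc i))) x y d e = fst (gs n (Suc i) x y d e)" for x y d e
    by (simp_all add: dgfun_comp_def square_zero_proj_def fob_gamma_stage del: gamma_stage.simps)
  have "dgfun_eq (attach R (int n) (St n i)) ?H (attach_ext (P n) (M_stage R n A i) (\<lambda>m x y c. \<zero>\<^bsub>hom_mod (P n) x y (m + 1)\<^esub>))"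
  proof (rule attach_extension.attach_ext_unique[OF M_extension[OF M_stage_functor]])
    show "dg_functor R (attach R (int n) (St n i)) (P n) ?H" using H by simp
    show "dgfun_eq (St n i) (dgfun_comp ?H (attach_incl R (int n) (St n i))) (M_stage R n A i)"
      unfolding dgfun_eq_def using gs_incl[of _ _ _ n i] Suc.IH
      by (simp add: dgfun_comp_def[of ?H] s stage_Obj fob_M_stage attach_incl_def stage_incl_def del: gamma_stage.simps)
    fix m x y c assume m: "m > int n" and o: "x \<in> Obj (St n i)" "y \<in> Obj (St n i)" and c: "c \<in> cycles (Mor (St n i) x y) m"
    show "fmor ?H x y (m + 1) (bounding_chain R (int n) (St n i) m x y c) = \<zero>\<^bsub>hom_mod (P n) x y (m + 1)\<^esub>"
      unfolding s unfolding gamma_stage_Suc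
      using attach_extension.attach_ext_bounding_chain[OF gamma_extension m o c] gamma_stage_functor_spec[of n i]
      by (simp add: gphi_def k_target_simps)
  qed
  from dgfun_eqD(2)[OF this, of x y e d] show ?case using Suc.prems
    by (simp add: s attach_cells.attach_simps(1)[OF stage_cells] stage_Obj del: gamma_stage.simps)
qed

section \<open>The map from the next section of the tower on the stages\<close>

abbreviation tw where "tw n i \<equiv> fmor (tower_stage R n A i)"

lemma fob_tower_stage: "fob (tower_stage R n A i) x = x"
  by (induction i) (auto simp: dgfun_comp_def dgfun_id_def attach_ext_def fob_stage_incl)

text \<open>Degrees \<open>m > n + 1\<close> are in particular above \<open>n\<close>, so the image
  of each cycle with an attached cell also receives a cell in the target.\<close>

lemma tower_extension:
  assumes F: "dg_functor R (St (Suc n) i) (St n i) (tower_stage R n A i)"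
  shows "attach_extension R (St (Suc n) i) (int (Suc n)) (St n (Suc i)) (dgfun_comp (stage_incl R n A i) (tower_stage R n A i))
    (\<lambda>m x y c. bounding_chain R (int n) (St n i) m x y (tw n i x y m c))"
proof (intro attach_extension.intro stage_cells attach_extension_axioms.intro dg_functor_comp[OF F stage_incl_functor], unfold stage_Obj)
  interpret B: attach_cells R "St n i" "int n" by (rule stage_cells)
  fix m x y c assume m: "m > int (Suc n)" and o: "x \<in> Obj A" "y \<in> Obj A" and c: "c \<in> cycles (Mor (St (Suc n) i) x y) m"
  have z: "tw n i x y m c \<in> cycles (Mor (St n i) x y) m"
    using dg_functor_cycles[OF F _ _ c] o by (simp add: stage_Obj fob_tower_stage)
  have ob: "fob (dgfun_comp (stage_incl R n A i) (tower_stage R n A i)) x = x" for x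
    by (simp add: dgfun_comp_def fob_tower_stage fob_stage_incl)
  show "bounding_chain R (int n) (St n i) m x y (tw n i x y m c) \<in> hom_set (St n (Suc i)) (fob (dgfun_comp (stage_incl R n A i) (tower_stage R n A i)) x)
      (fob (dgfun_comp (stage_incl R n A i) (tower_stage R n A i)) y) (m + 1) \<and>
    hom_diff (St n (Suc i)) (fob (dgfun_comp (stage_incl R n A i) (tower_stage R n A i)) x) (fob (dgfun_comp (stage_incl R n A i) (tower_stage R n A i)) y)
      (m + 1) (bounding_chain R (int n) (St n i) m x y (tw n i x y m c)) = fmor (dgfun_comp (stage_incl R n A i) (tower_stage R n A i)) x y m c"
    unfolding ob using B.bounding_chain_closed[OF _ _ _ z] B.bounding_chain_diff[OF _ _ _ z] m o
    by (simp add: stage_Obj dgfun_comp_def fob_tower_stage stage_incl_def)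
qed

lemma tower_stage_functor: "dg_functor R (St (Suc n) i) (St n i) (tower_stage R n A i)"
proof (induction i)
  case 0 show ?case by (simp add: dgfun_id_functor base_dg_category dg_category_axioms)
next
  case (Suc i) show ?case using attach_extension.attach_ext_functor[OF tower_extension[OF Suc]] by simp
qed

lemma tw_incl:
  assumes "x \<in> Obj A" "y \<in> Obj A" "a \<in> hom_set (St (Suc n) i) x y d"
  shows "tw n (Suc i) x y d (fmor (stage_incl R (Suc n) A i) x y d a) = fmor (stage_incl R n A i) x y d (tw n i x y d a)"
  using dgfun_eqD(2)[OF attach_extension.attach_ext_incl[OF tower_extension[OF tower_stage_functor]], unfolded stage_Obj, OF assms]
  by (simp add: dgfun_comp_def stage_incl_def attach_incl_def fob_tower_stage)

section \<open>The big Postnikov sections\<close>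

sublocale seq: dg_sequence R "stage R n A" "stage_incl R n A" for n by (rule stage_sequence)

abbreviation W where "W n \<equiv> big_postnikov R n A"
abbreviation cl where "cl n x y d i \<equiv> colim_class (St n) (stage_incl R n A) x y d i"

definition big_incl :: "nat \<Rightarrow> ('o, 'a, 'o, (nat \<times> ('o, 'b, 'a) expr) set) dgfun" where
  "big_incl n = dgfun_comp (colim_incl (St n) (stage_incl R n A) 0) base_fun"

abbreviation io where "io n \<equiv> fmor (big_incl n)"

lemma seq_ob: "seq.ob n = Obj A"
  using seq.Obj_D[of n 0] by (simp only: stage_Obj)

lemma W_Obj: "Obj (W n) = Obj A"
  by (simp add: big_postnikov_def seq_ob)

lemma W_dg_category: "dg_category R (W n)"
  unfolding big_postnikov_def by (rule seq.colim.dg_category)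

lemma big_incl_functor: "dg_functor R A (W n) (big_incl n)"
  unfolding big_incl_def big_postnikov_def
  using dg_functor_comp[OF base_fun_functor[OF dg_category_axioms]] seq.colim_incl_functor[of n 0] by simp

lemma fob_big_incl: "fob (big_incl n) x = x"
  by (simp add: big_incl_def dgfun_comp_def base_fun_def colim_incl_def)

lemmas io_hom = dg_functor_hom[OF big_incl_functor, unfolded fob_big_incl]
lemmas io_diff = dg_functorD(5)[OF big_incl_functor, unfolded fob_big_incl]
lemmas io_linear = dg_functorD(4)[OF big_incl_functor, unfolded fob_big_incl]
lemmas io_zero = dg_functor_zero[OF big_incl_functor, unfolded fob_big_incl]

text \<open>The inclusion of \<open>A\<close> can be read off at any stage; an element of low degree
  is lifted to \<open>A\<close> at the stage where it happens to be represented.\<close>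

lemma io_class: "io n x y d a = cl n x y d i (ts n i x y d a)"
proof -
  have "push (stage_incl R n A) x y d 0 i (Base a) = ts n i x y d a"
    by (induction i) (auto simp: base_fun_def dgfun_comp_def fob_to_stage)
  then show ?thesis using seq.class_up[of 0 i n x y d "Base a"]
    by (simp add: big_incl_def dgfun_comp_def base_fun_def colim_incl_def)
qed

lemma W_E:
  assumes "x \<in> Obj A" "y \<in> Obj A" "b \<in> hom_set (W n) x y d"
  obtains i e where "e \<in> hom_set (St n i) x y d" "b = cl n x y d i e"
  using assms seq.colim.hom[of x n y d] by (auto simp: big_postnikov_def seq_ob)

lemma cl_hom: "\<lbrakk>x \<in> Obj A; y \<in> Obj A; e \<in> hom_set (St n i) x y d\<rbrakk> \<Longrightarrow> cl n x y d i e \<in> hom_set (W n) x y d"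
  using seq.colim.hom_closed[of x n y e i d] by (simp add: big_postnikov_def seq_ob)

lemma cl_diff: "\<lbrakk>x \<in> Obj A; y \<in> Obj A; e \<in> hom_set (St n i) x y d\<rbrakk> \<Longrightarrow>
    hom_diff (W n) x y d (cl n x y d i e) = cl n x y (d - 1) i (hom_diff (St n i) x y d e)"
  using seq.colim.diff[of x n y e i d] by (simp add: big_postnikov_def seq_ob)

lemma cl_incl: "cl n x y d (Suc i) (fmor (stage_incl R n A i) x y d e) = cl n x y d i e"
  using seq.class_up[of i "Suc i" n x y d e] by simp

lemma W_low:
  assumes o: "x \<in> Obj A" "y \<in> Obj A" and b: "b \<in> hom_set (W n) x y d" "d \<le> int n + 1"
  obtains a where "a \<in> hom_set A x y d" "b = io n x y d a"
proof -
  obtain i e where e: "e \<in> hom_set (St n i) x y d" "b = cl n x y d i e" by (rule W_E[OF o b(1)])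
  obtain a where "a \<in> hom_set A x y d" "e = ts n i x y d a" using stage_low[OF o e(1) b(2)] by auto
  then show ?thesis using that io_class[of n x y d a i] e(2) by simp
qed

lemma io_inj:
  assumes o: "x \<in> Obj A" "y \<in> Obj A" and ab: "a \<in> hom_set A x y d" "b \<in> hom_set A x y d" and eq: "io n x y d a = io n x y d b"
  shows "a = b"
proof -
  have "(0, ts n 0 x y d a) \<in> cl n x y d 0 (ts n 0 x y d b)"
    using eq seq.class_self[OF ts_hom[OF o ab(1), of n 0]] by (simp only: io_class[of n x y d _ 0])
  then obtain l where l: "push (stage_incl R n A) x y d 0 l (ts n 0 x y d b) = push (stage_incl R n A) x y d 0 l (ts n 0 x y d a)"
    unfolding seq.class_mem_iff by auto
  have "push (stage_incl R n A) x y d 0 l (ts n 0 x y d c) = ts n l x y d c" for c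
    by (induction l) (auto simp: ts_Suc simp del: to_stage.simps)
  then have "ts n l x y d b = ts n l x y d a" using l by simp
  then show ?thesis using ts_inj[OF o ab(2,1)] by blast
qed

lemma io_cycle:
  assumes o: "x \<in> Obj A" "y \<in> Obj A" and a: "a \<in> hom_set A x y d" and z: "io n x y d a \<in> cycles (Mor (W n) x y) d"
  shows "a \<in> cycles (Mor A x y) d"
proof -
  have "io n x y (d - 1) (hom_diff A x y d a) = io n x y (d - 1) \<zero>\<^bsub>hom_mod A x y (d - 1)\<^esub>"
    using z io_diff[OF o a, of n] io_zero[OF o, of n "d - 1"] by (simp add: cycles_def)
  then show ?thesis using io_inj[OF o hom_diff_closed[OF o a] hom_zero_closed[OF o]] a by (simp add: cycles_def)
qed

text \<open>A cycle of the colimit is represented by a cycle of some stage, and the next stage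
  contains a cell bounding it.\<close>

lemma W_acyclic:
  assumes o: "x \<in> Obj A" "y \<in> Obj A" and c: "c \<in> cycles (Mor (W n) x y) m" and m: "m > int n"
  obtains b where "b \<in> hom_set (W n) x y (m + 1)" "hom_diff (W n) x y (m + 1) b = c"
proof -
  obtain i e where e: "e \<in> hom_set (St n i) x y m" "c = cl n x y m i e" by (rule W_E[OF o cycles_carrier[OF c]])
  interpret S: dg_category R "St n j" for j by (rule stage_dg_category)
  have os: "x \<in> seq.ob n" "y \<in> seq.ob n" using o by (simp_all add: seq_ob)
  \<comment> \<open>A representative of a cycle need not be a cycle: its differential vanishes only
    after passing to a later stage \<open>l\<close>.\<close>
  have "cl n x y (m - 1) i (hom_diff (St n i) x y m e) = cl n x y (m - 1) i \<zero>\<^bsub>hom_mod (St n i) x y (m - 1)\<^esub>"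
    using cl_diff[OF o e(1)] c e(2) seq.colim.zero[of x n y "m - 1" i] o by (simp add: cycles_def big_postnikov_def seq_ob)
  moreover have "(i, hom_diff (St n i) x y m e) \<in> cl n x y (m - 1) i (hom_diff (St n i) x y m e)"
    using seq.class_self seq.D_diff_closed[OF os e(1)] by blast
  ultimately obtain l where l: "i \<le> l"
    "push (stage_incl R n A) x y (m - 1) i (l - i) \<zero>\<^bsub>hom_mod (St n i) x y (m - 1)\<^esub> = push (stage_incl R n A) x y (m - 1) i (l - i) (hom_diff (St n i) x y m e)"
    by (auto simp: seq.class_mem_iff)
  define e' where "e' = push (stage_incl R n A) x y m i (l - i) e"
  have e': "e' \<in> hom_set (St n l) x y m" unfolding e'_def by (rule seq.up_closed[OF os e(1) l(1)])
  have "hom_diff (St n l) x y m e' = \<zero>\<^bsub>hom_mod (St n l) x y (m - 1)\<^esub>"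
    using seq.up_diff[OF os e(1) l(1)] l(2) linear_map_zero[OF seq.up_linear[OF os l(1)] seq.D_module[OF os] seq.D_module[OF os], of "m - 1"]
    by (simp add: e'_def)
  then have z: "e' \<in> cycles (Mor (St n l) x y) m" using e' by (simp add: cycles_def)
  interpret B: attach_cells R "St n l" "int n" by (rule stage_cells)
  let ?b = "bounding_chain R (int n) (St n l) m x y e'"
  have b: "?b \<in> hom_set (St n (Suc l)) x y (m + 1)" "hom_diff (St n (Suc l)) x y (m + 1) ?b = fmor (stage_incl R n A l) x y m e'"
    using B.bounding_chain_closed[OF m _ _ z] B.bounding_chain_diff[OF m _ _ z] o by (simp_all add: stage_Obj stage_incl_def)
  have "hom_diff (W n) x y (m + 1) (cl n x y (m + 1) (Suc l) ?b) = c"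
    using cl_diff[OF o b(1)] b(2) cl_incl[of n x y m l e'] seq.class_up[OF l(1), of n x y m e] e(2) by (simp add: e'_def del: stage.simps)
  then show ?thesis using that cl_hom[OF o b(1)] by blast
qed

section \<open>The maps induced on the colimits\<close>

abbreviation ga where "ga n \<equiv> fmor (gamma_map R n A)"
abbreviation Mm where "Mm n \<equiv> fmor (M_map R n A)"
abbreviation tm where "tm n \<equiv> fmor (tower_map R n A)"

lemma gamma_functor: "dg_functor R (W n) (k_target n A) (gamma_map R n A)"
  unfolding big_postnikov_def gamma_map_def
  by (rule seq.colim_map_functor[OF gamma_stage_functor]) (auto simp: fob_gamma_stage gs_incl seq_ob simp del: gamma_stage.simps)

lemma M_functor: "dg_functor R (W n) (P n) (M_map R n A)"
  unfolding big_postnikov_def M_map_def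
  by (rule seq.colim_map_functor[OF M_stage_functor]) (auto simp: fob_M_stage ms_incl seq_ob simp del: M_stage.simps)

lemma fob_maps: "fob (gamma_map R n A) x = x" "fob (M_map R n A) x = x" "fob (tower_map R n A) x = x"
  by (simp_all add: gamma_map_def M_map_def tower_map_def colim_map_def dgfun_comp_def colim_incl_def fob_gamma_stage fob_M_stage fob_tower_stage
    del: gamma_stage.simps M_stage.simps tower_stage.simps)

lemma fmor_tower_colim: "fmor (dgfun_comp (colim_incl (St n) (stage_incl R n A) i) (tower_stage R n A i)) x y d a = cl n x y d i (tw n i x y d a)"
    "fob (dgfun_comp (colim_incl (St n) (stage_incl R n A) i) (tower_stage R n A i)) x = x"
  by (simp_all add: dgfun_comp_def colim_incl_def fob_tower_stage)

lemma tower_compat: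
  assumes "x \<in> Obj A" "y \<in> Obj A" "a \<in> hom_set (St (Suc n) i) x y d"
  shows "fmor (dgfun_comp (colim_incl (St n) (stage_incl R n A) (Suc i)) (tower_stage R n A (Suc i))) x y d (fmor (stage_incl R (Suc n) A i) x y d a) =
    fmor (dgfun_comp (colim_incl (St n) (stage_incl R n A) i) (tower_stage R n A i)) x y d a"
  unfolding fmor_tower_colim tw_incl[OF assms] by (rule cl_incl)

lemma tower_functor: "dg_functor R (W (Suc n)) (W n) (tower_map R n A)"
  unfolding big_postnikov_def tower_map_def
proof (rule seq.colim_map_functor)
  show "dg_functor R (St (Suc n) i) (colim_dgcat (St n) (stage_incl R n A)) (dgfun_comp (colim_incl (St n) (stage_incl R n A) i) (tower_stage R n A i))" for i
    by (rule dg_functor_comp[OF tower_stage_functor seq.colim_incl_functor])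
qed (use tower_compat in \<open>simp_all only: fmor_tower_colim(2) seq_ob\<close>)

lemma ga_class: "\<lbrakk>x \<in> Obj A; y \<in> Obj A; e \<in> hom_set (St n i) x y d\<rbrakk> \<Longrightarrow> ga n x y d (cl n x y d i e) = gs n i x y d e"
  unfolding gamma_map_def by (rule seq.colim_map_class) (auto simp: gs_incl seq_ob simp del: gamma_stage.simps)

lemma Mm_class: "\<lbrakk>x \<in> Obj A; y \<in> Obj A; e \<in> hom_set (St n i) x y d\<rbrakk> \<Longrightarrow> Mm n x y d (cl n x y d i e) = ms n i x y d e"
  unfolding M_map_def by (rule seq.colim_map_class) (auto simp: ms_incl seq_ob simp del: M_stage.simps)

lemma tm_class:
  assumes "x \<in> Obj A" "y \<in> Obj A" "e \<in> hom_set (St (Suc n) i) x y d"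
  shows "tm n x y d (cl (Suc n) x y d i e) = cl n x y d i (tw n i x y d e)"
proof -
  have "tm n x y d (cl (Suc n) x y d i e) = fmor (dgfun_comp (colim_incl (St n) (stage_incl R n A) i) (tower_stage R n A i)) x y d e"
    unfolding tower_map_def by (rule seq.colim_map_class) (use assms tower_compat in \<open>auto simp: seq_ob\<close>)
  then show ?thesis by (simp add: dgfun_comp_def colim_incl_def fob_tower_stage)
qed

lemma ga_io: "\<lbrakk>x \<in> Obj A; y \<in> Obj A; a \<in> hom_set A x y d\<rbrakk> \<Longrightarrow> ga n x y d (io n x y d a) = (pc n x y d a, \<zero>\<^bsub>Hk n x y\<^esub>)"
  using ga_class[of x y "ts n 0 x y d a" n 0 d] ts_hom[of x y a d n 0] gs_ts[of x y a d n 0] by (simp only: io_class[of n x y d a 0])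

lemma tm_io: "\<lbrakk>x \<in> Obj A; y \<in> Obj A; a \<in> hom_set A x y d\<rbrakk> \<Longrightarrow> tm n x y d (io (Suc n) x y d a) = io n x y d a"
  using tm_class[of x y "ts (Suc n) 0 x y d a" n 0 d] ts_hom[of x y a d "Suc n" 0] by (simp only: io_class[of _ x y d a 0]) (simp add: base_fun_def dgfun_id_def)

lemma fst_ga: "\<lbrakk>x \<in> Obj A; y \<in> Obj A; b \<in> hom_set (W n) x y d\<rbrakk> \<Longrightarrow> fst (ga n x y d b) = Mm n x y d b"
  by (rule W_E[of x y b n d]) (simp_all add: ga_class Mm_class fst_gs)

lemma ga_hom:
  assumes "x \<in> Obj A" "y \<in> Obj A" "b \<in> hom_set (W n) x y d"
  shows "ga n x y d b \<in> hom_set (k_target n A) x y d"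
  using dg_functor_hom[OF gamma_functor, of x n y b d] assms by (simp add: W_Obj fob_maps)

lemma ga_low:
  assumes "x \<in> Obj A" "y \<in> Obj A" "b \<in> hom_set (W n) x y d" "d \<noteq> int n + 2"
  shows "ga n x y d b = (Mm n x y d b, \<zero>\<^bsub>Hk n x y\<^esub>)"
  using ga_hom[OF assms(1-3)] fst_ga[OF assms(1-3)] assms(4) by (cases "ga n x y d b") (simp add: k_target_simps NM_carrier)

text \<open>The second component can be nonzero only in degree \<open>n + 2\<close>, and there
  \<open>P_{n+1}(A)\<close> still agrees with \<open>A\<close>, on which it vanishes. This makes the
  square with the inclusion commute strictly and not just up to homotopy.\<close>

lemma ga_tm:
  assumes o: "x \<in> Obj A" "y \<in> Obj A" and e: "e \<in> hom_set (W (Suc n)) x y d"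
  shows "ga n x y d (tm n x y d e) = (Mm n x y d (tm n x y d e), \<zero>\<^bsub>Hk n x y\<^esub>)"
proof (cases "d = int n + 2")
  case True
  \<comment> \<open>The bound of \<open>W_low\<close> for \<open>Suc n\<close> is
    \<open>n + 2\<close>, one more than for \<open>n\<close>.\<close>
  obtain a where a: "a \<in> hom_set A x y d" "e = io (Suc n) x y d a" by (rule W_low[OF o e]) (use True in auto)
  then have "tm n x y d e = io n x y d a" using tm_io[OF o] by simp
  then show ?thesis using fst_ga[OF o io_hom[OF o a(1), of n]] ga_io[OF o a(1), of n] by simp
next
  case False
  show ?thesis using ga_low[OF o _ False] dg_functor_hom[OF tower_functor, of x n y e d] o e by (simp add: W_Obj fob_maps)
qed

lemma ga_spec:
  assumes o: "x \<in> Obj A" "y \<in> Obj A" and b: "b \<in> hom_set (W n) x y (int n + 2)"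
  obtains a where "a \<in> cycles (Mor A x y) (int n + 1)" "hom_diff (W n) x y (int n + 2) b = io n x y (int n + 1) a"
    "snd (ga n x y (int n + 2) b) = hk n x y a"
proof -
  obtain i e where e: "e \<in> hom_set (St n i) x y (int n + 2)" "b = cl n x y (int n + 2) i e" by (rule W_E[OF o b])
  obtain a where a: "a \<in> cycles (Mor A x y) (int n + 1)" "hom_diff (St n i) x y (int n + 2) e = ts n i x y (int n + 1) a"
    "snd (gs n i x y (int n + 2) e) = hk n x y a"
    using conjunct2[OF gamma_stage_functor_spec, unfolded gamma_spec_def, rule_format, OF o e(1)] by blast
  have "hom_diff (W n) x y (int n + 2) b = io n x y (int n + 1) a"
    using cl_diff[OF o e(1)] e(2) a(2) io_class[of n x y "int n + 1" a i] by (simp add: one_plus_int)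
  then show ?thesis using that a ga_class[OF o e(1)] e(2) by simp
qed

text \<open>Each class in \<open>H_{n+1}(A)\<close> is realized by the cell on a representing cycle,
  so \<open>\<gamma>\<close> maps chains of degree \<open>n + 2\<close> onto the bimodule.\<close>

lemma ga_bound:
  assumes o: "x \<in> Obj A" "y \<in> Obj A" and a: "a \<in> cycles (Mor A x y) (int n + 1)"
  obtains b where "b \<in> hom_set (W n) x y (int n + 2)" "hom_diff (W n) x y (int n + 2) b = io n x y (int n + 1) a"
    "ga n x y (int n + 2) b = (\<zero>\<^bsub>hom_mod (P n) x y (int n + 2)\<^esub>, hk n x y a)"
proof -
  \<comment> \<open>The index is named so that the recursion equations for stage \<open>0\<close> do
    not unfold.\<close>
  define i :: nat where "i = 0"
  interpret B: attach_cells R "St n i" "int n" by (rule stage_cells)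
  define c where "c = ts n i x y (int n + 1) a"
  have c: "c \<in> cycles (Mor (St n i) x y) (int n + 1)" unfolding c_def by (rule ts_cycles[OF o a])
  define b where "b = bounding_chain R (int n) (St n i) (int n + 1) x y c"
  have oi: "x \<in> Obj (St n i)" "y \<in> Obj (St n i)" "int n + 1 > int n" using o by (simp_all add: stage_Obj)
  have b: "b \<in> hom_set (St n (Suc i)) x y (int n + 2)"
      "hom_diff (St n (Suc i)) x y (int n + 2) b = fmor (stage_incl R n A i) x y (int n + 1) c"
    using B.bounding_chain_closed[OF oi(3,1,2) c] B.bounding_chain_diff[OF oi(3,1,2) c]
    by (simp_all add: stage_incl_def b_def add.commute add.left_commute)
  have d: "descend R n A i x y c = a" unfolding c_def by (rule descend[OF o cycles_carrier[OF a]])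
  have "gs n (Suc i) x y (int n + 2) b = (\<zero>\<^bsub>hom_mod (P n) x y (int n + 2)\<^esub>, hk n x y a)"
    using attach_extension.attach_ext_bounding_chain[OF gamma_extension oi(3,1,2) c] gamma_stage_functor_spec[of n i] d
    unfolding gamma_stage_Suc by (simp add: b_def gphi_def add.commute add.left_commute)
  moreover have "hom_diff (W n) x y (int n + 2) (cl n x y (int n + 2) (Suc i) b) = io n x y (int n + 1) a"
    using cl_diff[OF o b(1)] b(2) cl_incl[of n x y "int n + 1" i c] by (simp add: io_class[of n x y _ a i] c_def one_plus_int del: stage.simps)
  ultimately show ?thesis using that[OF cl_hom[OF o b(1)]] ga_class[OF o b(1)] by (simp del: stage.simps gamma_stage.simps)
qed

section \<open>The tower map on homology\<close>

lemma W_module: "\<lbrakk>x \<in> Obj A; y \<in> Obj A\<rbrakk> \<Longrightarrow> module R (hom_mod (W n) x y i)"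
  using dg_category.hom_module[OF W_dg_category] by (simp add: W_Obj)

lemma W_complex: "\<lbrakk>x \<in> Obj A; y \<in> Obj A\<rbrakk> \<Longrightarrow> chain_complex R (Mor (W n) x y)"
  using dg_category.complex[OF W_dg_category] by (simp add: W_Obj)

lemmas io_cycles = dg_functor_cycles[OF big_incl_functor, unfolded fob_big_incl]

lemma tm_zero: "\<lbrakk>x \<in> Obj A; y \<in> Obj A\<rbrakk> \<Longrightarrow> tm n x y i \<zero>\<^bsub>hom_mod (W (Suc n)) x y i\<^esub> = \<zero>\<^bsub>hom_mod (W n) x y i\<^esub>"
  using dg_functor_zero[OF tower_functor[of n], of x y i] by (simp add: W_Obj fob_maps)

lemma W_low_cycle:
  assumes "x \<in> Obj A" "y \<in> Obj A" "b \<in> cycles (Mor (W n) x y) d" "d \<le> int n + 1"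
  obtains v where "v \<in> cycles (Mor A x y) d" "b = io n x y d v"
  using W_low[OF assms(1,2) cycles_carrier[OF assms(3)] assms(4)] io_cycle[OF assms(1,2)] assms(3) by metis

text \<open>Supplies surjectivity on homology of the comparison map: \<open>b\<close> and the class
  \<open>h\<close> have to be corrected by the same chain \<open>b'\<close>. The value of
  \<open>\<gamma>\<close> on \<open>b'\<close> is \<open>- h\<close> because the middle component
  enters the differential of the path category with a minus sign.\<close>

lemma tower_lift:
  assumes o: "x \<in> Obj A" "y \<in> Obj A" and b: "b \<in> cycles (Mor (W n) x y) i" and h: "h \<in> carrier (NM n x y (i + 1))"
  obtains e b' where "e \<in> cycles (Mor (W (Suc n)) x y) i" "b' \<in> hom_set (W n) x y (i + 1)"
    "b = tm n x y i e \<oplus>\<^bsub>hom_mod (W n) x y i\<^esub> hom_diff (W n) x y (i + 1) b'"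
    "ga n x y (i + 1) b' = (\<zero>\<^bsub>hom_mod (P n) x y (i + 1)\<^esub>, \<ominus>\<^bsub>Hk n x y\<^esub> h)"
proof -
  interpret Wn: chain_complex R "Mor (W n) x y" by (rule W_complex[OF o])
  interpret Ws: chain_complex R "Mor (W (Suc n)) x y" by (rule W_complex[OF o])
  interpret Wi: module R "hom_mod (W n) x y i" by (rule W_module[OF o])
  interpret Wi1: module R "hom_mod (W n) x y (i + 1)" by (rule W_module[OF o])
  interpret H: module R "Hk n x y" by (rule H_module[OF o])
  interpret Ai: module R "hom_mod A x y i" by (rule hom_module[OF o])
  note bc = cycles_carrier[OF b]
  consider "i \<le> int n" | "i = int n + 1" | "i > int n + 1" by linarith
  then show ?thesis
  proof cases
    case 1
    then obtain v where v: "v \<in> cycles (Mor A x y) i" "b = io n x y i v" using W_low_cycle[OF o b] by auto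
    have "h = \<zero>\<^bsub>Hk n x y\<^esub>" using h 1 by (simp add: NM_carrier)
    moreover have "ga n x y (i + 1) \<zero>\<^bsub>hom_mod (W n) x y (i + 1)\<^esub> = (\<zero>\<^bsub>hom_mod (P n) x y (i + 1)\<^esub>, \<zero>\<^bsub>Hk n x y\<^esub>)"
      using dg_functor_zero[OF gamma_functor[of n], of x y "i + 1"] o by (simp add: W_Obj fob_maps k_target_simps NM_ops)
    ultimately show ?thesis
      using that[OF io_cycles[OF o v(1)], of "\<zero>\<^bsub>hom_mod (W n) x y (i + 1)\<^esub>"] tm_io[OF o cycles_carrier[OF v(1)], of n] v(2) bc Wn.diff_zero[of "i + 1"]
      by (simp add: H.a_inv_zero)
  next
    case 2
    obtain v where v: "v \<in> cycles (Mor A x y) i" "b = io n x y i v" using W_low_cycle[OF o b] 2 by auto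
    have "\<ominus>\<^bsub>Hk n x y\<^esub> h \<in> carrier (NM n x y (int n + 2))" using h 2 by (simp add: NM_carrier add.assoc)
    \<comment> \<open>The chain \<open>b'\<close> is a cell on a cycle \<open>w\<close> of class
      \<open>- h\<close>. Its boundary changes \<open>b\<close> by \<open>w\<close>, which is
      compensated by lifting \<open>v - w\<close> instead of \<open>v\<close>.\<close>
    then obtain w where w: "w \<in> cycles (Mor A x y) (int n + 1)" "\<ominus>\<^bsub>Hk n x y\<^esub> h = hk n x y w" by (rule H_E[OF o])
    obtain b' where b': "b' \<in> hom_set (W n) x y (int n + 2)" "hom_diff (W n) x y (int n + 2) b' = io n x y (int n + 1) w"
      "ga n x y (int n + 2) b' = (\<zero>\<^bsub>hom_mod (P n) x y (int n + 2)\<^esub>, hk n x y w)" by (rule ga_bound[OF o w(1)])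
    have wi: "w \<in> cycles (Mor A x y) i" using w(1) 2 by simp
    note c = cycles_carrier[OF v(1)] cycles_carrier[OF wi]
    have vw: "v \<ominus>\<^bsub>hom_mod A x y i\<^esub> w \<in> cycles (Mor A x y) i"
      unfolding a_minus_def using Ai.submoduleD(3,5)[OF chain_complex.cycles_submodule[OF complex[OF o]]] v(1) wi by blast
    have "tm n x y i (io (Suc n) x y i (v \<ominus>\<^bsub>hom_mod A x y i\<^esub> w)) = io n x y i v \<ominus>\<^bsub>hom_mod (W n) x y i\<^esub> io n x y i w"
      using tm_io[OF o cycles_carrier[OF vw], of n] linear_map_diff[OF io_linear[OF o] hom_module[OF o] W_module[OF o] c] by simp
    then have "b = tm n x y i (io (Suc n) x y i (v \<ominus>\<^bsub>hom_mod A x y i\<^esub> w)) \<oplus>\<^bsub>hom_mod (W n) x y i\<^esub> io n x y i w"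
      using Wi.minus_eq_iff[of "io n x y i v" "io n x y i w"] io_hom[OF o c(1), of n] io_hom[OF o c(2), of n] v(2)
      by (simp add: a_minus_def Wi.M.a_assoc Wi.M.l_neg)
    then show ?thesis using that[OF io_cycles[OF o vw], of b'] b' w(2) 2 by (simp add: add.assoc)
  next
    case 3
    \<comment> \<open>Here \<open>b\<close> itself bounds, so the zero cycle is a lift;
      \<open>\<gamma>\<close> vanishes on \<open>b'\<close> since the degree \<open>i + 1\<close>
      exceeds \<open>n + 2\<close>.\<close>
    obtain b' where b': "b' \<in> hom_set (W n) x y (i + 1)" "hom_diff (W n) x y (i + 1) b' = b" by (rule W_acyclic[OF o b]) (use 3 in auto)
    have "ga n x y (i + 1) b' = \<zero>\<^bsub>hom_mod (k_target n A) x y (i + 1)\<^esub>"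
      by (rule k_target_zero_at[OF o ga_hom[OF o b'(1)]]) (use 3 in auto)
    moreover have "h = \<zero>\<^bsub>Hk n x y\<^esub>" using h 3 by (simp add: NM_carrier)
    ultimately show ?thesis using that[OF Ws.cycles_zero b'(1)] b'(2) bc by (simp add: tm_zero[OF o] k_target_simps NM_ops H.a_inv_zero)
  qed
qed

text \<open>For \<open>i \<le> n\<close> the chain \<open>b\<close> comes from \<open>A\<close>. For
  \<open>i = n + 1\<close> it may involve cells, but the second component of its image under
  \<open>\<gamma>\<close> is the class of its boundary; since this is zero, the boundary also bounds
  in \<open>A\<close>. For \<open>i > n + 1\<close> the source is acyclic.\<close>

lemma tower_reflects_boundaries:
  assumes o: "x \<in> Obj A" "y \<in> Obj A" and e: "e \<in> cycles (Mor (W (Suc n)) x y) i" and b: "b \<in> hom_set (W n) x y (i + 1)"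
    and eq: "tm n x y i e = hom_diff (W n) x y (i + 1) b" and ga: "snd (ga n x y (i + 1) b) = \<zero>\<^bsub>Hk n x y\<^esub>"
  shows "e \<in> boundaries (Mor (W (Suc n)) x y) i"
proof -
  \<comment> \<open>It suffices that the image of \<open>e\<close> comes from a boundary of
    \<open>A\<close>: in degrees up to \<open>n + 1\<close> also \<open>e\<close> comes from
    \<open>A\<close>, and \<open>A\<close> embeds into \<open>P_n(A)\<close>.\<close>
  have *: "e \<in> boundaries (Mor (W (Suc n)) x y) i" if t: "i \<le> int n + 1" "a \<in> hom_set A x y (i + 1)" "tm n x y i e = io n x y i (hom_diff A x y (i + 1) a)" for a
  proof -
    obtain v where v: "v \<in> cycles (Mor A x y) i" "e = io (Suc n) x y i v" by (rule W_low_cycle[OF o e]) (use t(1) in simp)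
    have "io n x y i v = io n x y i (hom_diff A x y (i + 1) a)" using tm_io[OF o cycles_carrier[OF v(1)], of n] v(2) t(3) by simp
    then have "v = hom_diff A x y (i + 1) a"
      using io_inj[OF o cycles_carrier[OF v(1)]] hom_diff_closed[OF o t(2)] by simp
    then have "e = hom_diff (W (Suc n)) x y (i + 1) (io (Suc n) x y (i + 1) a)" using v(2) io_diff[OF o t(2), of "Suc n"] by simp
    then show ?thesis using io_hom[OF o t(2), of "Suc n"] by (auto simp: boundaries_def)
  qed
  consider "i \<le> int n" | "i = int n + 1" | "i > int n + 1" by linarith
  then show ?thesis
  proof cases
    case 1
    obtain a where a: "a \<in> hom_set A x y (i + 1)" "b = io n x y (i + 1) a" by (rule W_low[OF o b]) (use 1 in auto)
    show ?thesis by (rule *[OF _ a(1)]) (use 1 eq a(2) io_diff[OF o a(1), of n] in auto)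
  next
    case 2
    have i: "i + 1 = int n + 2" using 2 by simp
    obtain a where a: "a \<in> cycles (Mor A x y) (int n + 1)" "hom_diff (W n) x y (int n + 2) b = io n x y (int n + 1) a"
      "snd (ga n x y (int n + 2) b) = hk n x y a" using ga_spec[OF o b[unfolded i]] by blast
    have "a \<in> boundaries (Mor A x y) (int n + 1)"
      using chain_complex.hclass_zero_iff[OF complex[OF o] a(1)] a(3) ga unfolding i by simp
    then obtain c where c: "c \<in> hom_set A x y (i + 1)" "a = hom_diff A x y (i + 1) c" using 2 by (auto simp: boundaries_def)
    have "tm n x y i e = io n x y i (hom_diff A x y (i + 1) c)"
      using eq a(2) c(2) unfolding i[symmetric] 2[symmetric] by simp
    then show ?thesis using *[OF _ c(1)] 2 by simp
  next
    case 3
    obtain c where "c \<in> hom_set (W (Suc n)) x y (i + 1)" "hom_diff (W (Suc n)) x y (i + 1) c = e" by (rule W_acyclic[OF o e]) (use 3 in auto)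
    then show ?thesis by (auto simp: boundaries_def)
  qed
qed

section \<open>The homotopy pullback\<close>

abbreviation incl where "incl n \<equiv> square_zero_incl (k_bimod n A)"

lemma incl_functor: "dg_functor R (P n) (k_target n A) (incl n)"
  using k.square_zero_incl_functor[of n] by (simp add: k_target_def)

lemma proj_functor: "dg_functor R (k_target n A) (P n) square_zero_proj"
  using k.square_zero_proj_functor[of n] by (simp add: k_target_def)

lemma incl_simps: "fob (incl n) x = x" "fmor (incl n) x y i a = (a, \<zero>\<^bsub>Hk n x y\<^esub>)"
  by (simp_all add: square_zero_incl_def NM_ops)

sublocale path: mapping_path R "small_postnikov n A" "k_target n A" "incl n" for n
  by (rule mapping_path.intro[OF incl_functor]) (simp_all add: k_target_Obj incl_simps)

text \<open>The bimodule vanishes in degree \<open>0\<close> because \<open>n + 2\<close> is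
  positive; in that degree the projection is inverse to the inclusion.\<close>

lemma path_fibration: "dg_fibration R (path_dgcat R (P n) (k_target n A) (incl n)) (k_target n A) path_eval"
proof (rule path.path_eval_fibration[OF proj_functor])
  fix x y v assume "x \<in> Obj (P n)" "y \<in> Obj (P n)" "v \<in> hom_set (k_target n A) x y 0"
  then show "fmor (incl n) x y 0 (fmor square_zero_proj x y 0 v) = v"
    by (cases v) (simp add: incl_simps square_zero_proj_def k_target_simps NM_carrier)
qed (simp add: square_zero_proj_def)

lemma tower_over: "dgfun_eq (W (Suc n)) (dgfun_comp (gamma_map R n A) (tower_map R n A))
    (dgfun_comp (incl n) (dgfun_comp (M_map R n A) (tower_map R n A)))"
  by (simp add: dgfun_eq_def dgfun_comp_def fob_maps incl_simps W_Obj ga_tm)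

text \<open>The homotopy component \<open>(h1, h2)\<close> of a cycle is removed in two parts:
  \<open>h1\<close> by a chain in the \<open>P_n\<close> component of the path, and
  \<open>h2\<close> by \<open>tower_lift\<close>. Injectivity is
  \<open>tower_reflects_boundaries\<close>.\<close>

theorem tower_to_pullback_quasi_equivalence:
  "quasi_equivalence R (W (Suc n)) (pullback (W n) (path_dgcat R (P n) (k_target n A) (incl n)) (gamma_map R n A) path_eval)
     (dgfun_pair (tower_map R n A) (dgfun_comp (path_incl (k_target n A) (incl n)) (dgfun_comp (M_map R n A) (tower_map R n A))))"
  (is "quasi_equivalence R _ (pullback _ ?E _ _) ?F")
proof -
  let ?T = "k_target n A"
  let ?B = "pullback (W n) ?E (gamma_map R n A) path_eval"
  have J: "dg_functor R (W (Suc n)) ?E (dgfun_comp (path_incl ?T (incl n)) (dgfun_comp (M_map R n A) (tower_map R n A)))"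
    by (rule dg_functor_comp[OF dg_functor_comp[OF tower_functor M_functor] path.path_incl_functor])
  have F: "dg_functor R (W (Suc n)) ?B ?F"
  proof (rule dgfun_pair_functor[OF gamma_functor path.path_eval_functor tower_functor J])
    show "dgfun_eq (W (Suc n)) (dgfun_comp (gamma_map R n A) (tower_map R n A))
        (dgfun_comp path_eval (dgfun_comp (path_incl ?T (incl n)) (dgfun_comp (M_map R n A) (tower_map R n A))))"
      by (simp add: dgfun_eq_def dgfun_comp_def fob_maps incl_simps W_Obj ga_tm path_eval_def path_incl_def)
  qed
  have fob: "fob ?F x = (x, (x, x, Idt ?T x))" for x
    by (simp add: dgfun_pair_def dgfun_comp_def fob_maps path_incl_def)
  have fmor: "fmor ?F x y i e = (tm n x y i e, (Mm n x y i (tm n x y i e), (Mm n x y i (tm n x y i e), \<zero>\<^bsub>Hk n x y\<^esub>), \<zero>\<^bsub>hom_mod ?T x y (i + 1)\<^esub>))" for x y i e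
    by (simp add: dgfun_pair_def dgfun_comp_def fob_maps path_incl_def incl_simps)
  show ?thesis
  proof (rule quasi_equivalenceI[OF F])
    show "bij_betw (fob ?F) (Obj (W (Suc n))) (Obj ?B)"
      unfolding fob by (auto simp: bij_betw_def inj_on_def pullback_simps path.path_simps W_Obj fob_maps path_eval_def)
  next
    fix x y assume "x \<in> Obj (W (Suc n))" "y \<in> Obj (W (Suc n))"
    then have o: "x \<in> Obj A" "y \<in> Obj A" by (simp_all add: W_Obj)
    let ?p = "(x, (x, x, Idt ?T x))" and ?q = "(y, (y, y, Idt ?T y))"
    have op: "?p \<in> Obj ?B" "?q \<in> Obj ?B"
      using o by (auto simp: pullback_simps path.path_simps W_Obj fob_maps path_eval_def)
    \<comment> \<open>In the pullback the middle entry of the path is forced to be the image of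
      \<open>b\<close> under \<open>\<gamma>\<close>; the entries \<open>b\<close>, \<open>a\<close>
      and \<open>h\<close> are arbitrary.\<close>
    have homB: "hom_set ?B ?p ?q i = {(b, (a, ga n x y i b, h)) | b a h. b \<in> hom_set (W n) x y i \<and> a \<in> hom_set (P n) x y i \<and> h \<in> hom_set ?T x y (i + 1)}" for i
      using ga_hom[OF o] by (auto simp: pullback_simps path.path_simps path_eval_def)
    note dB = pullback_simps(3) path.path_simps(3)
    show "quasi_isomorphism R (Mor (W (Suc n)) x y) (Mor ?B (fob ?F x) (fob ?F y)) (fmor ?F x y)"
      unfolding fob
    proof (rule quasi_isomorphismI)
      show "chain_map R (Mor (W (Suc n)) x y) (Mor ?B ?p ?q) (fmor ?F x y)"
        using dg_functor_chain_map[OF F, of x y] o by (simp add: W_Obj fob)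
      show "chain_complex R (Mor (W (Suc n)) x y)" by (rule W_complex[OF o])
      show "chain_complex R (Mor ?B ?p ?q)"
        by (rule dg_category.complex[OF pullback_dg_category[OF gamma_functor path.path_eval_functor] op])
    next
      fix i z assume z: "z \<in> cycles (Mor ?B ?p ?q) i"
      interpret Pi: module R "hom_mod (P n) x y i" by (rule k.hom_module) (use o in auto)
      interpret Pj: module R "hom_mod (P n) x y (i + 1)" by (rule k.hom_module) (use o in auto)
      interpret Ti: module R "hom_mod ?T x y i" by (rule path.C.hom_module) (use o in \<open>auto simp: k_target_Obj\<close>)
      interpret Wi: module R "hom_mod (W n) x y i" by (rule W_module[OF o])
      interpret H: module R "Hk n x y" by (rule H_module[OF o])
      obtain b a h1 h2 where zb: "z = (b, (a, ga n x y i b, (h1, h2)))" "b \<in> hom_set (W n) x y i" "a \<in> hom_set (P n) x y i"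
          "h1 \<in> hom_set (P n) x y (i + 1)" "h2 \<in> carrier (NM n x y (i + 1))"
        using cycles_carrier[OF z] unfolding homB by (auto simp: k_target_simps)
      have X: "(a, \<zero>\<^bsub>Hk n x y\<^esub>) \<in> hom_set ?T x y i" using zb(3) NM_zero[OF o] by (simp add: k_target_simps)
      have dh: "hom_diff ?T x y (i + 1) (h1, h2) \<in> hom_set ?T x y i"
        using path.C.hom_diff_closed[of x n y "(h1, h2)" "i + 1"] o zb(4,5) by (simp add: k_target_Obj k_target_simps)
      note gb = ga_hom[OF o zb(2)]
      \<comment> \<open>The last entry of the cycle condition reads
        \<open>(a, 0) = \<gamma>(b) + d(h1, h2)\<close>. It determines \<open>a\<close> from
        \<open>b\<close> and \<open>h1\<close>, while \<open>h2\<close> stays free because the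
        bimodule has zero differential.\<close>
      have "hom_diff (W n) x y i b = \<zero>\<^bsub>hom_mod (W n) x y (i - 1)\<^esub>"
        "(a, \<zero>\<^bsub>Hk n x y\<^esub>) \<ominus>\<^bsub>hom_mod ?T x y i\<^esub> (ga n x y i b \<oplus>\<^bsub>hom_mod ?T x y i\<^esub> hom_diff ?T x y (i + 1) (h1, h2)) = \<zero>\<^bsub>hom_mod ?T x y i\<^esub>"
        using z by (simp_all add: zb(1) cycles_def dB pullback_simps(2) path.path_simps(2) incl_simps)
      then have bz: "b \<in> cycles (Mor (W n) x y) i"
        and "(a, \<zero>\<^bsub>Hk n x y\<^esub>) = ga n x y i b \<oplus>\<^bsub>hom_mod ?T x y i\<^esub> hom_diff ?T x y (i + 1) (h1, h2)"
        using Ti.minus_eq_iff[OF X Ti.M.a_closed[OF gb dh] Ti.M.zero_closed] gb dh zb(2) by (auto simp: cycles_def)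
      then have a: "a = Mm n x y i b \<oplus>\<^bsub>hom_mod (P n) x y i\<^esub> hom_diff (P n) x y (i + 1) h1"
        using fst_ga[OF o zb(2)] by (cases "ga n x y i b") (simp add: k_target_simps)
      obtain e b' where e: "e \<in> cycles (Mor (W (Suc n)) x y) i" and b': "b' \<in> hom_set (W n) x y (i + 1)"
        and eb: "b = tm n x y i e \<oplus>\<^bsub>hom_mod (W n) x y i\<^esub> hom_diff (W n) x y (i + 1) b'"
        and gb': "ga n x y (i + 1) b' = (\<zero>\<^bsub>hom_mod (P n) x y (i + 1)\<^esub>, \<ominus>\<^bsub>Hk n x y\<^esub> h2)"
        by (rule tower_lift[OF o bz zb(5)])
      define t where "t = tm n x y i e"
      have t: "t \<in> hom_set (W n) x y i"
        using dg_functor_hom[OF tower_functor, of x n y e i] o cycles_carrier[OF e] by (simp add: t_def W_Obj fob_maps)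
      have gt: "ga n x y i t = (Mm n x y i t, \<zero>\<^bsub>Hk n x y\<^esub>)" unfolding t_def by (rule ga_tm[OF o cycles_carrier[OF e]])
      have db': "hom_diff (W n) x y (i + 1) b' \<in> hom_set (W n) x y i"
        using dg_category.hom_diff_closed[OF W_dg_category, of x n y b' "i + 1"] o b' by (simp add: W_Obj)
      have gab: "ga n x y i b = ga n x y i t \<oplus>\<^bsub>hom_mod ?T x y i\<^esub> hom_diff ?T x y (i + 1) (ga n x y (i + 1) b')"
        using linear_mapD(2)[OF dg_functorD(4)[OF gamma_functor, of x n y i]] dg_functorD(5)[OF gamma_functor, of x n y b' "i + 1"] o t db' b'
        by (simp add: eb t_def[symmetric] W_Obj fob_maps)
      \<comment> \<open>The image of \<open>b'\<close> under \<open>\<gamma>\<close> has zero first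
        component, so \<open>b\<close> and \<open>t\<close> have the same image in the small
        section.\<close>
      have Mb: "Mm n x y i b = Mm n x y i t"
        using gab fst_ga[OF o zb(2)] fst_ga[OF o t] k.hom_diff_zero[of x n y "i + 1"] fst_ga[OF o zb(2)] o
          linear_mapD(1)[OF dg_functorD(4)[OF M_functor, of x n y i]] t
        by (simp add: gt gb' k_target_simps W_Obj fob_maps)
      \<comment> \<open>The last entry of the boundary of this chain is \<open>(h1, 0)\<close> minus
        \<open>\<gamma>(b') = (0, - h2)\<close>, that is \<open>(h1, h2)\<close>. Its other entries
        correct \<open>b\<close> by the boundary of \<open>b'\<close> and \<open>a\<close> by that
        of \<open>h1\<close>.\<close>
      let ?u = "(b', (h1, ga n x y (i + 1) b', \<zero>\<^bsub>hom_mod ?T x y (i + 2)\<^esub>))"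
      have u: "?u \<in> hom_set ?B ?p ?q (i + 1)"
        using b' zb(4) path.C.hom_zero_closed[of x n y "i + 2"] o unfolding homB by (auto simp: k_target_Obj add.assoc simp del: split_paired_Ex)
      interpret Tj: module R "hom_mod ?T x y (i + 1)" by (rule path.C.hom_module) (use o in \<open>auto simp: k_target_Obj\<close>)
      have hh: "(h1, h2) \<in> hom_set ?T x y (i + 1)" using zb(4,5) by (simp add: k_target_simps)
      have h2: "h2 \<in> carrier (Hk n x y)" using zb(5) H.M.zero_closed by (auto simp: NM_carrier split: if_splits)
      have d0: "hom_diff ?T x y (i + 2) \<zero>\<^bsub>hom_mod ?T x y (i + 2)\<^esub> = \<zero>\<^bsub>hom_mod ?T x y (i + 1)\<^esub>"
        using path.C.hom_diff_zero[of x n y "i + 2"] o by (simp add: k_target_Obj add.commute[of 1 i])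
      have "(h1, \<zero>\<^bsub>Hk n x y\<^esub>) \<ominus>\<^bsub>hom_mod ?T x y (i + 1)\<^esub> (ga n x y (i + 1) b' \<oplus>\<^bsub>hom_mod ?T x y (i + 1)\<^esub>
          hom_diff ?T x y (i + 2) \<zero>\<^bsub>hom_mod ?T x y (i + 2)\<^esub>) = (h1, h2)"
      proof (subst Tj.minus_eq_iff)
        show "(h1, \<zero>\<^bsub>Hk n x y\<^esub>) = ga n x y (i + 1) b' \<oplus>\<^bsub>hom_mod ?T x y (i + 1)\<^esub>
            hom_diff ?T x y (i + 2) \<zero>\<^bsub>hom_mod ?T x y (i + 2)\<^esub> \<oplus>\<^bsub>hom_mod ?T x y (i + 1)\<^esub> (h1, h2)"
          using d0 gb' zb(4) h2 by (simp add: k_target_simps NM_ops H.M.l_neg)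
        show "ga n x y (i + 1) b' \<oplus>\<^bsub>hom_mod ?T x y (i + 1)\<^esub> hom_diff ?T x y (i + 2) \<zero>\<^bsub>hom_mod ?T x y (i + 2)\<^esub> \<in> hom_set ?T x y (i + 1)"
          using ga_hom[OF o b'] d0 by simp
      qed (use zb(4,5) NM_zero[OF o] in \<open>simp_all add: k_target_simps\<close>)
      then have "z = fmor ?F x y i e \<oplus>\<^bsub>hom_mod ?B ?p ?q i\<^esub> hom_diff ?B ?p ?q (i + 1) ?u"
        using Mb a eb gab gt Tj.M.l_zero[OF hh]
        by (simp add: zb(1) fmor dB pullback_simps(2) path.path_simps(2) incl_simps t_def[symmetric] add.assoc)
      then show "\<exists>e\<in>cycles (Mor (W (Suc n)) x y) i. \<exists>u\<in>hom_set ?B ?p ?q (i + 1).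
          z = fmor ?F x y i e \<oplus>\<^bsub>hom_mod ?B ?p ?q i\<^esub> hom_diff ?B ?p ?q (i + 1) u"
        using e u by blast
    next
      fix i e u assume e: "e \<in> cycles (Mor (W (Suc n)) x y) i" and u: "u \<in> hom_set ?B ?p ?q (i + 1)"
        and eq: "fmor ?F x y i e = hom_diff ?B ?p ?q (i + 1) u"
      interpret Tj: module R "hom_mod ?T x y (i + 1)" by (rule path.C.hom_module) (use o in \<open>auto simp: k_target_Obj\<close>)
      interpret H: module R "Hk n x y" by (rule H_module[OF o])
      obtain b a h1 h2 where ub: "u = (b, (a, ga n x y (i + 1) b, (h1, h2)))" "b \<in> hom_set (W n) x y (i + 1)" "a \<in> hom_set (P n) x y (i + 1)"
          "(h1, h2) \<in> hom_set ?T x y (i + 2)"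
        using u unfolding homB by (auto simp: add.assoc)
      have X: "(a, \<zero>\<^bsub>Hk n x y\<^esub>) \<in> hom_set ?T x y (i + 1)" using ub(3) NM_zero[OF o] by (simp add: k_target_simps)
      have dh: "hom_diff ?T x y (i + 2) (h1, h2) \<in> hom_set ?T x y (i + 1)"
        using path.C.hom_diff_closed[of x n y "(h1, h2)" "i + 2"] o ub(4) by (simp add: k_target_Obj add.commute[of 1 i])
      note gb = ga_hom[OF o ub(2)]
      have tb: "tm n x y i e = hom_diff (W n) x y (i + 1) b"
        and "(a, \<zero>\<^bsub>Hk n x y\<^esub>) \<ominus>\<^bsub>hom_mod ?T x y (i + 1)\<^esub> (ga n x y (i + 1) b \<oplus>\<^bsub>hom_mod ?T x y (i + 1)\<^esub> hom_diff ?T x y (i + 2) (h1, h2)) =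
          \<zero>\<^bsub>hom_mod ?T x y (i + 1)\<^esub>"
        using eq by (simp_all add: fmor ub(1) dB incl_simps add.assoc)
      then have "(a, \<zero>\<^bsub>Hk n x y\<^esub>) = ga n x y (i + 1) b \<oplus>\<^bsub>hom_mod ?T x y (i + 1)\<^esub> hom_diff ?T x y (i + 2) (h1, h2)"
        using Tj.minus_eq_iff[OF X Tj.M.a_closed[OF gb dh] Tj.M.zero_closed] gb dh by auto
      moreover obtain g1 g2 where g: "ga n x y (i + 1) b = (g1, g2)" by (cases "ga n x y (i + 1) b")
      moreover have "g2 \<in> carrier (Hk n x y)" using gb H.M.zero_closed by (auto simp: g k_target_simps NM_carrier split: if_splits)
      \<comment> \<open>Second components of \<open>(a, 0) = \<gamma>(b) + d(h1, h2)\<close> are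
        compared: the homotopy contributes nothing there.\<close>
      ultimately have "snd (ga n x y (i + 1) b) = \<zero>\<^bsub>Hk n x y\<^esub>" by (simp add: k_target_simps NM_ops)
      then show "e \<in> boundaries (Mor (W (Suc n)) x y) i" by (rule tower_reflects_boundaries[OF o e ub(2) tb])
    qed
  qed
qed

theorem postnikov_fiber_sequence:
  "homotopy_fiber_sequence R (P n) (W (Suc n)) (dgfun_comp (M_map R n A) (tower_map R n A)) (W n) (M_map R n A)
    (k_target n A) square_zero_proj (tower_map R n A) (gamma_map R n A) (incl n)"
  unfolding homotopy_fiber_sequence_def over_map_def homotopy_pullback_def
\<comment> \<open>The factorization stays schematic: the first equation instantiates
  \<open>J\<close> and \<open>Q\<close>, and resolving with the quasi-equivalence of the path
  category instantiates \<open>E\<close>.\<close>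
proof (intro conjI exI)
  show "dgfun_eq (P n) (dgfun_comp path_eval (path_incl (k_target n A) (incl n))) (incl n)"
    by (simp add: dgfun_eq_def dgfun_comp_def path_eval_def path_incl_def incl_simps)
  show "dgfun_eq (W n) (dgfun_comp square_zero_proj (gamma_map R n A)) (M_map R n A)"
    by (simp add: dgfun_eq_def dgfun_comp_def fob_maps square_zero_proj_def W_Obj fst_ga)
  show "dgfun_eq (P n) (dgfun_comp square_zero_proj (incl n)) dgfun_id"
    by (simp add: dgfun_eq_def dgfun_comp_def square_zero_proj_def incl_simps dgfun_id_def)
  show "dgfun_eq (W (Suc n)) (dgfun_comp (M_map R n A) (tower_map R n A)) (dgfun_comp (M_map R n A) (tower_map R n A))"
    by (simp add: dgfun_eq_def)
qed (rule tower_functor M_functor gamma_functor incl_functor proj_functor dg_functor_comp[OF tower_functor M_functor] tower_over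
    dgfun_id_functor[OF small_dg_category] path.path_incl_quasi_equivalence path_fibration tower_to_pullback_quasi_equivalence)+

end

theorem theorem1p3:
  fixes R :: "('r, 'x) ring_scheme" and A :: "('o, 'r, 'a) dgcat" and n :: nat
  assumes "cring R" and "dg_category R A" and "homologically_connective A"
  shows "homotopy_fiber_sequence R (small_postnikov n (tau_ge0 A))
    (big_postnikov R (n + 1) (tau_ge0 A))
      (dgfun_comp (M_map R n (tau_ge0 A)) (tower_map R n (tau_ge0 A)))
    (big_postnikov R n (tau_ge0 A)) (M_map R n (tau_ge0 A))
    (k_target n (tau_ge0 A)) square_zero_proj
    (tower_map R n (tau_ge0 A)) (gamma_map R n (tau_ge0 A))
    (square_zero_incl (k_bimod n (tau_ge0 A)))"
proof -
  interpret positive_dg_category R "tau_ge0 A"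
    by (intro positive_dg_category.intro positive_dg_category_axioms.intro tau_ge0_dg_category assms positively_graded_tau_ge0)
  show ?thesis using postnikov_fiber_sequence[of n] by simp
qed

end
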